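(* Let $k$ be an infinite field and let $R=k[x_1,\dots,x_n]$ be the standard graded polynomial ring with $\mathfrak m=(x_1,\dots,x_n)$. Denote by $\mathcal H_{n,i,r}$ the set of numerical functions $h:\mathbb Z\to\mathbb Z$ such that there exists a homogeneous ideal $I\subset R$ satisfying the following conditions: (i) $\operatorname{reg} I\le r$; (ii) $\ell(H^i_{\mathfrak m}(R/I)_t)=h(t)$ for all $t\in\mathbb Z$. Then for fixed numbers $n,i,r$ the set $\mathcal H_{n,i,r}$ has only finitely many elements.
   Context: For a graded $R$-module $N$ put $\operatorname{end}(N)=\sup\{j\in\mathbb Z: N_j\ne 0\}$, with $\operatorname{end}(0)=-\infty$. For a finitely generated graded module $N$, the Castelnuovo-Mumford regularity is $\operatorname{reg}(N)=\max\{j+\operatorname{end}(H^j_{\mathfrak m}(N)): j\ge 0\}$. $H^i_{\mathfrak m}(R/I)_t$ is the degree-$t$ component of the $i$-th local cohomology module and $\ell$ denotes length (here, $k$-vector space dimension). *)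

theory Defs
  imports
    "HOL-Algebra.QuotRing"
    "HOL-Library.Poly_Mapping"
    "HOL-Library.Extended_Real"
    "Jordan_Normal_Form.VS_Connect"
begin

section \<open>The standard graded polynomial ring\<close>

text \<open>Monomials are exponent vectors of type \<^typ>\<open>nat \<Rightarrow>\<^sub>0 nat\<close>. The variables of the ring in \<open>n\<close>
  variables are those with index in \<^term>\<open>{..<n}\<close>, so \<open>x\<^sub>1, \<dots>, x\<^sub>n\<close> are numbered from \<open>0\<close>.\<close>

type_synonym 'k mpoly = "(nat \<Rightarrow>\<^sub>0 nat) \<Rightarrow>\<^sub>0 'k"

abbreviation mon :: "(nat \<Rightarrow>\<^sub>0 nat) \<Rightarrow> 'k::field mpoly"
  where "mon a \<equiv> Poly_Mapping.single a 1"

abbreviation const :: "'k::field \<Rightarrow> 'k mpoly"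
  where "const c \<equiv> Poly_Mapping.single 0 c"

definition mon_degree :: "(nat \<Rightarrow>\<^sub>0 nat) \<Rightarrow> nat"
  where "mon_degree a = (\<Sum>v\<in>Poly_Mapping.keys a. Poly_Mapping.lookup a v)"

definition poly_ring :: "nat \<Rightarrow> 'k::field mpoly ring"
  where "poly_ring n =
    \<lparr> carrier = {p. \<forall>a\<in>Poly_Mapping.keys p. Poly_Mapping.keys a \<subseteq> {..<n}},
      mult = (*), one = 1, zero = 0, add = (+) \<rparr>"

definition homogeneous_part :: "nat \<Rightarrow> int \<Rightarrow> 'k::field mpoly set"
  where "homogeneous_part n t =
    {p \<in> carrier (poly_ring n). \<forall>a\<in>Poly_Mapping.keys p. int (mon_degree a) = t}"

definition homogeneous_ideal :: "nat \<Rightarrow> 'k::field mpoly set \<Rightarrow> bool"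
  where "homogeneous_ideal n I \<longleftrightarrow>
    ideal I (poly_ring n) \<and>
    (\<exists>G \<subseteq> (\<Union>t. homogeneous_part n t). I = Idl\<^bsub>poly_ring n\<^esub> G)"


section \<open>Graded modules\<close>

text \<open>A graded module is a module record together with its homogeneous components. The
  fields \<^const>\<open>mult\<close> and \<^const>\<open>one\<close>, which module records inherit from rings, play no role for a
  module and are left undefined below.\<close>

record ('a, 'b) graded_module = "('a, 'b) module" +
  component :: "int \<Rightarrow> 'b set"

definition free_module :: "nat \<Rightarrow> ('k::field mpoly, 'k mpoly) graded_module"
  where "free_module n =
    \<lparr> carrier = carrier (poly_ring n), mult = undefined, one = undefined,
      zero = 0, add = (+), smult = (*), component = homogeneous_part n \<rparr>"

definition graded_submodule ::
    "('a, 'b) graded_module \<Rightarrow> 'b set \<Rightarrow> ('a, 'b) graded_module"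
  where "graded_submodule M N =
    M\<lparr> carrier := N, component := (\<lambda>t. component M t \<inter> N) \<rparr>"

definition graded_quotient ::
    "('a, 'b) graded_module \<Rightarrow> 'b set \<Rightarrow> ('a, 'b set) graded_module"
  where "graded_quotient M N =
    \<lparr> carrier = a_rcosets\<^bsub>M\<^esub> N, mult = undefined, one = undefined,
      zero = N, add = set_add M,
      smult = (\<lambda>r X. \<Union>x\<in>X. N +>\<^bsub>M\<^esub> (r \<odot>\<^bsub>M\<^esub> x)),
      component = (\<lambda>t. (\<lambda>x. N +>\<^bsub>M\<^esub> x) ` component M t) \<rparr>"

definition component_space ::
    "('k::field mpoly, 'b) graded_module \<Rightarrow> int \<Rightarrow> ('k, 'b) module"
  where "component_space M t =
    \<lparr> carrier = component M t, mult = undefined, one = undefined,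
      zero = zero M, add = add M, smult = (\<lambda>c x. const c \<odot>\<^bsub>M\<^esub> x) \<rparr>"

definition component_has_dim ::
    "('k::field mpoly, 'b) graded_module \<Rightarrow> int \<Rightarrow> int \<Rightarrow> bool"
  where "component_has_dim M t d \<longleftrightarrow>
    vectorspace.fin_dim (class_ring :: 'k ring) (component_space M t) \<and>
    int (vectorspace.dim (class_ring :: 'k ring) (component_space M t)) = d"

text \<open>Since the supremum of the empty set is \<^term>\<open>-\<infinity> :: ereal\<close>, the zero module has end \<open>-\<infinity>\<close>.\<close>

definition end_degree :: "('a, 'b) graded_module \<Rightarrow> ereal"
  where "end_degree M =
    (SUP t\<in>{t. component M t \<noteq> {zero M}}. ereal (of_int t))"


section \<open>Localization at a set of variables\<close>

text \<open>For a set \<open>\<sigma>\<close> of variables, the localization inverting the variables in \<open>\<sigma>\<close> (equivalently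
  inverting their product) is taken at the multiplicative set of all monomials in these variables.
  The fraction \<open>m/s\<close> is the equivalence class of the pair \<open>(m, s)\<close>.\<close>

definition denominators :: "nat set \<Rightarrow> 'k::field mpoly set"
  where "denominators \<sigma> = {mon a | a. Poly_Mapping.keys a \<subseteq> \<sigma>}"

definition frac_rel ::
    "nat set \<Rightarrow> ('k::field mpoly, 'b) graded_module \<Rightarrow> (('b \<times> 'k mpoly) \<times> ('b \<times> 'k mpoly)) set"
  where "frac_rel \<sigma> M =
    {((m, s), (m', s')). m \<in> carrier M \<and> m' \<in> carrier M \<and>
      s \<in> denominators \<sigma> \<and> s' \<in> denominators \<sigma> \<and>
      (\<exists>u\<in>denominators \<sigma>. u \<odot>\<^bsub>M\<^esub> (s' \<odot>\<^bsub>M\<^esub> m) = u \<odot>\<^bsub>M\<^esub> (s \<odot>\<^bsub>M\<^esub> m'))}"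

definition frac ::
    "nat set \<Rightarrow> ('k::field mpoly, 'b) graded_module \<Rightarrow> 'b \<Rightarrow> 'k mpoly \<Rightarrow> ('b \<times> 'k mpoly) set"
  where "frac \<sigma> M m s = frac_rel \<sigma> M `` {(m, s)}"

definition localize ::
    "nat \<Rightarrow> nat set \<Rightarrow> ('k::field mpoly, 'b) graded_module
      \<Rightarrow> ('k mpoly, ('b \<times> 'k mpoly) set) graded_module"
  where "localize n \<sigma> M =
    \<lparr> carrier = (carrier M \<times> denominators \<sigma>) // frac_rel \<sigma> M,
      mult = undefined, one = undefined,
      zero = frac \<sigma> M (zero M) 1,
      add = (\<lambda>X Y. \<Union>(m, s)\<in>X. \<Union>(m', s')\<in>Y.
        frac \<sigma> M ((s' \<odot>\<^bsub>M\<^esub> m) \<oplus>\<^bsub>M\<^esub> (s \<odot>\<^bsub>M\<^esub> m')) (s * s')),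
      smult = (\<lambda>r X. \<Union>(m, s)\<in>X. frac \<sigma> M (r \<odot>\<^bsub>M\<^esub> m) s),
      component = (\<lambda>t. {frac \<sigma> M m s | m s e.
        s \<in> denominators \<sigma> \<inter> homogeneous_part n e \<and> m \<in> component M (t + e)}) \<rparr>"

text \<open>For \<open>\<sigma> \<subseteq> \<tau>\<close>, the canonical map from the localization at \<open>\<sigma>\<close> to the one at \<open>\<tau>\<close>,
  sending \<open>m/s\<close> to \<open>m/s\<close>.\<close>

definition localize_map ::
    "nat set \<Rightarrow> ('k::field mpoly, 'b) graded_module \<Rightarrow> ('b \<times> 'k mpoly) set \<Rightarrow> ('b \<times> 'k mpoly) set"
  where "localize_map \<tau> M X = (\<Union>(m, s)\<in>X. frac \<tau> M m s)"


section \<open>Local cohomology with support in the irrelevant ideal\<close>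

text \<open>Local cohomology is the cohomology of the Cech complex on \<open>x\<^sub>1, \<dots>, x\<^sub>n\<close>: in cohomological
  degree \<open>p\<close> it is the (finite) direct sum of the localizations of \<open>M\<close> at the \<open>p\<close>-element sets of
  variables.\<close>

definition cech_index :: "nat \<Rightarrow> nat \<Rightarrow> nat set set"
  where "cech_index n p = {\<sigma>. \<sigma> \<subseteq> {..<n} \<and> card \<sigma> = p}"

definition cech ::
    "nat \<Rightarrow> ('k::field mpoly, 'b) graded_module \<Rightarrow> nat
      \<Rightarrow> ('k mpoly, nat set \<Rightarrow> ('b \<times> 'k mpoly) set) graded_module"
  where "cech n M p =
    \<lparr> carrier = (\<Pi>\<^sub>E \<sigma>\<in>cech_index n p. carrier (localize n \<sigma> M)),
      mult = undefined, one = undefined,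
      zero = (\<lambda>\<sigma>\<in>cech_index n p. zero (localize n \<sigma> M)),
      add = (\<lambda>f g. \<lambda>\<sigma>\<in>cech_index n p. f \<sigma> \<oplus>\<^bsub>localize n \<sigma> M\<^esub> g \<sigma>),
      smult = (\<lambda>r f. \<lambda>\<sigma>\<in>cech_index n p. r \<odot>\<^bsub>localize n \<sigma> M\<^esub> f \<sigma>),
      component = (\<lambda>t. \<Pi>\<^sub>E \<sigma>\<in>cech_index n p. component (localize n \<sigma> M) t) \<rparr>"

definition cech_diff ::
    "nat \<Rightarrow> ('k::field mpoly, 'b) graded_module \<Rightarrow> nat
      \<Rightarrow> (nat set \<Rightarrow> ('b \<times> 'k mpoly) set) \<Rightarrow> (nat set \<Rightarrow> ('b \<times> 'k mpoly) set)"
  where "cech_diff n M p f =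
    (\<lambda>\<tau>\<in>cech_index n (Suc p).
      \<Oplus>\<^bsub>localize n \<tau> M\<^esub>j\<in>\<tau>.
        ((-1) ^ card {i \<in> \<tau>. i < j}) \<odot>\<^bsub>localize n \<tau> M\<^esub> localize_map \<tau> M (f (\<tau> - {j})))"

definition cocycles ::
    "nat \<Rightarrow> ('k::field mpoly, 'b) graded_module \<Rightarrow> nat \<Rightarrow> (nat set \<Rightarrow> ('b \<times> 'k mpoly) set) set"
  where "cocycles n M p = a_kernel (cech n M p) (cech n M (Suc p)) (cech_diff n M p)"

definition coboundaries ::
    "nat \<Rightarrow> ('k::field mpoly, 'b) graded_module \<Rightarrow> nat \<Rightarrow> (nat set \<Rightarrow> ('b \<times> 'k mpoly) set) set"
  where "coboundaries n M p =
    (case p of 0 \<Rightarrow> {zero (cech n M 0)}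
     | Suc q \<Rightarrow> cech_diff n M q ` carrier (cech n M q))"

definition local_cohomology ::
    "nat \<Rightarrow> nat \<Rightarrow> ('k::field mpoly, 'b) graded_module
      \<Rightarrow> ('k mpoly, (nat set \<Rightarrow> ('b \<times> 'k mpoly) set) set) graded_module"
  where "local_cohomology n p M =
    graded_quotient (graded_submodule (cech n M p) (cocycles n M p)) (coboundaries n M p)"

definition regularity :: "nat \<Rightarrow> ('k::field mpoly, 'b) graded_module \<Rightarrow> ereal"
  where "regularity n M = (SUP j. ereal (of_nat j) + end_degree (local_cohomology n j M))"

end

theory Submission
  imports Defs "HOL-Library.Function_Algebras" "HOL-Library.Product_Lexorder"
begin

text \<open>Write \<open>I\<close> as the image of a free module \<open>F\<^sub>1\<close>, the kernel as the image of \<open>F\<^sub>2\<close>, and so on. The connecting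
  maps of \<open>0 \<rightarrow> N' \<rightarrow> F' \<rightarrow> F \<rightarrow> F/N \<rightarrow> 0\<close> identify \<open>H\<^sup>i(F/N)\<close> with \<open>H\<^sup>i\<^sup>+\<^sup>1(F'/N')\<close> as long as \<open>i + 1 < n\<close>, which reduces
  everything to \<open>H\<^sup>n\<^sup>-\<^sup>1\<close> and \<open>H\<^sup>n\<close>. There the Hilbert function of the cohomology is a difference of codimensions of
  kernels of maps between top cohomology modules of free modules, and these are by duality Hilbert
  functions of images of transposed matrices, that is, of submodules of a free module generated in
  bounded degree.

  Finiteness then rests on one statement: for all graded submodules \<open>N\<close> of a fixed free module that are
  generated in degrees \<open>\<le> d\<close>, the initial modules are generated in degrees \<open>\<le> e\<close> for a common \<open>e\<close>. Hence
  only finitely many initial modules and Hilbert functions occur, and the syzygies are generated in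
  degrees \<open>\<le> 2e\<close>, so that the resolutions above are uniformly bounded. The regularity enters only through the
  fact that an ideal of regularity at most \<open>r\<close> is generated in degrees \<open>\<le> r\<close>, proved by a chase through
  the double complex of Koszul and Cech differentials.

  All modules are realised inside spaces of Laurent polynomial vectors, where localization at a set of
  variables amounts to allowing negative exponents at these variables.\<close>

text \<open>Over an infinite field, bounded generation degree allows infinitely many submodules, so
  finiteness has to come from discrete data, the leading monomials. The bound \<open>e\<close> on
  their generators comes from compactness and is not explicit. Compactness works because
  Buchberger's criterion is a finite check: two leading monomials of degree at most \<open>e\<close>
  have a least common multiple of degree at most \<open>2 * e\<close>, so for a module generated in
  degrees at most \<open>e\<close>, a set of generators that accounts for all leading monomials up
  to degree \<open>2 * e\<close> accounts for all of them. Intermediate cohomology is not determined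
  by initial modules, which is why it is pushed to the top of the Cech complex. There a free module
  contributes a space with a monomial basis, and a matrix acts as the adjoint of its transpose under
  the residue pairing. The dimensions of H^n and H^(n-1) become differences of ranks of matrices. A
  rank equals the Hilbert function of the image of the transpose, and transposing keeps the entries,
  hence the degree bounds. One statement about graded submodules therefore controls both the
  resolutions and the ranks.\<close>

section \<open>Dimensions of subquotients\<close>

text \<open>The quotient of \<open>A\<close> by \<open>A \<inter> B\<close> has dimension \<open>d\<close>.\<close>

definition has_qdim :: "('k::field \<Rightarrow> 'v \<Rightarrow> 'v::ab_group_add) \<Rightarrow> 'v set \<Rightarrow> 'v set \<Rightarrow> nat \<Rightarrow> bool"
  where "has_qdim sc A B d \<longleftrightarrow> (\<exists>b.
    (\<forall>i<d. b i \<in> A) \<and>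
    (\<forall>a\<in>A. \<exists>c. a - (\<Sum>i<d. sc (c i) (b i)) \<in> B) \<and>
    (\<forall>c. (\<Sum>i<d. sc (c i) (b i)) \<in> B \<longrightarrow> (\<forall>i<d. c i = 0)))"

lemma has_qdim_index:
  assumes "finite X" "\<And>x. x \<in> X \<Longrightarrow> b x \<in> A"
    and "\<And>a. a \<in> A \<Longrightarrow> \<exists>c. a - (\<Sum>x\<in>X. sc (c x) (b x)) \<in> B"
    and "\<And>c. (\<Sum>x\<in>X. sc (c x) (b x)) \<in> B \<Longrightarrow> (\<forall>x\<in>X. c x = 0)"
  shows "has_qdim sc A B (card X)"
proof -
  obtain h where h: "bij_betw h {..<card X} X"
    using assms(1) ex_bij_betw_nat_finite atLeast0LessThan by metis
  define h' where "h' = the_inv_into {..<card X} h"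
  have inv: "\<And>i. i < card X \<Longrightarrow> h' (h i) = i"
    unfolding h'_def using h by (simp add: bij_betw_def the_inv_into_f_f)
  have re: "(\<Sum>x\<in>X. g x) = (\<Sum>i<card X. g (h i))" for g :: "_ \<Rightarrow> 'b"
    using sum.reindex_bij_betw[OF h, of g] by simp
  show ?thesis unfolding has_qdim_def
  proof (intro exI[of _ "b \<circ> h"] conjI allI ballI impI)
    fix i assume "i < card X" then show "(b \<circ> h) i \<in> A"
      using assms(2) h by (auto simp: bij_betw_def)
  next
    fix a assume "a \<in> A"
    then obtain c where "a - (\<Sum>x\<in>X. sc (c x) (b x)) \<in> B" using assms(3) by blast
    then show "\<exists>c. a - (\<Sum>i<card X. sc (c i) ((b \<circ> h) i)) \<in> B"
      by (intro exI[of _ "c \<circ> h"]) (simp add: re)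
  next
    fix c i assume *: "(\<Sum>i<card X. sc (c i) ((b \<circ> h) i)) \<in> B" and i: "i < card X"
    have "(\<Sum>x\<in>X. sc ((c \<circ> h') x) (b x)) = (\<Sum>i<card X. sc (c i) ((b \<circ> h) i))"
      unfolding re by (intro sum.cong) (simp_all add: inv)
    with * have "\<forall>x\<in>X. (c \<circ> h') x = 0" using assms(4)[of "c \<circ> h'"] by simp
    then show "c i = 0" using i h inv by (force simp: bij_betw_def)
  qed
qed

text \<open>Gaussian elimination by induction on the number of equations: if the last equation
  involves some unknown \<open>p\<close>, solving for it leaves one equation and one unknown
  fewer.\<close>

lemma underdetermined_system:
  fixes c :: "nat \<Rightarrow> nat \<Rightarrow> 'k::field"
  assumes "d < e"
  shows "\<exists>x. (\<exists>j<e. x j \<noteq> 0) \<and> (\<forall>i<d. (\<Sum>j<e. x j * c j i) = 0)"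
  using assms
proof (induction d arbitrary: e c)
  case 0
  then show ?case by (intro exI[of _ "\<lambda>_. 1"]) auto
next
  case (Suc d)
  obtain e' where e: "e = Suc e'" "d < e'" using Suc.prems by (cases e) auto
  show ?case
  proof (cases "\<exists>j<e. c j d \<noteq> 0")
    case False
    obtain x where x: "\<exists>j<e. x j \<noteq> 0" "\<forall>i<d. (\<Sum>j<e. x j * c j i) = 0"
      using Suc.IH[of e c] Suc.prems by auto
    have "\<forall>i<Suc d. (\<Sum>j<e. x j * c j i) = 0"
      using x(2) False by (auto simp: less_Suc_eq)
    with x(1) show ?thesis by blast
  next
    case True
    then obtain p where p: "p < e" "c p d \<noteq> 0" by blast
    \<comment> \<open>\<open>s\<close> numbers the unknowns other than the pivot \<open>p\<close>
      consecutively; \<open>t\<close> below is its inverse.\<close>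
    define s where "s j = (if j < p then j else Suc j)" for j
    have s: "bij_betw s {..<e'} ({..<e} - {p})"
      unfolding bij_betw_def
    proof
      show "inj_on s {..<e'}" by (auto simp: inj_on_def s_def split: if_splits)
      show "s ` {..<e'} = {..<e} - {p}"
      proof
        show "s ` {..<e'} \<subseteq> {..<e} - {p}" using e p by (auto simp: s_def)
        show "{..<e} - {p} \<subseteq> s ` {..<e'}"
        proof
          fix j assume j: "j \<in> {..<e} - {p}"
          show "j \<in> s ` {..<e'}"
          proof (cases "j < p")
            case True then show ?thesis using p e by (intro image_eqI[of _ _ j]) (auto simp: s_def)
          next
            case False then show ?thesis using j e by (intro image_eqI[of _ _ "j - 1"]) (auto simp: s_def)
          qed
        qed
      qed
    qed
    \<comment> \<open>Coefficients after the pivot has been eliminated with the help of equation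
      \<open>d\<close>; the pivot itself later receives the value \<open>- S\<close> that equation
      \<open>d\<close> forces.\<close>
    define c' where "c' j i = c (s j) i - c (s j) d / c p d * c p i" for j i
    obtain x where x: "\<exists>j<e'. x j \<noteq> 0" "\<forall>i<d. (\<Sum>j<e'. x j * c' j i) = 0"
      using Suc.IH[OF e(2), of c'] by auto
    define t where "t = the_inv_into {..<e'} s"
    have t: "\<And>j. j < e' \<Longrightarrow> t (s j) = j"
      unfolding t_def using s by (simp add: bij_betw_def the_inv_into_f_f)
    define S where "S = (\<Sum>j<e'. x j * (c (s j) d / c p d))"
    define y where "y j = (if j = p then - S else x (t j))" for j
    have sp: "s j \<noteq> p" for j by (auto simp: s_def)
    have split: "(\<Sum>j<e. y j * c j i) = - S * c p i + (\<Sum>j<e'. x j * c (s j) i)" for i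
    proof -
      have "(\<Sum>j<e. y j * c j i) = y p * c p i + (\<Sum>j\<in>{..<e} - {p}. y j * c j i)"
        using p by (subst sum.remove[of _ p]) auto
      also have "(\<Sum>j\<in>{..<e} - {p}. y j * c j i) = (\<Sum>j<e'. y (s j) * c (s j) i)"
        using sum.reindex_bij_betw[OF s, of "\<lambda>j. y j * c j i"] by simp
      also have "\<dots> = (\<Sum>j<e'. x j * c (s j) i)"
        by (intro sum.cong) (auto simp: y_def t sp)
      finally show ?thesis by (simp add: y_def)
    qed
    have "(\<Sum>j<e. y j * c j i) = (\<Sum>j<e'. x j * c' j i)" for i
      unfolding split c'_def S_def
      by (simp add: algebra_simps sum_subtractf sum_distrib_left sum_distrib_right)
    moreover have "(\<Sum>j<e'. x j * c' j d) = 0" using p by (simp add: c'_def)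
    ultimately have "\<forall>i<Suc d. (\<Sum>j<e. y j * c j i) = 0"
      using x(2) by (auto simp: less_Suc_eq)
    moreover obtain j where "j < e'" "x j \<noteq> 0" using x by blast
    then have "y (s j) \<noteq> 0" "s j < e" using s by (auto simp: y_def sp t bij_betw_def)
    ultimately show ?thesis by blast
  qed
qed

section \<open>Uniqueness, additivity and transfer of dimensions\<close>

context vector_space begin

text \<open>Exchange argument: writing the \<open>e\<close> independent elements through the
  \<open>d\<close> spanning ones modulo \<open>B\<close> gives, for \<open>d < e\<close>, more
  unknowns than equations and thus a forbidden relation.\<close>

lemma has_qdim_le:
  assumes "has_qdim scale A B d" "has_qdim scale A B e" "subspace B"
  shows "e \<le> d"
proof (rule ccontr)
  assume "\<not> e \<le> d"
  then have lt: "d < e" by simp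
  obtain b where b: "\<forall>a\<in>A. \<exists>c. a - (\<Sum>i<d. scale (c i) (b i)) \<in> B"
    using assms(1) unfolding has_qdim_def by blast
  obtain b' where b': "\<forall>i<e. b' i \<in> A"
      "\<forall>c. (\<Sum>i<e. scale (c i) (b' i)) \<in> B \<longrightarrow> (\<forall>i<e. c i = 0)"
    using assms(2) unfolding has_qdim_def by blast
  have "\<forall>j. \<exists>c. j < e \<longrightarrow> b' j - (\<Sum>i<d. scale (c i) (b i)) \<in> B" using b b' by blast
  then obtain c where c: "\<And>j. j < e \<Longrightarrow> b' j - (\<Sum>i<d. scale (c j i) (b i)) \<in> B" by metis
  obtain x where x: "\<exists>j<e. x j \<noteq> 0" "\<forall>i<d. (\<Sum>j<e. x j * c j i) = 0"
    using underdetermined_system[OF lt, of c] by blast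
  have "(\<Sum>j<e. scale (x j) (b' j - (\<Sum>i<d. scale (c j i) (b i)))) \<in> B"
    using c assms(3) by (intro subspace_sum subspace_scale) auto
  also have "(\<Sum>j<e. scale (x j) (b' j - (\<Sum>i<d. scale (c j i) (b i))))
    = (\<Sum>j<e. scale (x j) (b' j)) - (\<Sum>j<e. \<Sum>i<d. scale (x j * c j i) (b i))"
    by (simp add: scale_right_diff_distrib sum_subtractf scale_sum_right)
  also have "(\<Sum>j<e. \<Sum>i<d. scale (x j * c j i) (b i)) = (\<Sum>i<d. scale (\<Sum>j<e. x j * c j i) (b i))"
    by (subst sum.swap) (simp add: scale_sum_left)
  also have "\<dots> = 0" using x(2) by simp
  finally show False using b'(2) x(1) by auto
qed

lemma has_qdim_unique:
  "has_qdim scale A B d \<Longrightarrow> has_qdim scale A B e \<Longrightarrow> subspace B \<Longrightarrow> d = e"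
  using has_qdim_le by (metis antisym)

lemma has_qdim_trans:
  assumes "has_qdim scale A B d" "has_qdim scale B C e" "B \<subseteq> A" "C \<subseteq> B" "subspace B"
  shows "has_qdim scale A C (d + e)"
proof -
  obtain b where b: "\<forall>i<d. b i \<in> A" "\<forall>a\<in>A. \<exists>c. a - (\<Sum>i<d. scale (c i) (b i)) \<in> B"
      "\<forall>c. (\<Sum>i<d. scale (c i) (b i)) \<in> B \<longrightarrow> (\<forall>i<d. c i = 0)"
    using assms(1) unfolding has_qdim_def by blast
  obtain b' where b': "\<forall>i<e. b' i \<in> B" "\<forall>a\<in>B. \<exists>c. a - (\<Sum>i<e. scale (c i) (b' i)) \<in> C"
      "\<forall>c. (\<Sum>i<e. scale (c i) (b' i)) \<in> C \<longrightarrow> (\<forall>i<e. c i = 0)"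
    using assms(2) unfolding has_qdim_def by blast
  define f where "f i = (if i < d then b i else b' (i - d))" for i
  have sp: "(\<Sum>i<d + e. scale (c i) (f i)) = (\<Sum>i<d. scale (c i) (b i)) + (\<Sum>i<e. scale (c (d + i)) (b' i))" for c
  proof -
    have "{..<d + e} = {..<d} \<union> (+) d ` {..<e}"
    proof -
      have "i \<in> (+) d ` {..<e}" if "i < d + e" "\<not> i < d" for i
        using that by (intro image_eqI[of _ _ "i - d"]) auto
      then show ?thesis by auto
    qed
    then have "(\<Sum>i<d + e. scale (c i) (f i))
      = (\<Sum>i<d. scale (c i) (f i)) + (\<Sum>i\<in>(+) d ` {..<e}. scale (c i) (f i))"
      by (simp, subst sum.union_disjoint) auto
    then show ?thesis by (simp add: sum.reindex f_def)
  qed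
  show ?thesis unfolding has_qdim_def
  proof (intro exI[of _ f] conjI allI ballI impI)
    fix i assume "i < d + e" then show "f i \<in> A" using b(1) b'(1) assms(3) by (auto simp: f_def)
  next
    fix a assume "a \<in> A"
    then obtain c where c: "a - (\<Sum>i<d. scale (c i) (b i)) \<in> B" using b by blast
    then obtain c' where c': "a - (\<Sum>i<d. scale (c i) (b i)) - (\<Sum>i<e. scale (c' i) (b' i)) \<in> C"
      using b' by blast
    show "\<exists>c. a - (\<Sum>i<d + e. scale (c i) (f i)) \<in> C"
      using c' by (intro exI[of _ "\<lambda>i. if i < d then c i else c' (i - d)"])
        (simp add: sp algebra_simps)
  next
    fix c i assume *: "(\<Sum>i<d + e. scale (c i) (f i)) \<in> C" and i: "i < d + e"
    have "(\<Sum>i<e. scale (c (d + i)) (b' i)) \<in> B" using b'(1) assms(5)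
      by (intro subspace_sum subspace_scale) auto
    moreover have "(\<Sum>i<d + e. scale (c i) (f i)) \<in> B" using * assms(4) by blast
    ultimately have "(\<Sum>i<d. scale (c i) (b i)) \<in> B"
      unfolding sp using subspace_diff[OF assms(5)] by (metis add_diff_cancel_right')
    then have z: "\<forall>i<d. c i = 0" using b(3) by blast
    then have "(\<Sum>i<d. scale (c i) (b i)) = 0" by simp
    then have "(\<Sum>i<e. scale (c (d + i)) (b' i)) \<in> C" using * unfolding sp by simp
    then have "\<forall>i<e. c (d + i) = 0" using b'(3)[rule_format, of "\<lambda>i. c (d + i)"] by blast
    then show "c i = 0" using z i by (cases "i < d") (auto dest!: spec[of _ "i - d"])
  qed
qed

end

text \<open>The isomorphism of quotients is given by a linear relation \<open>R\<close> instead of a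
  map: a connecting homomorphism involves choosing lifts and becomes single valued only modulo
  \<open>B\<close> and \<open>B'\<close>.\<close>

lemma has_qdim_transfer:
  fixes sc :: "'k::field \<Rightarrow> 'v::ab_group_add \<Rightarrow> 'v" and sc' :: "'k \<Rightarrow> 'w::ab_group_add \<Rightarrow> 'w"
  assumes "vector_space sc" "vector_space sc'"
    and A: "module.subspace sc A" and A': "module.subspace sc' A'"
    and R0: "R 0 0" and Radd: "\<And>a b a' b'. R a a' \<Longrightarrow> R b b' \<Longrightarrow> R (a + b) (a' + b')"
    and Rsc: "\<And>c a a'. R a a' \<Longrightarrow> R (sc c a) (sc' c a')"
    and tot: "\<And>a. a \<in> A \<Longrightarrow> \<exists>a'\<in>A'. R a a'"
    and sur: "\<And>a'. a' \<in> A' \<Longrightarrow> \<exists>a\<in>A. R a a'"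
    and ker: "\<And>a a'. R a a' \<Longrightarrow> a \<in> A \<Longrightarrow> a' \<in> A' \<Longrightarrow> a \<in> B \<longleftrightarrow> a' \<in> B'"
    and d: "has_qdim sc A B d"
  shows "has_qdim sc' A' B' d"
proof -
  interpret V: vector_space sc by fact
  interpret W: vector_space sc' by fact
  obtain b where b: "\<forall>i<d. b i \<in> A" "\<forall>a\<in>A. \<exists>c. a - (\<Sum>i<d. sc (c i) (b i)) \<in> B"
      "\<forall>c. (\<Sum>i<d. sc (c i) (b i)) \<in> B \<longrightarrow> (\<forall>i<d. c i = 0)"
    using d unfolding has_qdim_def by blast
  have "\<forall>i. \<exists>x. i < d \<longrightarrow> x \<in> A' \<and> R (b i) x" using tot b by blast
  then obtain b' where b': "\<And>i. i < d \<Longrightarrow> b' i \<in> A'" "\<And>i. i < d \<Longrightarrow> R (b i) (b' i)" by metis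
  have Rsum: "R (\<Sum>i\<in>X. sc (c i) (b i)) (\<Sum>i\<in>X. sc' (c i) (b' i))" if "X \<subseteq> {..<d}" for c X
    using finite_subset[OF that finite_lessThan] that
    by (induction X rule: finite_induct) (auto intro!: R0 Radd Rsc b')
  have mem: "(\<Sum>i<d. sc (c i) (b i)) \<in> A" "(\<Sum>i<d. sc' (c i) (b' i)) \<in> A'" for c
    using A A' b(1) b'(1) by (auto intro!: V.subspace_sum V.subspace_scale W.subspace_sum W.subspace_scale)
  show ?thesis unfolding has_qdim_def
  proof (intro exI[of _ b'] conjI allI ballI impI)
    fix i assume "i < d" then show "b' i \<in> A'" by (rule b')
  next
    fix a' assume a': "a' \<in> A'"
    then obtain a where a: "a \<in> A" "R a a'" using sur by blast
    then obtain c where c: "a - (\<Sum>i<d. sc (c i) (b i)) \<in> B" using b by blast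
    have "R (a + sc (-1) (\<Sum>i<d. sc (c i) (b i))) (a' + sc' (-1) (\<Sum>i<d. sc' (c i) (b' i)))"
      using Rsum by (intro Radd Rsc a) auto
    then have "R (a - (\<Sum>i<d. sc (c i) (b i))) (a' - (\<Sum>i<d. sc' (c i) (b' i)))" by simp
    then have "a' - (\<Sum>i<d. sc' (c i) (b' i)) \<in> B'"
      using ker c mem a(1) a' A A' V.subspace_diff W.subspace_diff by meson
    then show "\<exists>c. a' - (\<Sum>i<d. sc' (c i) (b' i)) \<in> B'" by blast
  next
    fix c i assume "(\<Sum>i<d. sc' (c i) (b' i)) \<in> B'" and i: "i < d"
    then have "(\<Sum>i<d. sc (c i) (b i)) \<in> B" using ker[OF Rsum[of "{..<d}" c]] mem by auto
    then show "c i = 0" using b(3) i by blast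
  qed
qed

section \<open>Laurent vectors\<close>

abbreviation lk where "lk \<equiv> Poly_Mapping.lookup"
abbreviation ks where "ks \<equiv> Poly_Mapping.keys"

text \<open>The pair \<open>(i, a)\<close> stands for the Laurent monomial \<open>x\<^sup>a\<close> times the \<open>i\<close>-th basis vector of a free module,
  whose degree is \<open>\<delta> i\<close> throughout.\<close>

type_synonym expo = "nat \<Rightarrow>\<^sub>0 int"
type_synonym 'k vec = "(nat \<times> expo) \<Rightarrow>\<^sub>0 'k"

definition vscale :: "'k::field \<Rightarrow> ('x \<Rightarrow>\<^sub>0 'k) \<Rightarrow> ('x \<Rightarrow>\<^sub>0 'k)"
  where "vscale c f = Poly_Mapping.map ((*) c) f"

lemma lookup_vscale [simp]: "lk (vscale c f) x = c * lk f x"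
  by (simp add: vscale_def Poly_Mapping.map.rep_eq when_def)

global_interpretation vec: vector_space vscale
  by unfold_locales (auto intro!: poly_mapping_eqI simp: lookup_add algebra_simps)

lemma keys_vscale: "ks (vscale c f) \<subseteq> ks f"
  by (auto simp: in_keys_iff)

lemma keys_sum_subset: "(\<And>i. i \<in> I \<Longrightarrow> ks (f i) \<subseteq> S) \<Longrightarrow> ks (sum f I) \<subseteq> S"
  using keys_sum[of f I] by blast

lemma keys_minus_subset: "ks (f - (g::'x \<Rightarrow>\<^sub>0 'k::ab_group_add)) \<subseteq> ks f \<union> ks g"
  by (auto simp: in_keys_iff lookup_minus)

lemma keys_empty_iff: "ks f = {} \<longleftrightarrow> f = 0"
  by (metis keys_zero all_not_in_conv in_keys_iff lookup_zero poly_mapping_eqI)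

lemma subspace_keys: "vec.subspace {f :: 'x \<Rightarrow>\<^sub>0 'k::field. ks f \<subseteq> S}"
proof (rule vec.subspaceI)
  fix x y :: "'x \<Rightarrow>\<^sub>0 'k" and c
  assume x: "x \<in> {f. ks f \<subseteq> S}"
  then show "vscale c x \<in> {f. ks f \<subseteq> S}" using keys_vscale[of c x] by blast
  assume "y \<in> {f. ks f \<subseteq> S}"
  then show "x + y \<in> {f. ks f \<subseteq> S}" using keys_add[of x y] x by blast
qed simp

section \<open>Restriction to a set of monomials, multiplication by monomials, linear
  extension\<close>

definition filt :: "'x set \<Rightarrow> ('x \<Rightarrow>\<^sub>0 'k::zero) \<Rightarrow> ('x \<Rightarrow>\<^sub>0 'k)"
  where "filt S f = Poly_Mapping.mapp (\<lambda>x v. if x \<in> S then v else 0) f"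

lemma lookup_filt [simp]: "lk (filt S f) x = (if x \<in> S then lk f x else 0)"
  by (auto simp: filt_def lookup_mapp when_def in_keys_iff)

lemma keys_filt: "ks (filt S f) = ks f \<inter> S"
  by (auto simp: in_keys_iff split: if_splits)

lemma filt_zero [simp]: "filt S 0 = 0"
  by (rule poly_mapping_eqI) simp

lemma filt_add: "filt S (f + g) = filt S f + filt S (g :: _ \<Rightarrow>\<^sub>0 _::monoid_add)"
  by (rule poly_mapping_eqI) (simp add: lookup_add)

lemma filt_uminus: "filt S (- f) = - filt S (f :: _ \<Rightarrow>\<^sub>0 _::ab_group_add)"
  by (rule poly_mapping_eqI) simp

lemma filt_id: "ks f \<subseteq> S \<Longrightarrow> filt S f = f"
  by (rule poly_mapping_eqI) (auto simp: in_keys_iff)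

lemma filt_eq_0: "ks f \<inter> S = {} \<Longrightarrow> filt S f = 0"
  by (metis keys_empty_iff keys_filt)

lemma filt_sum: "filt S (sum f I) = (\<Sum>i\<in>I. filt S (f i :: _ \<Rightarrow>\<^sub>0 _::comm_monoid_add))"
  by (induction I rule: infinite_finite_induct) (simp_all add: filt_add)

text \<open>Multiplication by the Laurent monomial x^c; it is invertible, with inverse
  \<open>shift (- c)\<close>.\<close>

definition shift :: "expo \<Rightarrow> 'k::field vec \<Rightarrow> 'k vec"
  where "shift c f = Poly_Mapping.map_key (\<lambda>x. (fst x, snd x - c)) f"

lemma lookup_shift [simp]: "lk (shift c f) x = lk f (fst x, snd x - c)"
proof -
  have "inj (\<lambda>x::nat \<times> expo. (fst x, snd x - c))" by (auto simp: inj_on_def prod_eq_iff)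
  then show ?thesis by (simp add: shift_def map_key.rep_eq)
qed

lemma keys_shift: "ks (shift c f) = (\<lambda>x. (fst x, snd x + c)) ` ks f"
proof
  show "ks (shift c f) \<subseteq> (\<lambda>x. (fst x, snd x + c)) ` ks f"
  proof
    fix x assume "x \<in> ks (shift c f)"
    then have "(fst x, snd x - c) \<in> ks f" by (simp add: in_keys_iff)
    then show "x \<in> (\<lambda>x. (fst x, snd x + c)) ` ks f" by (rule rev_image_eqI) simp
  qed
qed (auto simp: in_keys_iff)

lemma shift_0 [simp]: "shift 0 f = f" by (rule poly_mapping_eqI) simp
lemma shift_zero [simp]: "shift c 0 = 0" by (rule poly_mapping_eqI) simp
lemma shift_shift [simp]: "shift c (shift d f) = shift (c + d) f"
  by (rule poly_mapping_eqI) (simp add: diff_diff_eq)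
lemma shift_add: "shift c (f + g) = shift c f + shift c g"
  by (rule poly_mapping_eqI) (simp add: lookup_add)
lemma shift_minus: "shift c (f - g) = shift c f - shift c g"
  by (rule poly_mapping_eqI) (simp add: lookup_minus)
lemma shift_vscale: "shift c (vscale a f) = vscale a (shift c f)"
  by (rule poly_mapping_eqI) simp
lemma shift_sum: "shift c (sum f I) = (\<Sum>i\<in>I. shift c (f i))"
  by (induction I rule: infinite_finite_induct) (simp_all add: shift_add)
lemma shift_single: "shift c (Poly_Mapping.single x a) = Poly_Mapping.single (fst x, snd x + c) a"
  by (rule poly_mapping_eqI) (auto simp: lookup_single when_def prod_eq_iff)
lemma shift_eq_0_iff [simp]: "shift c f = 0 \<longleftrightarrow> f = 0"
  by (metis shift_zero shift_shift add.left_inverse shift_0)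

definition lin :: "('x \<Rightarrow> ('y \<Rightarrow>\<^sub>0 'k::field)) \<Rightarrow> ('x \<Rightarrow>\<^sub>0 'k) \<Rightarrow> ('y \<Rightarrow>\<^sub>0 'k)"
  where "lin b f = (\<Sum>x\<in>ks f. vscale (lk f x) (b x))"

lemma lin_superset: "finite X \<Longrightarrow> ks f \<subseteq> X \<Longrightarrow> lin b f = (\<Sum>x\<in>X. vscale (lk f x) (b x))"
  unfolding lin_def by (rule sum.mono_neutral_left) (auto simp: in_keys_iff)

lemma lin_zero [simp]: "lin b 0 = 0" by (simp add: lin_def)

lemma lin_add: "lin b (f + g) = lin b f + lin b g"
  using keys_add[of f g]
  by (simp add: lin_superset[of "ks f \<union> ks g"] lookup_add vec.scale_left_distrib sum.distrib)

lemma lin_vscale: "lin b (vscale c f) = vscale c (lin b f)"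
  by (subst lin_superset[of "ks f"]) (simp_all add: keys_vscale lin_def vec.scale_sum_right)

lemma lin_uminus: "lin b (- f) = - lin b f"
  using lin_vscale[of b "-1" f] by simp

lemma lin_minus: "lin b (f - g) = lin b f - lin b g"
  using lin_add[of b f "- g"] by (simp add: lin_uminus)

lemma lin_sum: "lin b (sum f I) = (\<Sum>i\<in>I. lin b (f i))"
  by (induction I rule: infinite_finite_induct) (simp_all add: lin_add)

lemma lin_single [simp]: "lin b (Poly_Mapping.single x c) = vscale c (b x)"
  by (subst lin_superset[of "{x}"]) auto

lemma lookup_lin: "lk (lin b f) y = (\<Sum>x\<in>ks f. lk f x * lk (b x) y)"
  by (simp add: lin_def lookup_sum)

lemma lin_in_subspace: "vec.subspace V \<Longrightarrow> (\<And>x. x \<in> ks f \<Longrightarrow> b x \<in> V) \<Longrightarrow> lin b f \<in> V"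
  unfolding lin_def by (intro vec.subspace_sum vec.subspace_scale)

lemma decompose_single: "f = (\<Sum>x\<in>ks f. vscale (lk f x) (Poly_Mapping.single x 1))"
proof (rule poly_mapping_eqI)
  fix y
  have "(\<Sum>x\<in>ks f. lk f x * lk (Poly_Mapping.single x 1) y) = (\<Sum>x\<in>ks f. if x = y then lk f x else 0)"
    by (intro sum.cong) (auto simp: lookup_single)
  then show "lk f y = lk (\<Sum>x\<in>ks f. vscale (lk f x) (Poly_Mapping.single x 1)) y"
    by (simp add: lookup_sum) (simp add: in_keys_iff)
qed

text \<open>The homomorphism of free modules that sends the \<open>i\<close>-th basis vector to
  \<open>g i\<close>. It is defined on all Laurent vectors, so one formula serves for the module and
  for all its localizations.\<close>

definition ext :: "(nat \<Rightarrow> 'k::field vec) \<Rightarrow> 'k vec \<Rightarrow> 'k vec"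
  where "ext g = lin (\<lambda>x. shift (snd x) (g (fst x)))"

lemma ext_zero [simp]: "ext g 0 = 0"
  and ext_add: "ext g (e + f) = ext g e + ext g f"
  and ext_minus: "ext g (e - f) = ext g e - ext g f"
  and ext_vscale: "ext g (vscale c f) = vscale c (ext g f)"
  and ext_sum: "ext g (sum h I) = (\<Sum>i\<in>I. ext g (h i))"
  and ext_single: "ext g (Poly_Mapping.single x c) = vscale c (shift (snd x) (g (fst x)))"
  by (simp_all add: ext_def lin_add lin_minus lin_vscale lin_sum)

lemma ext_shift: "ext g (shift c f) = shift c (ext g f)"
proof -
  have inj: "inj_on (\<lambda>x. (fst x, snd x + c)) (ks f)" by (auto simp: inj_on_def prod_eq_iff)
  show ?thesis
    unfolding ext_def lin_def keys_shift
    by (subst sum.reindex[OF inj]) (simp add: shift_sum shift_vscale add.commute)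
qed

section \<open>Degrees, denominators and free modules\<close>

definition tdeg :: "expo \<Rightarrow> int" where "tdeg a = (\<Sum>v\<in>ks a. lk a v)"

lemma tdeg_superset: "finite X \<Longrightarrow> ks a \<subseteq> X \<Longrightarrow> tdeg a = (\<Sum>v\<in>X. lk a v)"
  unfolding tdeg_def by (rule sum.mono_neutral_left) (auto simp: in_keys_iff)

lemma tdeg_add: "tdeg (a + b) = tdeg a + tdeg b"
  using keys_add[of a b]
  by (simp add: tdeg_superset[of "ks a \<union> ks b"] lookup_add sum.distrib)

lemma tdeg_zero [simp]: "tdeg 0 = 0" by (simp add: tdeg_def)
lemma tdeg_uminus [simp]: "tdeg (- a) = - tdeg a"
  using tdeg_add[of a "- a"] by simp
lemma tdeg_diff: "tdeg (a - b) = tdeg a - tdeg b"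
  using tdeg_add[of a "- b"] by simp
lemma tdeg_single [simp]: "tdeg (Poly_Mapping.single v k) = k"
  by (simp add: tdeg_superset[of "{v}"])

definition kdeg :: "(nat \<Rightarrow> nat) \<Rightarrow> nat \<times> expo \<Rightarrow> int"
  where "kdeg \<delta> x = int (\<delta> (fst x)) + tdeg (snd x)"

definition neg :: "expo \<Rightarrow> nat set" where "neg a = {v. lk a v < 0}"

text \<open>Exponents of the monomials that become invertible in the localization at
  \<open>\<sigma>\<close>.\<close>

definition nexp :: "nat set \<Rightarrow> expo set" where "nexp \<sigma> = {c. ks c \<subseteq> \<sigma> \<and> neg c = {}}"

text \<open>The monomial basis of the localization at \<open>\<sigma>\<close> of the free module of
  rank \<open>m\<close>; \<open>\<sigma> = {}\<close> gives the free module itself.\<close>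

definition kset :: "nat \<Rightarrow> nat \<Rightarrow> nat set \<Rightarrow> (nat \<times> expo) set"
  where "kset n m \<sigma> = {x. fst x < m \<and> ks (snd x) \<subseteq> {..<n} \<and> neg (snd x) \<subseteq> \<sigma>}"

definition hom :: "(nat \<Rightarrow> nat) \<Rightarrow> int \<Rightarrow> 'k::field vec set"
  where "hom \<delta> t = {f. \<forall>x\<in>ks f. kdeg \<delta> x = t}"

definition gfree :: "nat \<Rightarrow> nat \<Rightarrow> nat set \<Rightarrow> 'k::field vec set"
  where "gfree n m \<sigma> = {f. ks f \<subseteq> kset n m \<sigma>}"

definition gpart :: "(nat \<Rightarrow> nat) \<Rightarrow> int \<Rightarrow> 'k::field vec \<Rightarrow> 'k vec"
  where "gpart \<delta> t f = filt {x. kdeg \<delta> x = t} f"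

lemma nexpD: "c \<in> nexp \<sigma> \<Longrightarrow> lk c v \<ge> 0" "c \<in> nexp \<sigma> \<Longrightarrow> ks c \<subseteq> \<sigma>"
  by (auto simp: nexp_def neg_def not_less)

lemma nexp_add: "c \<in> nexp \<sigma> \<Longrightarrow> d \<in> nexp \<sigma> \<Longrightarrow> c + d \<in> nexp \<sigma>"
  using keys_add[of c d] by (auto simp: nexp_def neg_def lookup_add not_less)

lemma nexp_0 [simp]: "0 \<in> nexp \<sigma>" by (simp add: nexp_def neg_def)

lemma nexp_single: "v \<in> \<sigma> \<Longrightarrow> k \<ge> 0 \<Longrightarrow> Poly_Mapping.single v k \<in> nexp \<sigma>"
  by (auto simp: nexp_def neg_def lookup_single when_def)

lemma nexp_mono: "\<sigma> \<subseteq> \<tau> \<Longrightarrow> nexp \<sigma> \<subseteq> nexp \<tau>" by (auto simp: nexp_def)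

lemma nexp_sum: "(\<And>i. i \<in> I \<Longrightarrow> c i \<in> nexp \<sigma>) \<Longrightarrow> sum c I \<in> nexp \<sigma>"
  by (induction I rule: infinite_finite_induct) (auto intro: nexp_add)

lemma tdeg_nexp: "c \<in> nexp \<sigma> \<Longrightarrow> tdeg c \<ge> 0"
  by (auto simp: tdeg_def nexpD intro: sum_nonneg)

lemma kdeg_shift: "kdeg \<delta> (fst x, snd x + c) = kdeg \<delta> x + tdeg c"
  by (simp add: kdeg_def tdeg_add)

lemma hom_shift: "f \<in> hom \<delta> t \<Longrightarrow> shift c f \<in> hom \<delta> (t + tdeg c)"
  by (auto simp: hom_def keys_shift kdeg_shift)

lemma hom_shift_iff: "shift c f \<in> hom \<delta> t \<longleftrightarrow> f \<in> hom \<delta> (t - tdeg c)"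
  using hom_shift[of f \<delta> "t - tdeg c" c] hom_shift[of "shift c f" \<delta> t "- c"] by auto

lemma subspace_hom: "vec.subspace (hom \<delta> t :: 'k::field vec set)"
proof -
  have "hom \<delta> t = {f :: 'k vec. ks f \<subseteq> {x. kdeg \<delta> x = t}}" by (auto simp: hom_def)
  then show ?thesis by (simp add: subspace_keys)
qed

lemma subspace_gfree: "vec.subspace (gfree n m \<sigma>)"
  by (simp add: gfree_def subspace_keys)

lemma gpart_hom: "gpart \<delta> t f \<in> hom \<delta> t"
  by (auto simp: gpart_def hom_def keys_filt)

lemma gpart_id: "f \<in> hom \<delta> t \<Longrightarrow> gpart \<delta> t f = f"
  unfolding gpart_def by (rule filt_id) (auto simp: hom_def)

lemma gpart_add: "gpart \<delta> t (f + g) = gpart \<delta> t f + gpart \<delta> t g"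
  by (simp add: gpart_def filt_add)

lemma gpart_shift: "gpart \<delta> t (shift c f) = shift c (gpart \<delta> (t - tdeg c) f)"
  by (rule poly_mapping_eqI) (auto simp: gpart_def kdeg_def tdeg_diff)

lemma gpart_sum: "finite T \<Longrightarrow> kdeg \<delta> ` ks f \<subseteq> T \<Longrightarrow> (\<Sum>t\<in>T. gpart \<delta> t f) = f"
  by (rule poly_mapping_eqI) (auto simp: gpart_def lookup_sum in_keys_iff subset_eq image_iff)

lemma hom_disjoint: "f \<in> hom \<delta> t \<Longrightarrow> s \<noteq> t \<Longrightarrow> gpart \<delta> s f = 0"
  unfolding gpart_def by (rule filt_eq_0) (auto simp: hom_def)

section \<open>Graded submodules of a free module and their localizations\<close>

definition gsub :: "nat \<Rightarrow> nat \<Rightarrow> (nat \<Rightarrow> nat) \<Rightarrow> 'k::field vec set \<Rightarrow> bool"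
  where "gsub n m \<delta> N \<longleftrightarrow> vec.subspace N \<and> N \<subseteq> gfree n m {} \<and>
    (\<forall>c\<in>nexp {..<n}. \<forall>f\<in>N. shift c f \<in> N) \<and> (\<forall>t. \<forall>f\<in>N. gpart \<delta> t f \<in> N)"

text \<open>Monomials act injectively on Laurent vectors, so a fraction is itself a Laurent vector
  rather than a class of pairs.\<close>

definition loc :: "nat set \<Rightarrow> 'k::field vec set \<Rightarrow> 'k vec set"
  where "loc \<sigma> N = {f. \<exists>c\<in>nexp \<sigma>. shift c f \<in> N}"

lemma gsubD:
  assumes "gsub n m \<delta> N"
  shows "vec.subspace N" "N \<subseteq> gfree n m {}" "c \<in> nexp {..<n} \<Longrightarrow> f \<in> N \<Longrightarrow> shift c f \<in> N"
    "f \<in> N \<Longrightarrow> gpart \<delta> t f \<in> N"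
  using assms by (auto simp: gsub_def)

lemma gfree_shift: "c \<in> nexp {..<n} \<Longrightarrow> f \<in> gfree n m \<sigma> \<Longrightarrow> shift c f \<in> gfree n m \<sigma>"
proof -
  assume c: "c \<in> nexp {..<n}" and f: "f \<in> gfree n m \<sigma>"
  have "(fst x, snd x + c) \<in> kset n m \<sigma>" if "x \<in> ks f" for x
  proof -
    have x: "x \<in> kset n m \<sigma>" using f that by (auto simp: gfree_def)
    have "ks (snd x + c) \<subseteq> {..<n}" using keys_add[of "snd x" c] nexpD(2)[OF c] x by (auto simp: kset_def)
    moreover have "neg (snd x + c) \<subseteq> neg (snd x)"
    proof
      fix v assume "v \<in> neg (snd x + c)"
      then show "v \<in> neg (snd x)" using nexpD(1)[OF c, of v] by (auto simp: neg_def lookup_add)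
    qed
    ultimately show ?thesis using x by (auto simp: kset_def)
  qed
  then show ?thesis by (auto simp: gfree_def keys_shift)
qed

lemma gsub_gfree: "gsub n m \<delta> (gfree n m {})"
  unfolding gsub_def using subspace_gfree[of n m "{}"] gfree_shift[of _ n _ m "{}"]
  by (auto simp: gfree_def gpart_def keys_filt)

lemma gsub_zero: "gsub n m \<delta> {0}"
  by (auto simp: gsub_def vec.subspace_single_0 gfree_def gpart_def)

lemma loc_shift_iff:
  assumes "\<And>c f. c \<in> nexp \<sigma> \<Longrightarrow> f \<in> N \<Longrightarrow> shift c f \<in> N" "c \<in> nexp \<sigma>"
  shows "shift c f \<in> loc \<sigma> N \<longleftrightarrow> f \<in> loc \<sigma> N"
proof
  assume "shift c f \<in> loc \<sigma> N"
  then obtain d where "d \<in> nexp \<sigma>" "shift (d + c) f \<in> N" by (auto simp: loc_def)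
  then show "f \<in> loc \<sigma> N" using assms(2) nexp_add by (auto simp: loc_def)
next
  assume "f \<in> loc \<sigma> N"
  then obtain d where "d \<in> nexp \<sigma>" "shift d f \<in> N" by (auto simp: loc_def)
  then show "shift c f \<in> loc \<sigma> N" using assms
    by (auto simp: loc_def intro!: bexI[of _ d]) (metis add.commute shift_shift)
qed

lemma subspace_loc:
  assumes N: "gsub n m \<delta> N" and \<sigma>: "\<sigma> \<subseteq> {..<n}"
  shows "vec.subspace (loc \<sigma> N)"
proof (rule vec.subspaceI)
  show "0 \<in> loc \<sigma> N" using vec.subspace_0[OF gsubD(1)[OF N]] by (auto simp: loc_def intro: nexp_0)
next
  fix x y assume "x \<in> loc \<sigma> N" "y \<in> loc \<sigma> N"
  then obtain c d where cd: "c \<in> nexp \<sigma>" "d \<in> nexp \<sigma>" "shift c x \<in> N" "shift d y \<in> N"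
    by (auto simp: loc_def)
  then have "shift d (shift c x) \<in> N" "shift c (shift d y) \<in> N"
    using gsubD(3)[OF N] nexp_mono[OF \<sigma>] by blast+
  then have "shift (c + d) (x + y) \<in> N"
    using vec.subspace_add[OF gsubD(1)[OF N]] by (simp add: shift_add add.commute)
  then show "x + y \<in> loc \<sigma> N" using nexp_add cd by (auto simp: loc_def)
next
  fix a x assume "x \<in> loc \<sigma> N"
  then show "vscale a x \<in> loc \<sigma> N"
    using vec.subspace_scale[OF gsubD(1)[OF N]] by (auto simp: loc_def shift_vscale)
qed

lemma loc_mono: "\<sigma> \<subseteq> \<tau> \<Longrightarrow> M \<subseteq> N \<Longrightarrow> loc \<sigma> M \<subseteq> loc \<tau> N"
  using nexp_mono[of \<sigma> \<tau>] by (auto simp: loc_def)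

lemma loc_gpart: "gsub n m \<delta> N \<Longrightarrow> f \<in> loc \<sigma> N \<Longrightarrow> gpart \<delta> t f \<in> loc \<sigma> N"
proof -
  assume N: "gsub n m \<delta> N" and "f \<in> loc \<sigma> N"
  then obtain c where c: "c \<in> nexp \<sigma>" "shift c f \<in> N" by (auto simp: loc_def)
  then have "gpart \<delta> (t + tdeg c) (shift c f) \<in> N" using gsubD(4)[OF N] by blast
  then show ?thesis using c by (auto simp: gpart_shift loc_def)
qed

text \<open>A common denominator is the product over \<open>X\<close> of the negative parts
  \<open>np\<close>, each of which involves only variables in \<open>\<sigma>\<close>.\<close>

lemma clear_denominators:
  assumes "finite X" "\<And>x. x \<in> X \<Longrightarrow> neg (snd x :: expo) \<subseteq> \<sigma>"
  shows "\<exists>c\<in>nexp \<sigma>. \<forall>x\<in>X. neg (snd x + c) = {}"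
proof -
  define np where "np a = Poly_Mapping.map (\<lambda>x. max 0 (- x)) (a::expo)" for a
  have lnp: "lk (np a) v = max 0 (- lk a v)" for a v
    by (auto simp: np_def Poly_Mapping.map.rep_eq when_def)
  have np: "np a \<in> nexp (neg a)" for a
    by (auto simp: nexp_def neg_def lnp in_keys_iff)
  define c where "c = (\<Sum>x\<in>X. np (snd x))"
  have "c \<in> nexp \<sigma>" unfolding c_def using np nexp_mono assms(2) by (intro nexp_sum) blast
  moreover have "neg (snd x + c) = {}" if "x \<in> X" for x
  proof -
    have "lk (np (snd x)) v \<le> lk c v" for v
      unfolding c_def lookup_sum using assms(1) that nexpD(1)[OF np]
      by (intro member_le_sum) auto
    then have "0 \<le> lk (snd x + c) v" for v
      using lnp[of "snd x" v] by (smt (verit) lookup_add)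
    then show ?thesis by (auto simp: neg_def not_less)
  qed
  ultimately show ?thesis by blast
qed

text \<open>A monomial in the variables of \<open>\<sigma>\<close> can repair negative exponents
  only at these variables; conversely the finitely many monomials of a vector have a common
  denominator.\<close>

lemma loc_gfree:
  assumes "\<sigma> \<subseteq> {..<n}"
  shows "loc \<sigma> (gfree n m {}) = (gfree n m \<sigma> :: 'k::field vec set)" (is "?A = ?B")
proof
  show "?A \<subseteq> ?B"
  proof
    fix f :: "'k vec" assume "f \<in> loc \<sigma> (gfree n m {})"
    then obtain c where c: "c \<in> nexp \<sigma>" "shift c f \<in> gfree n m {}" by (auto simp: loc_def)
    have "x \<in> kset n m \<sigma>" if x: "x \<in> ks f" for x
    proof -
      have k: "(fst x, snd x + c) \<in> kset n m {}" using c x by (force simp: gfree_def keys_shift)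
      have "ks (snd x) \<subseteq> ks (snd x + c) \<union> ks c" by (auto simp: in_keys_iff lookup_add)
      moreover have "neg (snd x) \<subseteq> ks c"
      proof
        fix v assume "v \<in> neg (snd x)"
        moreover have "lk (snd x + c) v \<ge> 0" using k by (auto simp: kset_def neg_def not_less)
        ultimately show "v \<in> ks c" by (auto simp: neg_def lookup_add in_keys_iff)
      qed
      moreover have "ks c \<subseteq> \<sigma>" "ks c \<subseteq> {..<n}" using nexpD(2)[OF c(1)] assms by auto
      moreover have "fst x < m" "ks (snd x + c) \<subseteq> {..<n}" using k by (auto simp: kset_def)
      ultimately show ?thesis unfolding kset_def by blast
    qed
    then show "f \<in> gfree n m \<sigma>" by (auto simp: gfree_def)
  qed
  show "?B \<subseteq> ?A"
  proof
    fix f :: "'k vec" assume f: "f \<in> gfree n m \<sigma>"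
    then obtain c where c: "c \<in> nexp \<sigma>" "\<forall>x\<in>ks f. neg (snd x + c) = {}"
      using clear_denominators[of "ks f" \<sigma>] by (auto simp: gfree_def kset_def)
    have "(fst x, snd x + c) \<in> kset n m {}" if "x \<in> ks f" for x
    proof -
      have "ks c \<subseteq> {..<n}" using nexpD(2)[OF c(1)] assms by auto
      moreover have "fst x < m" "ks (snd x) \<subseteq> {..<n}" using f that by (auto simp: gfree_def kset_def)
      ultimately show ?thesis using keys_add[of "snd x" c] c(2) that by (auto simp: kset_def)
    qed
    then have "shift c f \<in> gfree n m {}" by (auto simp: gfree_def keys_shift)
    then show "f \<in> loc \<sigma> (gfree n m {})" using c(1) by (auto simp: loc_def)
  qed
qed

section \<open>Cech and Koszul differentials\<close>

text \<open>The sign of the face \<open>\<tau> - {j}\<close> in a simplicial cochain complex. It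
  acts by negation rather than by a scalar, so that it applies in any abelian group, in particular
  to the families of cochains in the double complex.\<close>

definition ssgn :: "nat set \<Rightarrow> nat \<Rightarrow> 'a::ab_group_add \<Rightarrow> 'a"
  where "ssgn \<tau> j x = (if even (card {i\<in>\<tau>. i < j}) then x else - x)"

text \<open>Removing the smaller of two elements moves the larger one down by a position, while
  removing the larger leaves the smaller in place, so the two orders differ by one sign.\<close>

lemma ssgn_swap:
  assumes "finite \<tau>" "i \<in> \<tau>" "j \<in> \<tau>" "i \<noteq> j"
  shows "ssgn \<tau> j (ssgn (\<tau> - {j}) i x) = - ssgn \<tau> i (ssgn (\<tau> - {i}) j x)"
proof -
  have *: "even (card {k\<in>\<tau> - {j}. k < i}) = even (card {k\<in>\<tau>. k < i}) \<and>
      even (card {k\<in>\<tau> - {i}. k < j}) \<noteq> even (card {k\<in>\<tau>. k < j})"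
    if "i < j" "i \<in> \<tau>" for i j
  proof -
    have "{k\<in>\<tau> - {j}. k < i} = {k\<in>\<tau>. k < i}" using that by auto
    moreover have "{k\<in>\<tau>. k < j} = insert i {k\<in>\<tau> - {i}. k < j}" using that by auto
    then have "card {k\<in>\<tau>. k < j} = Suc (card {k\<in>\<tau> - {i}. k < j})" using assms(1) by simp
    ultimately show ?thesis by simp
  qed
  show ?thesis using *[of i j] *[of j i] assms(2-4) by (cases "i < j") (auto simp: ssgn_def)
qed

lemma ssgn_zero [simp]: "ssgn \<tau> j 0 = 0" by (simp add: ssgn_def)
lemma ssgn_ssgn [simp]: "ssgn \<tau> j (ssgn \<tau> j x) = x" by (simp add: ssgn_def)
lemma ssgn_add: "ssgn \<tau> j (x + y) = ssgn \<tau> j x + ssgn \<tau> j y" by (simp add: ssgn_def)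
lemma ssgn_sum: "ssgn \<tau> j (sum f I) = (\<Sum>i\<in>I. ssgn \<tau> j (f i))" by (simp add: ssgn_def sum_negf)
lemma ssgn_apply: "ssgn \<tau> j f x = ssgn \<tau> j (f x)" by (simp add: ssgn_def)
lemma ssgn_in: "(\<And>x. x \<in> S \<Longrightarrow> - x \<in> S) \<Longrightarrow> x \<in> S \<Longrightarrow> ssgn \<tau> j x \<in> S" by (simp add: ssgn_def)

text \<open>With \<open>X = (\<lambda>_. id)\<close> this is the differential of the Cech complex; when \<open>X j\<close> is multiplication by
  the variable \<open>x\<^sub>j\<close> it is that of the Koszul complex.\<close>

definition codiff :: "nat \<Rightarrow> (nat \<Rightarrow> 'a \<Rightarrow> 'a) \<Rightarrow> (nat set \<Rightarrow> 'a) \<Rightarrow> nat set \<Rightarrow> 'a::ab_group_add"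
  where "codiff n X f \<tau> = (if \<tau> \<subseteq> {..<n} then \<Sum>j\<in>\<tau>. ssgn \<tau> j (X j (f (\<tau> - {j}))) else 0)"

text \<open>A contracting homotopy in direction \<open>v\<close>, where \<open>Y\<close> will be an
  inverse of \<open>X v\<close>.\<close>

definition contract :: "nat \<Rightarrow> ('a \<Rightarrow> 'a) \<Rightarrow> nat \<Rightarrow> (nat set \<Rightarrow> 'a) \<Rightarrow> nat set \<Rightarrow> 'a::ab_group_add"
  where "contract n Y v f \<sigma> = (if v \<notin> \<sigma> then ssgn (insert v \<sigma>) v (Y (f (insert v \<sigma>))) else 0)"

lemma additive_simps:
  fixes X :: "'a::ab_group_add \<Rightarrow> 'a"
  assumes "\<And>a b. X (a + b) = X a + X b"
  shows "X 0 = 0" "X (- a) = - X a" "X (ssgn \<tau> j a) = ssgn \<tau> j (X a)" "X (sum f I) = (\<Sum>i\<in>I. X (f i))"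
proof -
  show z: "X 0 = 0" using assms[of 0 0] by simp
  show u: "X (- a) = - X a" for a using assms[of a "- a"] z by (simp add: eq_neg_iff_add_eq_0 add.commute)
  show "X (ssgn \<tau> j a) = ssgn \<tau> j (X a)" by (simp add: ssgn_def u)
  show "X (sum f I) = (\<Sum>i\<in>I. X (f i))" by (induction I rule: infinite_finite_induct) (simp_all add: z assms)
qed

text \<open>The term that removes \<open>j\<close> and then \<open>i\<close> cancels against the one
  that removes \<open>i\<close> and then \<open>j\<close>.\<close>

lemma codiff_codiff:
  fixes X :: "nat \<Rightarrow> 'a::ab_group_add \<Rightarrow> 'a"
  assumes add: "\<And>j a b. X j (a + b) = X j a + X j b"
    and comm: "\<And>i j a. X i (X j a) = X j (X i a)"
  shows "codiff n X (codiff n X f) \<tau> = 0"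
proof (cases "\<tau> \<subseteq> {..<n}")
  case True
  then have fin: "finite \<tau>" using finite_subset by blast
  define c where "c p = (case p of (j, i) \<Rightarrow> ssgn \<tau> j (ssgn (\<tau> - {j}) i (X j (X i (f (\<tau> - {j} - {i}))))))" for p
  have "\<tau> - {j} \<subseteq> {..<n}" for j using True by blast
  then have "codiff n X (codiff n X f) \<tau> = (\<Sum>j\<in>\<tau>. \<Sum>i\<in>\<tau> - {j}. c (j, i))"
    using True by (simp add: codiff_def additive_simps[where X = "X j" for j, OF add] ssgn_sum c_def)
  also have "\<dots> = sum c (SIGMA j:\<tau>. \<tau> - {j})"
    using fin by (simp add: sum.Sigma)
  also have "(SIGMA j:\<tau>. \<tau> - {j}) = {(j, i) \<in> \<tau> \<times> \<tau>. j < i} \<union> {(j, i) \<in> \<tau> \<times> \<tau>. i < j}"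
    by auto
  also have "sum c \<dots> = sum c {(j, i) \<in> \<tau> \<times> \<tau>. j < i} + sum c {(j, i) \<in> \<tau> \<times> \<tau>. i < j}"
    using fin by (intro sum.union_disjoint) (auto intro: finite_subset[of _ "\<tau> \<times> \<tau>"])
  also have "sum c {(j, i) \<in> \<tau> \<times> \<tau>. i < j} = (\<Sum>p\<in>{(j, i) \<in> \<tau> \<times> \<tau>. j < i}. - c p)"
  proof (rule sum.reindex_bij_witness[of _ prod.swap prod.swap])
    fix p assume p: "p \<in> {(j, i) \<in> \<tau> \<times> \<tau>. i < j}"
    obtain j i where ji: "p = (j, i)" "i \<in> \<tau>" "j \<in> \<tau>" "i < j" using p by auto
    have "\<tau> - {j} - {i} = \<tau> - {i} - {j}" by auto
    then show "- c (prod.swap p) = c p"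
      using ssgn_swap[OF fin ji(2,3), of "X j (X i (f (\<tau> - {j} - {i})))"] ji(4)
      by (simp add: ji(1) c_def comm[of i j])
  qed auto
  finally show ?thesis by (simp add: sum_negf)
qed (simp add: codiff_def)

text \<open>The homotopy formula: invertibility of a single \<open>X v\<close> makes the complex
  exact. For \<open>v\<close> in \<open>\<tau>\<close> only the summand \<open>j = v\<close> of the
  first term survives; for \<open>v\<close> outside \<open>\<tau>\<close> everything cancels except
  the summand of the second term that removes \<open>v\<close> again.\<close>

lemma codiff_contract:
  fixes X :: "nat \<Rightarrow> 'a::ab_group_add \<Rightarrow> 'a"
  assumes add: "\<And>j a b. X j (a + b) = X j a + X j b" and addY: "\<And>a b. Y (a + b) = Y a + Y b"
    and comm: "\<And>j a. X j (Y a) = Y (X j a)" and inv: "\<And>a. X v (Y a) = a"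
    and v: "v < n" and \<tau>: "\<tau> \<subseteq> {..<n}"
  shows "codiff n X (contract n Y v f) \<tau> + contract n Y v (codiff n X f) \<tau> = f \<tau>"
proof (cases "v \<in> \<tau>")
  case True
  have fin: "finite \<tau>" using \<tau> finite_subset by blast
  have "codiff n X (contract n Y v f) \<tau> = (\<Sum>j\<in>\<tau>. if j = v then f \<tau> else 0)"
    unfolding codiff_def using \<tau>
  proof (simp, intro sum.cong refl)
    fix j assume "j \<in> \<tau>"
    show "ssgn \<tau> j (X j (contract n Y v f (\<tau> - {j}))) = (if j = v then f \<tau> else 0)"
      using True by (auto simp: contract_def additive_simps[where X = "X j" for j, OF add] inv insert_absorb)
  qed
  then show ?thesis using True fin by (simp add: contract_def)
next
  case False
  have fin: "finite \<tau>" using \<tau> finite_subset by blast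
  let ?\<rho> = "insert v \<tau>"
  have \<rho>: "?\<rho> \<subseteq> {..<n}" "?\<rho> - {v} = \<tau>" using \<tau> v False by auto
  have "contract n Y v (codiff n X f) \<tau> = ssgn ?\<rho> v (Y (codiff n X f ?\<rho>))"
    using False by (simp add: contract_def)
  also have "codiff n X f ?\<rho> = (\<Sum>j\<in>?\<rho>. ssgn ?\<rho> j (X j (f (?\<rho> - {j}))))"
    using \<rho>(1) by (simp add: codiff_def)
  also have "\<dots> = ssgn ?\<rho> v (X v (f \<tau>)) + (\<Sum>j\<in>\<tau>. ssgn ?\<rho> j (X j (f (?\<rho> - {j}))))"
    using fin False \<rho>(2) by simp
  finally have 1: "contract n Y v (codiff n X f) \<tau>
      = f \<tau> + (\<Sum>j\<in>\<tau>. ssgn ?\<rho> v (ssgn ?\<rho> j (X j (Y (f (?\<rho> - {j}))))))"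
    using comm inv by (simp add: addY ssgn_add additive_simps[OF addY] ssgn_sum)
  have "codiff n X (contract n Y v f) \<tau> = (\<Sum>j\<in>\<tau>. - ssgn ?\<rho> v (ssgn ?\<rho> j (X j (Y (f (?\<rho> - {j}))))))"
    unfolding codiff_def using \<tau>
  proof (simp, intro sum.cong refl)
    fix j assume j: "j \<in> \<tau>"
    then have jv: "j \<noteq> v" using False by auto
    then have e: "insert v (\<tau> - {j}) = ?\<rho> - {j}" by auto
    have "ssgn ?\<rho> j (ssgn (?\<rho> - {j}) v x) = - ssgn ?\<rho> v (ssgn (?\<rho> - {v}) j x)" for x :: 'a
      using fin j jv by (intro ssgn_swap) auto
    then have *: "ssgn ?\<rho> j (ssgn (?\<rho> - {j}) v x) = - ssgn ?\<rho> v (ssgn \<tau> j x)" for x :: 'a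
      unfolding \<rho>(2) .
    have "ssgn \<tau> j (ssgn (?\<rho> - {j}) v x) = - ssgn ?\<rho> v (ssgn ?\<rho> j x)" for x :: 'a
      using *[of x] by (auto simp: ssgn_def split: if_splits)
    then show "ssgn \<tau> j (X j (contract n Y v f (\<tau> - {j}))) = - ssgn ?\<rho> v (ssgn ?\<rho> j (X j (Y (f (?\<rho> - {j})))))"
      using False by (simp add: contract_def e additive_simps[where X = "X j" for j, OF add])
  qed
  then show ?thesis using 1 by (simp add: sum_negf)
qed

section \<open>The Cech differential and cochains with values in prescribed sets\<close>

abbreviation cd :: "nat \<Rightarrow> (nat set \<Rightarrow> 'a) \<Rightarrow> nat set \<Rightarrow> 'a::ab_group_add"
  where "cd n \<equiv> codiff n (\<lambda>_ a. a)"

lemma codiff_hom: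
  assumes "\<And>a b. h (a + b) = h a + (h b :: _::ab_group_add)" "\<And>j a. h (X j a) = X' j (h a)"
  shows "codiff n X' (\<lambda>\<sigma>. h (f \<sigma>)) = (\<lambda>\<tau>. h (codiff n X f \<tau>))"
proof -
  have z: "h 0 = 0" using assms(1)[of 0 0] by simp
  have u: "h (- a) = - h a" for a using assms(1)[of a "- a"] z by (simp add: eq_neg_iff_add_eq_0 add.commute)
  have s: "h (ssgn \<tau> j a) = ssgn \<tau> j (h a)" for \<tau> j a by (simp add: ssgn_def u)
  have "h (sum g I) = (\<Sum>i\<in>I. h (g i))" for g and I :: "nat set"
    by (induction I rule: infinite_finite_induct) (simp_all add: z assms(1))
  then show ?thesis by (auto simp: codiff_def fun_eq_iff z s assms(2))
qed

lemma codiff_add: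
  assumes "\<And>j a b. X j (a + b) = X j a + X j b"
  shows "codiff n X (f + g) = codiff n X f + codiff n X g"
  by (auto simp: codiff_def fun_eq_iff assms ssgn_add sum.distrib)

lemma codiff_minus:
  assumes "\<And>j a b. X j (a + b) = X j a + X j b"
  shows "codiff n X (f - g) = codiff n X f - codiff n X g"
  using codiff_add[where X = X, OF assms, where f = "f - g" and g = g] by (simp add: eq_diff_eq)

lemma codiff_zero [simp]:
  assumes "\<And>j a b. X j (a + b) = X j a + X j b"
  shows "codiff n X 0 = 0"
  using codiff_add[where X = X, OF assms, where f = 0 and g = 0] by simp

lemma cd_cd [simp]: "cd n (cd n f) = 0"
  by (rule ext) (simp add: codiff_codiff)

text \<open>Cochains are total functions that vanish off the subsets of size \<open>q\<close>. The
  degree is an integer so that degree \<open>-1\<close> makes sense and contains only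
  \<open>0\<close>, which makes boundaries in degree \<open>0\<close> a case like any other.\<close>

definition fam :: "nat \<Rightarrow> int \<Rightarrow> (nat set \<Rightarrow> 'a set) \<Rightarrow> (nat set \<Rightarrow> 'a::zero) set"
  where "fam n q S = {f. \<forall>\<sigma>. if \<sigma> \<subseteq> {..<n} \<and> int (card \<sigma>) = q then f \<sigma> \<in> S \<sigma> else f \<sigma> = 0}"

lemma famD: "f \<in> fam n q S \<Longrightarrow> \<sigma> \<subseteq> {..<n} \<Longrightarrow> int (card \<sigma>) = q \<Longrightarrow> f \<sigma> \<in> S \<sigma>"
  "f \<in> fam n q S \<Longrightarrow> \<not> (\<sigma> \<subseteq> {..<n} \<and> int (card \<sigma>) = q) \<Longrightarrow> f \<sigma> = 0"
  by (auto simp: fam_def split: if_splits)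

lemma famI: "(\<And>\<sigma>. \<sigma> \<subseteq> {..<n} \<Longrightarrow> int (card \<sigma>) = q \<Longrightarrow> f \<sigma> \<in> S \<sigma>) \<Longrightarrow>
  (\<And>\<sigma>. \<not> (\<sigma> \<subseteq> {..<n} \<and> int (card \<sigma>) = q) \<Longrightarrow> f \<sigma> = 0) \<Longrightarrow> f \<in> fam n q S"
  by (simp add: fam_def)

lemma sum_closed: "0 \<in> S \<Longrightarrow> (\<And>x y. x \<in> S \<Longrightarrow> y \<in> S \<Longrightarrow> x + y \<in> S) \<Longrightarrow> (\<And>i. i \<in> I \<Longrightarrow> f i \<in> S) \<Longrightarrow> sum f I \<in> S"
  by (induction I rule: infinite_finite_induct) auto

lemma fam_codiff:
  assumes f: "f \<in> fam n q S" and z: "\<And>j. X j 0 = 0"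
    and S: "\<And>\<tau> j x. \<tau> \<subseteq> {..<n} \<Longrightarrow> j \<in> \<tau> \<Longrightarrow> int (card \<tau>) = q + 1 \<Longrightarrow> x \<in> S (\<tau> - {j}) \<Longrightarrow> X j x \<in> T \<tau>"
    and T: "\<And>\<tau>. \<tau> \<subseteq> {..<n} \<Longrightarrow> 0 \<in> T \<tau>" "\<And>\<tau> x. \<tau> \<subseteq> {..<n} \<Longrightarrow> x \<in> T \<tau> \<Longrightarrow> - x \<in> T \<tau>"
      "\<And>\<tau> x y. \<tau> \<subseteq> {..<n} \<Longrightarrow> x \<in> T \<tau> \<Longrightarrow> y \<in> T \<tau> \<Longrightarrow> x + y \<in> T \<tau>"
  shows "codiff n X f \<in> fam n (q + 1) T"
proof (rule famI)
  fix \<tau> assume \<tau>: "\<tau> \<subseteq> {..<n}" "int (card \<tau>) = q + 1"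
  then have fin: "finite \<tau>" using finite_subset by blast
  have "ssgn \<tau> j (X j (f (\<tau> - {j}))) \<in> T \<tau>" if "j \<in> \<tau>" for j
  proof (intro ssgn_in S famD(1)[OF f])
    show "int (card (\<tau> - {j})) = q" using card_Suc_Diff1[OF fin that] \<tau>(2) by linarith
  qed (use that \<tau> T in auto)
  then have "(\<Sum>j\<in>\<tau>. ssgn \<tau> j (X j (f (\<tau> - {j})))) \<in> T \<tau>"
    using sum_closed[of "T \<tau>" \<tau>] T \<tau>(1) by auto
  then show "codiff n X f \<tau> \<in> T \<tau>" using \<tau> by (simp add: codiff_def)
next
  fix \<tau> assume \<tau>: "\<not> (\<tau> \<subseteq> {..<n} \<and> int (card \<tau>) = q + 1)"
  show "codiff n X f \<tau> = 0"
  proof (cases "\<tau> \<subseteq> {..<n}")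
    case True
    then have fin: "finite \<tau>" using finite_subset by blast
    have "f (\<tau> - {j}) = 0" if "j \<in> \<tau>" for j
      using that True \<tau> fin card_Suc_Diff1[OF fin that] by (intro famD(2)[OF f]) auto
    then show ?thesis by (simp add: codiff_def z)
  qed (simp add: codiff_def)
qed

lemma fam_mono: "(\<And>\<sigma>. \<sigma> \<subseteq> {..<n} \<Longrightarrow> int (card \<sigma>) = q \<Longrightarrow> S \<sigma> \<subseteq> T \<sigma>) \<Longrightarrow> fam n q S \<subseteq> fam n q T"
  by (auto simp: fam_def subset_eq split: if_splits)

lemma fam_map: "f \<in> fam n q S \<Longrightarrow> h 0 = 0 \<Longrightarrow>
  (\<And>\<sigma> x. \<sigma> \<subseteq> {..<n} \<Longrightarrow> int (card \<sigma>) = q \<Longrightarrow> x \<in> S \<sigma> \<Longrightarrow> h x \<in> T \<sigma>) \<Longrightarrow> (\<lambda>\<sigma>. h (f \<sigma>)) \<in> fam n q T"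
  by (rule famI) (auto dest: famD)

lemma fam_lift:
  assumes "g \<in> fam n q T" "\<And>\<sigma> y. \<sigma> \<subseteq> {..<n} \<Longrightarrow> int (card \<sigma>) = q \<Longrightarrow> y \<in> T \<sigma> \<Longrightarrow> \<exists>x\<in>S \<sigma>. h x = y" "h 0 = 0"
  shows "\<exists>f\<in>fam n q S. g = (\<lambda>\<sigma>. h (f \<sigma>))"
proof -
  have "\<forall>\<sigma>. \<exists>x. if \<sigma> \<subseteq> {..<n} \<and> int (card \<sigma>) = q then x \<in> S \<sigma> \<and> h x = g \<sigma> else x = 0"
    using assms famD(1)[OF assms(1)] by (metis (full_types))
  then obtain f where f: "\<And>\<sigma>. if \<sigma> \<subseteq> {..<n} \<and> int (card \<sigma>) = q then f \<sigma> \<in> S \<sigma> \<and> h (f \<sigma>) = g \<sigma> else f \<sigma> = 0"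
    by metis
  have "f \<in> fam n q S" by (rule famI) (use f in \<open>auto split: if_splits\<close>)
  moreover have "g \<sigma> = h (f \<sigma>)" for \<sigma> using f[of \<sigma>] famD(2)[OF assms(1), of \<sigma>] assms(3) by (auto split: if_splits)
  ultimately show ?thesis by blast
qed

definition fscale :: "'k::field \<Rightarrow> (nat set \<Rightarrow> ('x \<Rightarrow>\<^sub>0 'k)) \<Rightarrow> nat set \<Rightarrow> ('x \<Rightarrow>\<^sub>0 'k)"
  where "fscale c f = (\<lambda>\<sigma>. vscale c (f \<sigma>))"

global_interpretation fv: vector_space fscale
  by unfold_locales (auto simp: fscale_def fun_eq_iff vec.scale_right_distrib vec.scale_left_distrib)

lemma cd_fscale: "cd n (fscale c f) = fscale c (cd n f)"
  unfolding fscale_def by (rule codiff_hom) (simp_all add: vec.scale_right_distrib)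

lemma subspace_fam:
  assumes "\<And>\<sigma>. \<sigma> \<subseteq> {..<n} \<Longrightarrow> vec.subspace (S \<sigma>)"
  shows "fv.subspace (fam n q S)"
proof (rule fv.subspaceI)
  show "0 \<in> fam n q S" by (rule famI) (auto intro: vec.subspace_0 assms)
  show "x + y \<in> fam n q S" if "x \<in> fam n q S" "y \<in> fam n q S" for x y
    by (rule famI) (auto simp: famD(2)[OF that(1)] famD(2)[OF that(2)]
      intro!: vec.subspace_add assms famD(1)[OF that(1)] famD(1)[OF that(2)])
  show "fscale c x \<in> fam n q S" if "x \<in> fam n q S" for c x
    by (rule famI) (auto simp: fscale_def famD(2)[OF that] intro!: vec.subspace_scale assms famD(1)[OF that])
qed

section \<open>The Cech complex of a graded submodule\<close>

lemma nonnegative_exponent_exists: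
  assumes "ks (snd x) \<subseteq> {..<n}" "neg (snd x) \<noteq> {..<n}"
  shows "(LEAST v. v \<notin> neg (snd x)) < n" "(LEAST v. v \<notin> neg (snd x)) \<notin> neg (snd x)"
proof -
  have "neg (snd x) \<subseteq> ks (snd x)" by (auto simp: neg_def in_keys_iff)
  with assms obtain v where v: "v < n" "v \<notin> neg (snd x)" by blast
  show "(LEAST v. v \<notin> neg (snd x)) < n" using Least_le[of "\<lambda>v. v \<notin> neg (snd x)", OF v(2)] v(1) by simp
  show "(LEAST v. v \<notin> neg (snd x)) \<notin> neg (snd x)" by (rule LeastI) (rule v(2))
qed

definition cch :: "nat \<Rightarrow> (nat \<Rightarrow> nat) \<Rightarrow> 'k::field vec set \<Rightarrow> int \<Rightarrow> int \<Rightarrow> (nat set \<Rightarrow> 'k vec) set"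
  where "cch n \<delta> N q t = fam n q (\<lambda>\<sigma>. loc \<sigma> N \<inter> hom \<delta> t)"

lemma subspace_lochom: "gsub n m \<delta> N \<Longrightarrow> \<sigma> \<subseteq> {..<n} \<Longrightarrow> vec.subspace (loc \<sigma> N \<inter> hom \<delta> t)"
  using subspace_loc subspace_hom by (rule vec.subspace_inter)

lemma subspace_cch: "gsub n m \<delta> N \<Longrightarrow> fv.subspace (cch n \<delta> N q t)"
  unfolding cch_def by (rule subspace_fam) (rule subspace_lochom)

lemma cd_cch:
  assumes N: "gsub n m \<delta> N" and f: "f \<in> cch n \<delta> N q t"
  shows "cd n f \<in> cch n \<delta> N (q + 1) t"
  unfolding cch_def
proof (rule fam_codiff[OF f[unfolded cch_def]])
  fix \<tau> j and x :: "'a vec" assume "x \<in> loc (\<tau> - {j}) N \<inter> hom \<delta> t"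
  then show "x \<in> loc \<tau> N \<inter> hom \<delta> t" using loc_mono[of "\<tau> - {j}" \<tau> N N] by auto
next
  fix \<tau> :: "nat set" and x y :: "'a vec" assume \<tau>: "\<tau> \<subseteq> {..<n}"
  note S = subspace_lochom[OF N \<tau>, of t]
  show "0 \<in> loc \<tau> N \<inter> hom \<delta> t" by (rule vec.subspace_0[OF S])
  assume x: "x \<in> loc \<tau> N \<inter> hom \<delta> t"
  show "- x \<in> loc \<tau> N \<inter> hom \<delta> t" by (rule vec.subspace_neg[OF S x])
  show "y \<in> loc \<tau> N \<inter> hom \<delta> t \<Longrightarrow> x + y \<in> loc \<tau> N \<inter> hom \<delta> t" by (rule vec.subspace_add[OF S x])
qed simp

lemma codiff_sum:
  assumes "\<And>j a b. X j (a + b) = X j a + X j b"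
  shows "codiff n X (sum f I) = (\<Sum>i\<in>I. codiff n X (f i))"
proof (induction I rule: infinite_finite_induct)
  case (insert i I)
  show ?case unfolding sum.insert[OF insert(1,2)] codiff_add[where X = X, OF assms] insert(3) ..
next
  case empty
  show ?case unfolding sum.empty by (rule codiff_zero[where X = X, OF assms])
next
  case (infinite I)
  show ?case unfolding sum.infinite[OF infinite] by (rule codiff_zero[where X = X, OF assms])
qed

lemma sum_fun_apply: "sum f I x = (\<Sum>i\<in>I. f i x)"
  by (induction I rule: infinite_finite_induct) auto

text \<open>A Laurent monomial with a nonnegative exponent at \<open>v\<close> lives in the localization at \<open>\<sigma>\<close> iff it
  lives in the one at \<open>insert v \<sigma>\<close>, so its strand of the Cech complex is contracted by \<open>v\<close>.\<close>

lemma cech_free_exact_nontop: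
  fixes g :: "nat set \<Rightarrow> 'k::field vec"
  assumes g: "g \<in> cch n \<delta> (gfree n m {}) q t" and d: "cd n g = 0"
    and nt: "\<And>\<sigma> x. x \<in> ks (g \<sigma>) \<Longrightarrow> neg (snd x) \<noteq> {..<n}"
  shows "\<exists>u\<in>cch n \<delta> (gfree n m {}) (q - 1) t. g = cd n u"
proof -
  define vm where "vm x = (LEAST v. v \<notin> neg (snd x))" for x :: "nat \<times> expo"
  \<comment> \<open>The cochain is split by the variable \<open>vm\<close> chosen for each monomial.
    The choice depends on the monomial but not on \<open>\<sigma>\<close>, so every piece is again a
    cocycle.\<close>
  define gv where "gv v \<sigma> = filt {x. vm x = v} (g \<sigma>)" for v \<sigma>
  define uv where "uv v = contract n (\<lambda>a. a) v (gv v)" for v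
  have gS: "\<sigma> \<subseteq> {..<n} \<Longrightarrow> int (card \<sigma>) = q \<Longrightarrow> g \<sigma> \<in> gfree n m \<sigma> \<inter> hom \<delta> t" for \<sigma>
    using famD(1)[OF g[unfolded cch_def], of \<sigma>] loc_gfree[of \<sigma> n m] by auto
  have g0: "\<not> (\<sigma> \<subseteq> {..<n} \<and> int (card \<sigma>) = q) \<Longrightarrow> g \<sigma> = 0" for \<sigma>
    using famD(2)[OF g[unfolded cch_def]] by blast
  have kn: "x \<in> ks (g \<sigma>) \<Longrightarrow> x \<in> kset n m \<sigma>" for x \<sigma>
    using gS[of \<sigma>] g0[of \<sigma>] by (cases "\<sigma> \<subseteq> {..<n} \<and> int (card \<sigma>) = q") (auto simp: gfree_def)
  have vm: "vm x < n" "vm x \<notin> neg (snd x)" if "x \<in> ks (g \<sigma>)" for x \<sigma>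
    using nonnegative_exponent_exists[of x n] kn[OF that] nt[OF that] by (auto simp: vm_def kset_def)
  have gsum: "g = (\<Sum>v<n. gv v)"
  proof (rule ext, rule poly_mapping_eqI)
    fix \<sigma> x
    have "lk (g \<sigma>) x = (\<Sum>v<n. if vm x = v then lk (g \<sigma>) x else 0)"
      using vm(1)[of x \<sigma>] by (auto simp: in_keys_iff)
    then show "lk (g \<sigma>) x = lk ((\<Sum>v<n. gv v) \<sigma>) x" by (simp add: sum_fun_apply lookup_sum gv_def)
  qed
  have dgv: "cd n (gv v) = 0" for v
  proof -
    have "cd n (gv v) = (\<lambda>\<tau>. filt {x. vm x = v} (cd n g \<tau>))"
      unfolding gv_def by (rule codiff_hom) (simp_all add: filt_add)
    then show ?thesis using d by (simp add: fun_eq_iff)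
  qed
  have guv: "gv v = cd n (uv v)" if "v < n" for v
  proof
    fix \<tau> show "gv v \<tau> = cd n (uv v) \<tau>"
    proof (cases "\<tau> \<subseteq> {..<n}")
      case True
      have "cd n (uv v) \<tau> + contract n (\<lambda>a. a) v (cd n (gv v)) \<tau> = gv v \<tau>"
        unfolding uv_def by (rule codiff_contract) (use that True in auto)
      moreover have "contract n (\<lambda>a. a) v (cd n (gv v)) \<tau> = 0" unfolding dgv by (simp add: contract_def)
      ultimately show ?thesis by simp
    next
      case False
      then show ?thesis using g0[of \<tau>] by (simp add: codiff_def gv_def)
    qed
  qed
  have uvc: "uv v \<in> cch n \<delta> (gfree n m {}) (q - 1) t" if "v < n" for v
    unfolding cch_def
  proof (rule famI)
    fix \<sigma> assume s: "\<sigma> \<subseteq> {..<n}" "int (card \<sigma>) = q - 1"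
    show "uv v \<sigma> \<in> loc \<sigma> (gfree n m {}) \<inter> hom \<delta> t"
    proof (cases "v \<in> \<sigma>")
      case True
      then show ?thesis
        using vec.subspace_0[OF subspace_lochom[OF gsub_gfree s(1)]] by (simp add: uv_def contract_def)
    next
      case False
      have i: "insert v \<sigma> \<subseteq> {..<n}" "int (card (insert v \<sigma>)) = q"
        using s False that finite_subset[OF s(1)] by auto
      have "gv v (insert v \<sigma>) \<in> gfree n m \<sigma> \<inter> hom \<delta> t"
      proof -
        have "x \<in> kset n m \<sigma>" if "x \<in> ks (gv v (insert v \<sigma>))" for x
        proof -
          have x: "x \<in> ks (g (insert v \<sigma>))" "vm x = v" using that by (auto simp: gv_def keys_filt)
          then show ?thesis using gS[OF i] vm(2)[OF x(1)] by (auto simp: gfree_def kset_def)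
        qed
        moreover have "gv v (insert v \<sigma>) \<in> hom \<delta> t" using gS[OF i] by (auto simp: hom_def gv_def keys_filt)
        ultimately show ?thesis by (auto simp: gfree_def)
      qed
      then have "ssgn (insert v \<sigma>) v (gv v (insert v \<sigma>)) \<in> gfree n m \<sigma> \<inter> hom \<delta> t"
        by (intro ssgn_in) (auto intro: vec.subspace_neg subspace_gfree subspace_hom)
      then show ?thesis using False s by (simp add: uv_def contract_def loc_gfree)
    qed
  next
    fix \<sigma> assume "\<not> (\<sigma> \<subseteq> {..<n} \<and> int (card \<sigma>) = q - 1)"
    then have "v \<notin> \<sigma> \<Longrightarrow> g (insert v \<sigma>) = 0"
      using finite_subset[of \<sigma> "{..<n}"] by (intro g0) auto
    then show "uv v \<sigma> = 0" by (simp add: uv_def contract_def gv_def)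
  qed
  have "(\<Sum>v<n. uv v) \<in> cch n \<delta> (gfree n m {}) (q - 1) t"
    by (intro fv.subspace_sum subspace_cch[OF gsub_gfree] uvc) auto
  moreover have "g = cd n (\<Sum>v<n. uv v)"
    by (subst gsum, subst codiff_sum) (auto intro!: sum.cong guv)
  ultimately show ?thesis by blast
qed

text \<open>A monomial that occurs at \<open>\<sigma>\<close> has its negative exponents inside
  \<open>\<sigma>\<close>, and below degree \<open>n\<close> this is a proper set of
  variables.\<close>

lemma cech_free_exact:
  assumes g: "g \<in> cch n \<delta> (gfree n m {}) q t" and "cd n g = 0" and q: "q < int n"
  shows "\<exists>u\<in>cch n \<delta> (gfree n m {}) (q - 1) t. g = cd n u"
proof (rule cech_free_exact_nontop[OF g assms(2)])
  fix \<sigma> x assume x: "x \<in> ks (g \<sigma>)"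
  then have "g \<sigma> \<noteq> 0" by auto
  then have s: "\<sigma> \<subseteq> {..<n}" "int (card \<sigma>) = q"
    using famD(2)[OF g[unfolded cch_def], of \<sigma>] by blast+
  then have "g \<sigma> \<in> gfree n m \<sigma>"
    using famD(1)[OF g[unfolded cch_def], of \<sigma>] loc_gfree[OF s(1), of m] by auto
  then have "neg (snd x) \<subseteq> \<sigma>" using x by (auto simp: gfree_def kset_def)
  moreover have "\<sigma> \<noteq> {..<n}" using s q by auto
  ultimately show "neg (snd x) \<noteq> {..<n}" using s by blast
qed

section \<open>Generators and syzygies, and what they do to Cech cochains\<close>

definition gens :: "nat \<Rightarrow> (nat \<Rightarrow> nat) \<Rightarrow> 'k::field vec set \<Rightarrow> nat \<Rightarrow> (nat \<Rightarrow> nat) \<Rightarrow> (nat \<Rightarrow> 'k vec) \<Rightarrow> bool"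
  where "gens n \<delta> N m' \<delta>' g \<longleftrightarrow> (\<forall>j<m'. g j \<in> N \<inter> hom \<delta> (int (\<delta>' j))) \<and>
    (\<forall>t. N \<inter> hom \<delta> t \<subseteq> ext g ` (gfree n m' {} \<inter> hom \<delta>' t))"

definition syz :: "nat \<Rightarrow> nat \<Rightarrow> (nat \<Rightarrow> 'k::field vec) \<Rightarrow> 'k vec set"
  where "syz n m' g = {f \<in> gfree n m' {}. ext g f = 0}"

lemma ext_in_hom:
  assumes "\<forall>j<m'. g j \<in> hom \<delta> (int (\<delta>' j))" "f \<in> hom \<delta>' t" "\<forall>x\<in>ks f. fst x < m'"
  shows "ext g f \<in> hom \<delta> t"
  unfolding ext_def
proof (rule lin_in_subspace[OF subspace_hom])
  fix x assume "x \<in> ks f"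
  then have "fst x < m'" "int (\<delta>' (fst x)) + tdeg (snd x) = t" using assms by (auto simp: hom_def kdeg_def)
  then show "shift (snd x) (g (fst x)) \<in> hom \<delta> t"
    using hom_shift[of "g (fst x)" \<delta> "int (\<delta>' (fst x))" "snd x"] assms(1) by auto
qed

lemma ext_in_sub:
  assumes N: "gsub n m \<delta> N" and "\<forall>j<m'. g j \<in> N" "f \<in> gfree n m' {}"
  shows "ext g f \<in> N"
  unfolding ext_def
proof (rule lin_in_subspace[OF gsubD(1)[OF N]])
  fix x assume "x \<in> ks f"
  then have "fst x < m'" "snd x \<in> nexp {..<n}" using assms(3) by (auto simp: gfree_def kset_def nexp_def)
  then show "shift (snd x) (g (fst x)) \<in> N" using assms(2) gsubD(3)[OF N] by blast
qed

lemma loc_gfree_fst: "f \<in> loc \<sigma> (gfree n m {}) \<Longrightarrow> x \<in> ks f \<Longrightarrow> fst x < m"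
  by (force simp: loc_def gfree_def keys_shift kset_def)

lemma ext_gpart:
  assumes g: "\<forall>j<m'. g j \<in> hom \<delta> (int (\<delta>' j))" and f: "f \<in> gfree n m' {}"
  shows "ext g (gpart \<delta>' t f) = gpart \<delta> t (ext g f)"
proof -
  define T where "T = insert t (kdeg \<delta>' ` ks f)"
  have fT: "f = (\<Sum>s\<in>T. gpart \<delta>' s f)" using gpart_sum[of T \<delta>' f] by (simp add: T_def subset_insertI)
  have gp: "gpart \<delta>' s f \<in> gfree n m' {}" for s using f by (auto simp: gfree_def gpart_def keys_filt)
  have h: "ext g (gpart \<delta>' s f) \<in> hom \<delta> s" for s
    using gp[of s] by (intro ext_in_hom[OF g gpart_hom]) (auto simp: gfree_def kset_def)
  have "gpart \<delta> t (ext g f) = (\<Sum>s\<in>T. gpart \<delta> t (ext g (gpart \<delta>' s f)))"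
    by (subst fT) (simp add: ext_sum gpart_def filt_sum)
  also have "\<dots> = (\<Sum>s\<in>T. if s = t then ext g (gpart \<delta>' t f) else 0)"
    by (intro sum.cong refl) (simp add: gpart_id[OF h] hom_disjoint[OF h])
  also have "\<dots> = ext g (gpart \<delta>' t f)" by (simp add: T_def)
  finally show ?thesis ..
qed

lemma gsub_syz:
  assumes g: "\<forall>j<m'. g j \<in> hom \<delta> (int (\<delta>' j))"
  shows "gsub n m' \<delta>' (syz n m' g)"
proof -
  have "gpart \<delta>' t f \<in> syz n m' g" if f: "f \<in> syz n m' g" for f t
    using f ext_gpart[OF g, of f n t] by (auto simp: syz_def gfree_def gpart_def keys_filt)
  moreover have "vec.subspace (syz n m' g)"
    unfolding syz_def using subspace_gfree[of n m' "{}"]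
    by (auto simp: vec.subspace_def ext_add ext_vscale)
  ultimately show ?thesis
    by (auto simp: gsub_def) (auto simp: syz_def ext_shift intro: gfree_shift)
qed

context
  fixes n m :: nat and \<delta> :: "nat \<Rightarrow> nat" and N :: "'k::field vec set"
    and m' \<delta>' and g :: "nat \<Rightarrow> 'k vec"
  assumes N: "gsub n m \<delta> N" and g: "gens n \<delta> N m' \<delta>' g"
begin

lemma gens_hom: "\<forall>j<m'. g j \<in> hom \<delta> (int (\<delta>' j))" and gens_mem: "\<forall>j<m'. g j \<in> N"
  using g by (auto simp: gens_def)

lemma syz_gsub: "gsub n m' \<delta>' (syz n m' g)" by (rule gsub_syz[OF gens_hom])

lemma ext_loc: "f \<in> loc \<sigma> (gfree n m' {}) \<Longrightarrow> ext g f \<in> loc \<sigma> N"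
  using ext_in_sub[OF N gens_mem] by (force simp: loc_def ext_shift[symmetric])

lemma ext_lochom: "f \<in> loc \<sigma> (gfree n m' {}) \<inter> hom \<delta>' t \<Longrightarrow> ext g f \<in> loc \<sigma> N \<inter> hom \<delta> t"
  using ext_loc ext_in_hom[OF gens_hom] loc_gfree_fst by blast

text \<open>Surjectivity survives localization: clear denominators, lift inside \<open>N\<close>,
  and divide again.\<close>

lemma ext_lift:
  assumes "y \<in> loc \<sigma> N \<inter> hom \<delta> t"
  shows "\<exists>x\<in>loc \<sigma> (gfree n m' {}) \<inter> hom \<delta>' t. ext g x = y"
proof -
  obtain c where c: "c \<in> nexp \<sigma>" "shift c y \<in> N" using assms by (auto simp: loc_def)
  then have "shift c y \<in> N \<inter> hom \<delta> (t + tdeg c)" using assms hom_shift by blast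
  then obtain x where x: "x \<in> gfree n m' {} \<inter> hom \<delta>' (t + tdeg c)" "shift c y = ext g x"
    using g unfolding gens_def by blast
  have "shift c (shift (- c) x) = x" by simp
  then have "shift (- c) x \<in> loc \<sigma> (gfree n m' {})" using x c unfolding loc_def by force
  moreover have "shift (- c) x \<in> hom \<delta>' t" using x by (simp add: hom_shift_iff)
  moreover have "ext g (shift (- c) x) = shift (- c) (shift c y)" by (simp only: ext_shift x(2))
  ultimately show ?thesis by (intro bexI[of _ "shift (- c) x"]) simp_all
qed

lemma loc_syz: "x \<in> loc \<sigma> (syz n m' g) \<longleftrightarrow> x \<in> loc \<sigma> (gfree n m' {}) \<and> ext g x = 0"
  by (auto simp: loc_def syz_def ext_shift)

lemma ext_cch: "f \<in> cch n \<delta>' (gfree n m' {}) q t \<Longrightarrow> (\<lambda>\<sigma>. ext g (f \<sigma>)) \<in> cch n \<delta> N q t"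
  unfolding cch_def by (erule fam_map) (use ext_lochom in auto)

lemma cch_lift: "y \<in> cch n \<delta> N q t \<Longrightarrow> \<exists>f\<in>cch n \<delta>' (gfree n m' {}) q t. y = (\<lambda>\<sigma>. ext g (f \<sigma>))"
  unfolding cch_def by (rule fam_lift) (use ext_lift in auto)

lemma cch_syz: "x \<in> cch n \<delta>' (syz n m' g) q t \<longleftrightarrow>
    x \<in> cch n \<delta>' (gfree n m' {}) q t \<and> (\<lambda>\<sigma>. ext g (x \<sigma>)) = 0"
proof
  assume x: "x \<in> cch n \<delta>' (syz n m' g) q t"
  then have "x \<in> cch n \<delta>' (gfree n m' {}) q t"
    unfolding cch_def using fam_mono[of n q "\<lambda>\<sigma>. loc \<sigma> (syz n m' g) \<inter> hom \<delta>' t" "\<lambda>\<sigma>. loc \<sigma> (gfree n m' {}) \<inter> hom \<delta>' t"]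
      loc_syz by blast
  moreover have "ext g (x \<sigma>) = 0" for \<sigma>
    using famD[OF x[unfolded cch_def], of \<sigma>] loc_syz by (cases "\<sigma> \<subseteq> {..<n} \<and> int (card \<sigma>) = q") auto
  ultimately show "x \<in> cch n \<delta>' (gfree n m' {}) q t \<and> (\<lambda>\<sigma>. ext g (x \<sigma>)) = 0" by auto
next
  assume x: "x \<in> cch n \<delta>' (gfree n m' {}) q t \<and> (\<lambda>\<sigma>. ext g (x \<sigma>)) = 0"
  then have x1: "x \<in> cch n \<delta>' (gfree n m' {}) q t" and "ext g (x \<sigma>) = 0" for \<sigma>
    by (auto simp: fun_eq_iff)
  then show "x \<in> cch n \<delta>' (syz n m' g) q t"
    unfolding cch_def by (intro famI) (auto simp: loc_syz dest: famD)
qed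

lemma ext_cd: "cd n (\<lambda>\<sigma>. ext g (f \<sigma>)) = (\<lambda>\<tau>. ext g (cd n f \<tau>))"
  by (rule codiff_hom) (simp_all add: ext_add)

end

text \<open>The Cech cohomology of \<open>F/N\<close>, where \<open>F\<close> is free, in terms of representatives in \<open>F\<close>: \<open>Zc\<close> is the preimage of
  the cocycles and \<open>Bc\<close> that of the coboundaries.\<close>

definition Zc :: "nat \<Rightarrow> nat \<Rightarrow> (nat \<Rightarrow> nat) \<Rightarrow> 'k::field vec set \<Rightarrow> int \<Rightarrow> int \<Rightarrow> (nat set \<Rightarrow> 'k vec) set"
  where "Zc n m \<delta> N q t = {f \<in> cch n \<delta> (gfree n m {}) q t. cd n f \<in> cch n \<delta> N (q + 1) t}"

definition Bc :: "nat \<Rightarrow> nat \<Rightarrow> (nat \<Rightarrow> nat) \<Rightarrow> 'k::field vec set \<Rightarrow> int \<Rightarrow> int \<Rightarrow> (nat set \<Rightarrow> 'k vec) set"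
  where "Bc n m \<delta> N q t = {w + cd n u | w u. w \<in> cch n \<delta> N q t \<and> u \<in> cch n \<delta> (gfree n m {}) (q - 1) t}"

lemma cch_mono: "M \<subseteq> N \<Longrightarrow> cch n \<delta> M q t \<subseteq> cch n \<delta> N q t"
  unfolding cch_def by (intro fam_mono Int_mono loc_mono) simp_all

lemma cd_add: "cd n (f + g) = cd n f + cd n g" by (rule codiff_add) simp
lemma cd_minus: "cd n (f - g) = cd n f - cd n g" by (rule codiff_minus) simp
lemma cd_zero [simp]: "cd n 0 = 0" by (rule codiff_zero) simp

lemma subspace_Zc:
  assumes "gsub n m \<delta> N" shows "fv.subspace (Zc n m \<delta> N q t)"
proof -
  note S = subspace_cch[OF assms] subspace_cch[OF gsub_gfree[of n m \<delta>]]
  show ?thesis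
  proof (rule fv.subspaceI)
    show "0 \<in> Zc n m \<delta> N q t" unfolding Zc_def using S[THEN fv.subspace_0] by simp
    show "x + y \<in> Zc n m \<delta> N q t" if "x \<in> Zc n m \<delta> N q t" "y \<in> Zc n m \<delta> N q t" for x y
      using that unfolding Zc_def mem_Collect_eq cd_add by (auto intro: fv.subspace_add[OF S(1)] fv.subspace_add[OF S(2)])
    show "fscale c x \<in> Zc n m \<delta> N q t" if "x \<in> Zc n m \<delta> N q t" for c x
      using that unfolding Zc_def mem_Collect_eq cd_fscale by (auto intro: fv.subspace_scale[OF S(1)] fv.subspace_scale[OF S(2)])
  qed
qed

lemma subspace_Bc:
  assumes N: "gsub n m \<delta> N" shows "fv.subspace (Bc n m \<delta> N q t)"
proof -
  note S = subspace_cch[OF N] subspace_cch[OF gsub_gfree[of n m \<delta>]]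
  show ?thesis unfolding Bc_def
  proof (rule fv.subspaceI, goal_cases)
    case 1
    have "0 = 0 + cd n 0" by simp
    then show ?case using S fv.subspace_0 by blast
  next
    case (2 x y)
    then obtain w u w' u' where *: "w \<in> cch n \<delta> N q t" "u \<in> cch n \<delta> (gfree n m {}) (q - 1) t"
      "w' \<in> cch n \<delta> N q t" "u' \<in> cch n \<delta> (gfree n m {}) (q - 1) t" "x = w + cd n u" "y = w' + cd n u'" by blast
    then have "x + y = (w + w') + cd n (u + u')" by (simp add: cd_add)
    then show ?case using * S fv.subspace_add by blast
  next
    case (3 c x)
    then obtain w u where *: "w \<in> cch n \<delta> N q t" "u \<in> cch n \<delta> (gfree n m {}) (q - 1) t" "x = w + cd n u" by blast
    then have "fscale c x = fscale c w + cd n (fscale c u)" by (simp add: cd_fscale fv.scale_right_distrib)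
    then show ?case using * S fv.subspace_scale by blast
  qed
qed

text \<open>The image of \<open>ext g\<close> is \<open>N\<close>, so \<open>F'/N'\<close> is
  isomorphic to \<open>N\<close> and the identification is the connecting map of 0 -> N -> F -> F/N
  -> 0: \<open>f\<close> corresponds to any \<open>f'\<close> that lifts the coboundary of
  \<open>f\<close>. The hypothesis \<open>q + 1 < int n\<close> makes the cohomology of
  \<open>F\<close> vanish in degrees \<open>q\<close> and \<open>q + 1\<close>, which gives
  injectivity and surjectivity.\<close>

lemma dimension_shift:
  fixes N :: "'k::field vec set"
  assumes N: "gsub n m \<delta> N" and g: "gens n \<delta> N m' \<delta>' g" and q: "q + 1 < int n"
    and d: "has_qdim fscale (Zc n m \<delta> N q t) (Bc n m \<delta> N q t) d"
  shows "has_qdim fscale (Zc n m' \<delta>' (syz n m' g) (q + 1) t) (Bc n m' \<delta>' (syz n m' g) (q + 1) t) d"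
proof -
  let ?N' = "syz n m' g"
  let ?F = "gfree n m {} :: 'k vec set" let ?F' = "gfree n m' {} :: 'k vec set"
  have N': "gsub n m' \<delta>' ?N'" by (rule syz_gsub[OF N g])
  note S = subspace_cch[OF N] subspace_cch[OF gsub_gfree[of n m \<delta>]]
    subspace_cch[OF N'] subspace_cch[OF gsub_gfree[of n m' \<delta>']]
  have NF: "cch n \<delta> N p s \<subseteq> cch n \<delta> ?F p s" for p s by (rule cch_mono) (rule gsubD(2)[OF N])
  define \<phi> where "\<phi> f = (\<lambda>\<sigma>. ext g (f \<sigma>))" for f :: "nat set \<Rightarrow> 'k vec"
  have \<phi>d: "cd n (\<phi> f) = \<phi> (cd n f)" for f unfolding \<phi>_def by (rule ext_cd[OF N g])
  have \<phi>0: "\<phi> 0 = 0" and \<phi>add: "\<phi> (a + b) = \<phi> a + \<phi> b" and \<phi>sub: "\<phi> (a - b) = \<phi> a - \<phi> b"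
    and \<phi>sc: "\<phi> (fscale c a) = fscale c (\<phi> a)" for a b c
    by (auto simp: \<phi>_def fun_eq_iff ext_add ext_minus fscale_def ext_vscale)
  have \<phi>N: "f \<in> cch n \<delta>' ?F' p s \<Longrightarrow> \<phi> f \<in> cch n \<delta> N p s" for f p s unfolding \<phi>_def by (rule ext_cch[OF N g])
  have \<phi>lift: "y \<in> cch n \<delta> N p s \<Longrightarrow> \<exists>f\<in>cch n \<delta>' ?F' p s. y = \<phi> f" for y p s
    unfolding \<phi>_def by (rule cch_lift[OF N g])
  have \<phi>ker: "x \<in> cch n \<delta>' ?N' p s \<longleftrightarrow> x \<in> cch n \<delta>' ?F' p s \<and> \<phi> x = 0" for x p s
    unfolding \<phi>_def by (rule cch_syz[OF N g])
  show ?thesis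
  proof (rule has_qdim_transfer[where R = "\<lambda>f f'. cd n f = \<phi> f'", OF fv.vector_space_axioms fv.vector_space_axioms
        subspace_Zc[OF N] subspace_Zc[OF N'] _ _ _ _ _ _ d])
    fix f assume "f \<in> Zc n m \<delta> N q t"
    then have "cd n f \<in> cch n \<delta> N (q + 1) t" by (simp add: Zc_def)
    then obtain f' where f': "f' \<in> cch n \<delta>' ?F' (q + 1) t" "cd n f = \<phi> f'"
      using \<phi>lift by blast
    have "\<phi> (cd n f') = 0" using \<phi>d[of f'] f'(2) cd_cd[of n f] by simp
    then have "cd n f' \<in> cch n \<delta>' ?N' (q + 1 + 1) t" using cd_cch[OF gsub_gfree f'(1)] \<phi>ker by blast
    then show "\<exists>f'\<in>Zc n m' \<delta>' ?N' (q + 1) t. cd n f = \<phi> f'" using f' by (auto simp: Zc_def)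
  next
    fix f' assume "f' \<in> Zc n m' \<delta>' ?N' (q + 1) t"
    then have f': "f' \<in> cch n \<delta>' ?F' (q + 1) t" "\<phi> (cd n f') = 0" using \<phi>ker by (auto simp: Zc_def)
    have "\<phi> f' \<in> cch n \<delta> ?F (q + 1) t" "cd n (\<phi> f') = 0" using \<phi>N[OF f'(1)] NF f'(2) \<phi>d by auto
    then obtain f where "f \<in> cch n \<delta> ?F q t" "\<phi> f' = cd n f" using cech_free_exact[of "\<phi> f'" n \<delta> m "q + 1" t] q by auto
    then show "\<exists>f\<in>Zc n m \<delta> N q t. cd n f = \<phi> f'" using \<phi>N[OF f'(1)] by (auto simp: Zc_def)
  next
    fix f f' assume R: "cd n f = \<phi> f'" and f: "f \<in> Zc n m \<delta> N q t" and f': "f' \<in> Zc n m' \<delta>' ?N' (q + 1) t"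
    show "f \<in> Bc n m \<delta> N q t \<longleftrightarrow> f' \<in> Bc n m' \<delta>' ?N' (q + 1) t"
    proof
      assume "f \<in> Bc n m \<delta> N q t"
      then obtain w u where w: "w \<in> cch n \<delta> N q t" "f = w + cd n u" by (auto simp: Bc_def)
      obtain w' where w': "w' \<in> cch n \<delta>' ?F' q t" "w = \<phi> w'" using \<phi>lift[OF w(1)] by blast
      have "\<phi> (f' - cd n w') = 0" using R w'(2) w(2) by (simp add: \<phi>sub \<phi>d[symmetric] cd_add)
      moreover have "f' - cd n w' \<in> cch n \<delta>' ?F' (q + 1) t"
        using f' cd_cch[OF gsub_gfree w'(1)] S(4) by (auto simp: Zc_def intro: fv.subspace_diff)
      ultimately have "f' - cd n w' \<in> cch n \<delta>' ?N' (q + 1) t" using \<phi>ker by blast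
      moreover have "f' = (f' - cd n w') + cd n w'" by simp
      ultimately show "f' \<in> Bc n m' \<delta>' ?N' (q + 1) t" using w'(1) unfolding Bc_def by fastforce
    next
      assume "f' \<in> Bc n m' \<delta>' ?N' (q + 1) t"
      then obtain w u where w: "w \<in> cch n \<delta>' ?N' (q + 1) t" "u \<in> cch n \<delta>' ?F' q t" "f' = w + cd n u"
        by (auto simp: Bc_def)
      have "\<phi> w = 0" using w(1) \<phi>ker by blast
      then have "cd n (f - \<phi> u) = 0" using R w(3) by (simp add: cd_minus \<phi>d \<phi>add)
      moreover have "f - \<phi> u \<in> cch n \<delta> ?F q t"
      proof (rule fv.subspace_diff[OF S(2)])
        show "f \<in> cch n \<delta> ?F q t" using f by (simp add: Zc_def)
        show "\<phi> u \<in> cch n \<delta> ?F q t" using \<phi>N[OF w(2)] NF by blast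
      qed
      ultimately obtain v where "v \<in> cch n \<delta> ?F (q - 1) t" "f - \<phi> u = cd n v"
        using cech_free_exact[of "f - \<phi> u" n \<delta> m q t] q by auto
      then have "f = \<phi> u + cd n v" "v \<in> cch n \<delta> ?F (q - 1) t" by (auto simp: algebra_simps)
      then show "f \<in> Bc n m \<delta> N q t" using \<phi>N[OF w(2)] unfolding Bc_def by blast
    qed
  qed (auto simp: \<phi>0 \<phi>add \<phi>sc cd_add cd_fscale)
qed

text \<open>The top cohomology of a free module is spanned by the monomials with all exponents negative, so
  \<open>nontop n\<close> is what is factored out.\<close>

definition nontop :: "nat \<Rightarrow> 'k::field vec set"
  where "nontop n = {f. \<forall>x\<in>ks f. neg (snd x) \<noteq> {..<n}}"

lemma subspace_nontop: "vec.subspace (nontop n)"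
proof -
  have "nontop n = {f :: 'k::field vec. ks f \<subseteq> {x. neg (snd x) \<noteq> {..<n}}}" by (auto simp: nontop_def)
  then show ?thesis using subspace_keys by metis
qed

definition tfam :: "nat \<Rightarrow> 'k::field vec \<Rightarrow> nat set \<Rightarrow> 'k vec"
  where "tfam n f \<sigma> = (if \<sigma> = {..<n} then f else 0)"

lemma top_index: "\<sigma> \<subseteq> {..<n} \<and> int (card \<sigma>) = int n \<longleftrightarrow> \<sigma> = {..<n}"
  using card_subset_eq[of "{..<n}" \<sigma>] by auto

lemma tfam_cch: "tfam n f \<in> cch n \<delta> N (int n) t \<longleftrightarrow> f \<in> loc {..<n} N \<inter> hom \<delta> t"
proof
  assume "tfam n f \<in> cch n \<delta> N (int n) t"
  from famD(1)[OF this[unfolded cch_def], of "{..<n}"] show "f \<in> loc {..<n} N \<inter> hom \<delta> t" by (simp add: tfam_def)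
next
  assume "f \<in> loc {..<n} N \<inter> hom \<delta> t"
  then show "tfam n f \<in> cch n \<delta> N (int n) t"
    unfolding cch_def fam_def mem_Collect_eq top_index by (auto simp: tfam_def)
qed

lemma cch_top: "f \<in> cch n \<delta> N (int n) t \<Longrightarrow> f = tfam n (f {..<n})"
  unfolding cch_def fam_def mem_Collect_eq top_index by (auto simp: fun_eq_iff tfam_def split: if_splits)

lemma cch_above: "q > int n \<Longrightarrow> f \<in> cch n \<delta> N q t \<Longrightarrow> f = 0"
proof (rule HOL.ext)
  fix \<sigma> assume q: "q > int n" and f: "f \<in> cch n \<delta> N q t"
  have "\<not> (\<sigma> \<subseteq> {..<n} \<and> int (card \<sigma>) = q)" using q card_mono[of "{..<n}" \<sigma>] by auto
  then show "f \<sigma> = 0 \<sigma>" using famD(2)[OF f[unfolded cch_def]] by simp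
qed

text \<open>Each summand of a boundary comes from the localization at a proper subset and so has a
  nonnegative exponent somewhere; the converse is the contraction of the strands of such
  monomials.\<close>

lemma boundary_top:
  fixes f :: "'k::field vec"
  shows "(\<exists>u\<in>cch n \<delta> (gfree n m {}) (int n - 1) t. tfam n f = cd n u) \<longleftrightarrow>
    f \<in> gfree n m {..<n} \<inter> hom \<delta> t \<inter> nontop n"
proof
  assume "\<exists>u\<in>cch n \<delta> (gfree n m {}) (int n - 1) t. tfam n f = cd n u"
  then obtain u where u: "u \<in> cch n \<delta> (gfree n m {}) (int n - 1) t" "tfam n f = cd n u" by blast
  have "cd n u \<in> cch n \<delta> (gfree n m {}) (int n) t" using cd_cch[OF gsub_gfree u(1)] by simp
  then have f: "f \<in> gfree n m {..<n} \<inter> hom \<delta> t" using u(2)[symmetric] by (simp add: tfam_cch loc_gfree)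
  have "ssgn {..<n} j (u ({..<n} - {j})) \<in> nontop n" if j: "j < n" for j
  proof (rule ssgn_in)
    have c: "int (card ({..<n} - {j})) = int n - 1" using j by simp
    have "u ({..<n} - {j}) \<in> gfree n m ({..<n} - {j})"
      using famD(1)[OF u(1)[unfolded cch_def] _ c] loc_gfree[of "{..<n} - {j}" n m] by blast
    then show "u ({..<n} - {j}) \<in> nontop n" using j by (fastforce simp: gfree_def nontop_def kset_def)
  qed (rule vec.subspace_neg[OF subspace_nontop])
  then have "cd n u {..<n} \<in> nontop n"
    by (auto simp: codiff_def intro!: vec.subspace_sum[OF subspace_nontop])
  then show "f \<in> gfree n m {..<n} \<inter> hom \<delta> t \<inter> nontop n" using f u(2)[symmetric] by (simp add: tfam_def)
next
  assume f: "f \<in> gfree n m {..<n} \<inter> hom \<delta> t \<inter> nontop n"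
  then have c: "tfam n f \<in> cch n \<delta> (gfree n m {}) (int n) t" by (simp add: tfam_cch loc_gfree)
  have "cd n (tfam n f) = 0" by (rule cch_above[OF _ cd_cch[OF gsub_gfree c]]) simp
  then show "\<exists>u\<in>cch n \<delta> (gfree n m {}) (int n - 1) t. tfam n f = cd n u"
    by (rule cech_free_exact_nontop[OF c]) (use f in \<open>auto simp: tfam_def nontop_def split: if_splits\<close>)
qed

text \<open>The form of \<open>Bc\<close> at the top, where a cochain is its single entry at the
  full set of variables and the boundaries of the free module are exactly its \<open>nontop\<close>
  part.\<close>

definition Btop :: "nat \<Rightarrow> nat \<Rightarrow> (nat \<Rightarrow> nat) \<Rightarrow> 'k::field vec set \<Rightarrow> int \<Rightarrow> 'k vec set"
  where "Btop n m \<delta> N t = {w + u | w u. w \<in> loc {..<n} N \<inter> hom \<delta> t \<and> u \<in> gfree n m {..<n} \<inter> hom \<delta> t \<inter> nontop n}"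

lemma tfam_add: "tfam n (f + g) = tfam n f + tfam n g"
  and tfam_zero: "tfam n 0 = 0"
  and tfam_fscale: "tfam n (vscale c f) = fscale c (tfam n f)"
  by (auto simp: tfam_def fscale_def fun_eq_iff)

lemma Btop_iff:
  "f \<in> Btop n m \<delta> N t \<longleftrightarrow> tfam n f \<in> Bc n m \<delta> N (int n) t"
proof
  assume "f \<in> Btop n m \<delta> N t"
  then obtain w u where *: "f = w + u" "w \<in> loc {..<n} N \<inter> hom \<delta> t" "u \<in> gfree n m {..<n} \<inter> hom \<delta> t \<inter> nontop n"
    by (auto simp: Btop_def)
  obtain v where v: "v \<in> cch n \<delta> (gfree n m {}) (int n - 1) t" "tfam n u = cd n v"
    using *(3) boundary_top by blast
  have "tfam n f = tfam n w + cd n v" by (simp only: *(1) tfam_add v(2))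
  then show "tfam n f \<in> Bc n m \<delta> N (int n) t" using *(2) v(1) tfam_cch unfolding Bc_def by blast
next
  assume "tfam n f \<in> Bc n m \<delta> N (int n) t"
  then obtain w v where *: "tfam n f = w + cd n v" "w \<in> cch n \<delta> N (int n) t"
      "v \<in> cch n \<delta> (gfree n m {}) (int n - 1) t" by (auto simp: Bc_def)
  have "cd n v \<in> cch n \<delta> (gfree n m {}) (int n) t" using cd_cch[OF gsub_gfree *(3)] by simp
  then have cv: "cd n v = tfam n (cd n v {..<n})" by (rule cch_top)
  then have 1: "cd n v {..<n} \<in> gfree n m {..<n} \<inter> hom \<delta> t \<inter> nontop n" using *(3) boundary_top by metis
  have w: "w {..<n} \<in> loc {..<n} N \<inter> hom \<delta> t" using cch_top[OF *(2)] *(2) tfam_cch by metis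
  have "f = w {..<n} + cd n v {..<n}" using fun_cong[OF *(1), of "{..<n}"] by (simp add: tfam_def)
  then show "f \<in> Btop n m \<delta> N t" using 1 w unfolding Btop_def by blast
qed

lemma top_cohomology:
  assumes N: "gsub n m \<delta> N" and d: "has_qdim fscale (Zc n m \<delta> N (int n) t) (Bc n m \<delta> N (int n) t) d"
  shows "has_qdim vscale (gfree n m {..<n} \<inter> hom \<delta> t) (Btop n m \<delta> N t) d"
proof (rule has_qdim_transfer[where R = "\<lambda>a f. a = tfam n f", OF fv.vector_space_axioms vec.vector_space_axioms
      subspace_Zc[OF N] vec.subspace_inter[OF subspace_gfree subspace_hom] _ _ _ _ _ _ d])
  fix a assume "a \<in> Zc n m \<delta> N (int n) t"
  then have a: "a \<in> cch n \<delta> (gfree n m {}) (int n) t" by (simp add: Zc_def)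
  then show "\<exists>f\<in>gfree n m {..<n} \<inter> hom \<delta> t. a = tfam n f"
    using cch_top[OF a] tfam_cch loc_gfree by (metis order_refl)
next
  fix f :: "'a vec" assume "f \<in> gfree n m {..<n} \<inter> hom \<delta> t"
  then have c: "tfam n f \<in> cch n \<delta> (gfree n m {}) (int n) t" by (simp add: tfam_cch loc_gfree)
  have "cd n (tfam n f) = 0" by (rule cch_above[OF _ cd_cch[OF gsub_gfree c]]) simp
  then have "cd n (tfam n f) \<in> cch n \<delta> N (int n + 1) t" using fv.subspace_0[OF subspace_cch[OF N]] by simp
  then show "\<exists>a\<in>Zc n m \<delta> N (int n) t. a = tfam n f" using c by (simp add: Zc_def)
qed (simp_all add: tfam_add tfam_zero tfam_fscale Btop_iff)

lemma above_top_cohomology: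
  assumes "gsub n m \<delta> N" "q > int n" and d: "has_qdim fscale (Zc n m \<delta> N q t) (Bc n m \<delta> N q t) d"
  shows "d = 0"
proof (rule ccontr)
  assume d0: "d \<noteq> 0"
  obtain b where b: "\<forall>i<d. b i \<in> Zc n m \<delta> N q t"
      "\<forall>c. (\<Sum>i<d. fscale (c i) (b i)) \<in> Bc n m \<delta> N q t \<longrightarrow> (\<forall>i<d. c i = 0)"
    using d unfolding has_qdim_def by blast
  have "b i = 0" if "i < d" for i using b(1) that cch_above[OF assms(2)] unfolding Zc_def by blast
  then have "(\<Sum>i<d. fscale 1 (b i)) = 0" by (intro sum.neutral ballI) (metis fv.scale_zero_right lessThan_iff)
  then have "(\<Sum>i<d. fscale 1 (b i)) \<in> Bc n m \<delta> N q t" using fv.subspace_0[OF subspace_Bc[OF assms(1)]] by metis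
  then show False using b(2)[rule_format, of "\<lambda>_. 1" 0] d0 by auto
qed

text \<open>One step below the top, H^(n-1)(F) still vanishes but H^n(F) does not. The connecting
  map is then only injective, and it identifies H^(n-1)(F/N) with the kernel of H^n(F'/N') ->
  H^n(F), where F'/N' stands for \<open>N\<close>.\<close>

lemma subtop_cohomology:
  fixes N :: "'k::field vec set"
  assumes N: "gsub n m \<delta> N" and g: "gens n \<delta> N m' \<delta>' g"
    and d: "has_qdim fscale (Zc n m \<delta> N (int n - 1) t) (Bc n m \<delta> N (int n - 1) t) d"
  shows "has_qdim vscale {f \<in> gfree n m' {..<n} \<inter> hom \<delta>' t. ext g f \<in> nontop n} (Btop n m' \<delta>' (syz n m' g) t) d"
    (is "has_qdim vscale ?Z ?B d")
proof -
  let ?F = "gfree n m {} :: 'k vec set" let ?F' = "gfree n m' {} :: 'k vec set"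
  let ?S = "syz n m' g"
  have S: "gsub n m' \<delta>' ?S" by (rule syz_gsub[OF N g])
  have NF: "cch n \<delta> N p s \<subseteq> cch n \<delta> ?F p s" for p s by (rule cch_mono) (rule gsubD(2)[OF N])
  define \<phi> where "\<phi> f = (\<lambda>\<sigma>. ext g (f \<sigma>))" for f :: "nat set \<Rightarrow> 'k vec"
  have \<phi>d: "cd n (\<phi> f) = \<phi> (cd n f)" for f unfolding \<phi>_def by (rule ext_cd[OF N g])
  have \<phi>t: "\<phi> (tfam n f) = tfam n (ext g f)" for f by (auto simp: \<phi>_def tfam_def)
  have ssZ: "vec.subspace ?Z"
  proof -
    have "?Z = (gfree n m' {..<n} \<inter> hom \<delta>' t) \<inter> {f. ext g f \<in> nontop n}" by auto
    moreover have "vec.subspace {f. ext g f \<in> nontop n}"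
      using subspace_nontop[of n] unfolding vec.subspace_def by (simp add: ext_add ext_vscale) blast
    ultimately show ?thesis by (simp only: vec.subspace_inter subspace_gfree subspace_hom)
  qed
  show ?thesis
  proof (rule has_qdim_transfer[where R = "\<lambda>f f'. cd n f = tfam n (ext g f')",
        OF fv.vector_space_axioms vec.vector_space_axioms subspace_Zc[OF N] ssZ _ _ _ _ _ _ d])
    fix f assume "f \<in> Zc n m \<delta> N (int n - 1) t"
    then have f: "f \<in> cch n \<delta> ?F (int n - 1) t" "cd n f \<in> cch n \<delta> N (int n) t" by (simp_all add: Zc_def)
    have t: "cd n f = tfam n (cd n f {..<n})" by (rule cch_top[OF f(2)])
    then have "cd n f {..<n} \<in> loc {..<n} N \<inter> hom \<delta> t" using f(2) tfam_cch by metis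
    then obtain x where x: "x \<in> loc {..<n} ?F' \<inter> hom \<delta>' t" "ext g x = cd n f {..<n}"
      using ext_lift[OF N g] by blast
    have "ext g x \<in> nontop n" using boundary_top[of n \<delta> m t "ext g x"] f(1) t x(2) by auto
    then show "\<exists>x\<in>?Z. cd n f = tfam n (ext g x)" using x t by (auto simp: loc_gfree)
  next
    fix x assume x: "x \<in> ?Z"
    then have x': "x \<in> loc {..<n} ?F' \<inter> hom \<delta>' t" by (simp add: loc_gfree)
    have l: "ext g x \<in> loc {..<n} N \<inter> hom \<delta> t" by (rule ext_lochom[OF N g x'])
    then have "ext g x \<in> gfree n m {..<n} \<inter> hom \<delta> t \<inter> nontop n"
      using x loc_mono[OF order_refl gsubD(2)[OF N], of "{..<n}"] loc_gfree[of "{..<n}" n m] by auto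
    then obtain u where u: "u \<in> cch n \<delta> ?F (int n - 1) t" "tfam n (ext g x) = cd n u" using boundary_top by blast
    have "cd n u \<in> cch n \<delta> N (int n) t" using l u(2)[symmetric] tfam_cch by metis
    then show "\<exists>f\<in>Zc n m \<delta> N (int n - 1) t. cd n f = tfam n (ext g x)" using u by (auto simp: Zc_def)
  next
    fix f x assume R: "cd n f = tfam n (ext g x)" and f: "f \<in> Zc n m \<delta> N (int n - 1) t" and x: "x \<in> ?Z"
    have x': "x \<in> loc {..<n} ?F' \<inter> hom \<delta>' t" using x by (simp add: loc_gfree)
    show "f \<in> Bc n m \<delta> N (int n - 1) t \<longleftrightarrow> x \<in> ?B"
    proof
      assume "f \<in> Bc n m \<delta> N (int n - 1) t"
      then obtain w u where w: "w \<in> cch n \<delta> N (int n - 1) t" "f = w + cd n u" by (auto simp: Bc_def)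
      obtain w' where w': "w' \<in> cch n \<delta>' ?F' (int n - 1) t" "w = \<phi> w'" using cch_lift[OF N g w(1)] by (auto simp: \<phi>_def)
      define y where "y = cd n w' {..<n}"
      have "cd n w' \<in> cch n \<delta>' ?F' (int n) t" using cd_cch[OF gsub_gfree w'(1)] by simp
      then have cw: "cd n w' = tfam n y" unfolding y_def by (rule cch_top)
      then have y: "y \<in> gfree n m' {..<n} \<inter> hom \<delta>' t \<inter> nontop n" using w'(1) boundary_top by metis
      have "tfam n (ext g x) = \<phi> (cd n w')" using R w(2) w'(2) by (simp only: cd_add cd_cd add_0_right \<phi>d)
      then have "ext g x = ext g y" unfolding cw \<phi>t by (metis tfam_def)
      then have "ext g (x - y) = 0" by (simp add: ext_minus)
      moreover have xy: "x - y \<in> loc {..<n} ?F' \<inter> hom \<delta>' t"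
        using x' y by (auto simp: loc_gfree intro: vec.subspace_diff subspace_gfree subspace_hom)
      ultimately have "x - y \<in> loc {..<n} ?S \<inter> hom \<delta>' t" using loc_syz[OF N g] by blast
      moreover have "x = (x - y) + y" by simp
      ultimately show "x \<in> ?B" using y unfolding Btop_def by blast
    next
      assume "x \<in> ?B"
      then obtain w u where w: "w \<in> loc {..<n} ?S \<inter> hom \<delta>' t" "u \<in> gfree n m' {..<n} \<inter> hom \<delta>' t \<inter> nontop n" "x = w + u"
        by (auto simp: Btop_def)
      obtain v where v: "v \<in> cch n \<delta>' ?F' (int n - 1) t" "tfam n u = cd n v" using w(2) boundary_top by blast
      have "ext g x = ext g u" using w(1,3) loc_syz[OF N g] by (simp add: ext_add)
      then have "cd n (f - \<phi> v) = 0" using R v(2) by (simp add: cd_minus \<phi>d flip: \<phi>t)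
      moreover have pv: "\<phi> v \<in> cch n \<delta> N (int n - 1) t" unfolding \<phi>_def by (rule ext_cch[OF N g v(1)])
      moreover have "f - \<phi> v \<in> cch n \<delta> ?F (int n - 1) t"
      proof (rule fv.subspace_diff[OF subspace_cch[OF gsub_gfree]])
        show "f \<in> cch n \<delta> ?F (int n - 1) t" using f by (simp add: Zc_def)
        show "\<phi> v \<in> cch n \<delta> ?F (int n - 1) t" using pv NF by blast
      qed
      ultimately obtain z where "z \<in> cch n \<delta> ?F (int n - 1 - 1) t" "f - \<phi> v = cd n z"
        using cech_free_exact[of "f - \<phi> v" n \<delta> m "int n - 1" t] by auto
      then have "f = \<phi> v + cd n z" "z \<in> cch n \<delta> ?F (int n - 1 - 1) t" by (auto simp: algebra_simps)
      then show "f \<in> Bc n m \<delta> N (int n - 1) t" using pv unfolding Bc_def by blast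
    qed
  qed (simp_all add: tfam_add tfam_zero tfam_fscale ext_add ext_vscale cd_add cd_fscale)
qed

section \<open>Uniform Groebner bases\<close>

definition act :: "nat \<times> expo \<Rightarrow> expo \<Rightarrow> nat \<times> expo"
  where "act x c = (fst x, snd x + c)"

lemma act_simps [simp]: "fst (act x c) = fst x" "snd (act x c) = snd x + c" "act x 0 = x"
  "act (act x c) d = act x (c + d)"
  by (simp_all add: act_def add.assoc)

text \<open>Translation invariance is what makes this lexicographic order, basis index first, a term
  order. Inductions along it run inside one degree, where only finitely many monomials with
  nonnegative exponents exist.\<close>

lemma act_less_iff [simp]: "act x c < act y c \<longleftrightarrow> x < y"
  by (auto simp: less_prod_def act_def)

lemma act_le_iff [simp]: "act x c \<le> act y c \<longleftrightarrow> x \<le> y"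
  by (auto simp: less_eq_prod_def act_def)

lemma kdeg_act [simp]: "kdeg \<delta> (act x c) = kdeg \<delta> x + tdeg c"
  by (simp add: kdeg_def tdeg_add)

lemma keys_shift_act: "ks (shift c f) = (\<lambda>x. act x c) ` ks f"
  by (simp add: keys_shift act_def)

lemma finite_nexp: "finite {a \<in> nexp {..<n}. tdeg a \<le> T}"
proof (rule inj_on_finite)
  show "inj_on (\<lambda>a. restrict (lk a) {..<n}) {a \<in> nexp {..<n}. tdeg a \<le> T}"
  proof (rule inj_onI, rule poly_mapping_eqI)
    fix a b v assume *: "a \<in> {a \<in> nexp {..<n}. tdeg a \<le> T}" "b \<in> {a \<in> nexp {..<n}. tdeg a \<le> T}"
      "restrict (lk a) {..<n} = restrict (lk b) {..<n}"
    show "lk a v = lk b v"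
    proof (cases "v < n")
      case True then show ?thesis using fun_cong[OF *(3), of v] by simp
    next
      case False
      then have "v \<notin> ks a" "v \<notin> ks b" using * nexpD(2) by blast+
      then show ?thesis by (simp add: in_keys_iff)
    qed
  qed
  show "(\<lambda>a. restrict (lk a) {..<n}) ` {a \<in> nexp {..<n}. tdeg a \<le> T} \<subseteq> (\<Pi>\<^sub>E v\<in>{..<n}. {0..T})"
  proof clarsimp
    fix a v assume a: "a \<in> nexp {..<n}" "tdeg a \<le> T" and v: "v < n"
    have "lk a v \<le> (\<Sum>v<n. lk a v)" using v nexpD(1)[OF a(1)] by (intro member_le_sum) auto
    also have "\<dots> = tdeg a" using nexpD(2)[OF a(1)] by (intro tdeg_superset[symmetric]) auto
    finally show "0 \<le> lk a v \<and> lk a v \<le> T" using a nexpD(1) by auto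
  qed
  show "finite (\<Pi>\<^sub>E v\<in>{..<n}. {0..T})" by (intro finite_PiE) auto
qed

definition mons :: "nat \<Rightarrow> nat \<Rightarrow> (nat \<Rightarrow> nat) \<Rightarrow> int \<Rightarrow> (nat \<times> expo) set"
  where "mons n m \<delta> e = {x \<in> kset n m {}. kdeg \<delta> x \<le> e}"

lemma kset_iff_nexp: "x \<in> kset n m {} \<longleftrightarrow> fst x < m \<and> snd x \<in> nexp {..<n}"
  by (auto simp: kset_def nexp_def)

lemma finite_mons: "finite (mons n m \<delta> e)"
proof (rule finite_subset)
  show "mons n m \<delta> e \<subseteq> {..<m} \<times> {a \<in> nexp {..<n}. tdeg a \<le> e}"
    by (auto simp: mons_def kset_iff_nexp kdeg_def)
qed (simp add: finite_nexp)

lemma kdeg_nonneg: "x \<in> kset n m {} \<Longrightarrow> kdeg \<delta> x \<ge> 0"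
  by (auto simp: kset_iff_nexp kdeg_def intro: add_nonneg_nonneg tdeg_nexp)

section \<open>Leading monomials and reduction\<close>

definition monic :: "(nat \<times> expo) \<Rightarrow> 'k::field vec \<Rightarrow> bool"
  where "monic x f \<longleftrightarrow> ks f \<subseteq> {..x} \<and> lk f x = 1"

lemma monic_shift: "monic x f \<Longrightarrow> monic (act x c) (shift c f)"
  by (auto simp: monic_def keys_shift_act)

text \<open>Distinct leading monomials cannot cancel: the largest \<open>x\<close> with nonzero
  coefficient survives as the leading monomial of the sum.\<close>

lemma Max_keys_combination:
  assumes "finite D" "\<And>x. x \<in> D \<Longrightarrow> monic x (\<gamma> x)" "\<exists>x\<in>D. c x \<noteq> 0"
  shows "(\<Sum>x\<in>D. vscale (c x) (\<gamma> x)) \<noteq> 0 \<and> Max (ks (\<Sum>x\<in>D. vscale (c x) (\<gamma> x))) \<in> D"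
proof -
  define E where "E = {x\<in>D. c x \<noteq> 0}"
  define x0 where "x0 = Max E"
  have E: "finite E" "E \<noteq> {}" using assms by (auto simp: E_def)
  then have x0: "x0 \<in> E" "\<And>x. x \<in> E \<Longrightarrow> x \<le> x0" by (auto simp: x0_def)
  let ?f = "\<Sum>x\<in>D. vscale (c x) (\<gamma> x)"
  have f: "?f = (\<Sum>x\<in>E. vscale (c x) (\<gamma> x))"
    using assms(1) by (intro sum.mono_neutral_right) (auto simp: E_def)
  have "ks ?f \<subseteq> {..x0}" unfolding f
  proof (rule keys_sum_subset)
    fix x assume "x \<in> E"
    then show "ks (vscale (c x) (\<gamma> x)) \<subseteq> {..x0}"
      using x0(2)[of x] assms(2)[of x] keys_vscale[of "c x" "\<gamma> x"] by (force simp: monic_def E_def)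
  qed
  moreover have "lk ?f x0 = c x0"
  proof -
    have "lk ?f x0 = (\<Sum>x\<in>E. if x = x0 then c x0 else 0)" unfolding f lookup_sum
    proof (rule sum.cong[OF refl])
      fix x assume x: "x \<in> E"
      then have m: "monic x (\<gamma> x)" "x \<le> x0" using assms(2) x0 by (auto simp: E_def)
      show "lk (vscale (c x) (\<gamma> x)) x0 = (if x = x0 then c x0 else 0)"
      proof (cases "x = x0")
        case False
        then have "x0 \<notin> ks (\<gamma> x)" using m by (auto simp: monic_def)
        then show ?thesis using False by (simp add: in_keys_iff)
      qed (use m in \<open>simp add: monic_def\<close>)
    qed
    then show ?thesis using E x0 by simp
  qed
  then have "x0 \<in> ks ?f" using x0 by (auto simp: in_keys_iff E_def)
  ultimately have "Max (ks ?f) = x0" by (intro Max_eqI) auto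
  then show ?thesis using x0 \<open>x0 \<in> ks ?f\<close> by (auto simp: E_def)
qed

text \<open>The division algorithm, treating the monomials of \<open>D\<close> from the largest
  down, so that later subtractions do not disturb the cancellations already made. The second clause,
  that only monomials below some monomial of \<open>f\<close> are used, drives the induction in
  Buchberger's criterion.\<close>

lemma reduction_modulo_monic:
  fixes \<gamma> :: "nat \<times> expo \<Rightarrow> 'k::field vec"
  assumes "finite D" "\<And>x. x \<in> D \<Longrightarrow> monic x (\<gamma> x)"
  shows "\<exists>c. ks (f - (\<Sum>x\<in>D. vscale (c x) (\<gamma> x))) \<inter> D = {} \<and> (\<forall>x\<in>D. c x \<noteq> 0 \<longrightarrow> (\<exists>y\<in>ks f. x \<le> y))"
  using assms
proof (induction D arbitrary: f rule: finite_linorder_max_induct)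
  case empty
  then show ?case by simp
next
  case (insert b A)
  have b: "ks (\<gamma> b) \<subseteq> {..b}" "lk (\<gamma> b) b = 1" using insert.prems by (auto simp: monic_def)
  define f' where "f' = f - vscale (lk f b) (\<gamma> b)"
  obtain c where c: "ks (f' - (\<Sum>x\<in>A. vscale (c x) (\<gamma> x))) \<inter> A = {}"
      "\<forall>x\<in>A. c x \<noteq> 0 \<longrightarrow> (\<exists>y\<in>ks f'. x \<le> y)"
    using insert.IH[of f'] insert.prems by auto
  define c' where "c' = c(b := lk f b)"
  have bA: "b \<notin> A" using insert.hyps by auto
  have "(\<Sum>x\<in>A. vscale (c' x) (\<gamma> x)) = (\<Sum>x\<in>A. vscale (c x) (\<gamma> x))"
    using bA by (intro sum.cong) (auto simp: c'_def)
  then have eq: "f - (\<Sum>x\<in>insert b A. vscale (c' x) (\<gamma> x)) = f' - (\<Sum>x\<in>A. vscale (c x) (\<gamma> x))"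
    using insert.hyps(1) bA by (simp add: c'_def f'_def algebra_simps)
  have "lk (\<Sum>x\<in>A. vscale (c x) (\<gamma> x)) b = 0"
    unfolding lookup_sum
  proof (rule sum.neutral, rule ballI)
    fix x assume x: "x \<in> A"
    then have "ks (\<gamma> x) \<subseteq> {..x}" "x < b" using insert by (auto simp: monic_def)
    then have "b \<notin> ks (\<gamma> x)" by auto
    then show "lk (vscale (c x) (\<gamma> x)) b = 0" by (simp add: in_keys_iff)
  qed
  then have "b \<notin> ks (f' - (\<Sum>x\<in>A. vscale (c x) (\<gamma> x)))"
    by (simp add: in_keys_iff lookup_minus f'_def b(2))
  moreover have "\<exists>y\<in>ks f. x \<le> y" if x: "x \<in> insert b A" "c' x \<noteq> 0" for x
  proof (cases "x = b")
    case True
    then show ?thesis using x by (intro bexI[of _ b]) (auto simp: c'_def in_keys_iff)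
  next
    case False
    then obtain y where y: "y \<in> ks f'" "x \<le> y" using x c(2) by (auto simp: c'_def)
    show ?thesis
    proof (cases "y \<in> ks f")
      case False
      then have "lk f b \<noteq> 0" "y \<in> ks (\<gamma> b)" using y(1) by (auto simp: f'_def in_keys_iff lookup_minus)
      then show ?thesis using y(2) b(1) by (intro bexI[of _ b]) (auto simp: in_keys_iff)
    qed (use y in auto)
  qed
  ultimately show ?case using c(1) unfolding eq[symmetric] by (intro exI[of _ c']) auto
qed

definition lms :: "(nat \<Rightarrow> nat) \<Rightarrow> 'k::field vec set \<Rightarrow> (nat \<times> expo) set"
  where "lms \<delta> N = {Max (ks f) | f. f \<in> N \<and> f \<noteq> 0 \<and> (\<exists>t. f \<in> hom \<delta> t)}"

lemma monic_representative:
  assumes "vec.subspace N" "x \<in> lms \<delta> N"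
  shows "\<exists>f\<in>N \<inter> hom \<delta> (kdeg \<delta> x). monic x f"
proof -
  obtain f t where f: "f \<in> N" "f \<noteq> 0" "f \<in> hom \<delta> t" "x = Max (ks f)" using assms(2) by (auto simp: lms_def)
  have ne: "ks f \<noteq> {}" using f(2) keys_empty_iff by blast
  have x: "x \<in> ks f" using ne f(4) by simp
  then have t: "t = kdeg \<delta> x" and l: "lk f x \<noteq> 0" using f(3) by (auto simp: hom_def in_keys_iff)
  let ?f = "vscale (inverse (lk f x)) f"
  have "ks ?f \<subseteq> {..x}" using keys_vscale[of _ f] f(4) by force
  then have "monic x ?f" using l by (simp add: monic_def)
  moreover have "?f \<in> N \<inter> hom \<delta> (kdeg \<delta> x)"
    using f(1,3) t assms(1) subspace_hom by (auto intro: vec.subspace_scale)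
  ultimately show ?thesis by blast
qed

lemma monic_leading_monomial:
  assumes "f \<in> N \<inter> hom \<delta> t" "monic x f" shows "x \<in> lms \<delta> N" "kdeg \<delta> x = t"
proof -
  have x: "x \<in> ks f" using assms by (auto simp: monic_def in_keys_iff)
  then have "Max (ks f) = x" using assms by (intro Max_eqI) (auto simp: monic_def)
  moreover have "f \<noteq> 0" using x by auto
  ultimately show "x \<in> lms \<delta> N" using assms unfolding lms_def by blast
  show "kdeg \<delta> x = t" using x assms by (auto simp: hom_def)
qed

lemma lms_kset: "N \<subseteq> gfree n m {} \<Longrightarrow> x \<in> lms \<delta> N \<Longrightarrow> x \<in> kset n m {}"
proof -
  assume N: "N \<subseteq> gfree n m {}" and "x \<in> lms \<delta> N"
  then obtain f where f: "f \<in> N" "f \<noteq> 0" "x = Max (ks f)" by (auto simp: lms_def)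
  then have "x \<in> ks f" using keys_empty_iff[of f] by simp
  moreover have "ks f \<subseteq> kset n m {}" using f(1) N by (auto simp: gfree_def)
  ultimately show ?thesis by blast
qed

lemma lms_act:
  assumes N: "gsub n m \<delta> N" and x: "x \<in> lms \<delta> N" and c: "c \<in> nexp {..<n}"
  shows "act x c \<in> lms \<delta> N"
proof -
  obtain f where f: "f \<in> N \<inter> hom \<delta> (kdeg \<delta> x)" "monic x f" using monic_representative[OF gsubD(1)[OF N] x] by blast
  then have "shift c f \<in> N \<inter> hom \<delta> (kdeg \<delta> x + tdeg c)" using gsubD(3)[OF N c] hom_shift by blast
  then show ?thesis using monic_leading_monomial(1) monic_shift[OF f(2)] by blast
qed

text \<open>Generation in bounded degree, phrased as an induction principle: to capture
  \<open>N\<close> it suffices to exhibit a subspace closed under monomials that contains its low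
  degrees.\<close>

definition gendeg :: "nat \<Rightarrow> (nat \<Rightarrow> nat) \<Rightarrow> 'k::field vec set \<Rightarrow> int \<Rightarrow> bool"
  where "gendeg n \<delta> N d \<longleftrightarrow> (\<forall>V. vec.subspace V \<and> (\<forall>c\<in>nexp {..<n}. \<forall>f\<in>V. shift c f \<in> V) \<and>
    (\<forall>t\<le>d. N \<inter> hom \<delta> t \<subseteq> V) \<longrightarrow> N \<subseteq> V)"

lemma gendeg_mono: "gendeg n \<delta> N d \<Longrightarrow> d \<le> e \<Longrightarrow> gendeg n \<delta> N e"
  unfolding gendeg_def by (meson order_trans)

text \<open>Generation of the initial module in degrees at most \<open>e\<close>, tested only up to
  degree \<open>T\<close>. The truncation turns it into a condition on finitely many
  monomials.\<close>

definition lmclosed :: "nat \<Rightarrow> (nat \<Rightarrow> nat) \<Rightarrow> 'k::field vec set \<Rightarrow> int \<Rightarrow> int \<Rightarrow> bool"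
  where "lmclosed n \<delta> N e T \<longleftrightarrow> (\<forall>x\<in>lms \<delta> N. kdeg \<delta> x \<le> T \<longrightarrow>
    (\<exists>y\<in>lms \<delta> N. kdeg \<delta> y \<le> e \<and> (\<exists>c\<in>nexp {..<n}. x = act y c)))"

text \<open>All monomials of degree at most \<open>e\<close> serve as basis of the next free module, so that it does not
  depend on the submodule \<open>N\<close>; those that are not leading monomials of \<open>N\<close> are sent to \<open>0\<close>.\<close>

definition nrk :: "nat \<Rightarrow> nat \<Rightarrow> (nat \<Rightarrow> nat) \<Rightarrow> int \<Rightarrow> nat"
  where "nrk n m \<delta> e = card (mons n m \<delta> e)"

definition nmon :: "nat \<Rightarrow> nat \<Rightarrow> (nat \<Rightarrow> nat) \<Rightarrow> int \<Rightarrow> nat \<Rightarrow> nat \<times> expo"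
  where "nmon n m \<delta> e j = sorted_list_of_set (mons n m \<delta> e) ! j"

definition ndeg :: "nat \<Rightarrow> nat \<Rightarrow> (nat \<Rightarrow> nat) \<Rightarrow> int \<Rightarrow> nat \<Rightarrow> nat"
  where "ndeg n m \<delta> e j = nat (kdeg \<delta> (nmon n m \<delta> e j))"

lemma nmon_mem: "j < nrk n m \<delta> e \<Longrightarrow> nmon n m \<delta> e j \<in> mons n m \<delta> e"
  using nth_mem[of j "sorted_list_of_set (mons n m \<delta> e)"] finite_mons[of n m \<delta> e]
  by (simp add: nmon_def nrk_def)

lemma nmon_surj: "x \<in> mons n m \<delta> e \<Longrightarrow> \<exists>j<nrk n m \<delta> e. nmon n m \<delta> e j = x"
  using finite_mons[of n m \<delta> e] by (metis in_set_conv_nth length_sorted_list_of_set nmon_def nrk_def set_sorted_list_of_set)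

lemma ndeg_kdeg: "j < nrk n m \<delta> e \<Longrightarrow> int (ndeg n m \<delta> e j) = kdeg \<delta> (nmon n m \<delta> e j)"
  using nmon_mem[of j n m \<delta> e] kdeg_nonneg[of "nmon n m \<delta> e j" n m \<delta>] by (auto simp: ndeg_def mons_def)

definition pospart :: "expo \<Rightarrow> expo" where "pospart a = Poly_Mapping.map (max 0) a"

lemma lookup_pospart [simp]: "lk (pospart a) v = max 0 (lk a v)"
  by (auto simp: pospart_def Poly_Mapping.map.rep_eq when_def)

lemma pospart_nexp: "ks a \<subseteq> \<sigma> \<Longrightarrow> pospart a \<in> nexp \<sigma>"
  by (auto simp: nexp_def neg_def in_keys_iff max_def split: if_splits)

lemma tdeg_mono: "finite X \<Longrightarrow> ks a \<subseteq> X \<Longrightarrow> ks b \<subseteq> X \<Longrightarrow> (\<And>v. lk a v \<le> lk b v) \<Longrightarrow> tdeg a \<le> tdeg b"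
  by (simp add: tdeg_superset sum_mono)

text \<open>Every common multiple of \<open>x\<close> and \<open>y\<close> is a multiple, by
  \<open>c\<close>, of their least common multiple. The cofactor \<open>b'\<close> of
  \<open>y\<close> is the part of \<open>x\<close> that is missing in \<open>y\<close>, hence its
  degree bound and, later, the constant \<open>2 * e\<close>.\<close>

lemma least_common_multiple:
  assumes y: "y \<in> kset n m {}" and x: "x \<in> kset n m {}" and a: "a \<in> nexp {..<n}" and b: "b \<in> nexp {..<n}"
    and eq: "act x a = act y b"
  obtains a' b' c where "a' \<in> nexp {..<n}" "b' \<in> nexp {..<n}" "c \<in> nexp {..<n}" "act x a' = act y b'"
    "a = a' + c" "b = b' + c" "tdeg b' \<le> tdeg (snd x)"
proof -
  have f: "fst x = fst y" and s: "snd x + a = snd y + b" using eq by (auto simp: act_def)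
  then have ab: "lk (snd x) v + lk a v = lk (snd y) v + lk b v" for v by (metis lookup_add)
  have nx: "snd x \<in> nexp {..<n}" and ny: "snd y \<in> nexp {..<n}" using x y by (auto simp: kset_iff_nexp)
  have kk: "ks (snd x - snd y) \<subseteq> {..<n}" "ks (snd y - snd x) \<subseteq> {..<n}"
    using keys_minus_subset[of "snd x" "snd y"] keys_minus_subset[of "snd y" "snd x"] nexpD(2)[OF nx] nexpD(2)[OF ny] by auto
  define b' where "b' = pospart (snd x - snd y)"
  define a' where "a' = pospart (snd y - snd x)"
  define c where "c = b - b'"
  have b': "b' \<in> nexp {..<n}" and a': "a' \<in> nexp {..<n}" using kk by (auto simp: b'_def a'_def intro: pospart_nexp)
  have 1: "snd x + a' = snd y + b'"
    by (rule poly_mapping_eqI) (auto simp: lookup_add lookup_minus a'_def b'_def max_def)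
  have c: "c \<in> nexp {..<n}"
  proof -
    have "ks c \<subseteq> {..<n}" using keys_minus_subset[of b b'] nexpD(2)[OF b] nexpD(2)[OF b'] by (auto simp: c_def)
    moreover have "lk c v \<ge> 0" for v
      using ab[of v] nexpD(1)[OF a, of v] nexpD(1)[OF b, of v] by (auto simp: c_def b'_def lookup_minus)
    ultimately show ?thesis by (auto simp: nexp_def neg_def not_less)
  qed
  have "a = a' + c"
  proof (rule poly_mapping_eqI)
    show "lk a v = lk (a' + c) v" for v
      using ab[of v] by (auto simp: lookup_add lookup_minus c_def a'_def b'_def max_def)
  qed
  moreover have "b = b' + c" by (simp add: c_def)
  moreover have "tdeg b' \<le> tdeg (snd x)"
    using nexpD(2)[OF b'] nexpD(2)[OF nx] nexpD(1)[OF nx] nexpD(1)[OF ny]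
    by (intro tdeg_mono[of "{..<n}"]) (auto simp: b'_def lookup_minus)
  moreover have "act x a' = act y b'" using f 1 by (simp add: act_def)
  ultimately show ?thesis using that a' b' c by blast
qed

lemma standard_generators:
  fixes N :: "'k::field vec set"
  assumes N: "gsub n m \<delta> N"
  obtains g where "\<And>j. j < nrk n m \<delta> e \<Longrightarrow> nmon n m \<delta> e j \<notin> lms \<delta> N \<Longrightarrow> g j = 0"
    "\<And>j. j < nrk n m \<delta> e \<Longrightarrow> nmon n m \<delta> e j \<in> lms \<delta> N \<Longrightarrow> monic (nmon n m \<delta> e j) (g j)"
    "\<And>j. j < nrk n m \<delta> e \<Longrightarrow> g j \<in> N \<inter> hom \<delta> (int (ndeg n m \<delta> e j))"
proof -
  have "\<exists>f. (nmon n m \<delta> e j \<notin> lms \<delta> N \<longrightarrow> f = 0) \<and> (nmon n m \<delta> e j \<in> lms \<delta> N \<longrightarrow> monic (nmon n m \<delta> e j) f) \<and>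
     (j < nrk n m \<delta> e \<longrightarrow> f \<in> N \<inter> hom \<delta> (int (ndeg n m \<delta> e j)))" for j
  proof (cases "nmon n m \<delta> e j \<in> lms \<delta> N")
    case True
    then show ?thesis using monic_representative[OF gsubD(1)[OF N] True] ndeg_kdeg[of j n m \<delta> e] by auto
  next
    case False
    then show ?thesis using vec.subspace_0[OF gsubD(1)[OF N]] vec.subspace_0[OF subspace_hom] by auto
  qed
  then show ?thesis using that by metis
qed

text \<open>Two presentations of the same monomial as a multiple of a leading monomial of degree at
  most \<open>e\<close> differ by an S-pair, which already occurs at a least common multiple of
  degree at most \<open>2 * e\<close>. There the hypothesis provides a syzygy resolving it. Modulo
  the syzygies of degree at most \<open>2 * e\<close>, the free module is thus spanned by one chosen
  presentation \<open>\<epsilon> x\<close> per monomial \<open>x\<close>, and the images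
  \<open>\<gamma> x\<close> have distinct leading monomials. Both conclusions follow from
  this.\<close>

lemma buchberger:
  fixes N :: "'k::field vec set"
  assumes N: "gsub n m \<delta> N" and gd: "gendeg n \<delta> N e" and cl: "lmclosed n \<delta> N e (2 * e)" and e0: "e \<ge> 0"
  shows "\<exists>g. gens n \<delta> N (nrk n m \<delta> e) (ndeg n m \<delta> e) g \<and>
      gendeg n (ndeg n m \<delta> e) (syz n (nrk n m \<delta> e) g) (2 * e)" (is ?thesis1)
    and "lmclosed n \<delta> N e T" (is ?thesis2)
proof -
  define L where "L = lms \<delta> N"
  define m' where "m' = nrk n m \<delta> e"
  define \<delta>' where "\<delta>' = ndeg n m \<delta> e"
  define h where "h = nmon n m \<delta> e"
  obtain g where g0: "\<And>j. j < m' \<Longrightarrow> h j \<notin> L \<Longrightarrow> g j = 0"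
    and gm: "\<And>j. j < m' \<Longrightarrow> h j \<in> L \<Longrightarrow> monic (h j) (g j)"
    and gens_mem: "\<And>j. j < m' \<Longrightarrow> g j \<in> N \<inter> hom \<delta> (int (\<delta>' j))"
    using standard_generators[OF N, of e] unfolding L_def m'_def \<delta>'_def h_def by metis
  have hmem: "h j \<in> kset n m {}" "kdeg \<delta> (h j) \<le> e" "int (\<delta>' j) = kdeg \<delta> (h j)" if "j < m'" for j
    using nmon_mem[of j n m \<delta> e] ndeg_kdeg[of j n m \<delta> e] that by (auto simp: h_def m'_def \<delta>'_def mons_def)
  have hsur: "\<exists>j<m'. h j = x" if "x \<in> L" "kdeg \<delta> x \<le> e" for x
    using nmon_surj[of x n m \<delta> e] that lms_kset[OF gsubD(2)[OF N]] by (auto simp: h_def m'_def mons_def L_def)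
  have Lk: "x \<in> L \<Longrightarrow> x \<in> kset n m {}" for x using lms_kset[OF gsubD(2)[OF N]] by (auto simp: L_def)
  define sg :: "nat \<Rightarrow> expo \<Rightarrow> 'k vec" where "sg j b = Poly_Mapping.single (j, b) 1" for j b
  have ext_sg: "ext g (sg j b) = shift b (g j)" for j b by (simp add: sg_def ext_single)
  have shift_sg: "shift c (sg j b) = sg j (b + c)" for c j b by (simp add: sg_def shift_single)
  have sg_mem: "sg j b \<in> gfree n m' {} \<inter> hom \<delta>' (kdeg \<delta> (h j) + tdeg b)" if "j < m'" "b \<in> nexp {..<n}" for j b
    using that hmem(3)[OF that(1)] by (auto simp: sg_def gfree_def hom_def kset_iff_nexp kdeg_def)
  text \<open>\<open>jj x\<close> and \<open>cc x\<close> choose a presentation of \<open>x\<close> as a multiple of a leading monomial of degree at most \<open>e\<close>.\<close>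
  define D where "D = {x. \<exists>j<m'. h j \<in> L \<and> (\<exists>c\<in>nexp {..<n}. x = act (h j) c)}"
  have "\<forall>x\<in>D. \<exists>j c. j < m' \<and> h j \<in> L \<and> c \<in> nexp {..<n} \<and> x = act (h j) c" by (auto simp: D_def)
  then obtain jj cc where jc: "\<And>x. x \<in> D \<Longrightarrow> jj x < m'" "\<And>x. x \<in> D \<Longrightarrow> h (jj x) \<in> L"
    "\<And>x. x \<in> D \<Longrightarrow> cc x \<in> nexp {..<n}" "\<And>x. x \<in> D \<Longrightarrow> x = act (h (jj x)) (cc x)" by metis
  define \<epsilon> where "\<epsilon> x = sg (jj x) (cc x)" for x
  define \<gamma> where "\<gamma> x = ext g (\<epsilon> x)" for x
  have \<gamma>m: "monic x (\<gamma> x)" if "x \<in> D" for x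
    using monic_shift[OF gm[OF jc(1)[OF that] jc(2)[OF that]], of "cc x"] jc(4)[OF that] by (simp add: \<gamma>_def \<epsilon>_def ext_sg)
  have kj: "kdeg \<delta> (h (jj x)) + tdeg (cc x) = kdeg \<delta> x" if "x \<in> D" for x
    using arg_cong[OF jc(4)[OF that], of "kdeg \<delta>"] by simp
  have \<epsilon>mem: "\<epsilon> x \<in> gfree n m' {} \<inter> hom \<delta>' (kdeg \<delta> x)" if "x \<in> D" for x
    using sg_mem[OF jc(1)[OF that] jc(3)[OF that]] unfolding \<epsilon>_def kj[OF that] .
  have gN': "\<forall>j<m'. g j \<in> N" and gh': "\<forall>j<m'. g j \<in> hom \<delta> (int (\<delta>' j))" using gens_mem by auto
  have \<gamma>N: "\<gamma> x \<in> N \<inter> hom \<delta> (kdeg \<delta> x)" if "x \<in> D" for x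
    using \<epsilon>mem[OF that] ext_in_sub[OF N gN'] ext_in_hom[OF gh', of "\<epsilon> x"] unfolding \<gamma>_def gfree_def kset_def by blast
  have D_kset: "x \<in> D \<Longrightarrow> x \<in> kset n m {}" for x
    using hmem(1) nexp_add by (auto simp: D_def kset_iff_nexp)
  define DT where "DT t = {x\<in>D. kdeg \<delta> x = t}" for t
  have finDT: "finite (DT t)" for t
    by (rule finite_subset[OF _ finite_mons[of n m \<delta> t]]) (auto simp: DT_def mons_def D_kset)
  \<comment> \<open>The only use of closure of the leading monomials, and only up to degree
    \<open>2 * e\<close>.\<close>
  have LD: "x \<in> D" if xL: "x \<in> L" "kdeg \<delta> x \<le> 2 * e" for x
  proof -
    obtain y c where y: "y \<in> L" "kdeg \<delta> y \<le> e" "c \<in> nexp {..<n}" "x = act y c"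
      using cl[unfolded lmclosed_def, rule_format, OF xL(1)[unfolded L_def] xL(2)] unfolding L_def by blast
    then show ?thesis using hsur[OF y(1,2)] by (auto simp: D_def)
  qed
  have NhD: "Max (ks f) \<in> DT t" if "f \<in> N \<inter> hom \<delta> t" "f \<noteq> 0" "t \<le> 2 * e" for f t
  proof -
    have "Max (ks f) \<in> L" using that by (auto simp: L_def lms_def)
    moreover have "Max (ks f) \<in> ks f" using that(2) keys_empty_iff[of f] by simp
    then have "kdeg \<delta> (Max (ks f)) = t" using that(1) by (auto simp: hom_def)
    ultimately show ?thesis using LD that(3) by (auto simp: DT_def)
  qed
  \<comment> \<open>Division leaves no remainder in these degrees: the leading monomial of a nonzero
    remainder would lie in \<open>D\<close>, where the remainder has no monomials.\<close>
  have expand: "\<exists>c. f = (\<Sum>x\<in>DT t. vscale (c x) (\<gamma> x)) \<and> (\<forall>x\<in>DT t. c x \<noteq> 0 \<longrightarrow> (\<exists>y\<in>ks f. x \<le> y))"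
    if f: "f \<in> N \<inter> hom \<delta> t" "t \<le> 2 * e" for f t
  proof -
    obtain c where c: "ks (f - (\<Sum>x\<in>DT t. vscale (c x) (\<gamma> x))) \<inter> DT t = {}"
      "\<forall>x\<in>DT t. c x \<noteq> 0 \<longrightarrow> (\<exists>y\<in>ks f. x \<le> y)"
      using reduction_modulo_monic[OF finDT, of t \<gamma> f] \<gamma>m unfolding DT_def by blast
    let ?r = "f - (\<Sum>x\<in>DT t. vscale (c x) (\<gamma> x))"
    have SN: "vec.subspace (N \<inter> hom \<delta> t)" using gsubD(1)[OF N] subspace_hom by (rule vec.subspace_inter)
    have rN: "?r \<in> N \<inter> hom \<delta> t"
      using f(1) \<gamma>N by (intro vec.subspace_diff[OF SN] vec.subspace_sum[OF SN] vec.subspace_scale[OF SN]) (auto simp: DT_def)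
    have "?r = 0"
    proof (rule ccontr)
      assume "?r \<noteq> 0"
      then show False using NhD[OF rN] f(2) c(1) keys_empty_iff[of ?r] Max_in[OF finite_keys, of ?r] by blast
    qed
    then show ?thesis using c(2) by auto
  qed
  have gens: "gens n \<delta> N m' \<delta>' g"
  proof -
    let ?V = "ext g ` gfree n m' {}"
    have sV: "vec.subspace ?V"
    proof (rule vec.subspaceI)
      show "0 \<in> ?V" using vec.subspace_0[OF subspace_gfree] ext_zero by (metis imageI)
      show "x + y \<in> ?V" if "x \<in> ?V" "y \<in> ?V" for x y
        using that by (auto simp: ext_add[symmetric] intro!: imageI vec.subspace_add[OF subspace_gfree])
      show "vscale c x \<in> ?V" if "x \<in> ?V" for c x
        using that by (auto simp: ext_vscale[symmetric] intro!: imageI vec.subspace_scale[OF subspace_gfree])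
    qed
    have "N \<subseteq> ?V"
    proof (rule gd[unfolded gendeg_def, rule_format], intro conjI sV ballI allI impI subsetI)
      fix c and f :: "'k vec" assume "c \<in> nexp {..<n}" "f \<in> ?V"
      then show "shift c f \<in> ?V" by (auto simp: ext_shift[symmetric] intro!: imageI gfree_shift)
    next
      fix t f assume t: "t \<le> e" and f: "f \<in> N \<inter> hom \<delta> t"
      then obtain c where "f = (\<Sum>x\<in>DT t. vscale (c x) (\<gamma> x))" using expand[of f t] e0 by auto
      moreover have "\<gamma> x \<in> ?V" if "x \<in> D" for x using \<epsilon>mem[OF that] by (auto simp: \<gamma>_def)
      ultimately show "f \<in> ?V"
        by (simp only:) (intro vec.subspace_sum[OF sV] vec.subspace_scale[OF sV], simp add: DT_def)
    qed
    then have "N \<inter> hom \<delta> t \<subseteq> ext g ` (gfree n m' {} \<inter> hom \<delta>' t)" for t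
    proof (intro subsetI)
      fix f assume V: "N \<subseteq> ?V" and f: "f \<in> N \<inter> hom \<delta> t"
      then obtain f' where f': "f' \<in> gfree n m' {}" "f = ext g f'" by blast
      have "f = gpart \<delta> t f" using f by (simp add: gpart_id)
      also have "\<dots> = ext g (gpart \<delta>' t f')" using ext_gpart[OF gh' f'(1)] f'(2) by simp
      finally show "f \<in> ext g ` (gfree n m' {} \<inter> hom \<delta>' t)"
        using gsubD(4)[OF gsub_gfree f'(1)] gpart_hom by blast
    qed
    then show ?thesis using gens_mem by (auto simp: gens_def)
  qed
  have S: "gsub n m' \<delta>' (syz n m' g)" by (rule gsub_syz[OF gh'])
  \<comment> \<open>Any \<open>V\<close> that is closed under monomials and contains the syzygies of
    degree at most \<open>2 * e\<close> spans the free module together with the chosen presentations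
    \<open>\<epsilon> x\<close>.\<close>
  have main: "\<exists>c. f - (\<Sum>x\<in>DT t. vscale (c x) (\<epsilon> x)) \<in> V"
    if V: "vec.subspace V" "\<And>c f. c \<in> nexp {..<n} \<Longrightarrow> f \<in> V \<Longrightarrow> shift c f \<in> V"
      "\<And>t. t \<le> 2 * e \<Longrightarrow> syz n m' g \<inter> hom \<delta>' t \<subseteq> V" and f: "f \<in> gfree n m' {} \<inter> hom \<delta>' t" for V f t
  proof -
    define U where "U = {f. \<exists>c. f - (\<Sum>x\<in>DT t. vscale (c x) (\<epsilon> x)) \<in> V}"
    have UI: "f \<in> U" if "f - (\<Sum>x\<in>DT t. vscale (c x) (\<epsilon> x)) \<in> V" for f c
      unfolding U_def by (intro CollectI exI) (rule that)
    have sU: "vec.subspace U"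
    proof (rule vec.subspaceI)
      have "0 - (\<Sum>x\<in>DT t. vscale 0 (\<epsilon> x)) \<in> V" using vec.subspace_0[OF V(1)] by simp
      then show "0 \<in> U" by (rule UI)
    next
      fix x y assume "x \<in> U" "y \<in> U"
      then obtain c d where "x - (\<Sum>z\<in>DT t. vscale (c z) (\<epsilon> z)) \<in> V" "y - (\<Sum>z\<in>DT t. vscale (d z) (\<epsilon> z)) \<in> V"
        by (auto simp: U_def)
      from vec.subspace_add[OF V(1) this] have "x + y - (\<Sum>z\<in>DT t. vscale (c z + d z) (\<epsilon> z)) \<in> V"
        by (simp add: vec.scale_left_distrib sum.distrib algebra_simps)
      then show "x + y \<in> U" by (rule UI)
    next
      fix a x assume "x \<in> U"
      then obtain c where "x - (\<Sum>z\<in>DT t. vscale (c z) (\<epsilon> z)) \<in> V" by (auto simp: U_def)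
      from vec.subspace_scale[OF V(1) this, of a] have "vscale a x - (\<Sum>z\<in>DT t. vscale (a * c z) (\<epsilon> z)) \<in> V"
        by (simp add: vec.scale_right_diff_distrib vec.scale_sum_right)
      then show "vscale a x \<in> U" by (rule UI)
    qed
    have VU: "V \<subseteq> U"
    proof
      fix x assume "x \<in> V"
      then have "x - (\<Sum>z\<in>DT t. vscale 0 (\<epsilon> z)) \<in> V" by simp
      then show "x \<in> U" by (rule UI)
    qed
    have \<epsilon>U: "\<epsilon> x \<in> U" if "x \<in> DT t" for x
    proof -
      have "(\<Sum>z\<in>DT t. vscale (if z = x then 1 else 0) (\<epsilon> z)) = (\<Sum>z\<in>DT t. if z = x then \<epsilon> x else 0)"
        by (intro sum.cong) auto
      then have "\<epsilon> x - (\<Sum>z\<in>DT t. vscale (if z = x then 1 else 0) (\<epsilon> z)) \<in> V"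
        using that finDT[of t] vec.subspace_0[OF V(1)] by simp
      then show ?thesis by (rule UI)
    qed
    \<comment> \<open>Induction on the number of monomials of \<open>D\<close> below
      \<open>x\<close> in degree \<open>t\<close>.\<close>
    have mono: "sg j b \<in> U" if "j < m'" "h j \<in> L" "b \<in> nexp {..<n}" "act (h j) b = x" "x \<in> DT t" for j b x
      using that
    proof (induction "card {y\<in>DT t. y < x}" arbitrary: x j b rule: less_induct)
      case less
      have xD: "x \<in> D" and kx: "kdeg \<delta> x = t" using less.prems by (auto simp: DT_def)
      let ?i = "jj x" let ?a = "cc x"
      note i = jc[OF xD]
      obtain a' b' c where abc: "a' \<in> nexp {..<n}" "b' \<in> nexp {..<n}" "c \<in> nexp {..<n}"
          "act (h ?i) a' = act (h j) b'" "?a = a' + c" "b = b' + c" "tdeg b' \<le> tdeg (snd (h ?i))"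
        using least_common_multiple[OF hmem(1)[OF less.prems(1)] hmem(1)[OF i(1)] i(3) less.prems(3)] less.prems(4) i(4) by metis
      define l where "l = act (h j) b'"
      have lx: "act l c = x" using less.prems(4) abc(6) by (simp add: l_def)
      have kl: "kdeg \<delta> l \<le> 2 * e"
      proof -
        have "tdeg (snd (h ?i)) \<le> kdeg \<delta> (h ?i)" by (simp add: kdeg_def)
        then show ?thesis using abc(7) hmem(2)[OF i(1)] hmem(2)[OF less.prems(1)] by (simp add: l_def)
      qed
      \<comment> \<open>The S-polynomial of the given and the chosen presentation, formed at their
        least common multiple \<open>l\<close>. Its expansion involves only monomials below
        \<open>l\<close> and yields the syzygy \<open>?s\<close>.\<close>
      define f where "f = shift b' (g j) - shift a' (g ?i)"
      have m1: "monic l (shift b' (g j))" unfolding l_def by (intro monic_shift gm less.prems)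
      have m2: "monic l (shift a' (g ?i))" unfolding l_def abc(4)[symmetric] by (intro monic_shift gm i)
      have fl: "y < l" if "y \<in> ks f" for y
      proof -
        have "y \<le> l" using that m1 m2 keys_minus_subset[of "shift b' (g j)" "shift a' (g ?i)"] unfolding f_def monic_def by auto
        moreover have "lk f l = 0" using m1 m2 unfolding f_def monic_def lookup_minus by simp
        ultimately show ?thesis using that by (cases "y = l") (auto simp: in_keys_iff)
      qed
      have s1: "sg j b' \<in> gfree n m' {} \<inter> hom \<delta>' (kdeg \<delta> l)"
        using sg_mem[OF less.prems(1) abc(2)] by (simp add: l_def)
      have s2: "sg ?i a' \<in> gfree n m' {} \<inter> hom \<delta>' (kdeg \<delta> l)"
        using sg_mem[OF i(1) abc(1)] unfolding l_def abc(4)[symmetric] by simp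
      have Sfh: "vec.subspace (gfree n m' {} \<inter> hom \<delta>' (kdeg \<delta> l))"
        using subspace_gfree subspace_hom by (rule vec.subspace_inter)
      have f_ext: "f = ext g (sg j b' - sg ?i a')" by (simp add: f_def ext_minus ext_sg)
      have dmem: "sg j b' - sg ?i a' \<in> gfree n m' {} \<inter> hom \<delta>' (kdeg \<delta> l)"
        using s1 s2 by (rule vec.subspace_diff[OF Sfh])
      have fN: "f \<in> N \<inter> hom \<delta> (kdeg \<delta> l)"
        using dmem ext_in_sub[OF N gN'] ext_in_hom[OF gh', of "sg j b' - sg ?i a'"] unfolding f_ext gfree_def kset_def by blast
      obtain c' where c': "f = (\<Sum>y\<in>DT (kdeg \<delta> l). vscale (c' y) (\<gamma> y))"
          "\<forall>y\<in>DT (kdeg \<delta> l). c' y \<noteq> 0 \<longrightarrow> (\<exists>z\<in>ks f. y \<le> z)"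
        using expand[OF fN kl] by blast
      let ?s = "sg j b' - sg ?i a' - (\<Sum>y\<in>DT (kdeg \<delta> l). vscale (c' y) (\<epsilon> y))"
      have "?s \<in> gfree n m' {} \<inter> hom \<delta>' (kdeg \<delta> l)"
      proof (intro vec.subspace_diff[OF Sfh, OF dmem] vec.subspace_sum[OF Sfh] vec.subspace_scale[OF Sfh])
        fix y assume "y \<in> DT (kdeg \<delta> l)"
        then show "\<epsilon> y \<in> gfree n m' {} \<inter> hom \<delta>' (kdeg \<delta> l)" using \<epsilon>mem[of y] by (simp add: DT_def)
      qed
      moreover have "ext g ?s = 0"
        using c'(1) f_ext by (simp add: ext_minus ext_sum ext_vscale \<gamma>_def)
      ultimately have "?s \<in> V" using V(3)[OF kl] by (auto simp: syz_def)
      \<comment> \<open>Multiplication by the remaining cofactor \<open>c\<close> leads back to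
        degree \<open>t\<close>: up to \<open>U\<close>, \<open>sg j b\<close> is
        \<open>\<epsilon> x\<close> plus presentations of monomials below \<open>x\<close>, which
        the induction covers.\<close>
      then have "shift c ?s \<in> U" using V(2)[OF abc(3)] VU by blast
      then have "sg j b - \<epsilon> x - (\<Sum>y\<in>DT (kdeg \<delta> l). vscale (c' y) (shift c (\<epsilon> y))) \<in> U"
        by (simp add: shift_minus shift_sum shift_vscale shift_sg abc(6)[symmetric] \<epsilon>_def abc(5)[symmetric])
      moreover have "vscale (c' y) (shift c (\<epsilon> y)) \<in> U" if y: "y \<in> DT (kdeg \<delta> l)" for y
      proof (cases "c' y = 0")
        case True then show ?thesis using vec.subspace_0[OF sU] by simp
      next
        case False
        then have "y < l" using c'(2) y fl by (meson le_less_trans)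
        then have lt: "act y c < x" using lx act_less_iff by metis
        have yD: "y \<in> D" "kdeg \<delta> y = kdeg \<delta> l" using y by (auto simp: DT_def)
        note k = jc[OF yD(1)]
        have "act y c \<in> D" using k nexp_add[OF k(3) abc(3)] unfolding D_def by (metis (mono_tags, lifting) act_simps(4) mem_Collect_eq)
        moreover have "kdeg \<delta> (act y c) = t" using yD(2) kx lx by (metis kdeg_act)
        ultimately have yt: "act y c \<in> DT t" by (simp add: DT_def)
        have "card {z\<in>DT t. z < act y c} < card {z\<in>DT t. z < x}"
          using lt yt finDT[of t] by (intro psubset_card_mono) auto
        moreover have "act (h (jj y)) (cc y + c) = act y c" using k(4) by (metis act_simps(4))
        ultimately have "sg (jj y) (cc y + c) \<in> U"
          using less.hyps[of "act y c" "jj y" "cc y + c"] k(1,2) nexp_add[OF k(3) abc(3)] yt by blast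
        then show ?thesis using vec.subspace_scale[OF sU] by (simp add: \<epsilon>_def shift_sg)
      qed
      then have "(\<Sum>y\<in>DT (kdeg \<delta> l). vscale (c' y) (shift c (\<epsilon> y))) \<in> U" by (intro vec.subspace_sum[OF sU])
      ultimately have "sg j b - \<epsilon> x \<in> U" using vec.subspace_add[OF sU] by fastforce
      then show ?case using vec.subspace_add[OF sU _ \<epsilon>U[OF less.prems(5)]] by fastforce
    qed
    have "sg j b \<in> U" if "j < m'" "b \<in> nexp {..<n}" "kdeg \<delta> (h j) + tdeg b = t" for j b
    proof (cases "h j \<in> L")
      case True
      then have "act (h j) b \<in> DT t" using that by (auto simp: DT_def D_def)
      then show ?thesis using mono that True by blast
    next
      case False
      \<comment> \<open>Here \<open>g j = 0\<close>, so the basis vector itself is a syzygy, of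
        degree at most \<open>e\<close>.\<close>
      have "sg j 0 \<in> syz n m' g \<inter> hom \<delta>' (kdeg \<delta> (h j))"
        using sg_mem[OF that(1), of 0] g0[OF that(1) False] by (simp add: syz_def ext_sg)
      then have "sg j 0 \<in> V" using V(3)[of "kdeg \<delta> (h j)"] hmem(2)[OF that(1)] e0 by auto
      then have "shift b (sg j 0) \<in> V" using V(2) that(2) by blast
      then show ?thesis using VU by (auto simp: shift_sg)
    qed
    then have "Poly_Mapping.single x 1 \<in> U" if "x \<in> ks f" for x
    proof -
      have "fst x < m'" "snd x \<in> nexp {..<n}" "kdeg \<delta>' x = t"
        using that f kset_iff_nexp[of x] unfolding gfree_def hom_def by blast+
      moreover have "Poly_Mapping.single x 1 = sg (fst x) (snd x)" by (simp add: sg_def)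
      moreover have "kdeg \<delta>' x = kdeg \<delta> (h (fst x)) + tdeg (snd x)"
        using hmem(3)[OF \<open>fst x < m'\<close>] by (simp add: kdeg_def[of \<delta>'])
      ultimately show ?thesis using \<open>\<And>j b. j < m' \<Longrightarrow> b \<in> nexp {..<n} \<Longrightarrow> kdeg \<delta> (h j) + tdeg b = t \<Longrightarrow> sg j b \<in> U\<close> by simp
    qed
    then have "f \<in> U"
      by (subst decompose_single) (intro vec.subspace_sum[OF sU] vec.subspace_scale[OF sU])
    then show ?thesis by (simp add: U_def)
  qed
  have gds: "gendeg n \<delta>' (syz n m' g) (2 * e)"
    unfolding gendeg_def
  proof (intro allI impI subsetI, elim conjE)
    fix V z assume V: "vec.subspace V" "\<forall>c\<in>nexp {..<n}. \<forall>f\<in>V. shift c f \<in> V" "\<forall>t\<le>2 * e. syz n m' g \<inter> hom \<delta>' t \<subseteq> V"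
      and z: "z \<in> syz n m' g"
    have hz: "z \<in> V" if z: "z \<in> syz n m' g \<inter> hom \<delta>' t" for z t
    proof -
      \<comment> \<open>Intersecting \<open>V\<close> with the syzygies forces the combination of
        the \<open>\<epsilon> x\<close> to be a syzygy too. Its image combines vectors with distinct
        leading monomials, so all its coefficients vanish.\<close>
      have "\<exists>c. z - (\<Sum>x\<in>DT t. vscale (c x) (\<epsilon> x)) \<in> V \<inter> syz n m' g"
      proof (rule main)
        show "vec.subspace (V \<inter> syz n m' g)" using V(1) gsubD(1)[OF S] by (rule vec.subspace_inter)
        show "z \<in> gfree n m' {} \<inter> hom \<delta>' t" using z by (auto simp: syz_def)
      qed (use V gsubD(3)[OF S] in auto)
      then obtain c where c: "z - (\<Sum>x\<in>DT t. vscale (c x) (\<epsilon> x)) \<in> V \<inter> syz n m' g" by blast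
      then have "ext g (z - (\<Sum>x\<in>DT t. vscale (c x) (\<epsilon> x))) = 0" by (simp add: syz_def)
      then have "(\<Sum>x\<in>DT t. vscale (c x) (\<gamma> x)) = 0"
        using z by (simp add: ext_minus ext_sum ext_vscale \<gamma>_def syz_def)
      then have "\<not> (\<exists>x\<in>DT t. c x \<noteq> 0)"
        using Max_keys_combination[OF finDT[of t], of \<gamma> c] \<gamma>m by (auto simp: DT_def)
      then have "(\<Sum>x\<in>DT t. vscale (c x) (\<epsilon> x)) = 0" by (intro sum.neutral) simp
      then show ?thesis using c by simp
    qed
    have "gpart \<delta>' t z \<in> V" for t using hz gsubD(4)[OF S z] gpart_hom by blast
    then have "(\<Sum>t\<in>kdeg \<delta>' ` ks z. gpart \<delta>' t z) \<in> V" by (intro vec.subspace_sum[OF V(1)])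
    then show "z \<in> V" using gpart_sum[of "kdeg \<delta>' ` ks z" \<delta>' z] by simp
  qed
  show ?thesis1 using gens gds unfolding m'_def \<delta>'_def by blast
  show ?thesis2 unfolding lmclosed_def
  proof (intro ballI impI)
    fix x assume "x \<in> lms \<delta> N"
    then obtain f t where f: "f \<in> N \<inter> hom \<delta> t" "f \<noteq> 0" "x = Max (ks f)" by (auto simp: lms_def)
    then obtain f' where f': "f' \<in> gfree n m' {} \<inter> hom \<delta>' t" "f = ext g f'" using gens unfolding gens_def by blast
    \<comment> \<open>With all syzygies in the role of \<open>V\<close>, every element of
      \<open>N\<close> becomes a combination of the \<open>\<gamma> x\<close>, which reveals its
      leading monomial.\<close>
    obtain c where c: "f' - (\<Sum>x\<in>DT t. vscale (c x) (\<epsilon> x)) \<in> syz n m' g"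
      using main[OF gsubD(1)[OF S] gsubD(3)[OF S] _ f'(1)] by blast
    then have "ext g (f' - (\<Sum>x\<in>DT t. vscale (c x) (\<epsilon> x))) = 0" by (simp add: syz_def)
    then have fc: "f = (\<Sum>x\<in>DT t. vscale (c x) (\<gamma> x))"
      using f'(2) by (simp add: ext_minus ext_sum ext_vscale \<gamma>_def)
    have "\<exists>x\<in>DT t. c x \<noteq> 0"
    proof (rule ccontr)
      assume "\<not> (\<exists>x\<in>DT t. c x \<noteq> 0)"
      then have "f = 0" unfolding fc by (intro sum.neutral) simp
      then show False using f(2) by simp
    qed
    then have "x \<in> DT t" using Max_keys_combination[OF finDT[of t], of \<gamma> c] \<gamma>m f(3) unfolding fc DT_def by auto
    then show "\<exists>y\<in>lms \<delta> N. kdeg \<delta> y \<le> e \<and> (\<exists>c\<in>nexp {..<n}. x = act y c)"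
      using hmem(2) by (fastforce simp: DT_def D_def L_def)
  qed
qed

section \<open>Dickson's lemma and uniformity of the degree bound\<close>

lemma simultaneously_monotone_subsequence:
  fixes f :: "nat \<Rightarrow> nat \<Rightarrow> nat"
  shows "\<exists>r :: nat \<Rightarrow> nat. strict_mono r \<and> (\<forall>v<k. \<forall>i j. i \<le> j \<longrightarrow> f (r i) v \<le> f (r j) v)"
proof (induction k)
  case 0
  then show ?case by (intro exI[of _ id]) (simp add: strict_mono_def)
next
  case (Suc k)
  then obtain r :: "nat \<Rightarrow> nat" where r: "strict_mono r" "\<forall>v<k. \<forall>i j. i \<le> j \<longrightarrow> f (r i) v \<le> f (r j) v" by blast
  obtain s where s: "strict_mono s" "monoseq (\<lambda>i. f (r (s i)) k)"
    using seq_monosub[of "\<lambda>i. f (r i) k"] by auto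
  have "\<exists>N. \<forall>i j. N \<le> i \<longrightarrow> i \<le> j \<longrightarrow> f (r (s i)) k \<le> f (r (s j)) k"
  proof (cases "\<forall>m n. m \<le> n \<longrightarrow> f (r (s m)) k \<le> f (r (s n)) k")
    case False
    then have dec: "f (r (s n)) k \<le> f (r (s m)) k" if "m \<le> n" for m n using s(2) that unfolding monoseq_def by blast
    \<comment> \<open>A decreasing sequence of natural numbers is constant from the index on where
      it attains its minimum, hence increasing there.\<close>
    obtain N where N: "\<And>i. f (r (s N)) k \<le> f (r (s i)) k"
      using ex_has_least_nat[of "\<lambda>_. True" 0 "\<lambda>i. f (r (s i)) k"] by auto
    have "f (r (s i)) k \<le> f (r (s j)) k" if "N \<le> i" "i \<le> j" for i j
      using dec[OF that(1)] N[of j] by (rule order_trans)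
    then show ?thesis by blast
  qed blast
  then obtain N where N: "\<And>i j. N \<le> i \<Longrightarrow> i \<le> j \<Longrightarrow> f (r (s i)) k \<le> f (r (s j)) k" by blast
  show ?case
  proof (intro exI[of _ "\<lambda>i. r (s (i + N))"] conjI allI impI)
    show "strict_mono (\<lambda>i. r (s (i + N)))" using r(1) s(1) by (simp add: strict_mono_def)
  next
    fix v i j :: nat assume v: "v < Suc k" and ij: "i \<le> j"
    have "s (i + N) \<le> s (j + N)" using s(1) ij by (simp add: strict_mono_less_eq)
    then show "f (r (s (i + N))) v \<le> f (r (s (j + N))) v"
      using v r(2) N[of "i + N" "j + N"] ij by (cases "v = k") auto
  qed
qed

text \<open>Dickson's lemma. A counterexample gives for each \<open>e\<close> a monomial that is no
  multiple of an element of \<open>L\<close> of degree at most \<open>e\<close>; a subsequence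
  increasing in all exponents contradicts this.\<close>

lemma monomials_finitely_generated:
  assumes L: "L \<subseteq> kset n m {}"
  shows "\<exists>e. \<forall>x\<in>L. \<exists>y\<in>L. kdeg \<delta> y \<le> e \<and> (\<exists>c\<in>nexp {..<n}. x = act y c)"
proof (rule ccontr)
  assume "\<not> ?thesis"
  then have "\<forall>e. \<exists>x\<in>L. \<forall>y\<in>L. kdeg \<delta> y \<le> int e \<longrightarrow> \<not> (\<exists>c\<in>nexp {..<n}. x = act y c)" by blast
  then obtain x where x: "\<And>e. x e \<in> L"
    "\<And>e y. y \<in> L \<Longrightarrow> kdeg \<delta> y \<le> int e \<Longrightarrow> \<not> (\<exists>c\<in>nexp {..<n}. x e = act y c)" by metis
  have xk: "fst (x e) < m" "snd (x e) \<in> nexp {..<n}" for e using x(1)[of e] L by (auto simp: kset_iff_nexp)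
  \<comment> \<open>The two extra coordinates, the basis index and its complement to
    \<open>m\<close>, can both increase only if the basis index is constant.\<close>
  define f where "f e v = (if v < n then nat (lk (snd (x e)) v) else if v = n then fst (x e) else m - fst (x e))" for e v
  obtain r :: "nat \<Rightarrow> nat" where r: "strict_mono r" "\<forall>v<n + 2. \<forall>i j. i \<le> j \<longrightarrow> f (r i) v \<le> f (r j) v"
    using simultaneously_monotone_subsequence[of "n + 2" f] by blast
  let ?y = "x (r 0)"
  \<comment> \<open>Far enough along the subsequence, the degree of the first element is within the
    range that the later monomial was chosen to avoid.\<close>
  obtain e where e: "kdeg \<delta> ?y \<le> int (r e)"
  proof
    have "nat (kdeg \<delta> ?y) \<le> r (nat (kdeg \<delta> ?y))" using r(1) by (rule strict_mono_imp_increasing)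
    then show "kdeg \<delta> ?y \<le> int (r (nat (kdeg \<delta> ?y)))" by linarith
  qed
  let ?z = "x (r e)"
  have le: "f (r 0) v \<le> f (r e) v" if "v < n + 2" for v using r(2) that by blast
  have 1: "fst ?y = fst ?z" using le[of n] le[of "n + 1"] xk(1)[of "r 0"] xk(1)[of "r e"] by (simp add: f_def)
  define c where "c = snd ?z - snd ?y"
  have "lk c v \<ge> 0" for v
  proof (cases "v < n")
    case True
    then have "nat (lk (snd ?y) v) \<le> nat (lk (snd ?z) v)" using le[of v] by (simp add: f_def)
    then show ?thesis using nexpD(1)[OF xk(2)[of "r 0"], of v] nexpD(1)[OF xk(2)[of "r e"], of v]
      by (simp add: c_def lookup_minus)
  next
    case False
    then have "v \<notin> ks (snd ?y)" "v \<notin> ks (snd ?z)" using nexpD(2)[OF xk(2)] by blast+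
    then show ?thesis by (simp add: c_def lookup_minus in_keys_iff)
  qed
  moreover have "ks c \<subseteq> {..<n}"
    using keys_minus_subset[of "snd ?z" "snd ?y"] nexpD(2)[OF xk(2)[of "r 0"]] nexpD(2)[OF xk(2)[of "r e"]] by (auto simp: c_def)
  ultimately have "c \<in> nexp {..<n}" by (auto simp: nexp_def neg_def not_less)
  moreover have "?z = act ?y c" using 1 by (simp add: act_def c_def prod_eq_iff)
  ultimately show False using x(2)[OF x(1) e] by blast
qed

lemma lmclosed_mono: "lmclosed n \<delta> N e T \<Longrightarrow> e \<le> e' \<Longrightarrow> T' \<le> T \<Longrightarrow> lmclosed n \<delta> N e' T'"
  unfolding lmclosed_def by (meson order_trans)

text \<open>Compactness: if no \<open>e\<close> worked for the whole family, one could successively fix the leading monomials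
  in degrees \<open>\<le> T\<close> while keeping the subfamily bad. The limit set of monomials is finitely generated,
  and Buchberger's criterion, which only looks at finitely many degrees, applies to a late subfamily.\<close>

lemma uniform_groebner_bound:
  fixes \<N> :: "'k::field vec set set"
  assumes \<N>: "\<And>N. N \<in> \<N> \<Longrightarrow> gsub n m \<delta> N \<and> gendeg n \<delta> N d"
  shows "\<exists>e. e \<ge> d \<and> e \<ge> 0 \<and> (\<forall>N\<in>\<N>. \<forall>T. lmclosed n \<delta> N e T)"
proof -
  define bad where "bad S \<longleftrightarrow> (\<forall>e. \<exists>N\<in>S. \<not> (\<forall>T. lmclosed n \<delta> N e T))" for S :: "'k vec set set"
  have "\<not> bad \<N>"
  proof
    assume bad0: "bad \<N>"
    define tr where "tr T N = {x \<in> lms \<delta> N. kdeg \<delta> x \<le> int T}" for T and N :: "'k vec set"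
    have tr_mons: "tr T N \<subseteq> mons n m \<delta> (int T)" if "N \<in> \<N>" for N T
      using lms_kset[OF gsubD(2)[OF conjunct1[OF \<N>[OF that]]]] by (auto simp: tr_def mons_def)
    \<comment> \<open>There are finitely many possible truncations; if each fibre had a bound, the
      maximum \<open>E\<close> of these bounds would serve the whole family.\<close>
    have pigeon: "\<exists>K. bad {N\<in>S. tr T N = K}" if "bad S" "S \<subseteq> \<N>" for S T
    proof (rule ccontr)
      assume "\<not> ?thesis"
      then have "\<forall>K. \<exists>e. \<forall>N\<in>S. tr T N = K \<longrightarrow> (\<forall>T. lmclosed n \<delta> N e T)" unfolding bad_def by blast
      then obtain ee where ee: "\<And>N. N \<in> S \<Longrightarrow> (\<forall>T'. lmclosed n \<delta> N (ee (tr T N)) T')" by metis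
      define E where "E = Max (ee ` Pow (mons n m \<delta> (int T)))"
      have "lmclosed n \<delta> N E T'" if "N \<in> S" for N T'
      proof -
        have "ee (tr T N) \<le> E" unfolding E_def
          using that \<open>S \<subseteq> \<N>\<close> tr_mons by (intro Max_ge finite_imageI) (auto simp: finite_mons)
        then show ?thesis using ee[OF that] lmclosed_mono by blast
      qed
      then show False using \<open>bad S\<close> unfolding bad_def by blast
    qed
    define nxt where "nxt T S = {N\<in>S. tr T N = (SOME K. bad {N\<in>S. tr T N = K})}" for T S
    define SS where "SS = rec_nat \<N> nxt"
    have SS: "SS 0 = \<N>" "SS (Suc T) = nxt T (SS T)" for T by (simp_all add: SS_def)
    have SSb: "bad (SS T) \<and> SS T \<subseteq> \<N>" for T
    proof (induction T)
      case (Suc T)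
      have "bad (nxt T (SS T))" unfolding nxt_def using someI_ex[OF pigeon, of "SS T" T] Suc by blast
      then show ?case using Suc by (auto simp: SS nxt_def)
    qed (simp add: SS bad0)
    have SSdec: "i \<le> j \<Longrightarrow> SS j \<subseteq> SS i" for i j
      by (rule lift_Suc_antimono_le) (auto simp: SS nxt_def)
    have "\<exists>N. N \<in> SS T" for T using SSb[of T] unfolding bad_def by blast
    then obtain W where W: "\<And>T. W T \<in> SS T" by metis
    \<comment> \<open>All members of \<open>SS (Suc T)\<close> agree up to degree \<open>T\<close>,
      so any one of them may represent the common truncation.\<close>
    define LL where "LL T = tr T (W (Suc T))" for T
    have same: "tr T N = LL T" if "N \<in> SS (Suc T)" for N T
      using that W[of "Suc T"] by (simp add: SS nxt_def LL_def)
    define L where "L = (\<Union>T. LL T)"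
    have LT: "LL T = {x\<in>L. kdeg \<delta> x \<le> int T}" for T
    proof -
      have "x \<in> LL T" if x: "x \<in> LL T'" "kdeg \<delta> x \<le> int T" for x T'
      proof -
        define M where "M = max T T'"
        have WM: "W (Suc M) \<in> SS (Suc T)" "W (Suc M) \<in> SS (Suc T')"
          using W[of "Suc M"] SSdec[of "Suc T" "Suc M"] SSdec[of "Suc T'" "Suc M"] by (auto simp: M_def)
        then have "x \<in> lms \<delta> (W (Suc M))" using same[of _ T'] x(1) by (auto simp: tr_def)
        then show ?thesis using same[OF WM(1)] x(2) by (auto simp: tr_def)
      qed
      moreover have "kdeg \<delta> x \<le> int T" if "x \<in> LL T" for x using that by (auto simp: LL_def tr_def)
      ultimately show ?thesis by (auto simp: L_def)
    qed
    have "L \<subseteq> kset n m {}"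
      using tr_mons SSb W by (fastforce simp: L_def LL_def mons_def)
    then obtain e0 where e0: "\<forall>x\<in>L. \<exists>y\<in>L. kdeg \<delta> y \<le> e0 \<and> (\<exists>c\<in>nexp {..<n}. x = act y c)"
      using monomials_finitely_generated by blast
    \<comment> \<open>\<open>e\<close> covers the generators of the limit set \<open>L\<close> as
      well as those of the modules. At stage \<open>Suc (nat (2 * e))\<close> the leading monomials
      up to degree \<open>2 * e\<close> are those of \<open>L\<close>, so the criterion gives a
      bound for a subfamily that was kept bad.\<close>
    define e where "e = max (max e0 d) 0"
    have eT: "int (nat (2 * e)) = 2 * e" by (simp add: e_def)
    have "\<forall>T. lmclosed n \<delta> N e T" if N: "N \<in> SS (Suc (nat (2 * e)))" for N
    proof -
      have tN: "tr (nat (2 * e)) N = {x\<in>L. kdeg \<delta> x \<le> 2 * e}" using same[OF N] LT[of "nat (2 * e)"] eT by simp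
      have "lmclosed n \<delta> N e (2 * e)" unfolding lmclosed_def
      proof (intro ballI impI)
        fix x assume "x \<in> lms \<delta> N" "kdeg \<delta> x \<le> 2 * e"
        then have "x \<in> L" using tN eT by (auto simp: tr_def)
        then obtain y c where y: "y \<in> L" "kdeg \<delta> y \<le> e0" "c \<in> nexp {..<n}" "x = act y c" using e0 by blast
        then have ye: "kdeg \<delta> y \<le> e" by (simp add: e_def)
        then have "y \<in> tr (nat (2 * e)) N" unfolding tN using y(1) by (simp add: e_def)
        then show "\<exists>y\<in>lms \<delta> N. kdeg \<delta> y \<le> e \<and> (\<exists>c\<in>nexp {..<n}. x = act y c)" using y ye by (auto simp: tr_def)
      qed
      moreover have "gsub n m \<delta> N" "gendeg n \<delta> N d" using \<N> SSb N by blast+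
      moreover have "d \<le> e" by (simp add: e_def)
      ultimately have "lmclosed n \<delta> N e (2 * e)" "gsub n m \<delta> N" "gendeg n \<delta> N e" using gendeg_mono by blast+
      then show ?thesis using buchberger(2)[of n m \<delta> N e] by (simp add: e_def)
    qed
    then show False using SSb[of "Suc (nat (2 * e))"] unfolding bad_def by blast
  qed
  then obtain e where e: "\<forall>N\<in>\<N>. \<forall>T. lmclosed n \<delta> N e T" unfolding bad_def by blast
  have "lmclosed n \<delta> N (max (max e d) 0) T" if "N \<in> \<N>" for N T
  proof (rule lmclosed_mono)
    show "lmclosed n \<delta> N e T" using e that by blast
  qed simp_all
  then show ?thesis by (intro exI[of _ "max (max e d) 0"]) auto
qed

text \<open>Rank and degrees of the next free module depend on \<open>e\<close> alone and not on
  \<open>N\<close>; this is what allows the reduction to be iterated for a whole family at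
  once.\<close>

lemma uniform_resolution:
  shows "\<exists>e\<ge>0. \<forall>N :: 'k::field vec set. gsub n m \<delta> N \<longrightarrow> gendeg n \<delta> N d \<longrightarrow>
    (\<exists>g. gens n \<delta> N (nrk n m \<delta> e) (ndeg n m \<delta> e) g \<and>
      gendeg n (ndeg n m \<delta> e) (syz n (nrk n m \<delta> e) g) (2 * e))"
proof -
  obtain e where e: "e \<ge> d" "e \<ge> 0" "\<forall>N\<in>{N :: 'k vec set. gsub n m \<delta> N \<and> gendeg n \<delta> N d}. \<forall>T. lmclosed n \<delta> N e T"
    using uniform_groebner_bound[of "{N :: 'k vec set. gsub n m \<delta> N \<and> gendeg n \<delta> N d}" n m \<delta> d] by auto
  show ?thesis
  proof (intro exI[of _ e] conjI allI impI)
    fix N :: "'k vec set" assume N: "gsub n m \<delta> N" "gendeg n \<delta> N d"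
    then have "lmclosed n \<delta> N e (2 * e)" using e(3) by blast
    then show "\<exists>g. gens n \<delta> N (nrk n m \<delta> e) (ndeg n m \<delta> e) g \<and>
      gendeg n (ndeg n m \<delta> e) (syz n (nrk n m \<delta> e) g) (2 * e)"
      using buchberger(1)[OF N(1) gendeg_mono[OF N(2) e(1)] _ e(2)] by blast
  qed (rule e(2))
qed

text \<open>Each such set is recovered from its part in degrees at most \<open>e\<close>, a subset
  of one finite set.\<close>

lemma finitely_many_leading_monomial_sets:
  "finite (lms \<delta> ` {N :: 'k::field vec set. gsub n m \<delta> N \<and> gendeg n \<delta> N d})"
proof -
  let ?\<N> = "{N :: 'k vec set. gsub n m \<delta> N \<and> gendeg n \<delta> N d}"
  obtain e where e: "\<forall>N\<in>?\<N>. \<forall>T. lmclosed n \<delta> N e T" using uniform_groebner_bound[of ?\<N> n m \<delta> d] by auto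
  define up where "up K = {act y c | y c. y \<in> K \<and> c \<in> nexp {..<n}}" for K
  have "lms \<delta> N = up {x \<in> lms \<delta> N. kdeg \<delta> x \<le> e}" if N: "N \<in> ?\<N>" for N
  proof
    show "lms \<delta> N \<subseteq> up {x \<in> lms \<delta> N. kdeg \<delta> x \<le> e}"
    proof
      fix x assume x: "x \<in> lms \<delta> N"
      have "lmclosed n \<delta> N e (kdeg \<delta> x)" using e N by blast
      then show "x \<in> up {x \<in> lms \<delta> N. kdeg \<delta> x \<le> e}" using x unfolding lmclosed_def up_def by blast
    qed
    show "up {x \<in> lms \<delta> N. kdeg \<delta> x \<le> e} \<subseteq> lms \<delta> N"
      using lms_act N by (auto simp: up_def)
  qed
  moreover have "{x \<in> lms \<delta> N. kdeg \<delta> x \<le> e} \<subseteq> mons n m \<delta> e" if "N \<in> ?\<N>" for N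
    using that lms_kset[OF gsubD(2)] by (auto simp: mons_def)
  ultimately have "lms \<delta> ` ?\<N> \<subseteq> up ` Pow (mons n m \<delta> e)" by blast
  then show ?thesis by (rule finite_subset) (simp add: finite_mons)
qed

text \<open>A reduced echelon basis in every degree. The vanishing at the other leading monomials
  makes it a dual basis, under the residue pairing, to the duals of the leading monomials.\<close>

lemma reduced_basis:
  fixes N :: "'k::field vec set"
  assumes N: "gsub n m \<delta> N"
  obtains \<gamma> where "\<And>x. x \<in> lms \<delta> N \<Longrightarrow> \<gamma> x \<in> N \<inter> hom \<delta> (kdeg \<delta> x)"
    "\<And>x y. x \<in> lms \<delta> N \<Longrightarrow> y \<in> lms \<delta> N \<Longrightarrow> kdeg \<delta> x = kdeg \<delta> y \<Longrightarrow> lk (\<gamma> x) y = (if y = x then 1 else 0)"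
    "\<And>f t. f \<in> N \<inter> hom \<delta> t \<Longrightarrow> \<exists>c. f = (\<Sum>x\<in>{x\<in>lms \<delta> N. kdeg \<delta> x = t}. vscale (c x) (\<gamma> x))"
proof -
  define L where "L = lms \<delta> N"
  define LT where "LT t = {x\<in>L. kdeg \<delta> x = t}" for t
  have fin: "finite (LT t)" for t
    using lms_kset[OF gsubD(2)[OF N]] by (intro finite_subset[OF _ finite_mons[of n m \<delta> t]]) (auto simp: LT_def L_def mons_def)
  have SN: "vec.subspace (N \<inter> hom \<delta> t)" for t using gsubD(1)[OF N] subspace_hom by (rule vec.subspace_inter)
  have "\<forall>x\<in>L. \<exists>f. f \<in> N \<inter> hom \<delta> (kdeg \<delta> x) \<and> monic x f" using monic_representative[OF gsubD(1)[OF N], of _ \<delta>] unfolding L_def by blast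
  then obtain \<beta> where \<beta>: "\<And>x. x \<in> L \<Longrightarrow> \<beta> x \<in> N \<inter> hom \<delta> (kdeg \<delta> x)" "\<And>x. x \<in> L \<Longrightarrow> monic x (\<beta> x)" by metis
  have sumN: "(\<Sum>x\<in>LT t. vscale (c x) (\<beta> x)) \<in> N \<inter> hom \<delta> t" for c t
    using \<beta>(1) by (intro vec.subspace_sum[OF SN] vec.subspace_scale[OF SN]) (auto simp: LT_def)
  have red: "\<exists>c. ks (f - (\<Sum>x\<in>LT t. vscale (c x) (\<beta> x))) \<inter> LT t = {}" for f t
    using reduction_modulo_monic[OF fin[of t], of \<beta> f] \<beta>(2) by (auto simp: LT_def)
  have zero: "f = 0" if f: "f \<in> N \<inter> hom \<delta> t" "ks f \<inter> LT t = {}" for f t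
  proof (rule ccontr)
    assume "f \<noteq> 0"
    then have "Max (ks f) \<in> ks f" "Max (ks f) \<in> L" using f(1) keys_empty_iff[of f] by (auto simp: L_def lms_def)
    then show False using f by (auto simp: LT_def hom_def)
  qed
  have "\<exists>g. g \<in> N \<inter> hom \<delta> (kdeg \<delta> x) \<and> (\<forall>y\<in>LT (kdeg \<delta> x). lk g y = (if y = x then 1 else 0))" for x
  proof -
    \<comment> \<open>Reducing the monomial \<open>x\<close> itself: what is subtracted agrees with
      \<open>x\<close> at all leading monomials of its degree.\<close>
    obtain c where c: "ks (Poly_Mapping.single x 1 - (\<Sum>x\<in>LT (kdeg \<delta> x). vscale (c x) (\<beta> x))) \<inter> LT (kdeg \<delta> x) = {}"
      using red by blast
    let ?g = "\<Sum>x\<in>LT (kdeg \<delta> x). vscale (c x) (\<beta> x)"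
    have "lk ?g y = (if y = x then 1 else 0)" if y: "y \<in> LT (kdeg \<delta> x)" for y
    proof -
      have "y \<notin> ks (Poly_Mapping.single x 1 - ?g)" using c y by blast
      then have "lk (Poly_Mapping.single x 1) y = lk ?g y" by (simp add: in_keys_iff lookup_minus)
      then show ?thesis by (auto simp: lookup_single when_def)
    qed
    then show ?thesis using sumN[of c "kdeg \<delta> x"] by blast
  qed
  then obtain \<gamma> where \<gamma>: "\<And>x. \<gamma> x \<in> N \<inter> hom \<delta> (kdeg \<delta> x)"
    "\<And>x y. y \<in> LT (kdeg \<delta> x) \<Longrightarrow> lk (\<gamma> x) y = (if y = x then 1 else 0)" by metis
  show ?thesis
  proof (rule that[of \<gamma>])
    fix x y assume "x \<in> lms \<delta> N" "y \<in> lms \<delta> N" "kdeg \<delta> x = kdeg \<delta> y"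
    then show "lk (\<gamma> x) y = (if y = x then 1 else 0)" by (intro \<gamma>(2)) (simp add: LT_def L_def)
  next
    fix f t assume f: "f \<in> N \<inter> hom \<delta> t"
    let ?s = "\<Sum>x\<in>LT t. vscale (lk f x) (\<gamma> x)"
    have "?s \<in> N \<inter> hom \<delta> t"
      using \<gamma>(1) by (intro vec.subspace_sum[OF SN] vec.subspace_scale[OF SN]) (force simp: LT_def)
    then have "f - ?s \<in> N \<inter> hom \<delta> t" using f by (intro vec.subspace_diff[OF SN])
    moreover have "lk ?s y = lk f y" if y: "y \<in> LT t" for y
    proof -
      have "lk ?s y = (\<Sum>x\<in>LT t. if x = y then lk f y else 0)"
        unfolding lookup_sum using y by (intro sum.cong) (auto simp: \<gamma>(2) LT_def)
      then show ?thesis using fin y by simp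
    qed
    then have "ks (f - ?s) \<inter> LT t = {}" by (auto simp: in_keys_iff lookup_minus)
    ultimately have "f - ?s = 0" by (rule zero)
    then show "\<exists>c. f = (\<Sum>x\<in>{x\<in>lms \<delta> N. kdeg \<delta> x = t}. vscale (c x) (\<gamma> x))" by (auto simp: LT_def L_def)
  qed (use \<gamma> in blast)
qed

section \<open>Duality at the top of the Cech complex\<close>

definition allones :: "nat \<Rightarrow> expo" where "allones n = (\<Sum>v<n. Poly_Mapping.single v 1)"

lemma lookup_allones: "lk (allones n) v = (if v < n then 1 else 0)"
  by (simp add: allones_def lookup_sum lookup_single when_def)

lemma keys_allones: "ks (allones n) = {..<n}"
  by (auto simp: in_keys_iff lookup_allones split: if_splits)

lemma tdeg_allones: "tdeg (allones n) = int n"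
  by (simp add: tdeg_def keys_allones lookup_allones)

text \<open>The map a -> -a - (1,...,1) exchanges the exponents that are all nonnegative with those
  that are all negative, that is, the monomial bases of a free module and of its top
  cohomology.\<close>

definition dual :: "nat \<Rightarrow> nat \<times> expo \<Rightarrow> nat \<times> expo"
  where "dual n x = (fst x, - snd x - allones n)"

lemma dual_dual [simp]: "dual n (dual n x) = x"
  by (simp add: dual_def)

lemma inj_dual: "inj_on (dual n) X"
  by (rule inj_on_inverseI[of _ "dual n"]) simp

lemma dual_top:
  assumes "x \<in> kset n m {}"
  shows "dual n x \<in> kset n m {..<n}" "neg (snd (dual n x)) = {..<n}"
proof -
  have a: "fst x < m" "snd x \<in> nexp {..<n}" using assms by (auto simp: kset_iff_nexp)
  have "lk (snd (dual n x)) v < 0 \<longleftrightarrow> v < n" for v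
    using nexpD(1)[OF a(2), of v] nexpD(2)[OF a(2)]
    by (auto simp: dual_def lookup_minus lookup_allones in_keys_iff)
  then show *: "neg (snd (dual n x)) = {..<n}" by (auto simp: neg_def)
  have "ks (snd (dual n x)) \<subseteq> {..<n}"
    using keys_minus_subset[of "- snd x" "allones n"] nexpD(2)[OF a(2)] by (auto simp: dual_def keys_allones)
  then show "dual n x \<in> kset n m {..<n}" using a(1) * by (auto simp: kset_def dual_def)
qed

lemma top_dual:
  assumes "x \<in> kset n m {..<n}" "neg (snd x) = {..<n}"
  shows "dual n x \<in> kset n m {}"
proof -
  have "lk (snd (dual n x)) v \<ge> 0" for v
  proof (cases "v < n")
    case True
    then have "lk (snd x) v < 0" using assms(2) by (auto simp: neg_def)
    then show ?thesis using True by (simp add: dual_def lookup_minus lookup_allones)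
  next
    case False
    then have "v \<notin> ks (snd x)" using assms(1) by (auto simp: kset_def)
    then show ?thesis using False by (simp add: dual_def lookup_minus lookup_allones in_keys_iff)
  qed
  moreover have "ks (snd (dual n x)) \<subseteq> {..<n}"
    using keys_minus_subset[of "- snd x" "allones n"] assms(1) by (auto simp: dual_def keys_allones kset_def)
  ultimately show ?thesis using assms(1) by (auto simp: kset_def dual_def neg_def not_less)
qed

text \<open>The residue pairing: the coefficient of x^(-1,...,-1) in the sum of the products of
  corresponding entries of \<open>p\<close> and \<open>f\<close>.\<close>

definition pair :: "nat \<Rightarrow> 'k::field vec \<Rightarrow> 'k vec \<Rightarrow> 'k"
  where "pair n p f = (\<Sum>x\<in>ks p. lk p x * lk f (dual n x))"

lemma pair_superset: "finite X \<Longrightarrow> ks p \<subseteq> X \<Longrightarrow> pair n p f = (\<Sum>x\<in>X. lk p x * lk f (dual n x))"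
  unfolding pair_def by (rule sum.mono_neutral_left) (auto simp: in_keys_iff)

lemma pair_add_right: "pair n p (f + g) = pair n p f + pair n p g"
  by (simp add: pair_def lookup_add algebra_simps sum.distrib)
lemma pair_minus_right: "pair n p (f - g) = pair n p f - pair n p g"
  by (simp add: pair_def lookup_minus algebra_simps sum_subtractf)
lemma pair_vscale_right: "pair n p (vscale c f) = c * pair n p f"
  by (simp add: pair_def sum_distrib_left mult.left_commute)
lemma pair_sum_right: "pair n p (sum h I) = (\<Sum>i\<in>I. pair n p (h i))"
  by (induction I rule: infinite_finite_induct) (simp_all add: pair_add_right, simp_all add: pair_def)
lemma pair_single_right: "pair n p (Poly_Mapping.single (dual n x) c) = c * lk p x"
proof -
  have "pair n p (Poly_Mapping.single (dual n x) c)
      = (\<Sum>y\<in>insert x (ks p). lk p y * lk (Poly_Mapping.single (dual n x) c) (dual n y))"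
    by (rule pair_superset) auto
  also have "\<dots> = (\<Sum>y\<in>insert x (ks p). if y = x then c * lk p x else 0)"
  proof (rule sum.cong[OF refl])
    fix y have "dual n y = dual n x \<longleftrightarrow> y = x" by (metis dual_dual)
    then show "lk p y * lk (Poly_Mapping.single (dual n x) c) (dual n y) = (if y = x then c * lk p x else 0)"
      by (auto simp: lookup_single when_def)
  qed
  finally show ?thesis by simp
qed
lemma pair_add_left: "pair n (p + q) f = pair n p f + pair n q f"
  using keys_add[of p q]
  by (simp add: pair_superset[of "ks p \<union> ks q"] lookup_add algebra_simps sum.distrib)
lemma pair_zero_left [simp]: "pair n 0 f = 0" by (simp add: pair_def)
lemma pair_vscale_left: "pair n (vscale c p) f = c * pair n p f"
  using keys_vscale[of c p] by (simp add: pair_superset[of "ks p"] sum_distrib_left mult.assoc)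
lemma pair_sum_left: "pair n (sum h I) f = (\<Sum>i\<in>I. pair n (h i) f)"
  by (induction I rule: infinite_finite_induct) (simp_all add: pair_add_left)

text \<open>The \<open>i\<close>-th row of the matrix whose columns are the \<open>g j\<close>, as a
  vector of rank \<open>m'\<close>.\<close>

definition transp :: "nat \<Rightarrow> (nat \<Rightarrow> 'k::field vec) \<Rightarrow> nat \<Rightarrow> 'k vec"
  where "transp m' g i = (\<Sum>j<m'. \<Sum>x\<in>{x\<in>ks (g j). fst x = i}. Poly_Mapping.single (j, snd x) (lk (g j) x))"

lemma lookup_transp: "lk (transp m' g i) y = (if fst y < m' then lk (g (fst y)) (i, snd y) else 0)"
proof -
  have "lk (\<Sum>x\<in>{x\<in>ks (g j). fst x = i}. Poly_Mapping.single (j, snd x) (lk (g j) x)) y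
      = (if j = fst y then lk (g (fst y)) (i, snd y) else 0)" for j
  proof -
    have "lk (\<Sum>x\<in>{x\<in>ks (g j). fst x = i}. Poly_Mapping.single (j, snd x) (lk (g j) x)) y
        = (\<Sum>x\<in>{x\<in>ks (g j). fst x = i}. if x = (i, snd y) then (if j = fst y then lk (g (fst y)) (i, snd y) else 0) else 0)"
      unfolding lookup_sum by (intro sum.cong) (auto simp: lookup_single when_def prod_eq_iff)
    then show ?thesis by (auto simp: in_keys_iff)
  qed
  then have "lk (transp m' g i) y = (\<Sum>j<m'. if j = fst y then lk (g (fst y)) (i, snd y) else 0)"
    by (simp add: transp_def lookup_sum)
  then show ?thesis by auto
qed

lemma lookup_ext: "lk (ext g f) y = (\<Sum>x\<in>ks f. lk f x * lk (g (fst x)) (fst y, snd y - snd x))"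
  by (simp add: ext_def lookup_lin)

text \<open>Adjointness read off coefficientwise: the coefficient of the \<open>i\<close>-th entry
  of a matrix product at a dual monomial is a residue of row \<open>i\<close>, multiplied by x^c,
  against \<open>f\<close>.\<close>

lemma transp_adjoint:
  assumes "\<forall>x\<in>ks f. fst x < m'"
  shows "lk (ext g f) (dual n (i, c)) = pair n (shift c (transp m' g i)) f"
proof -
  let ?p = "shift c (transp m' g i)"
  \<comment> \<open>A common index set for the two finite sums, which run over different
    supports.\<close>
  define Y where "Y = ks ?p \<union> dual n ` ks f"
  have Y: "finite Y" "ks ?p \<subseteq> Y" "ks f \<subseteq> dual n ` Y"
    by (auto simp: Y_def image_Un image_image)
  have "pair n ?p f = (\<Sum>y\<in>Y. lk ?p y * lk f (dual n y))" by (rule pair_superset[OF Y(1,2)])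
  also have "\<dots> = (\<Sum>y\<in>Y. lk f (dual n y) * lk (g (fst (dual n y))) (i, - c - allones n - snd (dual n y)))"
  proof (rule sum.cong[OF refl])
    fix y assume "y \<in> Y"
    have e: "- c - allones n - snd (dual n y) = snd y - c" by (simp add: dual_def)
    show "lk ?p y * lk f (dual n y) = lk f (dual n y) * lk (g (fst (dual n y))) (i, - c - allones n - snd (dual n y))"
    proof (cases "lk f (dual n y) = 0")
      case False
      then have "fst (dual n y) < m'" using assms by (auto simp: in_keys_iff)
      then show ?thesis unfolding e by (simp add: lookup_transp dual_def mult.commute)
    qed simp
  qed
  also have "\<dots> = (\<Sum>x\<in>dual n ` Y. lk f x * lk (g (fst x)) (i, - c - allones n - snd x))"
    using inj_dual by (simp add: sum.reindex)
  also have "\<dots> = (\<Sum>x\<in>ks f. lk f x * lk (g (fst x)) (i, - c - allones n - snd x))"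
    using Y by (intro sum.mono_neutral_right) (auto simp: in_keys_iff)
  finally show ?thesis by (simp add: lookup_ext dual_def)
qed

text \<open>Degrees of the dual basis, shifted by \<open>D\<close> to make them natural numbers; the subtraction truncates
  unless \<open>D\<close> bounds \<open>\<delta>\<close>.\<close>

definition ddeg :: "nat \<Rightarrow> (nat \<Rightarrow> nat) \<Rightarrow> nat \<Rightarrow> nat" where "ddeg D \<delta> i = D - \<delta> i"

definition imt :: "nat \<Rightarrow> nat \<Rightarrow> nat \<Rightarrow> (nat \<Rightarrow> 'k::field vec) \<Rightarrow> 'k vec set"
  where "imt n m m' g = ext (transp m' g) ` gfree n m {}"

context
  fixes n m :: nat and \<delta> :: "nat \<Rightarrow> nat" and m' \<delta>' and g :: "nat \<Rightarrow> 'k::field vec" and D :: nat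
  assumes gm: "\<forall>j<m'. g j \<in> gfree n m {} \<inter> hom \<delta> (int (\<delta>' j))"
    and D: "\<forall>i<m. \<delta> i \<le> D" "\<forall>j<m'. \<delta>' j \<le> D"
begin

lemma transp_mem:
  assumes i: "i < m" shows "transp m' g i \<in> gfree n m' {} \<inter> hom (ddeg D \<delta>') (int (ddeg D \<delta> i))"
proof -
  have "y \<in> kset n m' {} \<and> kdeg (ddeg D \<delta>') y = int (ddeg D \<delta> i)" if "y \<in> ks (transp m' g i)" for y
  proof -
    have j: "fst y < m'" "(i, snd y) \<in> ks (g (fst y))" using that by (auto simp: in_keys_iff lookup_transp split: if_splits)
    then have "(i, snd y) \<in> kset n m {}" "kdeg \<delta> (i, snd y) = int (\<delta>' (fst y))"
      using gm by (auto simp: gfree_def hom_def)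
    then show ?thesis using j(1) D i by (auto simp: kset_def kdeg_def ddeg_def of_nat_diff)
  qed
  then show ?thesis by (auto simp: gfree_def hom_def)
qed

lemma transp_hom: "\<forall>i<m. transp m' g i \<in> hom (ddeg D \<delta>') (int (ddeg D \<delta> i))"
  and transp_free: "\<forall>i<m. transp m' g i \<in> gfree n m' {}"
  using transp_mem by auto

lemma gsub_imt: "gsub n m' (ddeg D \<delta>') (imt n m m' g)"
  unfolding gsub_def
proof (intro conjI allI ballI)
  show "imt n m m' g \<subseteq> gfree n m' {}"
    using ext_in_sub[OF gsub_gfree transp_free] by (auto simp: imt_def)
  show "vec.subspace (imt n m m' g)" unfolding imt_def
  proof (rule vec.subspaceI)
    show "0 \<in> ext (transp m' g) ` gfree n m {}" using vec.subspace_0[OF subspace_gfree] ext_zero by (metis imageI)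
  qed (auto simp: ext_add[symmetric] ext_vscale[symmetric] intro!: imageI vec.subspace_add[OF subspace_gfree] vec.subspace_scale[OF subspace_gfree])
next
  fix c f assume "c \<in> nexp {..<n}" "f \<in> imt n m m' g"
  then show "shift c f \<in> imt n m m' g" by (auto simp: imt_def ext_shift[symmetric] intro!: imageI gfree_shift)
next
  fix t f assume "f \<in> imt n m m' g"
  then obtain p where p: "p \<in> gfree n m {}" "f = ext (transp m' g) p" by (auto simp: imt_def)
  then show "gpart (ddeg D \<delta>') t f \<in> imt n m m' g"
    using ext_gpart[OF transp_hom p(1), of t] gsubD(4)[OF gsub_gfree p(1)] unfolding imt_def by (metis imageI)
qed

lemma transp_in_imt: "i < m \<Longrightarrow> transp m' g i \<in> imt n m m' g"
  unfolding imt_def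
proof (rule image_eqI)
  show "i < m \<Longrightarrow> Poly_Mapping.single (i, 0) 1 \<in> gfree n m {}" by (auto simp: gfree_def kset_iff_nexp)
qed (simp add: ext_single)

text \<open>The rows generate, in degrees \<open>D - \<delta> i\<close>. The bound depends on the
  degrees only and not on the matrix.\<close>

lemma gendeg_imt: "gendeg n (ddeg D \<delta>') (imt n m m' g) (int D)"
  unfolding gendeg_def
proof (intro allI impI subsetI, elim conjE)
  fix V f assume V: "vec.subspace V" "\<forall>c\<in>nexp {..<n}. \<forall>f\<in>V. shift c f \<in> V"
    "\<forall>t\<le>int D. imt n m m' g \<inter> hom (ddeg D \<delta>') t \<subseteq> V" and "f \<in> imt n m m' g"
  then obtain p where p: "p \<in> gfree n m {}" "f = ext (transp m' g) p" by (auto simp: imt_def)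
  show "f \<in> V" unfolding p(2) ext_def
  proof (rule lin_in_subspace[OF V(1)])
    fix x assume "x \<in> ks p"
    then have x: "fst x < m" "snd x \<in> nexp {..<n}" using p(1) kset_iff_nexp[of x] unfolding gfree_def by blast+
    have "int (ddeg D \<delta> (fst x)) \<le> int D" by (simp add: ddeg_def)
    then have "transp m' g (fst x) \<in> V" using V(3) transp_mem[OF x(1)] transp_in_imt[OF x(1)] by blast
    then show "shift (snd x) (transp m' g (fst x)) \<in> V" using V(2) x(2) by blast
  qed
qed

text \<open>The coefficients of \<open>ext g f\<close> at monomials with only negative exponents are
  exactly the pairings of \<open>f\<close> with the monomial multiples of the rows, and these span
  the image of the transpose.\<close>

lemma nontop_iff_pair:
  assumes f: "f \<in> gfree n m' {..<n}"
  shows "ext g f \<in> nontop n \<longleftrightarrow> (\<forall>p\<in>imt n m m' g. pair n p f = 0)"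
proof
  have fm: "\<forall>x\<in>ks f. fst x < m'" using f by (auto simp: gfree_def kset_def)
  assume nt: "ext g f \<in> nontop n"
  show "\<forall>p\<in>imt n m m' g. pair n p f = 0"
  proof
    fix p assume "p \<in> imt n m m' g"
    then obtain q where q: "q \<in> gfree n m {}" "p = ext (transp m' g) q" by (auto simp: imt_def)
    have "pair n (shift (snd x) (transp m' g (fst x))) f = 0" if "x \<in> ks q" for x
    proof -
      have "x \<in> kset n m {}" using that q by (auto simp: gfree_def)
      then have "dual n x \<notin> ks (ext g f)" using nt dual_top(2) unfolding nontop_def by blast
      then show ?thesis using transp_adjoint[OF fm, of g n "fst x" "snd x"] by (simp add: in_keys_iff)
    qed
    then show "pair n p f = 0" unfolding q(2) ext_def lin_def pair_sum_left pair_vscale_left by simp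
  qed
next
  have fm: "\<forall>x\<in>ks f. fst x < m'" using f by (auto simp: gfree_def kset_def)
  assume a: "\<forall>p\<in>imt n m m' g. pair n p f = 0"
  have ef: "ext g f \<in> gfree n m {..<n}"
  proof -
    have "f \<in> loc {..<n} (gfree n m' {})" using f by (simp add: loc_gfree)
    then obtain c where c: "c \<in> nexp {..<n}" "shift c f \<in> gfree n m' {}" by (auto simp: loc_def)
    have "\<forall>j<m'. g j \<in> gfree n m {}" using gm by blast
    then have "shift c (ext g f) \<in> gfree n m {}" using ext_in_sub[OF gsub_gfree _ c(2)] by (simp add: ext_shift)
    then have "ext g f \<in> loc {..<n} (gfree n m {})" using c(1) by (auto simp: loc_def)
    then show ?thesis by (simp add: loc_gfree)
  qed
  show "ext g f \<in> nontop n" unfolding nontop_def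
  proof (intro CollectI ballI notI)
    fix x assume x: "x \<in> ks (ext g f)" "neg (snd x) = {..<n}"
    then have "x \<in> kset n m {..<n}" using ef by (auto simp: gfree_def)
    then have d: "dual n x \<in> kset n m {}" using x(2) by (rule top_dual)
    then have i: "fst (dual n x) < m" "snd (dual n x) \<in> nexp {..<n}" by (auto simp: kset_iff_nexp)
    have "shift (snd (dual n x)) (transp m' g (fst (dual n x))) \<in> imt n m m' g"
      using gsubD(3)[OF gsub_imt i(2) transp_in_imt[OF i(1)]] .
    then have "lk (ext g f) (dual n (dual n x)) = 0"
      using a transp_adjoint[OF fm, of g n "fst (dual n x)" "snd (dual n x)"] by simp
    then show False using x(1) by (simp add: in_keys_iff)
  qed
qed

text \<open>The summand \<open>int n\<close> is the degree of x^(1,...,1), and \<open>D\<close> is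
  the shift built into \<open>ddeg\<close>.\<close>

lemma kdeg_dual: "fst x < m' \<Longrightarrow> kdeg \<delta>' (dual n x) = int D - int n - kdeg (ddeg D \<delta>') x"
  using D by (simp add: kdeg_def dual_def ddeg_def tdeg_diff tdeg_allones of_nat_diff)

text \<open>The preimage is the annihilator of the image of the transpose in the dual degree, so its
  codimension is the dimension of that image there, counted by leading monomials. The duals of these
  monomials represent a basis of the quotient.\<close>

lemma codim_nontop_preimage:
  "has_qdim vscale (gfree n m' {..<n} \<inter> hom \<delta>' t) {f \<in> gfree n m' {..<n} \<inter> hom \<delta>' t. ext g f \<in> nontop n}
     (card {x \<in> lms (ddeg D \<delta>') (imt n m m' g). kdeg (ddeg D \<delta>') x = int D - int n - t})"
    (is "has_qdim vscale ?V ?Z (card ?L)")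
proof -
  let ?s = "int D - int n - t"
  let ?G = "imt n m m' g"
  have Lk: "x \<in> ?L \<Longrightarrow> x \<in> kset n m' {} \<and> kdeg (ddeg D \<delta>') x = ?s" for x
    using lms_kset[OF gsubD(2)[OF gsub_imt]] by blast
  have fin: "finite ?L"
  proof (rule finite_subset[OF subsetI finite_mons[of n m' "ddeg D \<delta>'" ?s]])
    show "x \<in> mons n m' (ddeg D \<delta>') ?s" if "x \<in> ?L" for x using Lk[OF that] by (simp add: mons_def)
  qed
  obtain \<gamma> where \<gamma>: "\<And>x. x \<in> ?L \<Longrightarrow> \<gamma> x \<in> ?G \<inter> hom (ddeg D \<delta>') ?s"
      "\<And>x y. x \<in> ?L \<Longrightarrow> y \<in> ?L \<Longrightarrow> lk (\<gamma> x) y = (if y = x then 1 else 0)"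
      "\<And>f. f \<in> ?G \<inter> hom (ddeg D \<delta>') ?s \<Longrightarrow> \<exists>c. f = (\<Sum>x\<in>?L. vscale (c x) (\<gamma> x))"
  proof (rule reduced_basis[OF gsub_imt])
    fix \<gamma> assume *: "\<And>x. x \<in> lms (ddeg D \<delta>') ?G \<Longrightarrow> \<gamma> x \<in> ?G \<inter> hom (ddeg D \<delta>') (kdeg (ddeg D \<delta>') x)"
      "\<And>x y. x \<in> lms (ddeg D \<delta>') ?G \<Longrightarrow> y \<in> lms (ddeg D \<delta>') ?G \<Longrightarrow> kdeg (ddeg D \<delta>') x = kdeg (ddeg D \<delta>') y \<Longrightarrow>
        lk (\<gamma> x) y = (if y = x then 1 else 0)"
      "\<And>f t. f \<in> ?G \<inter> hom (ddeg D \<delta>') t \<Longrightarrow>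
        \<exists>c. f = (\<Sum>x\<in>{x \<in> lms (ddeg D \<delta>') ?G. kdeg (ddeg D \<delta>') x = t}. vscale (c x) (\<gamma> x))"
    show thesis by (rule that[of \<gamma>]) (use * in force, use * in force, rule *(3))
  qed
  have V0: "vec.subspace ?V" using subspace_gfree subspace_hom by (rule vec.subspace_inter)
  have Z: "f \<in> ?Z \<longleftrightarrow> f \<in> ?V \<and> (\<forall>x\<in>?L. pair n (\<gamma> x) f = 0)" for f
  proof (cases "f \<in> ?V")
    case True
    have "(\<forall>p\<in>?G. pair n p f = 0) \<longleftrightarrow> (\<forall>x\<in>?L. pair n (\<gamma> x) f = 0)"
    proof
      assume "\<forall>p\<in>?G. pair n p f = 0" then show "\<forall>x\<in>?L. pair n (\<gamma> x) f = 0" using \<gamma>(1) by blast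
    next
      assume a: "\<forall>x\<in>?L. pair n (\<gamma> x) f = 0"
      show "\<forall>p\<in>?G. pair n p f = 0"
      proof
        fix p assume p: "p \<in> ?G"
        \<comment> \<open>As \<open>f\<close> is homogeneous of degree \<open>t\<close>, only the
          part of \<open>p\<close> in the dual degree \<open>?s\<close> pairs with it.\<close>
        have "pair n p f = (\<Sum>x\<in>ks p. lk (gpart (ddeg D \<delta>') ?s p) x * lk f (dual n x))"
          unfolding pair_def
        proof (rule sum.cong[OF refl])
          fix x assume "x \<in> ks p"
          then have "x \<in> kset n m' {}" using p gsubD(2)[OF gsub_imt] by (auto simp: gfree_def)
          then have xm: "fst x < m'" by (simp add: kset_def)
          show "lk p x * lk f (dual n x) = lk (gpart (ddeg D \<delta>') ?s p) x * lk f (dual n x)"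
          proof (cases "lk f (dual n x) = 0")
            case False
            then have "kdeg \<delta>' (dual n x) = t" using True by (auto simp: hom_def in_keys_iff)
            then have "kdeg (ddeg D \<delta>') x = ?s" using kdeg_dual[OF xm] by simp
            then show ?thesis by (simp add: gpart_def)
          qed simp
        qed
        also have "\<dots> = pair n (gpart (ddeg D \<delta>') ?s p) f"
          by (rule pair_superset[symmetric]) (auto simp: gpart_def keys_filt)
        also have "gpart (ddeg D \<delta>') ?s p \<in> ?G \<inter> hom (ddeg D \<delta>') ?s"
          using gsubD(4)[OF gsub_imt p] gpart_hom by blast
        then obtain c where "gpart (ddeg D \<delta>') ?s p = (\<Sum>x\<in>?L. vscale (c x) (\<gamma> x))" using \<gamma>(3) by blast
        then have "pair n (gpart (ddeg D \<delta>') ?s p) f = (\<Sum>x\<in>?L. c x * pair n (\<gamma> x) f)"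
          by (simp add: pair_sum_left pair_vscale_left)
        also have "\<dots> = 0"
        proof (rule sum.neutral, rule ballI)
          show "c x * pair n (\<gamma> x) f = 0" if "x \<in> ?L" for x using bspec[OF a that] by simp
        qed
        finally show "pair n p f = 0" .
      qed
    qed
    then show ?thesis using True nontop_iff_pair[of f] by blast
  qed blast
  have bV: "Poly_Mapping.single (dual n x) 1 \<in> ?V" if "x \<in> ?L" for x
  proof -
    have x: "x \<in> kset n m' {}" "kdeg (ddeg D \<delta>') x = ?s" using Lk[OF that] by auto
    then have "kdeg \<delta>' (dual n x) = t" using kdeg_dual[of x] by (simp add: kset_def)
    then show ?thesis using dual_top(1)[OF x(1)] by (auto simp: gfree_def hom_def)
  qed
  have pr: "pair n (\<gamma> y) (\<Sum>x\<in>?L. vscale (c x) (Poly_Mapping.single (dual n x) 1)) = c y" if y: "y \<in> ?L" for c y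
  proof -
    have "pair n (\<gamma> y) (\<Sum>x\<in>?L. vscale (c x) (Poly_Mapping.single (dual n x) 1)) = (\<Sum>x\<in>?L. if x = y then c y else 0)"
      unfolding pair_sum_right pair_vscale_right pair_single_right
      by (rule sum.cong[OF refl]) (simp add: \<gamma>(2)[OF y])
    then show ?thesis using fin y by simp
  qed
  show ?thesis
  proof (rule has_qdim_index[OF fin, where b = "\<lambda>x. Poly_Mapping.single (dual n x) 1"])
    fix f assume f: "f \<in> ?V"
    let ?r = "f - (\<Sum>x\<in>?L. vscale (pair n (\<gamma> x) f) (Poly_Mapping.single (dual n x) 1))"
    have "?r \<in> ?V"
      using f bV by (intro vec.subspace_diff[OF V0] vec.subspace_sum[OF V0] vec.subspace_scale[OF V0])
    moreover have "pair n (\<gamma> y) ?r = 0" if "y \<in> ?L" for y using pr[OF that] by (simp add: pair_minus_right)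
    ultimately have "?r \<in> ?Z" unfolding Z by blast
    then show "\<exists>c. f - (\<Sum>x\<in>?L. vscale (c x) (Poly_Mapping.single (dual n x) 1)) \<in> ?Z"
      by (rule exI[of _ "\<lambda>x. pair n (\<gamma> x) f"])
  next
    fix c assume "(\<Sum>x\<in>?L. vscale (c x) (Poly_Mapping.single (dual n x) 1)) \<in> ?Z"
    then have "\<forall>y\<in>?L. pair n (\<gamma> y) (\<Sum>x\<in>?L. vscale (c x) (Poly_Mapping.single (dual n x) 1)) = 0" unfolding Z by blast
    then show "\<forall>y\<in>?L. c y = 0" using pr by simp
  qed (rule bV)
qed

end

section \<open>Counting dimensions at the top of the complex\<close>

lemma subspace_lochom_top: "vec.subspace (gfree n m {..<n} \<inter> hom \<delta> t)"
  using subspace_gfree subspace_hom by (rule vec.subspace_inter)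

lemma subspace_Btop:
  assumes N: "gsub n m \<delta> N" shows "vec.subspace (Btop n m \<delta> N t)"
proof -
  let ?A = "loc {..<n} N \<inter> hom \<delta> t" let ?B = "gfree n m {..<n} \<inter> hom \<delta> t \<inter> nontop n"
  have "Btop n m \<delta> N t = {x + y |x y. x \<in> ?A \<and> y \<in> ?B}" by (auto simp: Btop_def)
  also have "vec.subspace \<dots>"
    by (rule vec.subspace_sums[OF subspace_lochom[OF N order_refl]
      vec.subspace_inter[OF subspace_lochom_top subspace_nontop]])
  finally show ?thesis .
qed

lemma Btop_sub: "gsub n m \<delta> N \<Longrightarrow> Btop n m \<delta> N t \<subseteq> gfree n m {..<n} \<inter> hom \<delta> t"
proof
  fix f assume N: "gsub n m \<delta> N" and "f \<in> Btop n m \<delta> N t"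
  then obtain w u where *: "f = w + u" "w \<in> loc {..<n} N \<inter> hom \<delta> t" "u \<in> gfree n m {..<n} \<inter> hom \<delta> t"
    by (auto simp: Btop_def)
  have "w \<in> gfree n m {..<n} \<inter> hom \<delta> t"
    using *(2) loc_mono[OF order_refl gsubD(2)[OF N], of "{..<n}"] loc_gfree[of "{..<n}" n m] by auto
  then show "f \<in> gfree n m {..<n} \<inter> hom \<delta> t" using * vec.subspace_add[OF subspace_lochom_top] by blast
qed

lemma nontop_Btop:
  fixes N :: "'k::field vec set"
  assumes "gsub n m \<delta> N" shows "gfree n m {..<n} \<inter> hom \<delta> t \<inter> nontop n \<subseteq> Btop n m \<delta> N t"
proof
  fix u :: "'k vec" assume "u \<in> gfree n m {..<n} \<inter> hom \<delta> t \<inter> nontop n"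
  moreover have "0 \<in> loc {..<n} N \<inter> hom \<delta> t" by (rule vec.subspace_0[OF subspace_lochom[OF assms order_refl]])
  moreover have "u = 0 + u" by simp
  ultimately show "u \<in> Btop n m \<delta> N t" unfolding Btop_def by blast
qed

text \<open>This is what lets a matrix act on top cohomology. By duality: the image of the transpose
  consists of polynomial vectors, and the duals of their monomials have only negative exponents,
  hence do not occur in \<open>u\<close>.\<close>

lemma nontop_ext:
  assumes gm: "\<forall>j<m'. g j \<in> gfree n m {} \<inter> hom \<delta> (int (\<delta>' j))"
    and u: "u \<in> gfree n m' {..<n}" "u \<in> nontop n"
  shows "ext g u \<in> nontop n"
proof -
  define D where "D = Max (insert 0 (\<delta> ` {..<m} \<union> \<delta>' ` {..<m'}))"
  have D: "\<forall>i<m. \<delta> i \<le> D" "\<forall>j<m'. \<delta>' j \<le> D" by (auto simp: D_def)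
  have "pair n p u = 0" if p: "p \<in> imt n m m' g" for p
    unfolding pair_def
  proof (rule sum.neutral, rule ballI)
    fix x assume "x \<in> ks p"
    then have "x \<in> kset n m' {}" using gsubD(2)[OF gsub_imt[OF gm D]] p by (auto simp: gfree_def)
    then have "dual n x \<notin> ks u" using dual_top(2) u(2) unfolding nontop_def by blast
    then show "lk p x * lk u (dual n x) = 0" by (simp add: in_keys_iff)
  qed
  then show ?thesis using nontop_iff_pair[OF gm D u(1)] by blast
qed

definition dbound :: "nat \<Rightarrow> (nat \<Rightarrow> nat) \<Rightarrow> nat \<Rightarrow> (nat \<Rightarrow> nat) \<Rightarrow> nat"
  where "dbound m \<delta> m' \<delta>' = Max (insert 0 (\<delta> ` {..<m} \<union> \<delta>' ` {..<m'}))"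

lemma degree_le_dbound: "\<forall>i<m. \<delta> i \<le> dbound m \<delta> m' \<delta>'" "\<forall>j<m'. \<delta>' j \<le> dbound m \<delta> m' \<delta>'"
  by (auto simp: dbound_def)

definition dhilb :: "nat \<Rightarrow> nat \<Rightarrow> (nat \<Rightarrow> nat) \<Rightarrow> (nat \<times> expo) set \<Rightarrow> int \<Rightarrow> nat"
  where "dhilb n D \<delta> L t = card {x \<in> L. kdeg (ddeg D \<delta>) x = int D - int n - t}"

text \<open>The candidates for initial modules of images of transposed matrices. The field is a
  parameter of its own because it does not occur in the type of the result.\<close>

definition dlms :: "nat \<Rightarrow> nat \<Rightarrow> (nat \<Rightarrow> nat) \<Rightarrow> 'k::field itself \<Rightarrow> nat \<Rightarrow> (nat \<times> expo) set set"
  where "dlms n m \<delta> _ D = lms (ddeg D \<delta>) ` {N :: 'k vec set. gsub n m (ddeg D \<delta>) N \<and> gendeg n (ddeg D \<delta>) N (int D)}"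

lemma finite_dlms: "finite (dlms n m \<delta> T D)"
  unfolding dlms_def by (rule finitely_many_leading_monomial_sets)

lemma gens_gfree: "gsub n m \<delta> N \<Longrightarrow> gens n \<delta> N m' \<delta>' g \<Longrightarrow> \<forall>j<m'. g j \<in> gfree n m {} \<inter> hom \<delta> (int (\<delta>' j))"
  using gsubD(2) by (fastforce simp: gens_def)

lemma codim_nontop_preimage_hilbert:
  fixes g :: "nat \<Rightarrow> 'k::field vec"
  assumes gm: "\<forall>j<m'. g j \<in> gfree n m {} \<inter> hom \<delta> (int (\<delta>' j))"
  shows "\<exists>L\<in>dlms n m' \<delta>' TYPE('k) (dbound m \<delta> m' \<delta>'). \<forall>t.
    has_qdim vscale (gfree n m' {..<n} \<inter> hom \<delta>' t) {f \<in> gfree n m' {..<n} \<inter> hom \<delta>' t. ext g f \<in> nontop n}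
      (dhilb n (dbound m \<delta> m' \<delta>') \<delta>' L t)"
proof -
  note a = gm degree_le_dbound(1)[where m = m and \<delta> = \<delta> and m' = m' and \<delta>' = \<delta>']
    degree_le_dbound(2)[where m = m and \<delta> = \<delta> and m' = m' and \<delta>' = \<delta>']
  show ?thesis
    using codim_nontop_preimage[OF a] gsub_imt[OF a] gendeg_imt[OF a] unfolding dlms_def dhilb_def by blast
qed

lemma codim_nontop_hilbert:
  "\<exists>L\<in>dlms n m \<delta> TYPE('k::field) (dbound m \<delta> m \<delta>). \<forall>t.
    has_qdim vscale (gfree n m {..<n} \<inter> hom \<delta> t :: 'k vec set) (gfree n m {..<n} \<inter> hom \<delta> t \<inter> nontop n)
      (dhilb n (dbound m \<delta> m \<delta>) \<delta> L t)"
proof -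
  \<comment> \<open>For the identity matrix the rank is the dimension of the top cohomology of the
    free module.\<close>
  define g where "g j = (Poly_Mapping.single (j, 0) 1 :: 'k vec)" for j :: nat
  have "\<forall>j<m. g j \<in> gfree n m {} \<inter> hom \<delta> (int (\<delta> j))"
    by (auto simp: g_def gfree_def hom_def kset_iff_nexp kdeg_def)
  from codim_nontop_preimage_hilbert[OF this] obtain L where L: "L\<in>dlms n m \<delta> TYPE('k) (dbound m \<delta> m \<delta>)"
    "\<And>t. has_qdim vscale (gfree n m {..<n} \<inter> hom \<delta> t) {f \<in> gfree n m {..<n} \<inter> hom \<delta> t. ext g f \<in> nontop n}
      (dhilb n (dbound m \<delta> m \<delta>) \<delta> L t)" by blast
  have "ext g f = f" for f :: "'k vec"
  proof -
    have "ext g f = (\<Sum>x\<in>ks f. vscale (lk f x) (Poly_Mapping.single x 1))"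
      by (simp add: ext_def lin_def g_def shift_single)
    then show ?thesis using decompose_single[of f] by simp
  qed
  then have "{f \<in> gfree n m {..<n} \<inter> hom \<delta> t. ext g f \<in> nontop n} = (gfree n m {..<n} \<inter> hom \<delta> t \<inter> nontop n :: 'k vec set)" for t
    by auto
  then show ?thesis using L by auto
qed

text \<open>\<open>Btop\<close> modulo \<open>nontop\<close> is the image of H^n(F') -> H^n(F), and
  its dimension is the codimension of the kernel.\<close>

lemma Btop_codim:
  fixes N :: "'k::field vec set"
  assumes N: "gsub n m \<delta> N" and g: "gens n \<delta> N m' \<delta>' g"
    and d: "has_qdim vscale (gfree n m' {..<n} \<inter> hom \<delta>' t) {f \<in> gfree n m' {..<n} \<inter> hom \<delta>' t. ext g f \<in> nontop n} d"
  shows "has_qdim vscale (Btop n m \<delta> N t) (gfree n m {..<n} \<inter> hom \<delta> t \<inter> nontop n) d"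
proof (rule has_qdim_transfer[where R = "\<lambda>f b. b - ext g f \<in> nontop n",
      OF vec.vector_space_axioms vec.vector_space_axioms subspace_lochom_top subspace_Btop[OF N] _ _ _ _ _ _ d])
  show "0 - ext g 0 \<in> nontop n" using vec.subspace_0[OF subspace_nontop] by simp
  fix a b :: "'k vec" and a' b' assume 1: "a' - ext g a \<in> nontop n"
  show "vscale c a' - ext g (vscale c a) \<in> nontop n" for c
    using vec.subspace_scale[OF subspace_nontop 1, of c] by (simp add: ext_vscale vec.scale_right_diff_distrib)
  assume "b' - ext g b \<in> nontop n"
  from vec.subspace_add[OF subspace_nontop 1 this] show "a' + b' - ext g (a + b) \<in> nontop n"
    by (simp add: ext_add algebra_simps)
next
  fix f :: "'k vec" assume "f \<in> gfree n m' {..<n} \<inter> hom \<delta>' t"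
  then have "f \<in> loc {..<n} (gfree n m' {}) \<inter> hom \<delta>' t" by (simp add: loc_gfree)
  then have "ext g f \<in> loc {..<n} N \<inter> hom \<delta> t" by (rule ext_lochom[OF N g])
  moreover have "0 \<in> gfree n m {..<n} \<inter> hom \<delta> t \<inter> nontop n"
    using vec.subspace_0[OF subspace_lochom_top] vec.subspace_0[OF subspace_nontop] by blast
  moreover have "ext g f = ext g f + 0" by simp
  ultimately have "ext g f \<in> Btop n m \<delta> N t" unfolding Btop_def by blast
  then show "\<exists>b\<in>Btop n m \<delta> N t. b - ext g f \<in> nontop n"
    by (rule rev_bexI) (simp add: vec.subspace_0[OF subspace_nontop])
next
  fix b :: "'k vec" assume "b \<in> Btop n m \<delta> N t"
  then obtain w u where *: "b = w + u" "w \<in> loc {..<n} N \<inter> hom \<delta> t" "u \<in> nontop n" by (auto simp: Btop_def)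
  obtain f where "f \<in> loc {..<n} (gfree n m' {}) \<inter> hom \<delta>' t" "ext g f = w" using ext_lift[OF N g *(2)] by blast
  then show "\<exists>f\<in>gfree n m' {..<n} \<inter> hom \<delta>' t. b - ext g f \<in> nontop n"
    using *(1,3) by (intro bexI[of _ f]) (simp_all add: loc_gfree)
next
  fix f b :: "'k vec" assume R: "b - ext g f \<in> nontop n" and f: "f \<in> gfree n m' {..<n} \<inter> hom \<delta>' t" and b: "b \<in> Btop n m \<delta> N t"
  have "ext g f \<in> nontop n \<longleftrightarrow> b \<in> nontop n"
    using vec.subspace_add[OF subspace_nontop R, of "ext g f"] vec.subspace_diff[OF subspace_nontop _ R, of b] by auto
  then show "f \<in> {f \<in> gfree n m' {..<n} \<inter> hom \<delta>' t. ext g f \<in> nontop n} \<longleftrightarrow> b \<in> gfree n m {..<n} \<inter> hom \<delta> t \<inter> nontop n"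
    using f b Btop_sub[OF N] by blast
qed

text \<open>The set of the theorem with F/N in place of R/I and generation degree in place of
  regularity; in this generality it is stable under passing to syzygies.\<close>

definition chilb :: "'k::field itself \<Rightarrow> nat \<Rightarrow> nat \<Rightarrow> (nat \<Rightarrow> nat) \<Rightarrow> int \<Rightarrow> int \<Rightarrow> (int \<Rightarrow> nat) set"
  where "chilb _ n m \<delta> d q = {h. \<exists>N :: 'k vec set. gsub n m \<delta> N \<and> gendeg n \<delta> N d \<and>
    (\<forall>t. has_qdim fscale (Zc n m \<delta> N q t) (Bc n m \<delta> N q t) (h t))}"

text \<open>H^n is right exact, so H^n(F/N) is the cokernel of H^n(F') -> H^n(F); the two functions
  subtracted are the dimension of H^n(F) and the rank of this map.\<close>

lemma finite_chilb_top: "finite (chilb TYPE('k::field) n m \<delta> d (int n))"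
proof -
  obtain e where e: "\<forall>N :: 'k vec set. gsub n m \<delta> N \<longrightarrow> gendeg n \<delta> N d \<longrightarrow>
    (\<exists>g. gens n \<delta> N (nrk n m \<delta> e) (ndeg n m \<delta> e) g \<and>
      gendeg n (ndeg n m \<delta> e) (syz n (nrk n m \<delta> e) g) (2 * e))" using uniform_resolution[of n m \<delta> d] by blast
  define m' where "m' = nrk n m \<delta> e"
  define \<delta>' where "\<delta>' = ndeg n m \<delta> e"
  let ?D = "dbound m \<delta> m \<delta>" and ?D' = "dbound m \<delta> m' \<delta>'"
  have "chilb TYPE('k) n m \<delta> d (int n) \<subseteq> (\<lambda>(L, L'). \<lambda>t. dhilb n ?D \<delta> L t - dhilb n ?D' \<delta>' L' t) `
      (dlms n m \<delta> TYPE('k) ?D \<times> dlms n m' \<delta>' TYPE('k) ?D')"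
  proof
    fix h assume "h \<in> chilb TYPE('k) n m \<delta> d (int n)"
    then obtain N :: "'k vec set" where N: "gsub n m \<delta> N" "gendeg n \<delta> N d"
      "\<And>t. has_qdim fscale (Zc n m \<delta> N (int n) t) (Bc n m \<delta> N (int n) t) (h t)" by (auto simp: chilb_def)
    obtain g where g: "gens n \<delta> N m' \<delta>' g" using e N(1,2) unfolding m'_def \<delta>'_def by blast
    obtain L' where L': "L' \<in> dlms n m' \<delta>' TYPE('k) ?D'"
      "\<And>t. has_qdim vscale (gfree n m' {..<n} \<inter> hom \<delta>' t) {f \<in> gfree n m' {..<n} \<inter> hom \<delta>' t. ext g f \<in> nontop n} (dhilb n ?D' \<delta>' L' t)"
      using codim_nontop_preimage_hilbert[OF gens_gfree[OF N(1) g]] by blast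
    obtain L where L: "L \<in> dlms n m \<delta> TYPE('k) ?D"
      "\<And>t. has_qdim vscale (gfree n m {..<n} \<inter> hom \<delta> t :: 'k vec set) (gfree n m {..<n} \<inter> hom \<delta> t \<inter> nontop n) (dhilb n ?D \<delta> L t)"
      using codim_nontop_hilbert[where ?'k = 'k, of n m \<delta>] by blast
    have "h t = dhilb n ?D \<delta> L t - dhilb n ?D' \<delta>' L' t" for t
    proof -
      have "has_qdim vscale (gfree n m {..<n} \<inter> hom \<delta> t :: 'k vec set) (gfree n m {..<n} \<inter> hom \<delta> t \<inter> nontop n)
          (h t + dhilb n ?D' \<delta>' L' t)"
        by (rule vec.has_qdim_trans[OF top_cohomology[OF N(1,3)] Btop_codim[OF N(1) g L'(2)]
            Btop_sub[OF N(1)] nontop_Btop[OF N(1)] subspace_Btop[OF N(1)]])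
      from vec.has_qdim_unique[OF this L(2) vec.subspace_inter[OF subspace_lochom_top subspace_nontop]]
      show ?thesis by simp
    qed
    then show "h \<in> (\<lambda>(L, L'). \<lambda>t. dhilb n ?D \<delta> L t - dhilb n ?D' \<delta>' L' t) `
      (dlms n m \<delta> TYPE('k) ?D \<times> dlms n m' \<delta>' TYPE('k) ?D')" using L(1) L'(1) by (intro image_eqI[of _ _ "(L, L')"]) auto
  qed
  then show ?thesis by (rule finite_subset) (simp add: finite_dlms)
qed

text \<open>H^(n-1)(F/N) is the homology at the middle of H^n(F'') -> H^n(F') -> H^n(F), for two
  steps of a resolution. Its dimension is that of H^n(F') minus the ranks of both maps.\<close>

lemma finite_chilb_subtop: "finite (chilb TYPE('k::field) n m \<delta> d (int n - 1))"
proof -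
  obtain e where e: "\<forall>N :: 'k vec set. gsub n m \<delta> N \<longrightarrow> gendeg n \<delta> N d \<longrightarrow>
    (\<exists>g. gens n \<delta> N (nrk n m \<delta> e) (ndeg n m \<delta> e) g \<and>
      gendeg n (ndeg n m \<delta> e) (syz n (nrk n m \<delta> e) g) (2 * e))" using uniform_resolution[of n m \<delta> d] by blast
  define m' where "m' = nrk n m \<delta> e"
  define \<delta>' where "\<delta>' = ndeg n m \<delta> e"
  obtain e' where e': "\<forall>N :: 'k vec set. gsub n m' \<delta>' N \<longrightarrow> gendeg n \<delta>' N (2 * e) \<longrightarrow>
    (\<exists>g. gens n \<delta>' N (nrk n m' \<delta>' e') (ndeg n m' \<delta>' e') g \<and>
      gendeg n (ndeg n m' \<delta>' e') (syz n (nrk n m' \<delta>' e') g) (2 * e'))" using uniform_resolution[of n m' \<delta>' "2 * e"] by blast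
  define m'' where "m'' = nrk n m' \<delta>' e'"
  define \<delta>'' where "\<delta>'' = ndeg n m' \<delta>' e'"
  let ?D = "dbound m' \<delta>' m' \<delta>'" and ?D1 = "dbound m \<delta> m' \<delta>'" and ?D2 = "dbound m' \<delta>' m'' \<delta>''"
  let ?H = "\<lambda>(L, L1, L2). \<lambda>t. dhilb n ?D \<delta>' L t - dhilb n ?D1 \<delta>' L1 t - dhilb n ?D2 \<delta>'' L2 t"
  let ?P = "dlms n m' \<delta>' TYPE('k) ?D \<times> dlms n m' \<delta>' TYPE('k) ?D1 \<times> dlms n m'' \<delta>'' TYPE('k) ?D2"
  have "chilb TYPE('k) n m \<delta> d (int n - 1) \<subseteq> ?H ` ?P"
  proof
    fix h assume "h \<in> chilb TYPE('k) n m \<delta> d (int n - 1)"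
    then obtain N :: "'k vec set" where N: "gsub n m \<delta> N" "gendeg n \<delta> N d"
      "\<And>t. has_qdim fscale (Zc n m \<delta> N (int n - 1) t) (Bc n m \<delta> N (int n - 1) t) (h t)" by (auto simp: chilb_def)
    obtain g where g: "gens n \<delta> N m' \<delta>' g" "gendeg n \<delta>' (syz n m' g) (2 * e)"
      using e N(1,2) unfolding m'_def \<delta>'_def by blast
    let ?N' = "syz n m' g"
    have N': "gsub n m' \<delta>' ?N'" by (rule syz_gsub[OF N(1) g(1)])
    obtain g' where g': "gens n \<delta>' ?N' m'' \<delta>'' g'" using e' N' g(2) unfolding m''_def \<delta>''_def by blast
    note gf = gens_gfree[OF N(1) g(1)]
    obtain L1 where L1: "L1 \<in> dlms n m' \<delta>' TYPE('k) ?D1"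
      "\<And>t. has_qdim vscale (gfree n m' {..<n} \<inter> hom \<delta>' t) {f \<in> gfree n m' {..<n} \<inter> hom \<delta>' t. ext g f \<in> nontop n} (dhilb n ?D1 \<delta>' L1 t)"
      using codim_nontop_preimage_hilbert[OF gf] by blast
    obtain L2 where L2: "L2 \<in> dlms n m'' \<delta>'' TYPE('k) ?D2"
      "\<And>t. has_qdim vscale (gfree n m'' {..<n} \<inter> hom \<delta>'' t) {f \<in> gfree n m'' {..<n} \<inter> hom \<delta>'' t. ext g' f \<in> nontop n} (dhilb n ?D2 \<delta>'' L2 t)"
      using codim_nontop_preimage_hilbert[OF gens_gfree[OF N' g']] by blast
    obtain L where L: "L \<in> dlms n m' \<delta>' TYPE('k) ?D"
      "\<And>t. has_qdim vscale (gfree n m' {..<n} \<inter> hom \<delta>' t :: 'k vec set) (gfree n m' {..<n} \<inter> hom \<delta>' t \<inter> nontop n) (dhilb n ?D \<delta>' L t)"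
      using codim_nontop_hilbert[where ?'k = 'k, of n m' \<delta>'] by blast
    have "h t = dhilb n ?D \<delta>' L t - dhilb n ?D1 \<delta>' L1 t - dhilb n ?D2 \<delta>'' L2 t" for t
    proof -
      let ?V = "gfree n m' {..<n} \<inter> hom \<delta>' t :: 'k vec set"
      let ?Z = "{f \<in> ?V. ext g f \<in> nontop n}"
      have BZ: "Btop n m' \<delta>' ?N' t \<subseteq> ?Z"
      proof
        fix f assume f: "f \<in> Btop n m' \<delta>' ?N' t"
        then obtain w u where *: "f = w + u" "w \<in> loc {..<n} ?N'" "u \<in> gfree n m' {..<n}" "u \<in> nontop n"
          by (auto simp: Btop_def)
        have "ext g w = 0" using *(2) loc_syz[OF N(1) g(1)] by blast
        then have "ext g f = ext g u" using *(1) by (simp add: ext_add)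
        then show "f \<in> ?Z" using nontop_ext[OF gf *(3,4)] Btop_sub[OF N'] f by auto
      qed
      have "has_qdim vscale ?Z (?V \<inter> nontop n) (h t + dhilb n ?D2 \<delta>'' L2 t)"
        by (rule vec.has_qdim_trans[OF subtop_cohomology[OF N(1) g(1) N(3)] Btop_codim[OF N' g' L2(2)]
            BZ nontop_Btop[OF N'] subspace_Btop[OF N']])
      moreover have "vec.subspace ?Z"
      proof -
        have "?Z = ?V \<inter> {f. ext g f \<in> nontop n}" by auto
        moreover have "vec.subspace {f. ext g f \<in> nontop n}"
          using subspace_nontop[of n] unfolding vec.subspace_def by (simp add: ext_add ext_vscale) blast
        ultimately show ?thesis by (simp only: vec.subspace_inter subspace_lochom_top)
      qed
      ultimately have "has_qdim vscale ?V (?V \<inter> nontop n) (dhilb n ?D1 \<delta>' L1 t + (h t + dhilb n ?D2 \<delta>'' L2 t))"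
        using nontop_Btop[OF N', of t] BZ by (intro vec.has_qdim_trans[OF L1(2)]) auto
      from vec.has_qdim_unique[OF this L(2) vec.subspace_inter[OF subspace_lochom_top subspace_nontop]]
      show ?thesis by simp
    qed
    then show "h \<in> ?H ` ?P" using L(1) L1(1) L2(1) by (intro image_eqI[of _ _ "(L, L1, L2)"]) auto
  qed
  then show ?thesis by (rule finite_subset) (simp add: finite_dlms)
qed

text \<open>Each dimension shift raises \<open>q\<close> by one and replaces rank, degrees and bound
  by data that depend on these alone, until \<open>q = int n - 1\<close>.\<close>

lemma finite_chilb: "finite (chilb TYPE('k::field) n m \<delta> d q)"
proof -
  consider "q > int n" | "q = int n" | "q < int n" by linarith
  then show ?thesis
  proof cases
    case 1
    then have "chilb TYPE('k) n m \<delta> d q \<subseteq> {\<lambda>_. 0}"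
      using above_top_cohomology by (fastforce simp: chilb_def)
    then show ?thesis by (rule finite_subset) simp
  next
    case 2
    then show ?thesis by (simp add: finite_chilb_top)
  next
    case 3
    then show ?thesis
    proof (induction "nat (int n - 1 - q)" arbitrary: q m \<delta> d)
      case 0
      then have "q = int n - 1" by simp
      then show ?case by (simp add: finite_chilb_subtop)
    next
      case (Suc k)
      obtain e where e: "\<forall>N :: 'k vec set. gsub n m \<delta> N \<longrightarrow> gendeg n \<delta> N d \<longrightarrow>
        (\<exists>g. gens n \<delta> N (nrk n m \<delta> e) (ndeg n m \<delta> e) g \<and>
          gendeg n (ndeg n m \<delta> e) (syz n (nrk n m \<delta> e) g) (2 * e))" using uniform_resolution[of n m \<delta> d] by blast
      have q: "q + 1 < int n" "k = nat (int n - 1 - (q + 1))" using Suc.hyps(2) by auto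
      have "chilb TYPE('k) n m \<delta> d q \<subseteq> chilb TYPE('k) n (nrk n m \<delta> e) (ndeg n m \<delta> e) (2 * e) (q + 1)"
      proof
        fix h assume "h \<in> chilb TYPE('k) n m \<delta> d q"
        then obtain N :: "'k vec set" where N: "gsub n m \<delta> N" "gendeg n \<delta> N d"
          "\<And>t. has_qdim fscale (Zc n m \<delta> N q t) (Bc n m \<delta> N q t) (h t)" by (auto simp: chilb_def)
        obtain g where g: "gens n \<delta> N (nrk n m \<delta> e) (ndeg n m \<delta> e) g"
            "gendeg n (ndeg n m \<delta> e) (syz n (nrk n m \<delta> e) g) (2 * e)" using e N(1,2) by blast
        show "h \<in> chilb TYPE('k) n (nrk n m \<delta> e) (ndeg n m \<delta> e) (2 * e) (q + 1)"
          using dimension_shift[OF N(1) g(1) q(1) N(3)] syz_gsub[OF N(1) g(1)] g(2) unfolding chilb_def by blast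
      qed
      then show ?case by (rule finite_subset) (use Suc.hyps(1)[OF q(2)] q(1) in simp)
    qed
  qed
qed

section \<open>Regularity bounds the degrees of generators\<close>

definition xshift :: "nat \<Rightarrow> (nat set \<Rightarrow> 'k::field vec) \<Rightarrow> nat set \<Rightarrow> 'k vec"
  where "xshift j f = (\<lambda>\<sigma>. shift (Poly_Mapping.single j 1) (f \<sigma>))"

text \<open>The double complex with Koszul degree \<open>p\<close> and Cech degree \<open>q\<close>.
  The internal degree is \<open>t\<close> at the full set of variables and drops by one for each
  variable left out, which matches multiplication by a variable in the Koszul direction.\<close>

definition KC :: "nat \<Rightarrow> (nat \<Rightarrow> nat) \<Rightarrow> 'k::field vec set \<Rightarrow> int \<Rightarrow> int \<Rightarrow> int \<Rightarrow> (nat set \<Rightarrow> nat set \<Rightarrow> 'k vec) set"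
  where "KC n \<delta> N t p q = fam n p (\<lambda>\<rho>. cch n \<delta> N q (t - int n + int (card \<rho>)))"

lemma xshift_add: "xshift j (a + b) = xshift j a + xshift j b"
  by (rule HOL.ext) (simp add: xshift_def shift_add)

lemma xshift_comm: "xshift i (xshift j a) = xshift j (xshift i a)"
  by (simp add: xshift_def add.commute)

lemma xshift_zero: "xshift j 0 = 0"
  by (rule HOL.ext) (simp add: xshift_def)

lemma koszul_apply:
  "codiff n xshift z \<rho> \<sigma> = codiff n (\<lambda>j. shift (Poly_Mapping.single j 1)) (\<lambda>\<rho>. z \<rho> \<sigma>) \<rho>"
  by (simp add: codiff_def sum_fun_apply ssgn_apply xshift_def)

lemma cd_xshift: "cd n (xshift j a) = xshift j (cd n a)"
  unfolding xshift_def by (rule codiff_hom) (simp_all add: shift_add)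

lemma koszul_cech_commute: "codiff n xshift (\<lambda>\<rho>. cd n (z \<rho>)) = (\<lambda>\<rho>. cd n (codiff n xshift z \<rho>))"
  by (rule codiff_hom[where h = "cd n" and X = xshift and X' = xshift and f = z]) (simp_all only: cd_add cd_xshift)

lemma koszul_koszul: "codiff n xshift (codiff n xshift z) = 0"
proof
  fix \<rho> show "codiff n xshift (codiff n xshift z) \<rho> = 0 \<rho>"
    using codiff_codiff[where X = xshift, OF xshift_add xshift_comm, of n z \<rho>] by simp
qed

section \<open>Exactness of the Koszul direction and the chase\<close>

context
  fixes n m :: nat and \<delta> :: "nat \<Rightarrow> nat" and N :: "'k::field vec set"
  assumes N: "gsub n m \<delta> N"
begin

lemma xshift_cch: "j < n \<Longrightarrow> f \<in> cch n \<delta> N q s \<Longrightarrow> xshift j f \<in> cch n \<delta> N q (s + 1)"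
  unfolding cch_def xshift_def
proof (erule fam_map)
  fix \<sigma> x assume j: "j < n" and \<sigma>: "\<sigma> \<subseteq> {..<n}" and x: "x \<in> loc \<sigma> N \<inter> hom \<delta> s"
  then obtain c where c: "c \<in> nexp \<sigma>" "shift c x \<in> N" by (auto simp: loc_def)
  have "shift (Poly_Mapping.single j 1) (shift c x) \<in> N"
    using gsubD(3)[OF N _ c(2)] nexp_single[of j "{..<n}" 1] j by simp
  then have "shift c (shift (Poly_Mapping.single j 1) x) \<in> N" by (simp add: add.commute)
  then show "shift (Poly_Mapping.single j 1) x \<in> loc \<sigma> N \<inter> hom \<delta> (s + 1)"
    using c(1) x hom_shift[of x \<delta> s "Poly_Mapping.single j 1"] by (auto simp: loc_def)
qed simp

lemma koszul_KC:
  assumes "z \<in> KC n \<delta> N t p q" shows "codiff n xshift z \<in> KC n \<delta> N t (p + 1) q"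
  unfolding KC_def
proof (rule fam_codiff[OF assms[unfolded KC_def]])
  fix \<tau> j and x :: "nat set \<Rightarrow> 'k vec"
  assume \<tau>: "\<tau> \<subseteq> {..<n}" "j \<in> \<tau>" "x \<in> cch n \<delta> N q (t - int n + int (card (\<tau> - {j})))"
  have "finite \<tau>" using \<tau>(1) finite_subset by blast
  then have "int (card (\<tau> - {j})) + 1 = int (card \<tau>)" using card_Suc_Diff1[of \<tau> j] \<tau>(2) by linarith
  then have e: "t - int n + int (card (\<tau> - {j})) + 1 = t - int n + int (card \<tau>)" by linarith
  have "j < n" using \<tau> by blast
  from xshift_cch[OF this \<tau>(3)] show "xshift j x \<in> cch n \<delta> N q (t - int n + int (card \<tau>))"
    unfolding e .
next
  fix \<tau> :: "nat set" and x y :: "nat set \<Rightarrow> 'k vec"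
  note S = subspace_cch[OF N, of q "t - int n + int (card \<tau>)"]
  show "0 \<in> cch n \<delta> N q (t - int n + int (card \<tau>))" by (rule fv.subspace_0[OF S])
  assume x: "x \<in> cch n \<delta> N q (t - int n + int (card \<tau>))"
  show "- x \<in> cch n \<delta> N q (t - int n + int (card \<tau>))" by (rule fv.subspace_neg[OF S x])
  show "y \<in> cch n \<delta> N q (t - int n + int (card \<tau>)) \<Longrightarrow> x + y \<in> cch n \<delta> N q (t - int n + int (card \<tau>))"
    by (rule fv.subspace_add[OF S x])
qed (rule xshift_zero)

lemma cech_KC: "z \<in> KC n \<delta> N t p q \<Longrightarrow> (\<lambda>\<rho>. cd n (z \<rho>)) \<in> KC n \<delta> N t p (q + 1)"
  unfolding KC_def by (erule fam_map) (rule cd_zero, rule cd_cch[OF N])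

lemma zero_KC: "0 \<in> KC n \<delta> N t p q"
  unfolding KC_def by (rule famI) (use fv.subspace_0[OF subspace_cch[OF N]] in auto)

lemma KC_outside: "z \<in> KC n \<delta> N t p q \<Longrightarrow> p < 0 \<or> p > int n \<Longrightarrow> z = 0"
proof (rule HOL.ext)
  fix \<rho> assume z: "z \<in> KC n \<delta> N t p q" and p: "p < 0 \<or> p > int n"
  have "\<not> (\<rho> \<subseteq> {..<n} \<and> int (card \<rho>) = p)" using p card_mono[of "{..<n}" \<rho>] by auto
  then show "z \<rho> = 0 \<rho>" using famD(2)[OF z[unfolded KC_def]] by simp
qed

text \<open>For \<open>q > 0\<close> every index \<open>\<sigma>\<close> contains some variable; it
  is invertible on the localization at \<open>\<sigma>\<close>, so the Koszul complex there is
  contractible.\<close>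

lemma koszul_contract:
  assumes dz: "y \<in> KC n \<delta> N t p q" and q: "q > 0" and k: "codiff n xshift y = 0"
  shows "\<exists>z'\<in>KC n \<delta> N t (p - 1) q. codiff n xshift z' = y"
proof -
  \<comment> \<open>The variable may vary with \<open>\<sigma>\<close> because the Koszul
    differential acts for each \<open>\<sigma>\<close> separately.\<close>
  define v where "v \<sigma> = (SOME v. v \<in> \<sigma>)" for \<sigma> :: "nat set"
  define z' where "z' \<rho> \<sigma> = (if \<sigma> \<subseteq> {..<n} \<and> int (card \<sigma>) = q then
      contract n (shift (Poly_Mapping.single (v \<sigma>) (-1))) (v \<sigma>) (\<lambda>\<rho>. y \<rho> \<sigma>) \<rho> else 0)" for \<rho> \<sigma>
  have v: "v \<sigma> \<in> \<sigma>" if "int (card \<sigma>) = q" for \<sigma> :: "nat set"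
  proof -
    have "\<sigma> \<noteq> {}" using q that by auto
    then show ?thesis unfolding v_def by (simp add: some_in_eq)
  qed
  have y0: "y \<rho> \<sigma> = 0" if "\<not> (\<sigma> \<subseteq> {..<n} \<and> int (card \<sigma>) = q)" for \<rho> \<sigma>
  proof (cases "\<rho> \<subseteq> {..<n} \<and> int (card \<rho>) = p")
    case True
    then have "y \<rho> \<in> cch n \<delta> N q (t - int n + int (card \<rho>))" using famD(1)[OF dz[unfolded KC_def]] by blast
    then show ?thesis using famD(2) that unfolding cch_def by blast
  next
    case False then show ?thesis using famD(2)[OF dz[unfolded KC_def], of \<rho>] by simp
  qed
  have "z' \<in> KC n \<delta> N t (p - 1) q"
    unfolding KC_def
  proof (rule famI)
    fix \<rho> assume \<rho>: "\<rho> \<subseteq> {..<n}" "int (card \<rho>) = p - 1"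
    show "z' \<rho> \<in> cch n \<delta> N q (t - int n + int (card \<rho>))"
      unfolding cch_def
    proof (rule famI)
      fix \<sigma> assume \<sigma>: "\<sigma> \<subseteq> {..<n}" "int (card \<sigma>) = q"
      let ?S = "loc \<sigma> N \<inter> hom \<delta> (t - int n + int (card \<rho>))"
      note S = subspace_lochom[OF N \<sigma>(1), of "t - int n + int (card \<rho>)"]
      show "z' \<rho> \<sigma> \<in> ?S"
      proof (cases "v \<sigma> \<in> \<rho>")
        case True
        then show ?thesis using vec.subspace_0[OF S] by (simp add: z'_def contract_def)
      next
        case False
        have f: "finite \<rho>" using \<rho>(1) finite_subset by blast
        have i: "insert (v \<sigma>) \<rho> \<subseteq> {..<n}" "int (card (insert (v \<sigma>) \<rho>)) = p"
          using v[OF \<sigma>(2)] \<sigma>(1) \<rho> False f by auto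
        have "y (insert (v \<sigma>) \<rho>) \<in> cch n \<delta> N q (t - int n + p)"
          using famD(1)[OF dz[unfolded KC_def] i] i(2) by simp
        then have a: "y (insert (v \<sigma>) \<rho>) \<sigma> \<in> loc \<sigma> N \<inter> hom \<delta> (t - int n + p)"
          unfolding cch_def using famD(1) \<sigma> by blast
        let ?b = "shift (Poly_Mapping.single (v \<sigma>) (-1)) (y (insert (v \<sigma>) \<rho>) \<sigma>)"
        have e: "shift (Poly_Mapping.single (v \<sigma>) 1) ?b = y (insert (v \<sigma>) \<rho>) \<sigma>"
          by (simp add: single_add[symmetric])
        have "shift (Poly_Mapping.single (v \<sigma>) 1) ?b \<in> loc \<sigma> N" unfolding e using a by blast
        moreover have "shift (Poly_Mapping.single (v \<sigma>) 1) ?b \<in> loc \<sigma> N \<longleftrightarrow> ?b \<in> loc \<sigma> N"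
          by (rule loc_shift_iff) (use gsubD(3)[OF N] nexp_mono[OF \<sigma>(1)] nexp_single[OF v[OF \<sigma>(2)], of 1] in auto)
        ultimately have "?b \<in> loc \<sigma> N" by blast
        moreover have "?b \<in> hom \<delta> (t - int n + int (card \<rho>))"
        proof -
          have e2: "t - int n + int (card \<rho>) - tdeg (Poly_Mapping.single (v \<sigma>) (-1)) = t - int n + p" using \<rho>(2) by simp
          show ?thesis using a unfolding hom_shift_iff e2 by blast
        qed
        ultimately have b: "?b \<in> ?S" by blast
        have "ssgn (insert (v \<sigma>) \<rho>) (v \<sigma>) ?b \<in> ?S" by (rule ssgn_in[OF vec.subspace_neg[OF S] b])
        then show ?thesis using False \<sigma> by (simp add: z'_def contract_def)
      qed
    qed (simp only: z'_def if_False)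
  next
    fix \<rho> assume \<rho>: "\<not> (\<rho> \<subseteq> {..<n} \<and> int (card \<rho>) = p - 1)"
    show "z' \<rho> = 0"
    proof (rule HOL.ext)
      fix \<sigma> show "z' \<rho> \<sigma> = 0 \<sigma>"
      proof (cases "\<sigma> \<subseteq> {..<n} \<and> int (card \<sigma>) = q \<and> v \<sigma> \<notin> \<rho>")
        case True
        then have "v \<sigma> < n" using v[of \<sigma>] by auto
        then have "\<not> (insert (v \<sigma>) \<rho> \<subseteq> {..<n} \<and> int (card (insert (v \<sigma>) \<rho>)) = p)"
          using \<rho> True finite_subset[of \<rho> "{..<n}"] by auto
        then have "y (insert (v \<sigma>) \<rho>) = 0" using famD(2)[OF dz[unfolded KC_def]] by blast
        then show ?thesis by (simp add: z'_def contract_def)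
      qed (auto simp: z'_def contract_def)
    qed
  qed
  moreover have "codiff n xshift z' = y"
  proof (intro HOL.ext)
    fix \<rho> \<sigma>
    show "codiff n xshift z' \<rho> \<sigma> = y \<rho> \<sigma>"
    proof (cases "\<sigma> \<subseteq> {..<n} \<and> int (card \<sigma>) = q")
      case False
      have "(\<lambda>\<rho>. z' \<rho> \<sigma>) = (\<lambda>_. 0)" by (simp only: z'_def False if_False)
      then show ?thesis using y0[OF False] unfolding koszul_apply by (simp add: codiff_def)
    next
      case True
      show ?thesis
      proof (cases "\<rho> \<subseteq> {..<n}")
        case False
        then have "y \<rho> = 0" using famD(2)[OF dz[unfolded KC_def]] by blast
        then show ?thesis using False by (simp add: codiff_def)
      next
        case \<rho>: True
        let ?X = "\<lambda>j. shift (Poly_Mapping.single j 1) :: 'k vec \<Rightarrow> 'k vec"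
        let ?Y = "shift (Poly_Mapping.single (v \<sigma>) (-1)) :: 'k vec \<Rightarrow> 'k vec"
        have vn: "v \<sigma> < n" using v[of \<sigma>] True by auto
        have "codiff n ?X (contract n ?Y (v \<sigma>) (\<lambda>\<rho>. y \<rho> \<sigma>)) \<rho> + contract n ?Y (v \<sigma>) (codiff n ?X (\<lambda>\<rho>. y \<rho> \<sigma>)) \<rho> = y \<rho> \<sigma>"
          by (rule codiff_contract[OF _ _ _ _ vn \<rho>]) (simp_all add: shift_add add.commute single_add[symmetric])
        moreover have "codiff n ?X (\<lambda>\<rho>. y \<rho> \<sigma>) = (\<lambda>_. 0)"
        proof
          fix \<rho>' show "codiff n ?X (\<lambda>\<rho>. y \<rho> \<sigma>) \<rho>' = 0"
            using fun_cong[OF fun_cong[OF k, of \<rho>'], of \<sigma>] by (simp add: koszul_apply)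
        qed
        moreover have "(\<lambda>\<rho>. z' \<rho> \<sigma>) = contract n ?Y (v \<sigma>) (\<lambda>\<rho>. y \<rho> \<sigma>)" using True by (auto simp: z'_def)
        moreover have "contract n ?Y (v \<sigma>) (\<lambda>_. 0) \<rho> = 0" by (simp add: contract_def)
        ultimately show ?thesis unfolding koszul_apply by simp
      qed
    qed
  qed
  ultimately show ?thesis by blast
qed

text \<open>Descending induction along a diagonal of the double complex, starting at
  \<open>p = int n + 1\<close>, where the Koszul degree is \<open>-1\<close> and everything is zero.
  The Cech coboundary of \<open>z\<close> is a Koszul boundary of some \<open>z'\<close> one step
  further; decomposing \<open>z'\<close> yields \<open>u'\<close> such that \<open>z\<close> minus
  the Koszul image of \<open>u'\<close> is a Cech cocycle, and acyclicity finishes.\<close>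

lemma koszul_cech_chase:
  assumes acyc: "\<And>j s z. j \<ge> 0 \<Longrightarrow> j + s > r \<Longrightarrow> z \<in> cch n \<delta> N j s \<Longrightarrow> cd n z = 0 \<Longrightarrow> \<exists>u\<in>cch n \<delta> N (j - 1) s. z = cd n u"
    and t: "t > r" and p: "0 \<le> p" "p \<le> int n + 1"
    and z: "z \<in> KC n \<delta> N t (int n - p) p" and kz: "codiff n xshift (\<lambda>\<rho>. cd n (z \<rho>)) = 0"
  shows "\<exists>u\<in>KC n \<delta> N t (int n - p) (p - 1). \<exists>w\<in>KC n \<delta> N t (int n - p - 1) p.
    z = (\<lambda>\<rho>. cd n (u \<rho>)) + codiff n xshift w"
  using p z kz
proof (induction "nat (int n + 1 - p)" arbitrary: p z)
  case 0
  then have "p = int n + 1" by simp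
  then have "z = 0" using KC_outside[OF 0(4)] by simp
  moreover have "(\<lambda>\<rho>. cd n (0 \<rho>)) + codiff n xshift 0 = 0"
    unfolding codiff_zero[where X = xshift, OF xshift_add] by (rule HOL.ext) (simp add: codiff_zero)
  ultimately show ?case using zero_KC by metis
next
  case (Suc k)
  define y where "y = (\<lambda>\<rho>. cd n (z \<rho>))"
  have y: "y \<in> KC n \<delta> N t (int n - p) (p + 1)" unfolding y_def by (rule cech_KC[OF Suc.prems(3)])
  obtain z' where z': "z' \<in> KC n \<delta> N t (int n - p - 1) (p + 1)" "codiff n xshift z' = y"
    using koszul_contract[OF y] Suc.prems(1,4) unfolding y_def[symmetric] by auto
  have "codiff n xshift (\<lambda>\<rho>. cd n (z' \<rho>)) = 0"
    unfolding koszul_cech_commute z'(2) y_def by (rule HOL.ext) (simp only: cd_cd zero_fun_apply)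
  moreover have e: "int n - p - 1 = int n - (p + 1)" "k = nat (int n + 1 - (p + 1))" "0 \<le> p + 1" "p + 1 \<le> int n + 1"
    using Suc.hyps(2) Suc.prems(1) by auto
  ultimately obtain u' w' where uw: "u' \<in> KC n \<delta> N t (int n - (p + 1)) (p + 1 - 1)"
      "z' = (\<lambda>\<rho>. cd n (u' \<rho>)) + codiff n xshift w'"
    using Suc.hyps(1)[OF e(2,3,4) z'(1)[unfolded e(1)]] by blast
  have u': "u' \<in> KC n \<delta> N t (int n - p - 1) p" using uw(1) by (simp add: algebra_simps)
  have "y = codiff n xshift (\<lambda>\<rho>. cd n (u' \<rho>)) + codiff n xshift (codiff n xshift w')"
    unfolding z'(2)[symmetric] uw(2) by (rule codiff_add[where X = xshift, OF xshift_add])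
  then have yu: "y = (\<lambda>\<rho>. cd n (codiff n xshift u' \<rho>))"
    unfolding koszul_koszul koszul_cech_commute by (simp only: add_0_right)
  have ku: "codiff n xshift u' \<in> KC n \<delta> N t (int n - p) p" using koszul_KC[OF u'] by simp
  have "\<exists>u. if \<rho> \<subseteq> {..<n} \<and> int (card \<rho>) = int n - p
      then u \<in> cch n \<delta> N (p - 1) (t - int n + int (card \<rho>)) \<and> z \<rho> = cd n u + codiff n xshift u' \<rho> else u = 0" for \<rho>
  proof (cases "\<rho> \<subseteq> {..<n} \<and> int (card \<rho>) = int n - p")
    case True
    let ?s = "t - int n + int (card \<rho>)"
    have "z \<rho> \<in> cch n \<delta> N p ?s" "codiff n xshift u' \<rho> \<in> cch n \<delta> N p ?s"
      using famD(1)[OF Suc.prems(3)[unfolded KC_def]] famD(1)[OF ku[unfolded KC_def]] True by blast+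
    then have "z \<rho> - codiff n xshift u' \<rho> \<in> cch n \<delta> N p ?s" by (rule fv.subspace_diff[OF subspace_cch[OF N]])
    moreover have "cd n (z \<rho> - codiff n xshift u' \<rho>) = 0"
      using fun_cong[OF yu, of \<rho>] unfolding y_def cd_minus by (simp only: diff_self)
    \<comment> \<open>At Koszul index of size \<open>int n - p\<close> the internal degree is
      \<open>t - p\<close>, so Cech degree plus internal degree is constantly \<open>t\<close> on
      this diagonal.\<close>
    moreover have "p + ?s > r" using True t by simp
    ultimately obtain u where "u \<in> cch n \<delta> N (p - 1) ?s" "z \<rho> - codiff n xshift u' \<rho> = cd n u"
      using acyc[OF Suc.prems(1)] by blast
    then show ?thesis using True by (metis diff_add_cancel)
  qed auto
  then have "\<forall>\<rho>. \<exists>u. if \<rho> \<subseteq> {..<n} \<and> int (card \<rho>) = int n - p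
      then u \<in> cch n \<delta> N (p - 1) (t - int n + int (card \<rho>)) \<and> z \<rho> = cd n u + codiff n xshift u' \<rho> else u = 0" ..
  then obtain u where u: "\<And>\<rho>. if \<rho> \<subseteq> {..<n} \<and> int (card \<rho>) = int n - p
      then u \<rho> \<in> cch n \<delta> N (p - 1) (t - int n + int (card \<rho>)) \<and> z \<rho> = cd n (u \<rho>) + codiff n xshift u' \<rho> else u \<rho> = 0"
    unfolding choice_iff by blast
  have "u \<in> KC n \<delta> N t (int n - p) (p - 1)"
    unfolding KC_def by (rule famI) (use u in metis)+
  moreover have "z = (\<lambda>\<rho>. cd n (u \<rho>)) + codiff n xshift u'"
  proof (rule HOL.ext)
    fix \<rho>
    show "z \<rho> = ((\<lambda>\<rho>. cd n (u \<rho>)) + codiff n xshift u') \<rho>"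
    proof (cases "\<rho> \<subseteq> {..<n} \<and> int (card \<rho>) = int n - p")
      case True
      then show ?thesis using u[of \<rho>] by (simp only: if_True plus_fun_apply[of "\<lambda>\<rho>. cd n (u \<rho>)"])
    next
      case False
      then have "z \<rho> = 0" "u \<rho> = 0" "codiff n xshift u' \<rho> = 0"
        using famD(2)[OF Suc.prems(3)[unfolded KC_def] False] u[of \<rho>] famD(2)[OF ku[unfolded KC_def] False] by (simp_all only: if_False)
      then show ?thesis by (simp only: plus_fun_apply[of "\<lambda>\<rho>. cd n (u \<rho>)"] cd_zero add_0_right)
    qed
  qed
  ultimately show ?case using u' by blast
qed

text \<open>An element \<open>f\<close> of degree \<open>t > r\<close> is placed in Cech degree
  \<open>0\<close> at the full Koszul index. The chase shows that it is a Koszul boundary there,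
  that is, a combination of the variables with coefficients in \<open>N\<close> of degree
  \<open>t - 1\<close>.\<close>

lemma regularity_bounds_generators:
  assumes acyc: "\<And>j s z. j \<ge> 0 \<Longrightarrow> j + s > r \<Longrightarrow> z \<in> cch n \<delta> N j s \<Longrightarrow> cd n z = 0 \<Longrightarrow> \<exists>u\<in>cch n \<delta> N (j - 1) s. z = cd n u"
  shows "gendeg n \<delta> N r"
  unfolding gendeg_def
proof (intro allI impI subsetI, elim conjE)
  fix V f assume V: "vec.subspace V" "\<forall>c\<in>nexp {..<n}. \<forall>f\<in>V. shift c f \<in> V" "\<forall>t\<le>r. N \<inter> hom \<delta> t \<subseteq> V" and f: "f \<in> N"
  have loc0: "loc {} N = N"
  proof -
    have "c = 0" if "c \<in> nexp {}" for c using nexpD(2)[OF that] keys_empty_iff[of c] by blast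
    then have "nexp {} = {0}" by auto
    then show ?thesis by (auto simp: loc_def)
  qed
  have step: "N \<inter> hom \<delta> t \<subseteq> V" if t: "t > r" and IH: "N \<inter> hom \<delta> (t - 1) \<subseteq> V" for t
  proof
    fix f assume f: "f \<in> N \<inter> hom \<delta> t"
    define c0 where "c0 \<sigma> = (if \<sigma> = {} then f else 0)" for \<sigma> :: "nat set"
    define z where "z \<rho> = (if \<rho> = {..<n} then c0 else 0)" for \<rho> :: "nat set"
    have c0: "c0 \<in> cch n \<delta> N 0 t"
      unfolding cch_def
    proof (rule famI)
      fix \<sigma> assume "\<sigma> \<subseteq> {..<n}" "int (card \<sigma>) = 0"
      then have "\<sigma> = {}" using finite_subset[of \<sigma> "{..<n}"] by auto
      then show "c0 \<sigma> \<in> loc \<sigma> N \<inter> hom \<delta> t" using f loc0 by (simp add: c0_def)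
    qed (auto simp: c0_def)
    have z: "z \<in> KC n \<delta> N t (int n - 0) 0"
      unfolding KC_def
    proof (rule famI)
      fix \<rho> assume "\<rho> \<subseteq> {..<n}" "int (card \<rho>) = int n - 0"
      then have "\<rho> = {..<n}" using top_index[of \<rho> n] by simp
      then show "z \<rho> \<in> cch n \<delta> N 0 (t - int n + int (card \<rho>))" using c0 by (simp add: z_def)
    qed (auto simp: z_def)
    \<comment> \<open>Its Koszul degree would be \<open>int n + 1\<close>.\<close>
    have kz: "codiff n xshift (\<lambda>\<rho>. cd n (z \<rho>)) = 0"
      by (rule KC_outside[OF koszul_KC[OF cech_KC[OF z]]]) simp
    obtain u w where u: "u \<in> KC n \<delta> N t (int n - 0) (0 - 1)" and w: "w \<in> KC n \<delta> N t (int n - 0 - 1) 0"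
      and zw: "z = (\<lambda>\<rho>. cd n (u \<rho>)) + codiff n xshift w"
    proof -
      have "\<exists>u\<in>KC n \<delta> N t (int n - 0) (0 - 1). \<exists>w\<in>KC n \<delta> N t (int n - 0 - 1) 0.
          z = (\<lambda>\<rho>. cd n (u \<rho>)) + codiff n xshift w"
        by (rule koszul_cech_chase[OF acyc t _ _ z kz]) simp_all
      then show ?thesis using that by blast
    qed
    \<comment> \<open>\<open>u\<close> has Cech degree \<open>-1\<close>, so \<open>z\<close> is a
      pure Koszul boundary.\<close>
    have u0: "u \<rho> = 0" for \<rho>
    proof (cases "\<rho> \<subseteq> {..<n} \<and> int (card \<rho>) = int n - 0")
      case True
      then have "u \<rho> \<in> cch n \<delta> N (0 - 1) (t - int n + int (card \<rho>))" using famD(1)[OF u[unfolded KC_def]] by blast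
      then have "u \<rho> \<sigma> = 0" for \<sigma> unfolding cch_def by (rule famD(2)) simp
      then show ?thesis by (intro HOL.ext) simp
    qed (use famD(2)[OF u[unfolded KC_def]] in blast)
    have "f = z {..<n} {}" by (simp add: z_def c0_def)
    also have "\<dots> = codiff n xshift w {..<n} {}"
      unfolding zw plus_fun_apply u0 cd_zero by simp
    also have "\<dots> = (\<Sum>j<n. ssgn {..<n} j (shift (Poly_Mapping.single j 1) (w ({..<n} - {j}) {})))"
      unfolding koszul_apply by (simp add: codiff_def)
    also have "\<dots> \<in> V"
    proof (intro vec.subspace_sum[OF V(1)] ssgn_in[OF vec.subspace_neg[OF V(1)]])
      fix j assume "j \<in> {..<n}"
      then have j: "j < n" by simp
      have c: "{..<n} - {j} \<subseteq> {..<n}" "int (card ({..<n} - {j})) = int n - 0 - 1" using j by auto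
      have "w ({..<n} - {j}) \<in> cch n \<delta> N 0 (t - 1)"
        using famD(1)[OF w[unfolded KC_def] c] c(2) by simp
      then have "w ({..<n} - {j}) {} \<in> loc {} N \<inter> hom \<delta> (t - 1)"
        unfolding cch_def using famD(1)[of _ n 0 _ "{}"] by fastforce
      then have "w ({..<n} - {j}) {} \<in> V" using loc0 IH by auto
      then show "shift (Poly_Mapping.single j 1) (w ({..<n} - {j}) {}) \<in> V"
        using V(2) nexp_single[of j "{..<n}" 1] j by simp
    qed
    finally show "f \<in> V" .
  qed
  have all: "N \<inter> hom \<delta> (r + int k) \<subseteq> V" for k
  proof (induction k)
    case 0 then show ?case using V(3) by simp
  next
    case (Suc k) then show ?case using step[of "r + int (Suc k)"] by (simp add: algebra_simps)
  qed
  have "N \<inter> hom \<delta> t \<subseteq> V" for t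
    using V(3) all[of "nat (t - r)"] by (cases "t \<le> r") auto
  then have "gpart \<delta> t f \<in> V" for t using gsubD(4)[OF N f] gpart_hom by blast
  then have "(\<Sum>t\<in>kdeg \<delta> ` ks f. gpart \<delta> t f) \<in> V" by (intro vec.subspace_sum[OF V(1)])
  then show "f \<in> V" using gpart_sum[of "kdeg \<delta> ` ks f" \<delta> f] by simp
qed

end

section \<open>Presentations of modules as subquotients\<close>

definition subgrp :: "'v::ab_group_add set \<Rightarrow> bool"
  where "subgrp A \<longleftrightarrow> 0 \<in> A \<and> (\<forall>a\<in>A. \<forall>b\<in>A. a - b \<in> A)"

lemma subgrpD:
  assumes "subgrp A"
  shows "0 \<in> A" "a \<in> A \<Longrightarrow> b \<in> A \<Longrightarrow> a - b \<in> A" "a \<in> A \<Longrightarrow> - a \<in> A" "a \<in> A \<Longrightarrow> b \<in> A \<Longrightarrow> a + b \<in> A"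
proof -
  show 0: "0 \<in> A" and m: "\<And>a b. a \<in> A \<Longrightarrow> b \<in> A \<Longrightarrow> a - b \<in> A" using assms by (auto simp: subgrp_def)
  show n: "- a \<in> A" if "a \<in> A" for a using m[OF 0 that] by simp
  show "a \<in> A \<Longrightarrow> b \<in> A \<Longrightarrow> a + b \<in> A" using m[OF _ n, of a b] by simp
qed

lemma subgrp_sum: "subgrp A \<Longrightarrow> (\<And>i. i \<in> I \<Longrightarrow> f i \<in> A) \<Longrightarrow> sum f I \<in> A"
  using subgrpD(1,4) by (rule sum_closed)

lemma (in vector_space) subspace_subgrp: "subspace A \<Longrightarrow> subgrp A"
  by (simp add: subgrp_def subspace_0 subspace_diff)

text \<open>\<open>M\<close> is the quotient of \<open>A\<close> by \<open>A \<inter> B\<close>, via \<open>\<pi>\<close>. All modules of the Cech construction are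
  presented in this way by spaces of Laurent polynomials.\<close>

definition presents :: "('b, 'm) ring_scheme \<Rightarrow> ('v::ab_group_add \<Rightarrow> 'b) \<Rightarrow> 'v set \<Rightarrow> 'v set \<Rightarrow> bool"
  where "presents M \<pi> A B \<longleftrightarrow> subgrp A \<and> subgrp B \<and> carrier M = \<pi> ` A \<and> \<zero>\<^bsub>M\<^esub> = \<pi> 0 \<and>
    (\<forall>a\<in>A. \<forall>b\<in>A. \<pi> a \<oplus>\<^bsub>M\<^esub> \<pi> b = \<pi> (a + b)) \<and> (\<forall>a\<in>A. \<forall>b\<in>A. \<pi> a = \<pi> b \<longleftrightarrow> a - b \<in> B)"

lemma presentsD:
  assumes "presents M \<pi> A B"
  shows "subgrp A" "subgrp B" "carrier M = \<pi> ` A" "\<zero>\<^bsub>M\<^esub> = \<pi> 0"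
    "a \<in> A \<Longrightarrow> b \<in> A \<Longrightarrow> \<pi> a \<oplus>\<^bsub>M\<^esub> \<pi> b = \<pi> (a + b)" "a \<in> A \<Longrightarrow> b \<in> A \<Longrightarrow> \<pi> a = \<pi> b \<longleftrightarrow> a - b \<in> B"
  using assms by (auto simp: presents_def)

lemma presents_abelian_group:
  assumes P: "presents M \<pi> A B"
  shows "abelian_group M"
proof (rule abelian_groupI)
  note D = presentsD[OF P] note S = subgrpD[OF D(1)]
  show "x \<oplus>\<^bsub>M\<^esub> y \<in> carrier M" if "x \<in> carrier M" "y \<in> carrier M" for x y
    using that S(4) D(5) unfolding D(3) by force
  show "\<zero>\<^bsub>M\<^esub> \<in> carrier M" unfolding D(3,4) using S(1) by blast
  show "x \<oplus>\<^bsub>M\<^esub> y \<oplus>\<^bsub>M\<^esub> z = x \<oplus>\<^bsub>M\<^esub> (y \<oplus>\<^bsub>M\<^esub> z)" if xyz: "x \<in> carrier M" "y \<in> carrier M" "z \<in> carrier M" for x y z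
  proof -
    obtain a b c where "a \<in> A" "b \<in> A" "c \<in> A" "x = \<pi> a" "y = \<pi> b" "z = \<pi> c" using xyz unfolding D(3) by blast
    then show ?thesis by (simp add: D(5) S(4) add.assoc)
  qed
  show "x \<oplus>\<^bsub>M\<^esub> y = y \<oplus>\<^bsub>M\<^esub> x" if xy: "x \<in> carrier M" "y \<in> carrier M" for x y
  proof -
    obtain a b where "a \<in> A" "b \<in> A" "x = \<pi> a" "y = \<pi> b" using xy unfolding D(3) by blast
    then show ?thesis by (simp add: D(5) add.commute)
  qed
  show "\<zero>\<^bsub>M\<^esub> \<oplus>\<^bsub>M\<^esub> x = x" if "x \<in> carrier M" for x
    using that S(1) D(5) unfolding D(3,4) by force
  show "\<exists>y\<in>carrier M. y \<oplus>\<^bsub>M\<^esub> x = \<zero>\<^bsub>M\<^esub>" if x: "x \<in> carrier M" for x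
  proof -
    obtain a where a: "a \<in> A" "x = \<pi> a" using x unfolding D(3) by blast
    then have "\<pi> (- a) \<oplus>\<^bsub>M\<^esub> x = \<pi> 0" using D(5)[OF S(3) a(1), of a] by simp
    then show ?thesis unfolding D(3,4) using S(3) a by blast
  qed
qed

lemma presents_finsum:
  assumes P: "presents M \<pi> A B" and "finite J" "\<And>j. j \<in> J \<Longrightarrow> f j \<in> A"
  shows "finsum M (\<lambda>j. \<pi> (f j)) J = \<pi> (\<Sum>j\<in>J. f j)"
proof -
  interpret abelian_group M by (rule presents_abelian_group[OF P])
  note D = presentsD[OF P] note S = subgrpD[OF D(1)]
  show ?thesis using assms(2,3)
  proof (induction J rule: finite_induct)
    case empty
    then show ?case by (simp add: D(4))
  next
    case (insert j J)
    have c: "(\<lambda>j. \<pi> (f j)) \<in> J \<rightarrow> carrier M" "\<pi> (f j) \<in> carrier M" using insert.prems by (auto simp: D(3))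
    have s: "(\<Sum>j\<in>J. f j) \<in> A" using insert.prems by (intro subgrp_sum[OF D(1)]) auto
    show ?case using insert by (simp add: finsum_insert[OF insert.hyps c] D(5)[OF _ s])
  qed
qed

section \<open>Submodules, quotients and dimensions of presented modules\<close>

lemma presents_submodule:
  assumes P: "presents M \<pi> A B" and Z: "subgrp Z" "Z \<subseteq> A"
  shows "presents (graded_submodule M (\<pi> ` Z)) \<pi> Z B"
proof -
  note D = presentsD[OF P]
  show ?thesis unfolding presents_def graded_submodule_def
  proof (intro conjI ballI)
    fix a b assume "a \<in> Z" "b \<in> Z"
    then have ab: "a \<in> A" "b \<in> A" using Z(2) by blast+
    show "\<pi> a \<oplus>\<^bsub>M\<lparr>carrier := \<pi> ` Z, component := \<lambda>t. component M t \<inter> \<pi> ` Z\<rparr>\<^esub> \<pi> b = \<pi> (a + b)"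
      using D(5)[OF ab] by simp
    show "\<pi> a = \<pi> b \<longleftrightarrow> a - b \<in> B" by (rule D(6)[OF ab])
  qed (use Z(1) D in simp_all)
qed

lemma coset_presents:
  assumes P: "presents M \<pi> A B" and C: "subgrp C" "C \<subseteq> A" and a: "a \<in> A"
  shows "\<pi> ` C +>\<^bsub>M\<^esub> \<pi> a = (\<lambda>c. \<pi> (c + a)) ` C"
  using presentsD(5)[OF P] C(2) a by (auto simp: a_r_coset_def' image_iff) (metis subsetD)+

lemma subgrp_plus:
  assumes "subgrp B" "subgrp C" shows "subgrp {b + c | b c. b \<in> B \<and> c \<in> C}"
  unfolding subgrp_def
proof (intro conjI ballI)
  have "0 = 0 + (0::'a)" by simp
  then show "0 \<in> {b + c | b c. b \<in> B \<and> c \<in> C}" using subgrpD(1)[OF assms(1)] subgrpD(1)[OF assms(2)] by blast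
next
  fix x y assume "x \<in> {b + c | b c. b \<in> B \<and> c \<in> C}" "y \<in> {b + c | b c. b \<in> B \<and> c \<in> C}"
  then obtain b c b' c' where *: "x = b + c" "y = b' + c'" "b \<in> B" "b' \<in> B" "c \<in> C" "c' \<in> C" by blast
  then have "x - y = (b - b') + (c - c')" by simp
  then show "x - y \<in> {b + c | b c. b \<in> B \<and> c \<in> C}"
    using subgrpD(2)[OF assms(1)] subgrpD(2)[OF assms(2)] * by blast
qed

text \<open>A coset of a coset: dividing further by the image of \<open>C\<close> enlarges the
  kernel of the presentation from \<open>B\<close> to \<open>B + C\<close>.\<close>

lemma presents_quotient:
  assumes P: "presents M \<pi> A B" and C: "subgrp C" "C \<subseteq> A"
  defines "Q \<equiv> graded_quotient M (\<pi> ` C)" and "\<kappa> \<equiv> \<lambda>x. \<pi> ` C +>\<^bsub>M\<^esub> \<pi> x"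
  shows "presents Q \<kappa> A {b + c | b c. b \<in> B \<and> c \<in> C}"
proof -
  note D = presentsD[OF P] note SA = subgrpD[OF D(1)] note SB = subgrpD[OF D(2)] note SC = subgrpD[OF C(1)]
  have k: "\<kappa> a = (\<lambda>c. \<pi> (c + a)) ` C" if "a \<in> A" for a unfolding \<kappa>_def by (rule coset_presents[OF P C that])
  have eq: "\<kappa> x = \<kappa> y \<longleftrightarrow> x - y \<in> {b + c | b c. b \<in> B \<and> c \<in> C}" if xy: "x \<in> A" "y \<in> A" for x y
  proof
    assume e: "\<kappa> x = \<kappa> y"
    have "\<pi> (0 + x) \<in> \<kappa> x" unfolding k[OF xy(1)] using SC(1) by (intro image_eqI[of _ _ 0]) auto
    then obtain c where c: "c \<in> C" "\<pi> x = \<pi> (c + y)" unfolding e k[OF xy(2)] by auto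
    then have "x - (c + y) \<in> B" using D(6) xy C(2) SA(4) by blast
    moreover have "x - y = (x - (c + y)) + c" by simp
    ultimately show "x - y \<in> {b + c | b c. b \<in> B \<and> c \<in> C}" using c(1) by blast
  next
    have sub: "\<kappa> x \<subseteq> \<kappa> y" if h: "x \<in> A" "y \<in> A" "x - y = b + c" "b \<in> B" "c \<in> C" for x y b c
    proof
      fix z assume "z \<in> \<kappa> x"
      then obtain c' where c': "c' \<in> C" "z = \<pi> (c' + x)" unfolding k[OF h(1)] by blast
      have m: "c' + x \<in> A" "c' + c + y \<in> A" using c' h C(2) SA(4) SC(4) by blast+
      have "(c' + x) - (c' + c + y) = b" using h(3) by (simp add: algebra_simps)
      then have "\<pi> (c' + x) = \<pi> ((c' + c) + y)" using D(6)[OF m] h(4) by simp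
      then show "z \<in> \<kappa> y" unfolding k[OF h(2)] using c' SC(4) h(5) by blast
    qed
    assume "x - y \<in> {b + c | b c. b \<in> B \<and> c \<in> C}"
    then obtain b c where bc: "x - y = b + c" "b \<in> B" "c \<in> C" by blast
    then have "y - x = (- b) + (- c)" by (metis minus_diff_eq minus_add_distrib)
    then show "\<kappa> x = \<kappa> y" using sub[OF xy bc] sub[OF xy(2,1) _ SB(3)[OF bc(2)] SC(3)[OF bc(3)]] by blast
  qed
  have zero: "\<pi> ` C = \<kappa> 0" unfolding k[OF SA(1)] by simp
  have add: "set_add M (\<kappa> x) (\<kappa> y) = \<kappa> (x + y)" if xy: "x \<in> A" "y \<in> A" for x y
  proof
    show "set_add M (\<kappa> x) (\<kappa> y) \<subseteq> \<kappa> (x + y)"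
    proof
      fix z assume "z \<in> set_add M (\<kappa> x) (\<kappa> y)"
      then obtain c c' where c: "c \<in> C" "c' \<in> C" "z = \<pi> (c + x) \<oplus>\<^bsub>M\<^esub> \<pi> (c' + y)"
        unfolding set_add_def' k[OF xy(1)] k[OF xy(2)] by blast
      then have "z = \<pi> ((c + c') + (x + y))" using D(5)[of "c + x" "c' + y"] xy C(2) SA(4)
        by (simp add: subset_iff algebra_simps)
      then show "z \<in> \<kappa> (x + y)" unfolding k[OF SA(4)[OF xy]] using SC(4) c by blast
    qed
    show "\<kappa> (x + y) \<subseteq> set_add M (\<kappa> x) (\<kappa> y)"
    proof
      fix z assume "z \<in> \<kappa> (x + y)"
      then obtain c where c: "c \<in> C" "z = \<pi> (c + (x + y))" unfolding k[OF SA(4)[OF xy]] by blast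
      have "c + x \<in> A" using c(1) xy(1) C(2) SA(4) by blast
      from D(5)[OF this xy(2)] have "z = \<pi> (c + x) \<oplus>\<^bsub>M\<^esub> \<pi> (0 + y)" using c(2) by (simp add: add.assoc)
      then show "z \<in> set_add M (\<kappa> x) (\<kappa> y)"
        unfolding set_add_def' k[OF xy(1)] k[OF xy(2)] using c(1) SC(1) by blast
    qed
  qed
  have car: "carrier Q = \<kappa> ` A"
    unfolding Q_def graded_quotient_def \<kappa>_def by (auto simp: A_RCOSETS_def' D(3))
  have AQ: "add Q = set_add M" and ZQ: "zero Q = \<pi> ` C" by (simp_all add: Q_def graded_quotient_def)
  show ?thesis
    unfolding presents_def AQ ZQ
    by (intro conjI ballI D(1) subgrp_plus[OF D(2) C(1)] car zero add eq)
qed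

text \<open>If a scalar acts through an additive map \<open>h\<close> that preserves
  \<open>C\<close>, all members of a coset yield the same coset, and the union defining the action
  collapses.\<close>

lemma quotient_smult:
  assumes P: "presents M \<pi> A B" and C: "subgrp C" "C \<subseteq> A" and a: "a \<in> A"
    and h: "\<And>x. x \<in> A \<Longrightarrow> h x \<in> A" "\<And>x. x \<in> C \<Longrightarrow> h x \<in> C" "\<And>x y. h (x + y) = h x + h y"
    and sm: "\<And>x. x \<in> A \<Longrightarrow> r \<odot>\<^bsub>M\<^esub> \<pi> x = \<pi> (h x)"
  shows "r \<odot>\<^bsub>graded_quotient M (\<pi> ` C)\<^esub> (\<pi> ` C +>\<^bsub>M\<^esub> \<pi> a) = \<pi> ` C +>\<^bsub>M\<^esub> \<pi> (h a)"
proof -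
  note SA = subgrpD[OF presentsD(1)[OF P]] note SC = subgrpD[OF C(1)]
  note Q = presentsD[OF presents_quotient[OF P C]]
  have e: "\<pi> ` C +>\<^bsub>M\<^esub> (r \<odot>\<^bsub>M\<^esub> \<pi> (c + a)) = \<pi> ` C +>\<^bsub>M\<^esub> \<pi> (h a)" if c: "c \<in> C" for c
  proof -
    have ca: "c + a \<in> A" using c a C(2) SA(4) by blast
    have "h (c + a) - h a = 0 + h c" by (simp add: h(3))
    then have "h (c + a) - h a \<in> {b + c | b c. b \<in> B \<and> c \<in> C}"
      using subgrpD(1)[OF presentsD(2)[OF P]] h(2)[OF c] by blast
    then show ?thesis unfolding sm[OF ca] using Q(6)[OF h(1)[OF ca] h(1)[OF a]] by blast
  qed
  have "r \<odot>\<^bsub>graded_quotient M (\<pi> ` C)\<^esub> (\<pi> ` C +>\<^bsub>M\<^esub> \<pi> a)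
      = (\<Union>x\<in>(\<lambda>c. \<pi> (c + a)) ` C. \<pi> ` C +>\<^bsub>M\<^esub> (r \<odot>\<^bsub>M\<^esub> x))"
    by (simp add: graded_quotient_def coset_presents[OF P C a])
  also have "\<dots> = (\<Union>c\<in>C. \<pi> ` C +>\<^bsub>M\<^esub> (r \<odot>\<^bsub>M\<^esub> \<pi> (c + a)))" by (simp only: image_image)
  also have "\<dots> = (\<Union>c\<in>C. \<pi> ` C +>\<^bsub>M\<^esub> \<pi> (h a))" by (rule SUP_cong[OF refl e])
  also have "\<dots> = \<pi> ` C +>\<^bsub>M\<^esub> \<pi> (h a)" using SC(1) by (subst UN_constant) auto
  finally show ?thesis .
qed

lemma class_field_ring: "field (class_ring :: 'k::field ring)"
  by (rule class_field.field_axioms)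

text \<open>A finite basis of \<open>V\<close>, lifted along \<open>\<pi>\<close>, is a basis of
  \<open>Z\<close> modulo \<open>B\<close>. This is the bridge from the dimensions in the theorem to
  \<open>has_qdim\<close>.\<close>

lemma presents_dim:
  fixes V :: "('k::field, 'b) module" and sc :: "'k \<Rightarrow> 'v::ab_group_add \<Rightarrow> 'v"
  assumes P: "presents V \<pi> Z B" and sc: "vector_space sc" and Z: "module.subspace sc Z"
    and sm: "\<And>c z. z \<in> Z \<Longrightarrow> c \<odot>\<^bsub>V\<^esub> \<pi> z = \<pi> (sc c z)"
    and fd: "vectorspace.fin_dim (class_ring :: 'k ring) V"
  shows "has_qdim sc Z B (vectorspace.dim (class_ring :: 'k ring) V)"
proof -
  interpret sc: vector_space sc by fact
  note D = presentsD[OF P]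
  interpret K: field "class_ring :: 'k ring" by (rule class_field_ring)
  have "Module.module (class_ring :: 'k ring) V"
  proof (rule moduleI)
    show "cring (class_ring :: 'k ring)" by unfold_locales
    show "abelian_group V" by (rule presents_abelian_group[OF P])
    fix a b :: 'k and x y
    assume "x \<in> carrier V"
    then obtain z where z: "z \<in> Z" "x = \<pi> z" unfolding D(3) by blast
    have sz: "sc c z \<in> Z" for c using Z z(1) by (rule sc.subspace_scale)
    show "a \<odot>\<^bsub>V\<^esub> x \<in> carrier V" using z sz by (simp add: sm D(3))
    show "(a \<oplus>\<^bsub>class_ring\<^esub> b) \<odot>\<^bsub>V\<^esub> x = a \<odot>\<^bsub>V\<^esub> x \<oplus>\<^bsub>V\<^esub> b \<odot>\<^bsub>V\<^esub> x"
      using z sz by (simp add: sm D(5) sc.scale_left_distrib)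
    show "(a \<otimes>\<^bsub>class_ring\<^esub> b) \<odot>\<^bsub>V\<^esub> x = a \<odot>\<^bsub>V\<^esub> (b \<odot>\<^bsub>V\<^esub> x)"
      using z sz by (simp add: sm)
    show "\<one>\<^bsub>class_ring\<^esub> \<odot>\<^bsub>V\<^esub> x = x" using z by (simp add: sm)
    assume "y \<in> carrier V"
    then obtain z' where z': "z' \<in> Z" "y = \<pi> z'" unfolding D(3) by blast
    show "a \<odot>\<^bsub>V\<^esub> (x \<oplus>\<^bsub>V\<^esub> y) = a \<odot>\<^bsub>V\<^esub> x \<oplus>\<^bsub>V\<^esub> a \<odot>\<^bsub>V\<^esub> y"
      using z z' sz sc.subspace_scale[OF Z z'(1)] sc.subspace_add[OF Z z(1) z'(1)]
      by (simp add: sm D(5) sc.scale_right_distrib)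
  qed
  then interpret V: vectorspace "class_ring :: 'k ring" V
    by (intro vectorspace.intro class_field_ring)
  obtain X where X: "finite X" "V.basis X" using V.finite_basis_exists fd by blast
  then have Xc: "X \<subseteq> carrier V" and li: "V.lin_indpt X" and gen: "V.gen_set X" by (auto simp: V.basis_def)
  have "\<forall>x\<in>X. \<exists>z\<in>Z. \<pi> z = x" using Xc unfolding D(3) by blast
  then obtain b where b: "\<And>x. x \<in> X \<Longrightarrow> b x \<in> Z" "\<And>x. x \<in> X \<Longrightarrow> \<pi> (b x) = x" by metis
  have lc: "V.lincomb c X = \<pi> (\<Sum>x\<in>X. sc (c x) (b x))" for c
  proof -
    have ab: "abelian_monoid V" using presents_abelian_group[OF P] by (rule abelian_group.axioms(1))
    have "V.lincomb c X = finsum V (\<lambda>x. \<pi> (sc (c x) (b x))) X"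
      unfolding V.lincomb_def
    proof (rule abelian_monoid.finsum_cong'[OF ab refl])
      show "(\<lambda>x. \<pi> (sc (c x) (b x))) \<in> X \<rightarrow> carrier V"
        unfolding D(3) using b(1) sc.subspace_scale[OF Z] by blast
      show "c x \<odot>\<^bsub>V\<^esub> x = \<pi> (sc (c x) (b x))" if "x \<in> X" for x
        using sm[OF b(1)[OF that], of "c x"] b(2)[OF that] by simp
    qed
    also have "\<dots> = \<pi> (\<Sum>x\<in>X. sc (c x) (b x))"
      by (rule presents_finsum[OF P X(1)]) (use b(1) sc.subspace_scale[OF Z] in blast)
    finally show ?thesis .
  qed
  have sZ: "(\<Sum>x\<in>X. sc (c x) (b x)) \<in> Z" for c
    using b(1) by (intro sc.subspace_sum[OF Z] sc.subspace_scale[OF Z])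
  have "has_qdim sc Z B (card X)"
  proof (rule has_qdim_index[OF X(1) b(1)])
    fix a assume a: "a \<in> Z"
    then have "\<pi> a \<in> carrier V" unfolding D(3) by blast
    then obtain c where "V.lincomb c X = \<pi> a" using gen V.finite_in_span[OF X(1) Xc] by blast
    then have "a - (\<Sum>x\<in>X. sc (c x) (b x)) \<in> B" using D(6)[OF a sZ] lc by metis
    then show "\<exists>c. a - (\<Sum>x\<in>X. sc (c x) (b x)) \<in> B" by (rule exI[of _ c])
  next
    fix c assume "(\<Sum>x\<in>X. sc (c x) (b x)) \<in> B"
    then have "\<pi> (\<Sum>x\<in>X. sc (c x) (b x)) = \<pi> 0" using D(6)[OF sZ subgrpD(1)[OF D(1)]] by simp
    then have z: "V.lincomb c X = \<zero>\<^bsub>V\<^esub>" by (simp add: lc D(4))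
    show "\<forall>x\<in>X. c x = 0"
    proof (rule ccontr)
      assume "\<not> (\<forall>x\<in>X. c x = 0)"
      then have "V.lin_dep X" unfolding V.lin_dep_def using X(1) z by fastforce
      then show False using li by blast
    qed
  qed
  then show ?thesis using V.dim_basis[OF X] by simp
qed

section \<open>Polynomials as Laurent vectors\<close>

declare One_nat_def [simp del]

definition emb :: "(nat \<Rightarrow>\<^sub>0 nat) \<Rightarrow> expo" where "emb a = Poly_Mapping.map int a"
definition unemb :: "expo \<Rightarrow> (nat \<Rightarrow>\<^sub>0 nat)" where "unemb c = Poly_Mapping.map nat c"

lemma lookup_emb [simp]: "lk (emb a) v = int (lk a v)"
  by (auto simp: emb_def Poly_Mapping.map.rep_eq when_def)
lemma lookup_unemb [simp]: "lk (unemb a) v = nat (lk a v)"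
  by (auto simp: unemb_def Poly_Mapping.map.rep_eq when_def)
lemma emb_add: "emb (a + b) = emb a + emb b"
  by (rule poly_mapping_eqI) (simp add: lookup_add)
lemma emb_zero [simp]: "emb 0 = 0"
  by (rule poly_mapping_eqI) simp
lemma unemb_emb [simp]: "unemb (emb a) = a"
  by (rule poly_mapping_eqI) simp
lemma emb_unemb: "neg c = {} \<Longrightarrow> emb (unemb c) = c"
  by (rule poly_mapping_eqI) (auto simp: neg_def not_less)
lemma emb_inj [simp]: "emb a = emb b \<longleftrightarrow> a = b"
  by (metis unemb_emb)
lemma keys_emb [simp]: "ks (emb a) = ks a"
  by (auto simp: in_keys_iff)
lemma neg_emb [simp]: "neg (emb a) = {}"
  by (auto simp: neg_def)
lemma emb_nexp: "emb a \<in> nexp \<sigma> \<longleftrightarrow> ks a \<subseteq> \<sigma>"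
  by (simp add: nexp_def)
lemma nexp_emb: "c \<in> nexp \<sigma> \<Longrightarrow> \<exists>b. ks b \<subseteq> \<sigma> \<and> c = emb b"
proof (intro exI conjI)
  assume c: "c \<in> nexp \<sigma>"
  then show e: "c = emb (unemb c)" by (simp add: emb_unemb nexp_def)
  have "ks (unemb c) = ks (emb (unemb c))" by simp
  also have "\<dots> = ks c" unfolding e[symmetric] ..
  finally show "ks (unemb c) \<subseteq> \<sigma>" using c by (simp add: nexp_def)
qed
lemma tdeg_emb: "tdeg (emb a) = int (mon_degree a)"
  by (simp add: tdeg_def mon_degree_def)

definition iota :: "'k::field mpoly \<Rightarrow> 'k vec"
  where "iota p = lin (\<lambda>a. Poly_Mapping.single (0, emb a) 1) p"
text \<open>A left inverse of \<open>iota\<close>. It forgets the basis index and cuts negative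
  exponents off at \<open>0\<close>, so it is a two-sided inverse only on
  \<open>gfree n 1 {}\<close>.\<close>

definition uniota :: "'k::field vec \<Rightarrow> 'k mpoly"
  where "uniota f = lin (\<lambda>x. Poly_Mapping.single (unemb (snd x)) 1) f"

lemma vscale_single: "vscale c (Poly_Mapping.single x d) = Poly_Mapping.single x (c * d)"
  by (rule poly_mapping_eqI) (simp add: lookup_single when_def)

lemma iota_add: "iota (p + q) = iota p + iota q"
  and iota_sum: "iota (sum h I) = (\<Sum>i\<in>I. iota (h i))"
  and iota_zero [simp]: "iota 0 = 0"
  and iota_uminus: "iota (- p) = - iota p"
  by (simp_all add: iota_def lin_add lin_sum lin_uminus)
lemma uniota_add: "uniota (p + q) = uniota p + uniota q"
  and uniota_zero [simp]: "uniota 0 = 0"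
  and uniota_vscale: "uniota (vscale c p) = vscale c (uniota p)"
  by (simp_all add: uniota_def lin_add lin_vscale)

lemma lookup_iota [simp]: "lk (iota p) (0, emb b) = lk p b"
proof -
  have "lk (iota p) (0, emb b) = (\<Sum>a\<in>ks p. if a = b then lk p b else 0)"
    unfolding iota_def lookup_lin by (intro sum.cong) (auto simp: lookup_single)
  then show ?thesis by (simp add: in_keys_iff)
qed

lemma keys_iota: "ks (iota p) = (\<lambda>a. (0, emb a)) ` ks p"
proof
  have "lk (iota p) y = 0" if "y \<notin> (\<lambda>a. (0, emb a)) ` ks p" for y
    unfolding iota_def lookup_lin using that by (intro sum.neutral) (auto simp: lookup_single when_def)
  then show "ks (iota p) \<subseteq> (\<lambda>a. (0, emb a)) ` ks p" by (auto simp: in_keys_iff)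
  show "(\<lambda>a. (0, emb a)) ` ks p \<subseteq> ks (iota p)" by (auto simp: in_keys_iff)
qed

lemma iota_single: "iota (Poly_Mapping.single a c) = Poly_Mapping.single (0, emb a) c"
  by (simp add: iota_def vscale_single)
lemma uniota_single: "uniota (Poly_Mapping.single x c) = Poly_Mapping.single (unemb (snd x)) c"
  by (simp add: uniota_def vscale_single)

lemma uniota_sum: "uniota (sum h I) = (\<Sum>i\<in>I. uniota (h i))"
  by (simp add: uniota_def lin_sum)

lemma decompose_single_mpoly: "f = (\<Sum>x\<in>ks f. Poly_Mapping.single x (lk f x))" for f :: "'x \<Rightarrow>\<^sub>0 'k::field"
  using decompose_single[of f] by (simp add: vscale_single)

lemma uniota_iota [simp]: "uniota (iota p) = p"
proof -
  have "uniota (iota p) = uniota (iota (\<Sum>x\<in>ks p. Poly_Mapping.single x (lk p x)))" using decompose_single_mpoly[of p] by simp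
  also have "\<dots> = (\<Sum>x\<in>ks p. Poly_Mapping.single x (lk p x))" by (simp add: iota_sum uniota_sum iota_single uniota_single)
  finally show ?thesis using decompose_single_mpoly[of p] by simp
qed

lemma iota_uniota: "f \<in> gfree n 1 {} \<Longrightarrow> iota (uniota f) = f"
proof -
  assume f: "f \<in> gfree n 1 {}"
  have "iota (uniota f) = iota (uniota (\<Sum>x\<in>ks f. Poly_Mapping.single x (lk f x)))" using decompose_single_mpoly[of f] by simp
  also have "\<dots> = (\<Sum>x\<in>ks f. Poly_Mapping.single x (lk f x))"
    unfolding iota_sum uniota_sum iota_single uniota_single
  proof (rule sum.cong[OF refl])
    fix x assume "x \<in> ks f"
    then have "x \<in> kset n 1 {}" using f by (auto simp: gfree_def)
    then have "fst x = 0" "neg (snd x) = {}" by (auto simp: kset_def)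
    then have "(0, emb (unemb (snd x))) = x" by (simp add: emb_unemb prod_eq_iff)
    then show "Poly_Mapping.single (0, emb (unemb (snd x))) (lk f x) = Poly_Mapping.single x (lk f x)" by simp
  qed
  finally show ?thesis using decompose_single_mpoly[of f] by simp
qed

lemma iota_mon: "iota (mon a * p) = shift (emb a) (iota p)"
proof -
  have "mon a * p = mon a * (\<Sum>x\<in>ks p. Poly_Mapping.single x (lk p x))" using decompose_single_mpoly[of p] by simp
  also have "\<dots> = (\<Sum>x\<in>ks p. Poly_Mapping.single (a + x) (lk p x))" by (simp add: sum_distrib_left mult_single)
  finally have "iota (mon a * p) = (\<Sum>x\<in>ks p. Poly_Mapping.single (0, emb (a + x)) (lk p x))"
    by (simp add: iota_sum iota_single)
  also have "\<dots> = shift (emb a) (iota (\<Sum>x\<in>ks p. Poly_Mapping.single x (lk p x)))"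
    by (simp add: iota_sum iota_single shift_sum shift_single emb_add add.commute)
  finally show ?thesis using decompose_single_mpoly[of p] by simp
qed

lemma const_mult: "const c * p = vscale c p"
  by (simp add: vscale_def mult_map_scale_conv_mult)

lemma iota_vscale: "iota (vscale c p) = vscale c (iota p)"
  by (simp add: iota_def lin_vscale)

lemma iota_mult: "iota (r * p) = (\<Sum>a\<in>ks r. vscale (lk r a) (shift (emb a) (iota p)))"
proof -
  have "r * p = (\<Sum>a\<in>ks r. vscale (lk r a) (mon a)) * p" using decompose_single[of r] by simp
  also have "\<dots> = (\<Sum>a\<in>ks r. vscale (lk r a) (mon a * p))"
    by (simp add: sum_distrib_right const_mult[symmetric] mult.assoc)
  finally show ?thesis by (simp add: iota_sum iota_vscale iota_mon)
qed

abbreviation \<delta>0 :: "nat \<Rightarrow> nat" where "\<delta>0 \<equiv> \<lambda>_. 0"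

lemma iota_gfree: "iota p \<in> gfree n 1 {} \<longleftrightarrow> p \<in> carrier (poly_ring n)"
proof -
  have "(0, emb a) \<in> kset n 1 {} \<longleftrightarrow> ks a \<subseteq> {..<n}" for a by (simp add: kset_def)
  then show ?thesis by (simp add: gfree_def keys_iota poly_ring_def image_subset_iff)
qed

lemma iota_hom: "iota p \<in> hom \<delta>0 t \<longleftrightarrow> (\<forall>a\<in>ks p. int (mon_degree a) = t)"
  by (auto simp: hom_def keys_iota kdeg_def tdeg_emb)

lemma homogeneous_part_iota: "p \<in> homogeneous_part n t \<longleftrightarrow> iota p \<in> gfree n 1 {} \<inter> hom \<delta>0 t"
  by (simp add: homogeneous_part_def iota_gfree iota_hom)

lemma uniota_image: "uniota ` gfree n 1 {} = carrier (poly_ring n)"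
proof
  show "uniota ` gfree n 1 {} \<subseteq> carrier (poly_ring n)" using iota_gfree iota_uniota by (metis image_subsetI)
  show "carrier (poly_ring n) \<subseteq> uniota ` gfree n 1 {}" using iota_gfree uniota_iota by (metis image_eqI subsetI)
qed

lemma presents_free: "presents (free_module n) uniota (gfree n 1 {}) ({0} :: 'k::field vec set)"
  unfolding presents_def
proof (intro conjI ballI)
  show "subgrp (gfree n 1 {} :: 'k vec set)" by (rule vec.subspace_subgrp[OF subspace_gfree])
  fix a b :: "'k vec" assume "a \<in> gfree n 1 {}" "b \<in> gfree n 1 {}"
  then show "uniota a = uniota b \<longleftrightarrow> a - b \<in> {0}" using iota_uniota by (metis eq_iff_diff_eq_0 singleton_iff)
  show "uniota a \<oplus>\<^bsub>free_module n\<^esub> uniota b = uniota (a + b)" by (simp add: free_module_def uniota_add)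
qed (auto simp: subgrp_def free_module_def uniota_image)

lemma uniota_mon:
  assumes "ks b \<subseteq> {..<n}" "x \<in> gfree n 1 {}"
  shows "mon b * uniota x = uniota (shift (emb b) x)"
proof -
  have "mon b * uniota x = uniota (iota (mon b * uniota x))" by simp
  then show ?thesis by (simp add: iota_mon iota_uniota[OF assms(2)])
qed

section \<open>Homogeneous ideals and their residue rings as presented modules\<close>

lemma ideal_iota_closed:
  assumes I: "ideal I (poly_ring n :: 'k::field mpoly ring)"
  shows "vec.subspace (iota ` I)" "c \<in> nexp {..<n} \<Longrightarrow> f \<in> iota ` I \<Longrightarrow> shift c f \<in> iota ` I"
    "iota ` I \<subseteq> gfree n 1 {}"
proof -
  interpret ideal I "poly_ring n :: 'k mpoly ring" by fact
  have add: "p + q \<in> I" if "p \<in> I" "q \<in> I" for p q using additive_subgroup.a_closed[OF additive_subgroup_axioms that] by (simp add: poly_ring_def)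
  have mult: "r * p \<in> I" if "p \<in> I" "r \<in> carrier (poly_ring n)" for p r
    using I_l_closed[OF that] by (simp add: poly_ring_def)
  have z: "0 \<in> I" using additive_subgroup.zero_closed[OF additive_subgroup_axioms] by (simp add: poly_ring_def)
  have sc: "vscale c p \<in> I" if "p \<in> I" for c p
    unfolding const_mult[symmetric] by (rule mult[OF that]) (simp add: poly_ring_def)
  show "vec.subspace (iota ` I)"
  proof (rule vec.subspaceI)
    show "0 \<in> iota ` I" using z iota_zero by (metis imageI)
  qed (auto simp: iota_add[symmetric] iota_vscale[symmetric] intro!: imageI add sc)
  show "iota ` I \<subseteq> gfree n 1 {}" using Icarr iota_gfree by blast
  assume "c \<in> nexp {..<n}" and f: "f \<in> iota ` I"
  then obtain b where b: "ks b \<subseteq> {..<n}" "c = emb b" using nexp_emb by blast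
  obtain p where p: "p \<in> I" "f = iota p" using f by blast
  have "mon b * p \<in> I" by (rule mult[OF p(1)]) (use b in \<open>simp add: poly_ring_def\<close>)
  then show "shift c f \<in> iota ` I" unfolding b(2) p(2) iota_mon[symmetric] by blast
qed

text \<open>The polynomials all of whose homogeneous parts lie in \<open>I\<close> form an ideal
  \<open>J\<close>; it contains the homogeneous generators and therefore \<open>I\<close>.\<close>

lemma homogeneous_ideal_gsub:
  assumes "homogeneous_ideal n (I :: 'k::field mpoly set)"
  shows "gsub n 1 \<delta>0 (iota ` I)"
proof -
  obtain G where I: "ideal I (poly_ring n)" and G: "G \<subseteq> (\<Union>t. homogeneous_part n t)" "I = Idl\<^bsub>poly_ring n\<^esub> G"
    using assms by (auto simp: homogeneous_ideal_def)
  note C = ideal_iota_closed[OF I]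
  interpret ideal I "poly_ring n :: 'k mpoly ring" by fact
  define J where "J = {p \<in> carrier (poly_ring n). \<forall>t. gpart \<delta>0 t (iota p) \<in> iota ` I}"
  have gp: "gpart \<delta>0 t (- f) = - gpart \<delta>0 t f" for t and f :: "'k vec" by (simp add: gpart_def filt_uminus)
  have gs: "gpart \<delta>0 t (sum h K) = (\<Sum>i\<in>K. gpart \<delta>0 t (h i))" for t and h :: "_ \<Rightarrow> 'k vec" and K
    by (simp add: gpart_def filt_sum)
  have gv: "gpart \<delta>0 t (vscale c f) = vscale c (gpart \<delta>0 t f)" for t c and f :: "'k vec"
    by (rule poly_mapping_eqI) (simp add: gpart_def)
  have Jmult: "r * p \<in> J" if p: "p \<in> J" and r: "r \<in> carrier (poly_ring n)" for r p
  proof -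
    have "r * p \<in> carrier (poly_ring n)" using m_closed[of r p] p r by (simp add: J_def poly_ring_def)
    moreover have "gpart \<delta>0 t (iota (r * p)) \<in> iota ` I" for t
      unfolding iota_mult gs gv gpart_shift
    proof (intro vec.subspace_sum[OF C(1)] vec.subspace_scale[OF C(1)] C(2))
      fix a assume "a \<in> ks r"
      then show "emb a \<in> nexp {..<n}" using r by (auto simp: poly_ring_def emb_nexp)
    qed (use p in \<open>simp add: J_def\<close>)
    ultimately show ?thesis by (simp add: J_def)
  qed
  have "ideal J (poly_ring n)"
  proof (rule idealI)
    show "ring (poly_ring n :: 'k mpoly ring)" by (rule ring_axioms)
    show "subgroup J (add_monoid (poly_ring n))"
    proof (rule group.subgroupI)
      show "group (add_monoid (poly_ring n :: 'k mpoly ring))" by (rule a_group)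
      show "J \<subseteq> carrier (add_monoid (poly_ring n))" by (auto simp: J_def)
      have "0 \<in> J" using vec.subspace_0[OF C(1)] by (simp add: J_def poly_ring_def gpart_def)
      then show "J \<noteq> {}" by blast
      show "a \<otimes>\<^bsub>add_monoid (poly_ring n)\<^esub> b \<in> J" if ab: "a \<in> J" "b \<in> J" for a b
      proof -
        have c: "a \<in> carrier (poly_ring n)" "b \<in> carrier (poly_ring n)" using ab unfolding J_def by blast+
        have "a + b \<in> carrier (poly_ring n)"
          using c unfolding iota_gfree[symmetric] iota_add by (rule vec.subspace_add[OF subspace_gfree])
        moreover have "gpart \<delta>0 t (iota (a + b)) \<in> iota ` I" for t
          unfolding iota_add gpart_add using ab unfolding J_def by (blast intro: vec.subspace_add[OF C(1)])
        ultimately show ?thesis by (simp add: J_def poly_ring_def)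
      qed
      show "inv\<^bsub>add_monoid (poly_ring n)\<^esub> a \<in> J" if a: "a \<in> J" for a
      proof -
        have c: "a \<in> carrier (poly_ring n)" "- a \<in> carrier (poly_ring n)" using a unfolding J_def poly_ring_def by simp_all
        have "inv\<^bsub>add_monoid (poly_ring n)\<^esub> a = - a"
          by (rule group.inv_equality[OF a_group]) (use c in \<open>simp_all add: poly_ring_def\<close>)
        moreover have "gpart \<delta>0 t (iota (- a)) \<in> iota ` I" for t
          unfolding iota_uminus gp using a by (intro vec.subspace_neg[OF C(1)]) (simp add: J_def)
        ultimately show ?thesis using c(2) by (simp add: J_def)
      qed
    qed
    fix a x :: "'k mpoly" assume ax: "a \<in> J" "x \<in> carrier (poly_ring n)"
    show "x \<otimes>\<^bsub>poly_ring n\<^esub> a \<in> J" using Jmult[OF ax] by (simp add: poly_ring_def)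
    then show "a \<otimes>\<^bsub>poly_ring n\<^esub> x \<in> J" by (simp add: poly_ring_def mult.commute)
  qed
  moreover have "G \<subseteq> J"
  proof
    fix p assume p: "p \<in> G"
    then obtain t where t: "p \<in> homogeneous_part n t" using G(1) by blast
    have Gc: "G \<subseteq> carrier (poly_ring n)" using G(1) by (auto simp: homogeneous_part_def)
    then have pI: "p \<in> I" using genideal_self[OF Gc] p G(2) by blast
    have h: "iota p \<in> hom \<delta>0 t" using t by (simp add: homogeneous_part_iota)
    have "gpart \<delta>0 s (iota p) \<in> iota ` I" for s
      using gpart_id[OF h] hom_disjoint[OF h] pI vec.subspace_0[OF C(1)] by (cases "s = t") auto
    then show "p \<in> J" using Gc p by (auto simp: J_def)
  qed
  ultimately have "I \<subseteq> J" unfolding G(2) by (rule genideal_minimal)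
  then have "gpart \<delta>0 t f \<in> iota ` I" if "f \<in> iota ` I" for f t using that by (auto simp: J_def)
  then show ?thesis unfolding gsub_def using C by blast
qed

text \<open>One interface for the two modules of the theorem: the ideal, with
  \<open>B = {0}\<close>, for the regularity, and the residue ring, with \<open>A\<close> the whole
  ring, for the Hilbert functions. Scalars are monomials, which form the denominators, and
  constants, which supply signs and vector space structure.\<close>

locale graded_presentation =
  fixes n :: nat and M :: "('k::field mpoly, 'b) graded_module" and \<pi> :: "'k vec \<Rightarrow> 'b" and A B :: "'k vec set"
  assumes pres: "presents M \<pi> A B"
    and gA: "gsub n 1 \<delta>0 A" and gB: "gsub n 1 \<delta>0 B" and BA: "B \<subseteq> A"
    and smult_mon: "ks b \<subseteq> {..<n} \<Longrightarrow> x \<in> A \<Longrightarrow> mon b \<odot>\<^bsub>M\<^esub> \<pi> x = \<pi> (shift (emb b) x)"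
    and smult_const: "x \<in> A \<Longrightarrow> const c \<odot>\<^bsub>M\<^esub> \<pi> x = \<pi> (vscale c x)"
    and component: "component M t = \<pi> ` (A \<inter> hom \<delta>0 t)"

lemma graded_presentation_ideal:
  assumes "homogeneous_ideal n (I :: 'k::field mpoly set)"
  shows "graded_presentation n (graded_submodule (free_module n) I) uniota (iota ` I) {0}"
proof -
  have g: "gsub n 1 \<delta>0 (iota ` I)" by (rule homogeneous_ideal_gsub[OF assms])
  have sub: "subgrp (iota ` I)" "iota ` I \<subseteq> gfree n 1 {}"
    using gsubD(1,2)[OF g] vec.subspace_subgrp by blast+
  have I: "uniota ` iota ` I = I" by (simp add: image_image)
  have "component (graded_submodule (free_module n) I) t = uniota ` (iota ` I \<inter> hom \<delta>0 t)" for t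
  proof -
    have "iota p \<in> gfree n 1 {}" if "p \<in> I" for p using sub(2) that by blast
    then have "homogeneous_part n t \<inter> I = uniota ` (iota ` I \<inter> hom \<delta>0 t)"
      by (auto simp: homogeneous_part_iota image_iff) force
    then show ?thesis by (simp add: graded_submodule_def free_module_def)
  qed
  note cmp = this
  show ?thesis
  proof
    show "presents (graded_submodule (free_module n) I) uniota (iota ` I) {0}"
      using presents_submodule[OF presents_free sub] unfolding I .
    show "{0} \<subseteq> iota ` I" using vec.subspace_0[OF gsubD(1)[OF g]] by blast
    fix b :: "nat \<Rightarrow>\<^sub>0 nat" and x :: "'k vec" assume b: "ks b \<subseteq> {..<n}" and x: "x \<in> iota ` I"
    show "mon b \<odot>\<^bsub>graded_submodule (free_module n) I\<^esub> uniota x = uniota (shift (emb b) x)"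
      using uniota_mon[OF b subsetD[OF sub(2) x]] by (simp add: graded_submodule_def free_module_def)
  qed (simp_all add: g gsub_zero graded_submodule_def free_module_def const_mult uniota_vscale
      cmp[unfolded graded_submodule_def free_module_def, simplified])
qed

lemma graded_presentation_quotient:
  assumes "homogeneous_ideal n (I :: 'k::field mpoly set)"
  shows "graded_presentation n (graded_quotient (free_module n) I) (\<lambda>x. I +>\<^bsub>free_module n\<^esub> uniota x) (gfree n 1 {}) (iota ` I)"
proof -
  have g: "gsub n 1 \<delta>0 (iota ` I)" by (rule homogeneous_ideal_gsub[OF assms])
  have sub: "subgrp (iota ` I)" "iota ` I \<subseteq> gfree n 1 {}"
    using gsubD(1,2)[OF g] vec.subspace_subgrp by blast+
  have I: "uniota ` iota ` I = I" by (simp add: image_image)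
  have e: "{b + c | b c. b \<in> {0} \<and> c \<in> iota ` I} = iota ` I" by auto
  note q = presents_quotient[OF presents_free sub, unfolded I e]
  note qs = quotient_smult[OF presents_free sub, unfolded I]
  show ?thesis
  proof
    fix b :: "nat \<Rightarrow>\<^sub>0 nat" and x :: "'k vec" assume b: "ks b \<subseteq> {..<n}" and x: "x \<in> gfree n 1 {}"
    have nb: "emb b \<in> nexp {..<n}" using b by (simp add: emb_nexp)
    show "mon b \<odot>\<^bsub>graded_quotient (free_module n) I\<^esub> (I +>\<^bsub>free_module n\<^esub> uniota x) =
        I +>\<^bsub>free_module n\<^esub> uniota (shift (emb b) x)"
      by (rule qs[OF x]) (use gfree_shift[OF nb] gsubD(3)[OF g nb] uniota_mon[OF b] in \<open>auto simp: shift_add free_module_def\<close>)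
  next
    fix c and x :: "'k vec" assume x: "x \<in> gfree n 1 {}"
    show "const c \<odot>\<^bsub>graded_quotient (free_module n) I\<^esub> (I +>\<^bsub>free_module n\<^esub> uniota x) =
        I +>\<^bsub>free_module n\<^esub> uniota (vscale c x)"
      by (rule qs[OF x]) (use vec.subspace_scale[OF subspace_gfree] vec.subspace_scale[OF gsubD(1)[OF g]] in
        \<open>auto simp: vec.scale_right_distrib free_module_def const_mult uniota_vscale\<close>)
  next
    fix t
    have "homogeneous_part n t = uniota ` (gfree n 1 {} \<inter> hom \<delta>0 t :: 'k vec set)"
    proof
      show "homogeneous_part n t \<subseteq> uniota ` (gfree n 1 {} \<inter> hom \<delta>0 t :: 'k vec set)"
        using homogeneous_part_iota uniota_iota by (metis image_eqI subsetI)
      show "uniota ` (gfree n 1 {} \<inter> hom \<delta>0 t :: 'k vec set) \<subseteq> homogeneous_part n t"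
      proof
        fix p :: "'k mpoly" assume "p \<in> uniota ` (gfree n 1 {} \<inter> hom \<delta>0 t)"
        then obtain f where f: "f \<in> gfree n 1 {} \<inter> hom \<delta>0 t" "p = uniota f" by blast
        then have "iota p = f" using iota_uniota by blast
        then show "p \<in> homogeneous_part n t" using f(1) by (simp add: homogeneous_part_iota)
      qed
    qed
    then show "component (graded_quotient (free_module n) I) t = (\<lambda>x. I +>\<^bsub>free_module n\<^esub> uniota x) ` (gfree n 1 {} \<inter> hom \<delta>0 t)"
      by (simp add: graded_quotient_def free_module_def image_image)
  qed (use q g gsub_gfree sub(2) in auto)
qed

section \<open>Local cohomology of a presented module\<close>

lemma mon_mult: "mon a * mon b = (mon (a + b) :: 'k::field mpoly)"
  by (simp add: mult_single)

lemma minus_one_power_const: "(-1 :: 'k::field mpoly) ^ k = const (if even k then 1 else - 1)"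
  by (cases "even k") (simp_all add: single_uminus)

context graded_presentation
begin

lemma A_sub: "vec.subspace A"
  using gsubD(1) gA by blast

lemma A_shift: "ks b \<subseteq> {..<n} \<Longrightarrow> x \<in> A \<Longrightarrow> shift (emb b) x \<in> A"
  and B_shift: "ks b \<subseteq> {..<n} \<Longrightarrow> x \<in> B \<Longrightarrow> shift (emb b) x \<in> B"
  using gsubD(3)[OF gA] gsubD(3)[OF gB] by (simp_all add: emb_nexp)

text \<open>The fraction with numerator \<open>\<pi> a\<close> and denominator x^b is represented by
  the Laurent vector x^(-b) a.\<close>

definition val :: "'k vec \<Rightarrow> (nat \<Rightarrow>\<^sub>0 nat) \<Rightarrow> 'k vec"
  where "val a b = shift (- emb b) a"

definition fr :: "nat set \<Rightarrow> 'k vec \<Rightarrow> (nat \<Rightarrow>\<^sub>0 nat) \<Rightarrow> ('b \<times> 'k mpoly) set"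
  where "fr \<sigma> a b = frac \<sigma> M (\<pi> a) (mon b)"

lemma A_add: "x \<in> A \<Longrightarrow> y \<in> A \<Longrightarrow> x + y \<in> A"
  by (rule vec.subspace_add[OF A_sub])

text \<open>Cross multiplying by x^d, x^b and x^b' turns equality of fractions into membership of a
  shifted difference in \<open>B\<close>; conversely a shift that reaches \<open>B\<close> may be
  enlarged by b + b'.\<close>

lemma frac_rel_iff:
  assumes \<sigma>: "\<sigma> \<subseteq> {..<n}" and a: "a \<in> A" "a' \<in> A" and b: "ks b \<subseteq> \<sigma>" "ks b' \<subseteq> \<sigma>"
  shows "((\<pi> a, mon b), (\<pi> a', mon b')) \<in> frac_rel \<sigma> M \<longleftrightarrow> val a b - val a' b' \<in> loc \<sigma> B"
proof -
  have bn: "ks b \<subseteq> {..<n}" "ks b' \<subseteq> {..<n}" using b \<sigma> by auto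
  have key: "mon d \<odot>\<^bsub>M\<^esub> (mon b' \<odot>\<^bsub>M\<^esub> \<pi> a) = mon d \<odot>\<^bsub>M\<^esub> (mon b \<odot>\<^bsub>M\<^esub> \<pi> a') \<longleftrightarrow>
      shift (emb d + emb b + emb b') (val a b - val a' b') \<in> B" if d: "ks d \<subseteq> \<sigma>" for d
  proof -
    have dn: "ks d \<subseteq> {..<n}" using d \<sigma> by auto
    have "mon d \<odot>\<^bsub>M\<^esub> (mon b' \<odot>\<^bsub>M\<^esub> \<pi> a) = \<pi> (shift (emb d) (shift (emb b') a))"
      using smult_mon[OF bn(2) a(1)] smult_mon[OF dn A_shift[OF bn(2) a(1)]] by simp
    moreover have "mon d \<odot>\<^bsub>M\<^esub> (mon b \<odot>\<^bsub>M\<^esub> \<pi> a') = \<pi> (shift (emb d) (shift (emb b) a'))"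
      using smult_mon[OF bn(1) a(2)] smult_mon[OF dn A_shift[OF bn(1) a(2)]] by simp
    moreover have "shift (emb d) (shift (emb b') a) - shift (emb d) (shift (emb b) a')
        = shift (emb d + emb b + emb b') (val a b - val a' b')"
      by (simp add: val_def shift_minus add.assoc)
    ultimately show ?thesis
      using presentsD(6)[OF pres A_shift[OF dn A_shift[OF bn(2) a(1)]] A_shift[OF dn A_shift[OF bn(1) a(2)]]] by simp
  qed
  show ?thesis
  proof
    assume "((\<pi> a, mon b), (\<pi> a', mon b')) \<in> frac_rel \<sigma> M"
    then obtain d where d: "ks d \<subseteq> \<sigma>"
      "mon d \<odot>\<^bsub>M\<^esub> (mon b' \<odot>\<^bsub>M\<^esub> \<pi> a) = mon d \<odot>\<^bsub>M\<^esub> (mon b \<odot>\<^bsub>M\<^esub> \<pi> a')"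
      by (auto simp: frac_rel_def denominators_def)
    moreover have "emb d + emb b + emb b' \<in> nexp \<sigma>"
      using b d(1) emb_nexp by (intro nexp_add) auto
    ultimately show "val a b - val a' b' \<in> loc \<sigma> B" using key by (auto simp: loc_def)
  next
    assume "val a b - val a' b' \<in> loc \<sigma> B"
    then obtain c where c: "c \<in> nexp \<sigma>" "shift c (val a b - val a' b') \<in> B" by (auto simp: loc_def)
    obtain d where d: "ks d \<subseteq> \<sigma>" "c = emb d" using nexp_emb[OF c(1)] by blast
    have "shift (emb b) (shift (emb b') (shift c (val a b - val a' b'))) \<in> B"
      by (rule B_shift[OF bn(1) B_shift[OF bn(2) c(2)]])
    then have "shift (emb d + emb b + emb b') (val a b - val a' b') \<in> B" by (simp add: d(2) add_ac)
    then have "mon d \<odot>\<^bsub>M\<^esub> (mon b' \<odot>\<^bsub>M\<^esub> \<pi> a) = mon d \<odot>\<^bsub>M\<^esub> (mon b \<odot>\<^bsub>M\<^esub> \<pi> a')" using key[OF d(1)] by simp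
    then show "((\<pi> a, mon b), (\<pi> a', mon b')) \<in> frac_rel \<sigma> M"
      using a b d(1) presentsD(3)[OF pres] by (auto simp: frac_rel_def denominators_def)
  qed
qed

lemma fr_mem:
  assumes \<sigma>: "\<sigma> \<subseteq> {..<n}" and a: "a \<in> A" and b: "ks b \<subseteq> \<sigma>"
  shows "(m, s) \<in> fr \<sigma> a b \<longleftrightarrow> (\<exists>a'\<in>A. \<exists>b'. ks b' \<subseteq> \<sigma> \<and> m = \<pi> a' \<and> s = mon b' \<and> val a b - val a' b' \<in> loc \<sigma> B)"
proof
  assume "(m, s) \<in> fr \<sigma> a b"
  then have r: "((\<pi> a, mon b), (m, s)) \<in> frac_rel \<sigma> M" by (simp add: fr_def frac_def)
  then have "m \<in> carrier M" "s \<in> denominators \<sigma>" by (auto simp: frac_rel_def)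
  then obtain a' b' where a': "a' \<in> A" "m = \<pi> a'" "ks b' \<subseteq> \<sigma>" "s = mon b'"
    unfolding presentsD(3)[OF pres] denominators_def by blast
  moreover have "val a b - val a' b' \<in> loc \<sigma> B"
    using r frac_rel_iff[OF \<sigma> a a'(1) b a'(3)] unfolding a'(2,4) by blast
  ultimately show "\<exists>a'\<in>A. \<exists>b'. ks b' \<subseteq> \<sigma> \<and> m = \<pi> a' \<and> s = mon b' \<and> val a b - val a' b' \<in> loc \<sigma> B" by blast
next
  assume "\<exists>a'\<in>A. \<exists>b'. ks b' \<subseteq> \<sigma> \<and> m = \<pi> a' \<and> s = mon b' \<and> val a b - val a' b' \<in> loc \<sigma> B"
  then show "(m, s) \<in> fr \<sigma> a b" using frac_rel_iff[OF \<sigma> a _ b] by (auto simp: fr_def frac_def)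
qed

lemma subspace_loc_B: "\<sigma> \<subseteq> {..<n} \<Longrightarrow> vec.subspace (loc \<sigma> B)"
  by (rule subspace_loc[OF gB])

lemma fr_eq:
  assumes \<sigma>: "\<sigma> \<subseteq> {..<n}" and a: "a \<in> A" "a' \<in> A" and b: "ks b \<subseteq> \<sigma>" "ks b' \<subseteq> \<sigma>"
  shows "fr \<sigma> a b = fr \<sigma> a' b' \<longleftrightarrow> val a b - val a' b' \<in> loc \<sigma> B"
proof
  assume e: "fr \<sigma> a b = fr \<sigma> a' b'"
  have "val a' b' - val a' b' \<in> loc \<sigma> B" using vec.subspace_0[OF subspace_loc_B[OF \<sigma>]] by simp
  then have "(\<pi> a', mon b') \<in> fr \<sigma> a' b'" unfolding fr_mem[OF \<sigma> a(2) b(2)] using a b by blast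
  then have "((\<pi> a, mon b), (\<pi> a', mon b')) \<in> frac_rel \<sigma> M" unfolding e[symmetric] by (simp add: fr_def frac_def)
  then show "val a b - val a' b' \<in> loc \<sigma> B" using frac_rel_iff[OF \<sigma> a b] by blast
next
  have sub: "fr \<sigma> a b \<subseteq> fr \<sigma> a' b'" if h: "a \<in> A" "a' \<in> A" "ks b \<subseteq> \<sigma>" "ks b' \<subseteq> \<sigma>" "val a' b' - val a b \<in> loc \<sigma> B" for a a' b b'
  proof (rule subrelI)
    fix m s assume "(m, s) \<in> fr \<sigma> a b"
    then obtain a'' b'' where c: "a'' \<in> A" "ks b'' \<subseteq> \<sigma>" "m = \<pi> a''" "s = mon b''" "val a b - val a'' b'' \<in> loc \<sigma> B"
      unfolding fr_mem[OF \<sigma> h(1,3)] by blast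
    have "val a' b' - val a'' b'' \<in> loc \<sigma> B"
      using vec.subspace_add[OF subspace_loc_B[OF \<sigma>] h(5) c(5)] by simp
    then show "(m, s) \<in> fr \<sigma> a' b'" unfolding fr_mem[OF \<sigma> h(2,4)] using c by blast
  qed
  assume d: "val a b - val a' b' \<in> loc \<sigma> B"
  then have "val a' b' - val a b \<in> loc \<sigma> B" using vec.subspace_neg[OF subspace_loc_B[OF \<sigma>] d] by simp
  then show "fr \<sigma> a b = fr \<sigma> a' b'" using sub[OF a b] sub[OF a(2,1) b(2,1) d] by blast
qed

text \<open>The presentation map of the localization. The denominator is chosen arbitrarily; by
  \<open>lp_val\<close> the class does not depend on it.\<close>

definition lp :: "nat set \<Rightarrow> 'k vec \<Rightarrow> ('b \<times> 'k mpoly) set"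
  where "lp \<sigma> x = (let b = (SOME b. ks b \<subseteq> \<sigma> \<and> shift (emb b) x \<in> A) in fr \<sigma> (shift (emb b) x) b)"

lemma locA_val: "a \<in> A \<Longrightarrow> ks b \<subseteq> \<sigma> \<Longrightarrow> val a b \<in> loc \<sigma> A"
  by (auto simp: loc_def val_def emb_nexp intro!: bexI[of _ "emb b"])

lemma locA_obtain:
  assumes "x \<in> loc \<sigma> A"
  obtains a b where "a \<in> A" "ks b \<subseteq> \<sigma>" "x = val a b"
proof -
  obtain c where c: "c \<in> nexp \<sigma>" "shift c x \<in> A" using assms by (auto simp: loc_def)
  obtain b where b: "ks b \<subseteq> \<sigma>" "c = emb b" using nexp_emb[OF c(1)] by blast
  have "x = val (shift c x) b" by (simp add: val_def b(2))
  then show ?thesis using that c(2) b(1) by blast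
qed

lemma lp_val:
  assumes \<sigma>: "\<sigma> \<subseteq> {..<n}" and a: "a \<in> A" and b: "ks b \<subseteq> \<sigma>"
  shows "lp \<sigma> (val a b) = fr \<sigma> a b"
proof -
  let ?P = "\<lambda>b'. ks b' \<subseteq> \<sigma> \<and> shift (emb b') (val a b) \<in> A"
  have "?P b" using a b by (simp add: val_def)
  then have s: "?P (SOME b. ?P b)" by (rule someI)
  define b' where "b' = (SOME b. ?P b)"
  have b': "ks b' \<subseteq> \<sigma>" "shift (emb b') (val a b) \<in> A" using s by (simp_all add: b'_def)
  have "fr \<sigma> (shift (emb b') (val a b)) b' = fr \<sigma> a b"
    using vec.subspace_0[OF subspace_loc_B[OF \<sigma>]] by (subst fr_eq[OF \<sigma> b'(2) a b'(1) b]) (simp add: val_def)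
  then show ?thesis unfolding lp_def b'_def[symmetric] Let_def .
qed

lemma lp_eq:
  assumes \<sigma>: "\<sigma> \<subseteq> {..<n}" and x: "x \<in> loc \<sigma> A" and y: "y \<in> loc \<sigma> A"
  shows "lp \<sigma> x = lp \<sigma> y \<longleftrightarrow> x - y \<in> loc \<sigma> B"
proof -
  obtain a b where a: "a \<in> A" "ks b \<subseteq> \<sigma>" "x = val a b" using locA_obtain[OF x] .
  obtain a' b' where a': "a' \<in> A" "ks b' \<subseteq> \<sigma>" "y = val a' b'" using locA_obtain[OF y] .
  show ?thesis unfolding a(3) a'(3) lp_val[OF \<sigma> a(1,2)] lp_val[OF \<sigma> a'(1,2)]
    by (rule fr_eq[OF \<sigma> a(1) a'(1) a(2) a'(2)])
qed

lemma lp_mem: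
  assumes \<sigma>: "\<sigma> \<subseteq> {..<n}" and x: "x \<in> loc \<sigma> A"
  shows "(m, s) \<in> lp \<sigma> x \<longleftrightarrow> (\<exists>a'\<in>A. \<exists>b'. ks b' \<subseteq> \<sigma> \<and> m = \<pi> a' \<and> s = mon b' \<and> x - val a' b' \<in> loc \<sigma> B)"
proof -
  obtain a b where a: "a \<in> A" "ks b \<subseteq> \<sigma>" "x = val a b" using locA_obtain[OF x] .
  show ?thesis unfolding a(3) lp_val[OF \<sigma> a(1,2)] by (rule fr_mem[OF \<sigma> a(1,2)])
qed

lemma lp_nonempty:
  assumes \<sigma>: "\<sigma> \<subseteq> {..<n}" and x: "x \<in> loc \<sigma> A" shows "lp \<sigma> x \<noteq> {}"
proof -
  obtain a b where a: "a \<in> A" "ks b \<subseteq> \<sigma>" "x = val a b" using locA_obtain[OF x] .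
  have "x - val a b \<in> loc \<sigma> B" using a(3) vec.subspace_0[OF subspace_loc_B[OF \<sigma>]] by simp
  then have "(\<pi> a, mon b) \<in> lp \<sigma> x" unfolding lp_mem[OF \<sigma> x] using a(1,2) by blast
  then show ?thesis by blast
qed

lemma loc_B_subset_loc_A: "loc \<sigma> B \<subseteq> loc \<sigma> A"
  by (rule loc_mono[OF order_refl BA])

lemma val_add: "val a b + val a' b' = val (shift (emb b') a + shift (emb b) a') (b + b')"
  by (simp add: val_def shift_add emb_add)

lemma lp_add:
  assumes \<sigma>: "\<sigma> \<subseteq> {..<n}" and x: "x \<in> loc \<sigma> A" and y: "y \<in> loc \<sigma> A"
  shows "lp \<sigma> x \<oplus>\<^bsub>localize n \<sigma> M\<^esub> lp \<sigma> y = lp \<sigma> (x + y)"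
proof -
  note SA = subspace_loc[OF gA \<sigma>]
  have one: "frac \<sigma> M ((s' \<odot>\<^bsub>M\<^esub> m) \<oplus>\<^bsub>M\<^esub> (s \<odot>\<^bsub>M\<^esub> m')) (s * s') = lp \<sigma> (x + y)"
    if h: "(m, s) \<in> lp \<sigma> x" "(m', s') \<in> lp \<sigma> y" for m s m' s'
  proof -
    obtain a b where a: "a \<in> A" "ks b \<subseteq> \<sigma>" "m = \<pi> a" "s = mon b" "x - val a b \<in> loc \<sigma> B"
      using h(1) unfolding lp_mem[OF \<sigma> x] by blast
    obtain a' b' where a': "a' \<in> A" "ks b' \<subseteq> \<sigma>" "m' = \<pi> a'" "s' = mon b'" "y - val a' b' \<in> loc \<sigma> B"
      using h(2) unfolding lp_mem[OF \<sigma> y] by blast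
    have bn: "ks b \<subseteq> {..<n}" "ks b' \<subseteq> {..<n}" using a(2) a'(2) \<sigma> by auto
    have bb: "ks (b + b') \<subseteq> \<sigma>" using keys_add[of b b'] a(2) a'(2) by blast
    note c = A_shift[OF bn(2) a(1)] A_shift[OF bn(1) a'(1)]
    have "frac \<sigma> M ((s' \<odot>\<^bsub>M\<^esub> m) \<oplus>\<^bsub>M\<^esub> (s \<odot>\<^bsub>M\<^esub> m')) (s * s') = fr \<sigma> (shift (emb b') a + shift (emb b) a') (b + b')"
      unfolding fr_def a(3,4) a'(3,4) smult_mon[OF bn(2) a(1)] smult_mon[OF bn(1) a'(1)] presentsD(5)[OF pres c] mon_mult ..
    also have "\<dots> = lp \<sigma> (val a b + val a' b')"
      unfolding val_add by (rule lp_val[OF \<sigma> A_add[OF c] bb, symmetric])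
    also have "\<dots> = lp \<sigma> (x + y)"
    proof (subst lp_eq[OF \<sigma>])
      show "val a b + val a' b' \<in> loc \<sigma> A" "x + y \<in> loc \<sigma> A"
        by (rule vec.subspace_add[OF SA locA_val[OF a(1,2)] locA_val[OF a'(1,2)]], rule vec.subspace_add[OF SA x y])
      have e: "val a b + val a' b' - (x + y) = - ((x - val a b) + (y - val a' b'))" by simp
      show "val a b + val a' b' - (x + y) \<in> loc \<sigma> B"
        unfolding e by (rule vec.subspace_neg[OF subspace_loc_B[OF \<sigma>] vec.subspace_add[OF subspace_loc_B[OF \<sigma>] a(5) a'(5)]])
    qed
    finally show ?thesis .
  qed
  have "lp \<sigma> x \<oplus>\<^bsub>localize n \<sigma> M\<^esub> lp \<sigma> y = (\<Union>p\<in>lp \<sigma> x. \<Union>q\<in>lp \<sigma> y. lp \<sigma> (x + y))"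
    unfolding localize_def using one by (auto simp: split_def)
  then show ?thesis using lp_nonempty[OF \<sigma> x] lp_nonempty[OF \<sigma> y] by simp
qed

lemma lp_const:
  assumes \<sigma>: "\<sigma> \<subseteq> {..<n}" and x: "x \<in> loc \<sigma> A"
  shows "const c \<odot>\<^bsub>localize n \<sigma> M\<^esub> lp \<sigma> x = lp \<sigma> (vscale c x)"
proof -
  note SA = subspace_loc[OF gA \<sigma>]
  have one: "frac \<sigma> M (const c \<odot>\<^bsub>M\<^esub> m) s = lp \<sigma> (vscale c x)" if h: "(m, s) \<in> lp \<sigma> x" for m s
  proof -
    obtain a b where a: "a \<in> A" "ks b \<subseteq> \<sigma>" "m = \<pi> a" "s = mon b" "x - val a b \<in> loc \<sigma> B"
      using h unfolding lp_mem[OF \<sigma> x] by blast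
    note ca = vec.subspace_scale[OF A_sub a(1), of c]
    have "frac \<sigma> M (const c \<odot>\<^bsub>M\<^esub> m) s = fr \<sigma> (vscale c a) b"
      unfolding fr_def a(3,4) smult_const[OF a(1)] ..
    also have "\<dots> = lp \<sigma> (val (vscale c a) b)" by (rule lp_val[OF \<sigma> ca a(2), symmetric])
    also have "\<dots> = lp \<sigma> (vscale c x)"
    proof (subst lp_eq[OF \<sigma> locA_val[OF ca a(2)] vec.subspace_scale[OF SA x]])
      have "val (vscale c a) b - vscale c x = vscale (- c) (x - val a b)"
        by (simp add: val_def shift_vscale vec.scale_right_diff_distrib)
      then show "val (vscale c a) b - vscale c x \<in> loc \<sigma> B"
        using vec.subspace_scale[OF subspace_loc_B[OF \<sigma>] a(5), of "- c"] by simp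
    qed
    finally show ?thesis .
  qed
  have "const c \<odot>\<^bsub>localize n \<sigma> M\<^esub> lp \<sigma> x = (\<Union>p\<in>lp \<sigma> x. lp \<sigma> (vscale c x))"
    unfolding localize_def using one by (auto simp: split_def)
  then show ?thesis using lp_nonempty[OF \<sigma> x] by simp
qed

lemma lp_map:
  assumes \<tau>: "\<tau> \<subseteq> {..<n}" and s: "\<sigma> \<subseteq> \<tau>" and x: "x \<in> loc \<sigma> A"
  shows "localize_map \<tau> M (lp \<sigma> x) = lp \<tau> x"
proof -
  have \<sigma>: "\<sigma> \<subseteq> {..<n}" using \<tau> s by blast
  have x': "x \<in> loc \<tau> A" using x loc_mono[OF s order_refl] by blast
  have one: "frac \<tau> M m s = lp \<tau> x" if h: "(m, s) \<in> lp \<sigma> x" for m s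
  proof -
    obtain a b where a: "a \<in> A" "ks b \<subseteq> \<sigma>" "m = \<pi> a" "s = mon b" "x - val a b \<in> loc \<sigma> B"
      using h unfolding lp_mem[OF \<sigma> x] by blast
    have b: "ks b \<subseteq> \<tau>" using a(2) s by blast
    have "frac \<tau> M m s = lp \<tau> (val a b)" unfolding lp_val[OF \<tau> a(1) b] fr_def a(3,4) ..
    also have "\<dots> = lp \<tau> x"
      using vec.subspace_neg[OF subspace_loc_B[OF \<sigma>] a(5)] loc_mono[OF s order_refl, of B]
      by (subst lp_eq[OF \<tau> locA_val[OF a(1) b] x']) auto
    finally show ?thesis .
  qed
  have "localize_map \<tau> M (lp \<sigma> x) = (\<Union>p\<in>lp \<sigma> x. lp \<tau> x)"
    unfolding localize_map_def using one by (auto simp: split_def)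
  then show ?thesis using lp_nonempty[OF \<sigma> x] by simp
qed

lemma localize_carrier:
  assumes \<sigma>: "\<sigma> \<subseteq> {..<n}" shows "carrier (localize n \<sigma> M) = lp \<sigma> ` loc \<sigma> A"
proof -
  have "carrier (localize n \<sigma> M) = {fr \<sigma> a b | a b. a \<in> A \<and> ks b \<subseteq> \<sigma>}"
    by (auto simp: localize_def quotient_def fr_def frac_def presentsD(3)[OF pres] denominators_def)
  also have "\<dots> = lp \<sigma> ` loc \<sigma> A"
  proof
    show "{fr \<sigma> a b | a b. a \<in> A \<and> ks b \<subseteq> \<sigma>} \<subseteq> lp \<sigma> ` loc \<sigma> A"
      using lp_val[OF \<sigma>] locA_val by (auto simp: image_iff) metis
    show "lp \<sigma> ` loc \<sigma> A \<subseteq> {fr \<sigma> a b | a b. a \<in> A \<and> ks b \<subseteq> \<sigma>}"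
    proof clarify
      fix x assume "x \<in> loc \<sigma> A"
      then obtain a b where a: "a \<in> A" "ks b \<subseteq> \<sigma>" "x = val a b" by (rule locA_obtain)
      then show "\<exists>a b. lp \<sigma> x = fr \<sigma> a b \<and> a \<in> A \<and> ks b \<subseteq> \<sigma>" using lp_val[OF \<sigma> a(1,2)] by blast
    qed
  qed
  finally show ?thesis .
qed

lemma presents_localize:
  assumes \<sigma>: "\<sigma> \<subseteq> {..<n}"
  shows "presents (localize n \<sigma> M) (lp \<sigma>) (loc \<sigma> A) (loc \<sigma> B)"
  unfolding presents_def
proof (intro conjI ballI)
  show "subgrp (loc \<sigma> A)" "subgrp (loc \<sigma> B)"
    using subspace_loc[OF gA \<sigma>] subspace_loc_B[OF \<sigma>] vec.subspace_subgrp by blast+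
  have "lp \<sigma> (val 0 0) = fr \<sigma> 0 0" by (rule lp_val[OF \<sigma>]) (simp_all add: vec.subspace_0[OF A_sub])
  then show "\<zero>\<^bsub>localize n \<sigma> M\<^esub> = lp \<sigma> 0"
    by (simp add: val_def fr_def localize_def presentsD(4)[OF pres])
qed (simp_all add: localize_carrier[OF \<sigma>] lp_add[OF \<sigma>] lp_eq[OF \<sigma>])

lemma localize_component:
  assumes \<sigma>: "\<sigma> \<subseteq> {..<n}"
  shows "component (localize n \<sigma> M) t = lp \<sigma> ` (loc \<sigma> A \<inter> hom \<delta>0 t)"
proof
  show "component (localize n \<sigma> M) t \<subseteq> lp \<sigma> ` (loc \<sigma> A \<inter> hom \<delta>0 t)"
  proof
    fix X assume "X \<in> component (localize n \<sigma> M) t"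
    then obtain m s e where X: "X = frac \<sigma> M m s" "s \<in> denominators \<sigma>" "s \<in> homogeneous_part n e" "m \<in> component M (t + e)"
      by (auto simp: localize_def)
    obtain b where b: "ks b \<subseteq> \<sigma>" "s = mon b" using X(2) by (auto simp: denominators_def)
    have e: "int (mon_degree b) = e" using X(3) by (simp add: b(2) homogeneous_part_def)
    obtain a where a: "a \<in> A" "a \<in> hom \<delta>0 (t + e)" "m = \<pi> a" using X(4) unfolding component by blast
    have "X = lp \<sigma> (val a b)" unfolding lp_val[OF \<sigma> a(1) b(1)] fr_def X(1) a(3) b(2) ..
    moreover have "val a b \<in> hom \<delta>0 t" using a(2) e by (simp add: val_def hom_shift_iff tdeg_emb)
    ultimately show "X \<in> lp \<sigma> ` (loc \<sigma> A \<inter> hom \<delta>0 t)" using locA_val[OF a(1) b(1)] by blast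
  qed
  show "lp \<sigma> ` (loc \<sigma> A \<inter> hom \<delta>0 t) \<subseteq> component (localize n \<sigma> M) t"
  proof clarify
    fix x assume x: "x \<in> loc \<sigma> A" "x \<in> hom \<delta>0 t"
    obtain a b where a: "a \<in> A" "ks b \<subseteq> \<sigma>" "x = val a b" using locA_obtain[OF x(1)] .
    let ?e = "int (mon_degree b)"
    have "a \<in> hom \<delta>0 (t + ?e)" using x(2) unfolding a(3) val_def hom_shift_iff by (simp add: tdeg_emb)
    then have "\<pi> a \<in> component M (t + ?e)" unfolding component using a(1) by blast
    moreover have "mon b \<in> denominators \<sigma>" using a(2) by (auto simp: denominators_def)
    moreover have "mon b \<in> homogeneous_part n ?e" using a(2) \<sigma> by (simp add: homogeneous_part_def poly_ring_def)
    moreover have "lp \<sigma> x = frac \<sigma> M (\<pi> a) (mon b)" unfolding a(3) lp_val[OF \<sigma> a(1,2)] fr_def ..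
    ultimately show "lp \<sigma> x \<in> component (localize n \<sigma> M) t" unfolding localize_def by auto
  qed
qed

section \<open>Presentation of the Cech complex\<close>

lemma subspace_fam_A: "fv.subspace (fam n q (\<lambda>\<sigma>. loc \<sigma> A))"
  by (rule subspace_fam) (rule subspace_loc[OF gA])

lemma subspace_fam_B: "fv.subspace (fam n q (\<lambda>\<sigma>. loc \<sigma> B))"
  by (rule subspace_fam) (rule subspace_loc_B)

definition cp :: "nat \<Rightarrow> (nat set \<Rightarrow> 'k vec) \<Rightarrow> nat set \<Rightarrow> ('b \<times> 'k mpoly) set"
  where "cp p f = (\<lambda>\<sigma>\<in>cech_index n p. lp \<sigma> (f \<sigma>))"

lemma cech_indexD: "\<sigma> \<in> cech_index n p \<longleftrightarrow> \<sigma> \<subseteq> {..<n} \<and> int (card \<sigma>) = int p"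
  by (simp add: cech_index_def)

lemma PiE_cp_image:
  assumes "\<And>\<sigma>. \<sigma> \<in> cech_index n p \<Longrightarrow> X \<sigma> = lp \<sigma> ` S \<sigma>"
  shows "(\<Pi>\<^sub>E \<sigma>\<in>cech_index n p. X \<sigma>) = cp p ` fam n (int p) S"
proof
  show "cp p ` fam n (int p) S \<subseteq> (\<Pi>\<^sub>E \<sigma>\<in>cech_index n p. X \<sigma>)"
  proof clarify
    fix f assume f: "f \<in> fam n (int p) S"
    show "cp p f \<in> (\<Pi>\<^sub>E \<sigma>\<in>cech_index n p. X \<sigma>)"
      unfolding cp_def
    proof (rule restrict_PiE_iff[THEN iffD2], rule ballI)
      fix \<sigma> assume i: "\<sigma> \<in> cech_index n p"
      then have "f \<sigma> \<in> S \<sigma>" using famD(1)[OF f] by (simp add: cech_indexD)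
      then show "lp \<sigma> (f \<sigma>) \<in> X \<sigma>" unfolding assms[OF i] by blast
    qed
  qed
  show "(\<Pi>\<^sub>E \<sigma>\<in>cech_index n p. X \<sigma>) \<subseteq> cp p ` fam n (int p) S"
  proof
    fix F assume F: "F \<in> (\<Pi>\<^sub>E \<sigma>\<in>cech_index n p. X \<sigma>)"
    have "\<forall>\<sigma>. \<exists>x. if \<sigma> \<in> cech_index n p then x \<in> S \<sigma> \<and> F \<sigma> = lp \<sigma> x else x = 0"
    proof
      fix \<sigma> show "\<exists>x. if \<sigma> \<in> cech_index n p then x \<in> S \<sigma> \<and> F \<sigma> = lp \<sigma> x else x = 0"
        using PiE_mem[OF F, of \<sigma>] assms[of \<sigma>] by (cases "\<sigma> \<in> cech_index n p") auto
    qed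
    then obtain f where f: "\<And>\<sigma>. if \<sigma> \<in> cech_index n p then f \<sigma> \<in> S \<sigma> \<and> F \<sigma> = lp \<sigma> (f \<sigma>) else f \<sigma> = 0" by metis
    have "f \<in> fam n (int p) S" by (rule famI) (use f in \<open>metis cech_indexD\<close>)+
    moreover have "F = cp p f" using f F by (auto simp: cp_def fun_eq_iff PiE_def extensional_def split: if_splits)
    ultimately show "F \<in> cp p ` fam n (int p) S" by blast
  qed
qed

lemma presents_cech:
  "presents (cech n M p) (cp p) (fam n (int p) (\<lambda>\<sigma>. loc \<sigma> A)) (fam n (int p) (\<lambda>\<sigma>. loc \<sigma> B))"
  unfolding presents_def
proof (intro conjI ballI)
  let ?A = "fam n (int p) (\<lambda>\<sigma>. loc \<sigma> A)" let ?B = "fam n (int p) (\<lambda>\<sigma>. loc \<sigma> B)"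
  show "subgrp ?A" by (rule fv.subspace_subgrp[OF subspace_fam_A])
  show "subgrp ?B" by (rule fv.subspace_subgrp[OF subspace_fam_B])
  show "carrier (cech n M p) = cp p ` ?A"
    unfolding cech_def by (simp, rule PiE_cp_image) (simp add: localize_carrier cech_indexD)
  have idx: "\<sigma> \<in> cech_index n p \<Longrightarrow> \<sigma> \<subseteq> {..<n}" for \<sigma> by (simp add: cech_indexD)
  show "\<zero>\<^bsub>cech n M p\<^esub> = cp p 0"
    by (auto simp: cech_def cp_def fun_eq_iff presentsD(4)[OF presents_localize] idx)
  fix f g assume f: "f \<in> ?A" and g: "g \<in> ?A"
  have m: "f \<sigma> \<in> loc \<sigma> A" "g \<sigma> \<in> loc \<sigma> A" if "\<sigma> \<in> cech_index n p" for \<sigma>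
    using famD(1)[OF f, of \<sigma>] famD(1)[OF g, of \<sigma>] that by (simp_all add: cech_indexD)
  show "cp p f \<oplus>\<^bsub>cech n M p\<^esub> cp p g = cp p (f + g)"
    using m by (auto simp: cech_def cp_def fun_eq_iff lp_add idx)
  show "cp p f = cp p g \<longleftrightarrow> f - g \<in> ?B"
  proof
    assume e: "cp p f = cp p g"
    show "f - g \<in> ?B"
    proof (rule famI)
      fix \<sigma> assume s: "\<sigma> \<subseteq> {..<n}" "int (card \<sigma>) = int p"
      then have i: "\<sigma> \<in> cech_index n p" by (simp add: cech_indexD)
      then have "lp \<sigma> (f \<sigma>) = lp \<sigma> (g \<sigma>)" using fun_cong[OF e, of \<sigma>] by (simp add: cp_def)
      then show "(f - g) \<sigma> \<in> loc \<sigma> B" using lp_eq[OF s(1) m[OF i]] by simp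
    next
      fix \<sigma> assume "\<not> (\<sigma> \<subseteq> {..<n} \<and> int (card \<sigma>) = int p)"
      then show "(f - g) \<sigma> = 0" using famD(2)[OF f] famD(2)[OF g] by simp
    qed
  next
    assume b: "f - g \<in> ?B"
    have "lp \<sigma> (f \<sigma>) = lp \<sigma> (g \<sigma>)" if i: "\<sigma> \<in> cech_index n p" for \<sigma>
      using lp_eq[OF idx[OF i] m[OF i]] famD(1)[OF b, of \<sigma>] i by (simp add: cech_indexD)
    then show "cp p f = cp p g" unfolding cp_def by (rule restrict_ext)
  qed
qed

lemma cech_component:
  "component (cech n M p) t = cp p ` cch n \<delta>0 A (int p) t"
  unfolding cech_def cch_def by (simp, rule PiE_cp_image) (simp add: localize_component cech_indexD)

lemma cech_smult_const:
  assumes f: "f \<in> fam n (int p) (\<lambda>\<sigma>. loc \<sigma> A)"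
  shows "const c \<odot>\<^bsub>cech n M p\<^esub> cp p f = cp p (fscale c f)"
  using famD(1)[OF f] by (auto simp: cech_def cp_def fscale_def fun_eq_iff cech_indexD lp_const)

text \<open>Termwise, the canonical maps between localizations become inclusions of Laurent vectors
  and the scalar signs become \<open>ssgn\<close>.\<close>

lemma cech_diff_cp:
  assumes f: "f \<in> fam n (int p) (\<lambda>\<sigma>. loc \<sigma> A)"
  shows "cech_diff n M p (cp p f) = cp (Suc p) (cd n f)"
proof (rule HOL.ext)
  fix \<tau>
  show "cech_diff n M p (cp p f) \<tau> = cp (Suc p) (cd n f) \<tau>"
  proof (cases "\<tau> \<in> cech_index n (Suc p)")
    case True
    then have \<tau>: "\<tau> \<subseteq> {..<n}" "card \<tau> = Suc p" by (auto simp: cech_index_def)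
    then have fin: "finite \<tau>" using finite_subset by blast
    have m: "f (\<tau> - {j}) \<in> loc (\<tau> - {j}) A" "\<tau> - {j} \<in> cech_index n p" if j: "j \<in> \<tau>" for j
    proof -
      have "\<tau> - {j} \<subseteq> {..<n}" "int (card (\<tau> - {j})) = int p" using \<tau> fin j by auto
      then show "f (\<tau> - {j}) \<in> loc (\<tau> - {j}) A" "\<tau> - {j} \<in> cech_index n p"
        using famD(1)[OF f] by (simp_all add: cech_indexD)
    qed
    have t: "((-1) ^ card {i \<in> \<tau>. i < j}) \<odot>\<^bsub>localize n \<tau> M\<^esub> localize_map \<tau> M (cp p f (\<tau> - {j}))
        = lp \<tau> (ssgn \<tau> j (f (\<tau> - {j})))" if j: "j \<in> \<tau>" for j
    proof -
      have "cp p f (\<tau> - {j}) = lp (\<tau> - {j}) (f (\<tau> - {j}))" using m(2)[OF j] by (simp add: cp_def)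
      moreover have "f (\<tau> - {j}) \<in> loc \<tau> A" using m(1)[OF j] loc_mono[of "\<tau> - {j}" \<tau> A A] by blast
      ultimately show ?thesis
        using lp_map[OF \<tau>(1) Diff_subset m(1)[OF j]] lp_const[OF \<tau>(1)]
        by (simp add: minus_one_power_const ssgn_def)
    qed
    have a: "ssgn \<tau> j (f (\<tau> - {j})) \<in> loc \<tau> A" if j: "j \<in> \<tau>" for j
      using vec.subspace_neg[OF subspace_loc[OF gA \<tau>(1)]] m(1)[OF j] loc_mono[of "\<tau> - {j}" \<tau> A A]
      by (intro ssgn_in) auto
    have am: "abelian_monoid (localize n \<tau> M)"
      using presents_abelian_group[OF presents_localize[OF \<tau>(1)]] by (rule abelian_group.axioms(1))
    have "cech_diff n M p (cp p f) \<tau> = finsum (localize n \<tau> M) (\<lambda>j. lp \<tau> (ssgn \<tau> j (f (\<tau> - {j})))) \<tau>"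
      unfolding cech_diff_def using True
    proof (simp, intro abelian_monoid.finsum_cong'[OF am refl])
      show "(\<lambda>j. lp \<tau> (ssgn \<tau> j (f (\<tau> - {j})))) \<in> \<tau> \<rightarrow> carrier (localize n \<tau> M)"
        using a by (auto simp: localize_carrier[OF \<tau>(1)])
    qed (rule t)
    also have "\<dots> = lp \<tau> (\<Sum>j\<in>\<tau>. ssgn \<tau> j (f (\<tau> - {j})))"
      by (rule presents_finsum[OF presents_localize[OF \<tau>(1)] fin a])
    finally show ?thesis using True \<tau>(1) by (simp add: cp_def codiff_def)
  qed (simp add: cech_diff_def cp_def)
qed

lemma cd_fam:
  fixes S :: "'k vec set"
  assumes S: "\<And>\<sigma>. \<sigma> \<subseteq> {..<n} \<Longrightarrow> vec.subspace (loc \<sigma> S)" and f: "f \<in> fam n q (\<lambda>\<sigma>. loc \<sigma> S)"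
  shows "cd n f \<in> fam n (q + 1) (\<lambda>\<sigma>. loc \<sigma> S)"
proof (rule fam_codiff[OF f])
  fix \<tau> j and x :: "'k vec" assume "x \<in> loc (\<tau> - {j}) S"
  then show "x \<in> loc \<tau> S" using loc_mono[of "\<tau> - {j}" \<tau> S S] by blast
qed (use vec.subspace_0[OF S] vec.subspace_neg[OF S] vec.subspace_add[OF S] in simp_all)

section \<open>Representatives of cocycles, coboundaries and cohomology classes\<close>

definition ZZ :: "nat \<Rightarrow> (nat set \<Rightarrow> 'k vec) set"
  where "ZZ p = {f \<in> fam n (int p) (\<lambda>\<sigma>. loc \<sigma> A). cd n f \<in> fam n (int p + 1) (\<lambda>\<sigma>. loc \<sigma> B)}"

text \<open>In degree \<open>p = 0\<close> the cochains of degree \<open>-1\<close> are zero, so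
  this agrees with the separate case in \<open>coboundaries\<close>.\<close>

definition DD :: "nat \<Rightarrow> (nat set \<Rightarrow> 'k vec) set"
  where "DD p = cd n ` fam n (int p - 1) (\<lambda>\<sigma>. loc \<sigma> A)"

definition BB :: "nat \<Rightarrow> (nat set \<Rightarrow> 'k vec) set"
  where "BB p = {b + c | b c. b \<in> fam n (int p) (\<lambda>\<sigma>. loc \<sigma> B) \<and> c \<in> DD p}"

lemma fam_B_subset_fam_A: "fam n q (\<lambda>\<sigma>. loc \<sigma> B) \<subseteq> fam n q (\<lambda>\<sigma>. loc \<sigma> A)"
  by (rule fam_mono) (rule loc_B_subset_loc_A)

lemma subspace_ZZ: "fv.subspace (ZZ p)"
proof (rule fv.subspaceI)
  show "0 \<in> ZZ p" unfolding ZZ_def using fv.subspace_0[OF subspace_fam_A] fv.subspace_0[OF subspace_fam_B] by simp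
  show "x + y \<in> ZZ p" if "x \<in> ZZ p" "y \<in> ZZ p" for x y
    using that unfolding ZZ_def mem_Collect_eq cd_add by (auto intro: fv.subspace_add[OF subspace_fam_A] fv.subspace_add[OF subspace_fam_B])
  show "fscale c x \<in> ZZ p" if "x \<in> ZZ p" for c x
    using that unfolding ZZ_def mem_Collect_eq cd_fscale by (auto intro: fv.subspace_scale[OF subspace_fam_A] fv.subspace_scale[OF subspace_fam_B])
qed

lemma subspace_DD: "fv.subspace (DD p)"
  unfolding DD_def
proof (rule fv.subspaceI)
  let ?A = "fam n (int p - 1) (\<lambda>\<sigma>. loc \<sigma> A)"
  show "0 \<in> cd n ` ?A" using fv.subspace_0[OF subspace_fam_A] cd_zero by (metis imageI)
  show "x + y \<in> cd n ` ?A" if "x \<in> cd n ` ?A" "y \<in> cd n ` ?A" for x y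
    using that by (elim imageE) (simp only: cd_add[symmetric], intro imageI fv.subspace_add[OF subspace_fam_A])
  show "fscale c x \<in> cd n ` ?A" if "x \<in> cd n ` ?A" for c x
    using that by (elim imageE) (simp only: cd_fscale[symmetric], intro imageI fv.subspace_scale[OF subspace_fam_A])
qed

lemma DD_ZZ: "DD p \<subseteq> ZZ p"
proof
  fix x assume "x \<in> DD p"
  then obtain u where u: "u \<in> fam n (int p - 1) (\<lambda>\<sigma>. loc \<sigma> A)" "x = cd n u" by (auto simp: DD_def)
  have "x \<in> fam n (int p) (\<lambda>\<sigma>. loc \<sigma> A)" using cd_fam[OF subspace_loc[OF gA] u(1)] u(2) by simp
  moreover have "cd n x = 0" unfolding u(2) by (rule cd_cd)
  ultimately show "x \<in> ZZ p" unfolding ZZ_def using fv.subspace_0[OF subspace_fam_B] by simp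
qed

lemma cocycles_eq: "cocycles n M p = cp p ` ZZ p"
proof -
  note P = presentsD[OF presents_cech[of p]] and Q = presentsD[OF presents_cech[of "Suc p"]]
  have "cech_diff n M p (cp p f) = \<zero>\<^bsub>cech n M (Suc p)\<^esub> \<longleftrightarrow> cd n f \<in> fam n (int p + 1) (\<lambda>\<sigma>. loc \<sigma> B)"
    if f: "f \<in> fam n (int p) (\<lambda>\<sigma>. loc \<sigma> A)" for f
  proof -
    have "cd n f \<in> fam n (int (Suc p)) (\<lambda>\<sigma>. loc \<sigma> A)" using cd_fam[OF subspace_loc[OF gA] f] by (simp add: add.commute)
    from Q(6)[OF this fv.subspace_0[OF subspace_fam_A]] show ?thesis
      unfolding cech_diff_cp[OF f] Q(4) by (simp add: add.commute)
  qed
  then show ?thesis unfolding cocycles_def a_kernel_def' P(3) ZZ_def by blast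
qed

lemma coboundaries_eq: "coboundaries n M p = cp p ` DD p"
proof (cases p)
  case 0
  have "f = 0" if f: "f \<in> fam n (int p - 1) (\<lambda>\<sigma>. loc \<sigma> A)" for f
  proof (rule HOL.ext)
    fix \<sigma> show "f \<sigma> = 0 \<sigma>" using famD(2)[OF f, of \<sigma>] 0 by simp
  qed
  then have "DD p = {0}" using fv.subspace_0[OF subspace_DD, of p] unfolding DD_def by fastforce
  then show ?thesis by (simp add: 0 coboundaries_def presentsD(4)[OF presents_cech])
next
  case (Suc q)
  have "coboundaries n M p = (\<lambda>f. cech_diff n M q (cp q f)) ` fam n (int q) (\<lambda>\<sigma>. loc \<sigma> A)"
    by (simp add: Suc coboundaries_def presentsD(3)[OF presents_cech] image_image)
  also have "\<dots> = (\<lambda>f. cp p (cd n f)) ` fam n (int q) (\<lambda>\<sigma>. loc \<sigma> A)"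
    by (rule image_cong[OF refl]) (simp add: cech_diff_cp Suc)
  finally show ?thesis by (simp add: DD_def image_image Suc)
qed

definition hp :: "nat \<Rightarrow> (nat set \<Rightarrow> 'k vec) \<Rightarrow> (nat set \<Rightarrow> ('b \<times> 'k mpoly) set) set"
  where "hp p f = cp p ` DD p +>\<^bsub>graded_submodule (cech n M p) (cp p ` ZZ p)\<^esub> cp p f"

lemma presents_submod: "presents (graded_submodule (cech n M p) (cp p ` ZZ p)) (cp p) (ZZ p) (fam n (int p) (\<lambda>\<sigma>. loc \<sigma> B))"
  by (rule presents_submodule[OF presents_cech fv.subspace_subgrp[OF subspace_ZZ]]) (auto simp: ZZ_def)

lemma local_cohomology_eq: "local_cohomology n p M =
    graded_quotient (graded_submodule (cech n M p) (cp p ` ZZ p)) (cp p ` DD p)"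
  by (simp add: local_cohomology_def cocycles_eq coboundaries_eq)

lemma presents_cohomology: "presents (local_cohomology n p M) (hp p) (ZZ p) (BB p)"
  unfolding local_cohomology_eq hp_def BB_def
  by (rule presents_quotient[OF presents_submod fv.subspace_subgrp[OF subspace_DD] DD_ZZ])

lemma cohomology_smult:
  assumes "z \<in> ZZ p"
  shows "const c \<odot>\<^bsub>local_cohomology n p M\<^esub> hp p z = hp p (fscale c z)"
  unfolding local_cohomology_eq hp_def
proof (rule quotient_smult[OF presents_submod fv.subspace_subgrp[OF subspace_DD] DD_ZZ assms, where h = "fscale c"])
  show "const c \<odot>\<^bsub>graded_submodule (cech n M p) (cp p ` ZZ p)\<^esub> cp p x = cp p (fscale c x)" if "x \<in> ZZ p" for x
    using cech_smult_const[of x p c] that by (simp add: graded_submodule_def ZZ_def)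
qed (auto intro: fv.subspace_scale[OF subspace_ZZ] fv.subspace_scale[OF subspace_DD] simp: fv.scale_right_distrib)

text \<open>A homogeneous class that is a cocycle also has a representative with both properties: a
  homogeneous and a cocycle representative differ by a cochain with values in \<open>B\<close>, and
  such cochains lie in \<open>ZZ\<close>.\<close>

lemma cohomology_component:
  "component (local_cohomology n p M) t = hp p ` (ZZ p \<inter> cch n \<delta>0 A (int p) t)"
proof -
  have sub: "cch n \<delta>0 A (int p) t \<subseteq> fam n (int p) (\<lambda>\<sigma>. loc \<sigma> A)"
    unfolding cch_def by (rule fam_mono) blast
  have ZA: "ZZ p \<subseteq> fam n (int p) (\<lambda>\<sigma>. loc \<sigma> A)" by (auto simp: ZZ_def)
  have BZ: "fam n (int p) (\<lambda>\<sigma>. loc \<sigma> B) \<subseteq> ZZ p"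
    using fam_B_subset_fam_A cd_fam[OF subspace_loc_B] unfolding ZZ_def by blast
  have "cp p ` cch n \<delta>0 A (int p) t \<inter> cp p ` ZZ p = cp p ` (ZZ p \<inter> cch n \<delta>0 A (int p) t)"
  proof
    show "cp p ` cch n \<delta>0 A (int p) t \<inter> cp p ` ZZ p \<subseteq> cp p ` (ZZ p \<inter> cch n \<delta>0 A (int p) t)"
    proof
      fix X assume "X \<in> cp p ` cch n \<delta>0 A (int p) t \<inter> cp p ` ZZ p"
      then obtain f z where f: "f \<in> cch n \<delta>0 A (int p) t" and z: "z \<in> ZZ p" and e: "cp p f = cp p z" and X: "X = cp p f"
        by blast
      have "f - z \<in> fam n (int p) (\<lambda>\<sigma>. loc \<sigma> B)"
        using presentsD(6)[OF presents_cech subsetD[OF sub f] subsetD[OF ZA z]] e by blast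
      then have "f - z \<in> ZZ p" using BZ by blast
      from fv.subspace_add[OF subspace_ZZ this z] have "f \<in> ZZ p" by simp
      then show "X \<in> cp p ` (ZZ p \<inter> cch n \<delta>0 A (int p) t)" using f X by blast
    qed
  qed blast
  then show ?thesis
    unfolding local_cohomology_eq by (simp add: graded_quotient_def graded_submodule_def[of "cech n M p"] cech_component image_image hp_def[abs_def])
qed

text \<open>If a homogeneous cochain is a boundary modulo \<open>B\<close>, taking degree
  \<open>t\<close> parts of the two summands makes them homogeneous as well, since the differential
  preserves degrees.\<close>

lemma graded_boundary:
  assumes z: "z \<in> cch n \<delta>0 A (int p) t"
  shows "z \<in> BB p \<longleftrightarrow> (\<exists>w\<in>cch n \<delta>0 B (int p) t. \<exists>u\<in>cch n \<delta>0 A (int p - 1) t. z = w + cd n u)"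
proof
  assume "z \<in> BB p"
  then obtain w u where wu: "w \<in> fam n (int p) (\<lambda>\<sigma>. loc \<sigma> B)" "u \<in> fam n (int p - 1) (\<lambda>\<sigma>. loc \<sigma> A)" "z = w + cd n u"
    by (auto simp: BB_def DD_def)
  define g where "g f = (\<lambda>\<sigma>. gpart \<delta>0 t (f \<sigma>))" for f :: "nat set \<Rightarrow> 'k vec"
  have g0: "gpart \<delta>0 t 0 = (0 :: 'k vec)" by (simp add: gpart_def)
  have "g z = z"
  proof (rule HOL.ext)
    fix \<sigma> show "g z \<sigma> = z \<sigma>"
      using famD[OF z[unfolded cch_def], of \<sigma>] g0 gpart_id by (cases "\<sigma> \<subseteq> {..<n} \<and> int (card \<sigma>) = int p") (auto simp: g_def)
  qed
  moreover have "g z = g w + cd n (g u)"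
  proof -
    have "cd n (g u) = g (cd n u)" unfolding g_def by (rule codiff_hom) (simp_all add: gpart_add)
    moreover have "g (w + cd n u) = g w + g (cd n u)" by (rule HOL.ext) (simp add: g_def gpart_add)
    ultimately show ?thesis unfolding wu(3) by (simp only:)
  qed
  moreover have "g w \<in> cch n \<delta>0 B (int p) t"
    unfolding g_def cch_def by (rule fam_map[where h = "gpart \<delta>0 t" and f = w, OF wu(1) g0]) (use loc_gpart[OF gB] gpart_hom in blast)
  moreover have "g u \<in> cch n \<delta>0 A (int p - 1) t"
    unfolding g_def cch_def by (rule fam_map[where h = "gpart \<delta>0 t" and f = u, OF wu(2) g0]) (use loc_gpart[OF gA] gpart_hom in blast)
  ultimately show "\<exists>w\<in>cch n \<delta>0 B (int p) t. \<exists>u\<in>cch n \<delta>0 A (int p - 1) t. z = w + cd n u" by metis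
next
  assume "\<exists>w\<in>cch n \<delta>0 B (int p) t. \<exists>u\<in>cch n \<delta>0 A (int p - 1) t. z = w + cd n u"
  then obtain w u where wu: "w \<in> cch n \<delta>0 B (int p) t" "u \<in> cch n \<delta>0 A (int p - 1) t" "z = w + cd n u" by blast
  have "w \<in> fam n (int p) (\<lambda>\<sigma>. loc \<sigma> B)" "u \<in> fam n (int p - 1) (\<lambda>\<sigma>. loc \<sigma> A)"
    using wu(1,2) fam_mono[of n _ "\<lambda>\<sigma>. loc \<sigma> B \<inter> hom \<delta>0 t" "\<lambda>\<sigma>. loc \<sigma> B"]
      fam_mono[of n _ "\<lambda>\<sigma>. loc \<sigma> A \<inter> hom \<delta>0 t" "\<lambda>\<sigma>. loc \<sigma> A"] unfolding cch_def by blast+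
  then show "z \<in> BB p" unfolding BB_def DD_def wu(3) by blast
qed

end

section \<open>Finiteness\<close>

lemma loc_zero: "loc \<sigma> {0} = {0 :: 'k::field vec}"
  by (auto simp: loc_def intro: nexp_0)

lemma cch_zero: "f \<in> cch n \<delta> {0} q t \<Longrightarrow> f = 0"
proof (rule HOL.ext)
  fix \<sigma> assume f: "f \<in> cch n \<delta> {0} q t"
  show "f \<sigma> = 0 \<sigma>"
    using famD[OF f[unfolded cch_def], of \<sigma>] loc_zero by (cases "\<sigma> \<subseteq> {..<n} \<and> int (card \<sigma>) = q") auto
qed

lemma regularity_vanishing:
  assumes "regularity n M \<le> ereal (of_int r)" and "int j + s > r"
  shows "component (local_cohomology n j M) s = {\<zero>\<^bsub>local_cohomology n j M\<^esub>}"
proof (rule ccontr)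
  assume ne: "\<not> ?thesis"
  have "ereal (of_int s) \<le> end_degree (local_cohomology n j M)"
    unfolding end_degree_def by (rule SUP_upper) (use ne in simp)
  then have "ereal (of_nat j) + ereal (of_int s) \<le> ereal (of_nat j) + end_degree (local_cohomology n j M)"
    by (rule add_left_mono)
  also have "\<dots> \<le> regularity n M" unfolding regularity_def by (rule SUP_upper) simp
  also have "\<dots> \<le> ereal (of_int r)" by (rule assms(1))
  finally have "real j + of_int s \<le> of_int r" by simp
  then have "int j + s \<le> r" by linarith
  then show False using assms(2) by simp
qed

text \<open>The regularity bound says that H^j(I) vanishes in degree \<open>s\<close> whenever
  \<open>j + s > r\<close>. With \<open>B = {0}\<close> this is exactness of the Cech complex of the
  ideal in these degrees, which is what the Koszul-Cech chase consumes.\<close>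

lemma ideal_generation_degree:
  fixes I :: "'k::field mpoly set"
  assumes I: "homogeneous_ideal n I" and r: "regularity n (graded_submodule (free_module n) I) \<le> ereal (of_int r)"
  shows "gendeg n \<delta>0 (iota ` I) r"
proof (rule regularity_bounds_generators[OF homogeneous_ideal_gsub[OF I]])
  interpret graded_presentation n "graded_submodule (free_module n) I" uniota "iota ` I" "{0}"
    by (rule graded_presentation_ideal[OF I])
  fix j s z assume j: "0 \<le> j" "r < j + s" and z: "z \<in> cch n \<delta>0 (iota ` I) j s" "cd n z = 0"
  define p where "p = nat j"
  have p: "int p = j" using j by (simp add: p_def)
  have zf: "z \<in> fam n (int p) (\<lambda>\<sigma>. loc \<sigma> (iota ` I))"
    using z(1) fam_mono[of n j "\<lambda>\<sigma>. loc \<sigma> (iota ` I) \<inter> hom \<delta>0 s" "\<lambda>\<sigma>. loc \<sigma> (iota ` I)"]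
    unfolding cch_def p by blast
  then have zz: "z \<in> ZZ p" unfolding ZZ_def using z(2) fv.subspace_0[OF subspace_fam_B] by simp
  have "hp p z \<in> component (local_cohomology n p (graded_submodule (free_module n) I)) s"
    unfolding cohomology_component p using zz z(1) by blast
  also have "\<dots> = {hp p 0}"
    using regularity_vanishing[OF r, of p s] j(2) presentsD(4)[OF presents_cohomology, of p] by (simp add: p)
  finally have "z - 0 \<in> BB p"
    using presentsD(6)[OF presents_cohomology zz fv.subspace_0[OF subspace_ZZ]] by blast
  then have "z \<in> BB p" by simp
  then obtain w u where wu: "w \<in> cch n \<delta>0 {0} j s" "u \<in> cch n \<delta>0 (iota ` I) (j - 1) s" "z = w + cd n u"
    using graded_boundary[of z p s] z(1) unfolding p by blast
  have "z = cd n u" unfolding wu(3) cch_zero[OF wu(1)] by simp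
  then show "\<exists>u\<in>cch n \<delta>0 (iota ` I) (j - 1) s. z = cd n u" using wu(2) by blast
qed

text \<open>In degree \<open>t\<close>, the representatives \<open>ZZ\<close> and \<open>BB\<close>
  of the Cech construction become \<open>Zc\<close> and \<open>Bc\<close>, so the component of local
  cohomology has the dimension that was counted.\<close>

lemma cohomology_has_qdim:
  fixes I :: "'k::field mpoly set"
  assumes I: "homogeneous_ideal n I"
    and d: "component_has_dim (local_cohomology n i (graded_quotient (free_module n) I)) t d"
  shows "has_qdim fscale (Zc n 1 \<delta>0 (iota ` I) (int i) t) (Bc n 1 \<delta>0 (iota ` I) (int i) t) (nat d)"
proof -
  let ?M = "graded_quotient (free_module n) I" let ?F = "gfree n 1 {} :: 'k vec set"
  let ?V = "component_space (local_cohomology n i ?M) t"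
  let ?Z = "Zc n 1 \<delta>0 (iota ` I) (int i) t"
  have g: "gsub n 1 \<delta>0 (iota ` I)" by (rule homogeneous_ideal_gsub[OF I])
  interpret graded_presentation n ?M "\<lambda>x. I +>\<^bsub>free_module n\<^esub> uniota x" ?F "iota ` I"
    by (rule graded_presentation_quotient[OF I])
  have Z: "ZZ i \<inter> cch n \<delta>0 ?F (int i) t = ?Z"
  proof
    show "ZZ i \<inter> cch n \<delta>0 ?F (int i) t \<subseteq> ?Z"
    proof
      fix z assume z: "z \<in> ZZ i \<inter> cch n \<delta>0 ?F (int i) t"
      then have a: "cd n z \<in> fam n (int i + 1) (\<lambda>\<sigma>. loc \<sigma> (iota ` I))" and b: "cd n z \<in> cch n \<delta>0 ?F (int i + 1) t"
        using cd_cch[OF gsub_gfree] by (auto simp: ZZ_def)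
      have "cd n z \<in> cch n \<delta>0 (iota ` I) (int i + 1) t"
        unfolding cch_def by (rule famI) (use famD[OF a] famD[OF b[unfolded cch_def]] in blast)+
      then show "z \<in> ?Z" using z by (simp add: Zc_def)
    qed
    show "?Z \<subseteq> ZZ i \<inter> cch n \<delta>0 ?F (int i) t"
    proof
      fix z assume "z \<in> ?Z"
      then have z: "z \<in> cch n \<delta>0 ?F (int i) t" "cd n z \<in> cch n \<delta>0 (iota ` I) (int i + 1) t" by (simp_all add: Zc_def)
      have "z \<in> fam n (int i) (\<lambda>\<sigma>. loc \<sigma> ?F)" "cd n z \<in> fam n (int i + 1) (\<lambda>\<sigma>. loc \<sigma> (iota ` I))"
        using z fam_mono[of n "int i" "\<lambda>\<sigma>. loc \<sigma> ?F \<inter> hom \<delta>0 t" "\<lambda>\<sigma>. loc \<sigma> ?F"]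
          fam_mono[of n "int i + 1" "\<lambda>\<sigma>. loc \<sigma> (iota ` I) \<inter> hom \<delta>0 t" "\<lambda>\<sigma>. loc \<sigma> (iota ` I)"]
        unfolding cch_def by blast+
      then show "z \<in> ZZ i \<inter> cch n \<delta>0 ?F (int i) t" using z(1) by (simp add: ZZ_def)
    qed
  qed
  note Sz = subspace_Zc[OF g, where q = "int i" and t = t]
  have ZZi: "?Z \<subseteq> ZZ i" using Z by blast
  note D = presentsD[OF presents_cohomology[of i]]
  have P: "presents ?V (hp i) ?Z (BB i)"
    unfolding presents_def
  proof (intro conjI ballI)
    show "subgrp ?Z" by (rule fv.subspace_subgrp[OF Sz])
    show "carrier ?V = hp i ` ?Z" by (simp add: component_space_def cohomology_component Z)
    fix a b assume "a \<in> ?Z" "b \<in> ?Z"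
    then have ab: "a \<in> ZZ i" "b \<in> ZZ i" using ZZi by blast+
    show "hp i a \<oplus>\<^bsub>?V\<^esub> hp i b = hp i (a + b)" using D(5)[OF ab] by (simp add: component_space_def)
    show "hp i a = hp i b \<longleftrightarrow> a - b \<in> BB i" by (rule D(6)[OF ab])
  qed (use D(2,4) in \<open>simp_all add: component_space_def\<close>)
  have sm: "c \<odot>\<^bsub>?V\<^esub> hp i z = hp i (fscale c z)" if "z \<in> ?Z" for c z
    using cohomology_smult[OF subsetD[OF ZZi that]] by (simp add: component_space_def)
  have fd: "vectorspace.fin_dim (class_ring :: 'k ring) ?V" and dim: "vectorspace.dim (class_ring :: 'k ring) ?V = nat d"
    using d by (auto simp: component_has_dim_def)
  have "has_qdim fscale ?Z (BB i) (nat d)"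
    unfolding dim[symmetric] by (rule presents_dim[OF P fv.vector_space_axioms Sz _ fd]) (rule sm)
  then show ?thesis
  \<comment> \<open>The transfer is along equality: \<open>BB i\<close> and \<open>Bc\<close> have
    the same members in degree \<open>t\<close>, although \<open>BB i\<close> also contains cochains
    of other degrees.\<close>
  proof (rule has_qdim_transfer[where R = "(=)", OF fv.vector_space_axioms fv.vector_space_axioms Sz Sz, rotated -1])
    fix a a' assume a: "a = a'" "a \<in> ?Z"
    then have "a \<in> cch n \<delta>0 ?F (int i) t" by (simp add: Zc_def)
    from graded_boundary[OF this] show "a \<in> BB i \<longleftrightarrow> a' \<in> Bc n 1 \<delta>0 (iota ` I) (int i) t"
      unfolding a(1) Bc_def by blast
  qed auto
qed

theorem corollary18:
  fixes n i :: nat and r :: int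
  assumes "infinite (UNIV :: 'k::field set)"
  shows "finite {h :: int \<Rightarrow> int. \<exists>I :: 'k mpoly set.
    homogeneous_ideal n I \<and>
    regularity n (graded_submodule (free_module n) I) \<le> ereal (of_int r) \<and>
    (\<forall>t. component_has_dim (local_cohomology n i (graded_quotient (free_module n) I)) t (h t))}"
    (is "finite ?H")
proof (rule finite_subset)
  show "?H \<subseteq> (\<lambda>h t. int (h t)) ` chilb TYPE('k) n 1 \<delta>0 r (int i)"
  proof
    fix h assume "h \<in> ?H"
    then obtain I :: "'k mpoly set" where I: "homogeneous_ideal n I"
      "regularity n (graded_submodule (free_module n) I) \<le> ereal (of_int r)"
      "\<And>t. component_has_dim (local_cohomology n i (graded_quotient (free_module n) I)) t (h t)" by blast
    have "(\<lambda>t. nat (h t)) \<in> chilb TYPE('k) n 1 \<delta>0 r (int i)"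
      unfolding chilb_def
      using homogeneous_ideal_gsub[OF I(1)] ideal_generation_degree[OF I(1,2)] cohomology_has_qdim[OF I(1,3)] by blast
    moreover have "h t \<ge> 0" for t using I(3)[of t] by (auto simp: component_has_dim_def)
    then have "h = (\<lambda>t. int (nat (h t)))" by auto
    ultimately show "h \<in> (\<lambda>h t. int (h t)) ` chilb TYPE('k) n 1 \<delta>0 r (int i)"
      by (intro image_eqI[of _ _ "\<lambda>t. nat (h t)"])
  qed
  show "finite ((\<lambda>h t. int (h t)) ` chilb TYPE('k) n 1 \<delta>0 r (int i))"
    by (intro finite_imageI finite_chilb)
qed

end
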